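(* Let $\alpha,\beta\in\mathbb{C}$ with $|\arg\alpha|<\pi/2$, $|\arg\beta|<\pi/2$ and $\operatorname{Re}(\sqrt{\alpha})>\operatorname{Re}(\sqrt{\beta})$. Let $\lambda\in\mathbb{C}$ with $\operatorname{Re}(\lambda)>0$. Define $$h(s,\lambda):=\begin{cases}0,&\text{if }\operatorname{Re}(s+\lambda)>0,\\[1mm] \dfrac{(\alpha-\beta)^{\lambda}}{2^{4\lambda+1}},&\text{if }s=-\lambda.\end{cases}$$ Then for all $s\in\mathbb{C}$ such that $\operatorname{Re}(s+\lambda)>0$ or $s=-\lambda$, we have $$\begin{aligned} &\sum_{n=1}^{\infty}\sigma_s(n)\Big\{I_{\lambda}\left(2\pi\overline{\epsilon}(\sqrt{n\alpha}-\sqrt{n\beta})\right)K_{\lambda}\left(2\pi\overline{\epsilon}(\sqrt{n\alpha}+\sqrt{n\beta})\right)+I_{\lambda}\left(2\pi\epsilon(\sqrt{n\alpha}-\sqrt{n\beta})\right)K_{\lambda}\left(2\pi\epsilon(\sqrt{n\alpha}+\sqrt{n\beta})\right)\Big\}\\ &=-\frac{\Gamma(s+\lambda+1)\zeta(1-s)}{2(8\pi)^s\Gamma(\lambda+1)}h(s,\lambda)-\frac{\zeta(-s)}{2\lambda}\left(\frac{\sqrt{\alpha}-\sqrt{\beta}}{\sqrt{\alpha}+\sqrt{\beta}}\right)^{\lambda}\\ &\quad+\frac{\zeta(-s)}{2^{3s+2}\pi^{s+1}\sqrt{\alpha\beta}}\frac{\Gamma(\lambda+s+1)}{\Gamma(\lambda+1)}\left(\frac{\sqrt{\alpha}-\sqrt{\beta}}{\sqrt{\alpha}+\sqrt{\beta}}\right)^{\lambda}\left(\frac{1}{\sqrt{\alpha}}+\frac{1}{\sqrt{\beta}}\right)^{2s}{}_2F_1\left(\lambda-s,-s;\lambda+1;\left(\frac{\sqrt{\alpha}-\sqrt{\beta}}{\sqrt{\alpha}+\sqrt{\beta}}\right)^2\right)\\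 &\quad+\frac{\Gamma(\lambda+s+1)}{2^{3s+2}\pi^{s+1}\Gamma(\lambda+1)}\sum_{n=1}^{\infty}\sigma_s(n)\left(\mathcal{A}(s,\lambda,\sqrt{\alpha},\sqrt{\beta},n)+\mathcal{A}(s,\lambda,\sqrt{\alpha},\sqrt{\beta},-n)\right). \end{aligned}$$
   Context: Notation: $\epsilon=e^{i\pi/4}$, $\overline{\epsilon}=e^{-i\pi/4}$; $\sigma_s(n)=\sum_{d\mid n}d^{s}$; $\zeta$ is the Riemann zeta function; $I_\lambda,K_\lambda$ are the modified Bessel functions of the first and second kind of order $\lambda$ (principal branches). For real $t$ and complex $z,w$ with $|\arg z|<\pi/4$, $|\arg w|<\pi/4$, $\operatorname{Re}(z)>\operatorname{Re}(w)$, $$\mathcal{A}(s,\lambda,z,w,t):=\frac{1}{\sqrt{z^2+it}\,\sqrt{w^2+it}}\left(\frac{1}{\sqrt{z^2+it}}+\frac{1}{\sqrt{w^2+it}}\right)^{2s}\left(\frac{\sqrt{z^2+it}-\sqrt{w^2+it}}{\sqrt{z^2+it}+\sqrt{w^2+it}}\right)^{\lambda}{}_2F_1\left(\lambda-s,-s;\lambda+1;\left(\frac{\sqrt{z^2+it}-\sqrt{w^2+it}}{\sqrt{z^2+it}+\sqrt{w^2+it}}\right)^{2}\right),$$ where ${}_2F_1(a,b;c;\xi)=\sum_{n\ge0}\frac{(a)_n(b)_n}{(c)_n n!}\xi^n$ for $|\xi|<1$, with $(a)_n=a(a+1)\cdots(a+n-1)$. All square roots and powers are principal, except that the $\lambda$-th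 power of the quotient in $\mathcal{A}$ is the branch obtained by analytic continuation in $(z,w)$, within the convex region just described (where the quotient never vanishes), from real $z>w>0$, where it is the principal value. Conventions at exceptional values: when $\operatorname{Re}(s+\lambda)>0$ the term containing $h(s,\lambda)$ is $0$ (also at $s=0$); at $s=-1$ the sum of the two terms containing $\zeta(-s)$ is understood as its limit as $s\to-1$ with $\lambda$ fixed (the poles cancel). *)

theory Defs
  imports "HOL-Complex_Analysis.Complex_Analysis"
begin

definition eps8 :: complex where
  "eps8 = exp (\<i> * of_real (pi / 4))"

definition divisor_sigma :: "complex \<Rightarrow> nat \<Rightarrow> complex" where
  "divisor_sigma s n = (\<Sum>d | d dvd n. of_nat d powr s)"

text \<open>
  The Riemann zeta function is the analytic continuation of the Dirichlet series to the plane
  without the point 1; the continuation is unique, and its value at 1 is left unspecified.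
\<close>

definition zeta :: "complex \<Rightarrow> complex" where
  "zeta = (SOME f. f holomorphic_on - {1} \<and>
                   (\<forall>s. Re s > 1 \<longrightarrow> (\<lambda>n. 1 / of_nat (Suc n) powr s) sums f s))"

definition bessel_I :: "complex \<Rightarrow> complex \<Rightarrow> complex" where
  "bessel_I \<nu> z = (z / 2) powr \<nu> * (\<Sum>m. (z / 2) ^ (2 * m) * rGamma (\<nu> + of_nat m + 1) / fact m)"

definition bessel_K_nonint :: "complex \<Rightarrow> complex \<Rightarrow> complex" where
  "bessel_K_nonint \<nu> z =
     of_real pi / 2 * (bessel_I (- \<nu>) z - bessel_I \<nu> z) / sin (of_real pi * \<nu>)"

definition bessel_K :: "complex \<Rightarrow> complex \<Rightarrow> complex" where
  "bessel_K \<nu> z =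
     (if \<nu> \<in> \<int> then Lim (at \<nu>) (\<lambda>\<mu>. bessel_K_nonint \<mu> z) else bessel_K_nonint \<nu> z)"

text \<open>Only meaningful for arguments of modulus less than 1.\<close>

definition hyp2F1 :: "complex \<Rightarrow> complex \<Rightarrow> complex \<Rightarrow> complex \<Rightarrow> complex" where
  "hyp2F1 a b c x = (\<Sum>n. pochhammer a n * pochhammer b n / (pochhammer c n * fact n) * x ^ n)"

definition shifted_root :: "real \<Rightarrow> complex \<Rightarrow> complex" where
  "shifted_root t z = csqrt (z\<^sup>2 + \<i> * of_real t)"

definition root_quot :: "real \<Rightarrow> complex \<Rightarrow> complex \<Rightarrow> complex" where
  "root_quot t z w = (shifted_root t z - shifted_root t w) / (shifted_root t z + shifted_root t w)"

text \<open>The condition of being nonzero is needed because \<^term>\<open>Arg 0 = 0\<close> in the library.\<close>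

definition zw_region :: "(complex \<times> complex) set" where
  "zw_region = {(z, w). z \<noteq> 0 \<and> \<bar>Arg z\<bar> < pi / 4 \<and> w \<noteq> 0 \<and> \<bar>Arg w\<bar> < pi / 4 \<and> Re z > Re w}"

text \<open>
  Holomorphy in two complex variables: joint continuity together with holomorphy in each
  variable separately (equivalent to joint complex differentiability by Osgood's lemma).
\<close>

definition holomorphic2_on :: "(complex \<times> complex \<Rightarrow> complex) \<Rightarrow> (complex \<times> complex) set \<Rightarrow> bool" where
  "holomorphic2_on f S \<longleftrightarrow>
     continuous_on S f \<and>
     (\<forall>w. (\<lambda>z. f (z, w)) holomorphic_on {z. (z, w) \<in> S}) \<and>
     (\<forall>z. (\<lambda>w. f (z, w)) holomorphic_on {w. (z, w) \<in> S})"

text \<open>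
  The power with exponent \<open>\<nu>\<close> of \<^const>\<open>root_quot\<close>, continued analytically from real
  \<open>z > w > 0\<close>, where it is the principal value. On the (convex) region such a continuation
  exists and is unique. It can differ from the principal power, since \<^const>\<open>root_quot\<close> may
  cross the negative real axis.
\<close>

definition root_quot_powr :: "real \<Rightarrow> complex \<Rightarrow> complex \<times> complex \<Rightarrow> complex" where
  "root_quot_powr t \<nu> = (SOME P. holomorphic2_on P zw_region \<and>
     (\<forall>x y :: real. 0 < y \<and> y < x \<longrightarrow>
        P (of_real x, of_real y) = root_quot t (of_real x) (of_real y) powr \<nu>))"

definition \<A> :: "complex \<Rightarrow> complex \<Rightarrow> complex \<Rightarrow> complex \<Rightarrow> real \<Rightarrow> complex" where
  "\<A> s \<nu> z w t =
     1 / (shifted_root t z * shifted_root t w)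
     * (1 / shifted_root t z + 1 / shifted_root t w) powr (2 * s)
     * root_quot_powr t \<nu> (z, w)
     * hyp2F1 (\<nu> - s) (- s) (\<nu> + 1) ((root_quot t z w)\<^sup>2)"

definition h_term :: "complex \<Rightarrow> complex \<Rightarrow> complex \<Rightarrow> complex \<Rightarrow> complex" where
  "h_term \<alpha> \<beta> s \<nu> =
     (if Re (s + \<nu>) > 0 then 0
      else if s = - \<nu> then (\<alpha> - \<beta>) powr \<nu> / 2 powr (4 * \<nu> + 1)
      else undefined)"

definition zeta_terms :: "complex \<Rightarrow> complex \<Rightarrow> complex \<Rightarrow> complex \<Rightarrow> complex" where
  "zeta_terms \<alpha> \<beta> \<nu> s =
     - (zeta (- s) / (2 * \<nu>) * ((csqrt \<alpha> - csqrt \<beta>) / (csqrt \<alpha> + csqrt \<beta>)) powr \<nu>)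
     + zeta (- s) / (2 powr (3 * s + 2) * of_real pi powr (s + 1) * csqrt (\<alpha> * \<beta>))
       * (Gamma (\<nu> + s + 1) / Gamma (\<nu> + 1))
       * ((csqrt \<alpha> - csqrt \<beta>) / (csqrt \<alpha> + csqrt \<beta>)) powr \<nu>
       * (1 / csqrt \<alpha> + 1 / csqrt \<beta>) powr (2 * s)
       * hyp2F1 (\<nu> - s) (- s) (\<nu> + 1) (((csqrt \<alpha> - csqrt \<beta>) / (csqrt \<alpha> + csqrt \<beta>))\<^sup>2)"

end

theory Submission
 imports Defs "HOL-Real_Asymp.Real_Asymp"
begin

text \<open>
 Write \<open>I\<close> of order \<open>\<nu>\<close> as a power times an entire function, and let \<open>\<Psi> x\<close> be that entire function at
 \<open>pi * (\<alpha> - \<beta>) * x\<close> times \<open>exp (- (pi * (\<alpha> + \<beta>) * x))\<close>. The double series over \<open>d, k \<ge> 1\<close> with terms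
 \<open>d powr s * k powr (- 1) * (d / k) powr \<nu> * \<Psi> (d / k)\<close> can be summed in two ways. Poisson summation over
 \<open>d\<close> produces Laplace transforms of \<open>\<Psi>\<close>, which are the hypergeometric summands \<open>\<A>\<close>; Poisson summation
 over \<open>k\<close> produces integrals with the kernel \<open>exp (- X / x)\<close>, which are the products of \<open>I\<close> and \<open>K\<close>.
 This gives the identity when \<open>Re s < - 1\<close> and \<open>Re (s + \<nu>) > 1\<close>.

 Once the leading asymptotic term of \<open>\<A>\<close> is subtracted, both sides are holomorphic for \<open>Re \<nu> > 0\<close>,
 \<open>Re (s + \<nu>) > - 1\<close> apart from the pole at \<open>s = - 1\<close>, and the identity persists by analytic continuation.
 The subtracted terms add up to \<open>sin (pi * (s + \<nu>) / 2) * zeta (1 + s + \<nu>) * zeta (1 + \<nu>)\<close> up to elementary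
 factors. For \<open>Re (s + \<nu>) > 0\<close> they are put back into the series; for \<open>s = - \<nu>\<close> the zero of the sine cancels
 against the pole of \<open>zeta\<close>, and what remains is the term with \<open>h\<close>.
\<close>

text \<open>Both integral transforms can be evaluated because, with \<open>q\<close> the quotient of
  difference and sum of the two square roots and \<open>\<mu>\<close> half the square of their sum,
  \<open>a + b = \<mu> * (1 + q^2)\<close> and \<open>a - b = 2 * q * \<mu>\<close>. The kernel is
  then a generating function in \<open>q\<close> with Laguerre polynomials as coefficients, and
  their moments collapse to single terms: by a three-term recurrence for the kernel
  \<open>exp (- X / x)\<close>, by Chu-Vandermonde for the Laplace transform. The latter gives a 2F1
  with parameters \<open>s + \<nu> + 1\<close>, \<open>s + 1\<close>, \<open>\<nu> + 1\<close>,
  which Euler's transformation turns into the one in the summand. Absolute convergence forces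
  \<open>Re \<nu> > 2\<close>, so continuation in \<open>s\<close> alone never reaches small
  \<open>Re \<nu>\<close>; both variables have to move. At \<open>s = - \<nu>\<close> the values at
  \<open>t = n\<close> and \<open>t = - n\<close> are only of order \<open>1 / n\<close>, and
  convergence rests on their cancellation in pairs. \<open>zeta\<close> and
  \<open>root_quot_powr\<close> are choice terms, so for each an explicit witness must be built
  before anything is known about it.\<close>

abbreviation halfline :: "real measure" where "halfline \<equiv> lebesgue_on {0<..}"

section \<open>Holomorphic dependence of integrals and series on a parameter\<close>

text \<open>Cauchy's inequality on discs of a fixed radius turns the local bound \<open>B\<close> on
  the integrand into the bound \<open>B / \<rho>\<close> on its derivative, hence on all difference
  quotients near \<open>z0\<close>. Dominated convergence then differentiates under the integral
  sign.\<close>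

lemma holomorphic_on_lebesgue_integral:
 fixes f :: "complex \<Rightarrow> 'a \<Rightarrow> complex"
 assumes "open S"
  and meas: "\<And>z. z \<in> S \<Longrightarrow> f z \<in> borel_measurable M"
  and hol: "\<And>x. x \<in> space M \<Longrightarrow> (\<lambda>z. f z x) holomorphic_on S"
  and dom: "\<And>z0. z0 \<in> S \<Longrightarrow> \<exists>r>0. \<exists>B. integrable M B \<and>
        (\<forall>z\<in>ball z0 r \<inter> S. \<forall>x\<in>space M. norm (f z x) \<le> B x)"
 shows "(\<lambda>z. \<integral>x. f z x \<partial>M) holomorphic_on S"
unfolding holomorphic_on_def
proof
 let ?B = "\<lambda>z0 M. \<integral>x. f z0 x \<partial>M"
 let ?A = "\<lambda>x. \<lambda>z. f z x"
 fix z0 assume z0: "z0 \<in> S"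
 obtain r0 B where r0: "r0 > 0" and B: "integrable M B"
  and Bd: "\<And>z x. z \<in> ball z0 r0 \<inter> S \<Longrightarrow> x \<in> space M \<Longrightarrow> norm (f z x) \<le> B x"
  using dom[OF z0] by blast
 obtain r1 where r1: "r1 > 0" "ball z0 r1 \<subseteq> S"
  using \<open>open S\<close> z0 openE by blast
 \<comment> \<open>A third of the available radius, so that a closed disc of radius
   \<open>\<rho>\<close> about any point of \<open>ball z0 \<rho>\<close> stays where both the
   holomorphy and the bound hold.\<close>
 define \<rho> where "\<rho> = min r0 r1 / 3"
 have \<rho>: "\<rho> > 0" using r0 r1 by (simp add: \<rho>_def)
 have sub: "cball z \<rho> \<subseteq> ball z0 r0 \<inter> S" if "z \<in> ball z0 \<rho>" for z
 proof
  fix w assume "w \<in> cball z \<rho>"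
  hence "dist z0 w < 3 * \<rho>"
   using that dist_triangle[of z0 w z] \<rho> by (simp add: dist_commute)
  moreover have "3 * \<rho> = min r0 r1" by (simp add: \<rho>_def)
  ultimately have "w \<in> ball z0 r0" "w \<in> ball z0 r1" by auto
  with r1 show "w \<in> ball z0 r0 \<inter> S" by auto
 qed
 have int: "integrable M (f z)" if "z \<in> ball z0 \<rho>" for z
 proof (rule Bochner_Integration.integrable_bound[OF B])
  have "z \<in> ball z0 r0 \<inter> S" using subsetD[OF sub[OF that], of z] \<rho> by simp
  then show "f z \<in> borel_measurable M" "AE x in M. norm (f z x) \<le> norm (B x)"
   using meas Bd by (auto intro!: AE_I2 order_trans[OF _ abs_ge_self])
 qed
 define g where "g = (\<lambda>x. deriv (?A x) z0)"
 have dbound: "norm (deriv (?A x) z) \<le> B x / \<rho>" if z: "z \<in> ball z0 \<rho>" and x: "x \<in> space M" for z x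
 proof -
  have "norm ((deriv ^^ 1) (?A x) z) \<le> fact 1 * B x / \<rho> ^ 1"
  proof (rule Cauchy_inequality)
   show "(?A x) holomorphic_on ball z \<rho>"
    using sub[OF z] ball_subset_cball by (intro holomorphic_on_subset[OF hol[OF x]]) blast
   show "continuous_on (cball z \<rho>) (?A x)"
    using sub[OF z] by (intro holomorphic_on_imp_continuous_on holomorphic_on_subset[OF hol[OF x]]) blast
   show "norm (f w x) \<le> B x" if "norm (z - w) = \<rho>" for w
    using sub[OF z] that x by (intro Bd) (auto simp: dist_norm)
  qed (use \<rho> in auto)
  thus ?thesis by simp
 qed
 have deriv: "((?A x) has_field_derivative deriv (?A x) z) (at z)" if "z \<in> ball z0 \<rho>" "x \<in> space M" for z x
 proof -
  have "z \<in> S" using subsetD[OF sub[OF that(1)], of z] \<rho> by simp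
  thus ?thesis using hol[OF that(2)] \<open>open S\<close> holomorphic_derivI by blast
 qed
 have lip: "norm ((f z x - f z0 x) / (z - z0)) \<le> B x / \<rho>" if z: "z \<in> ball z0 \<rho>" and x: "x \<in> space M" for z x
 proof -
  have "norm (f z x - f z0 x) \<le> (B x / \<rho>) * norm (z - z0)"
   by (rule field_differentiable_bound[where S = "ball z0 \<rho>" and f' = "\<lambda>z. deriv (?A x) z"])
     (use z x \<rho> deriv dbound in \<open>auto intro: has_field_derivative_at_within\<close>)
  moreover have "0 \<le> B x / \<rho>" using dbound[OF _ x, of z0] \<rho> norm_ge_zero
   by (meson centre_in_ball order_trans)
  ultimately show ?thesis
   by (cases "z = z0") (auto simp: norm_divide divide_simps)
 qed
 have "((\<lambda>z. \<integral>x. f z x \<partial>M) has_field_derivative (\<integral>x. g x \<partial>M)) (at z0)"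
  unfolding has_field_derivative_iff tendsto_at_iff_sequentially comp_def
 proof (intro allI impI)
  fix X :: "nat \<Rightarrow> complex" assume X: "\<forall>i. X i \<in> UNIV - {z0}" "X \<longlonglongrightarrow> z0"
  obtain N where N: "\<And>n. n \<ge> N \<Longrightarrow> X n \<in> ball z0 \<rho>"
   using X(2) \<rho> unfolding tendsto_iff eventually_sequentially by (fastforce simp: dist_commute)
  have "(\<lambda>n. \<integral>x. (f (X (n + N)) x - f z0 x) / (X (n + N) - z0) \<partial>M) \<longlonglongrightarrow> (\<integral>x. g x \<partial>M)"
  proof (rule integral_dominated_convergence)
   have lim: "(\<lambda>n. (f (X (n + N)) x - f z0 x) / (X (n + N) - z0)) \<longlonglongrightarrow> g x" if "x \<in> space M" for x
   proof -
    have "(\<lambda>z. (f z x - f z0 x) / (z - z0)) \<midarrow>z0\<rightarrow> g x"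
     using deriv[of z0 x] that \<rho> unfolding has_field_derivative_iff g_def by simp
    moreover have "(\<lambda>n. X (n + N)) \<longlonglongrightarrow> z0" using X(2) by (rule LIMSEQ_ignore_initial_segment)
    ultimately show ?thesis using X(1) unfolding tendsto_at_iff_sequentially comp_def by auto
   qed
   show meas': "(\<lambda>x. (f (X (n + N)) x - f z0 x) / (X (n + N) - z0)) \<in> borel_measurable M" for n
    using int[OF N[of "n + N"]] int[of z0] \<rho> by (intro borel_measurable_divide borel_measurable_diff) auto
   \<comment> \<open>The pointwise derivative is measurable as a limit of difference quotients along
     the given sequence.\<close>
   show "g \<in> borel_measurable M"
    by (rule borel_measurable_LIMSEQ_metric[OF meas' lim])
   show "AE x in M. (\<lambda>n. (f (X (n + N)) x - f z0 x) / (X (n + N) - z0)) \<longlonglongrightarrow> g x"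
    using lim by auto
   show "integrable M (\<lambda>x. B x / \<rho>)" using B by simp
   show "AE x in M. norm ((f (X (n + N)) x - f z0 x) / (X (n + N) - z0)) \<le> B x / \<rho>" for n
    using lip[OF N[of "n + N"]] by (intro AE_I2) auto
  qed
  also have "(\<lambda>n. \<integral>x. (f (X (n + N)) x - f z0 x) / (X (n + N) - z0) \<partial>M) =
    (\<lambda>n. ((\<integral>x. f (X (n + N)) x \<partial>M) - (?B z0 M)) / (X (n + N) - z0))"
  proof
   fix n
   have "(\<integral>x. (f (X (n + N)) x - f z0 x) / (X (n + N) - z0) \<partial>M) = (\<integral>x. f (X (n + N)) x - f z0 x \<partial>M) / (X (n + N) - z0)"
    by (rule integral_divide_zero)
   also have "(\<integral>x. f (X (n + N)) x - f z0 x \<partial>M) = (\<integral>x. f (X (n + N)) x \<partial>M) - (?B z0 M)"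
    using int[OF N[of "n + N"]] int[of z0] \<rho> by (intro Bochner_Integration.integral_diff) auto
   finally show "(\<integral>x. (f (X (n + N)) x - f z0 x) / (X (n + N) - z0) \<partial>M) = ((\<integral>x. f (X (n + N)) x \<partial>M) - (?B z0 M)) / (X (n + N) - z0)" .
  qed
  finally show "(\<lambda>n. ((\<integral>x. f (X n) x \<partial>M) - (?B z0 M)) / (X n - z0)) \<longlonglongrightarrow> (\<integral>x. g x \<partial>M)"
   by (rule LIMSEQ_offset)
 qed
 thus "(\<lambda>z. \<integral>x. f z x \<partial>M) field_differentiable at z0 within S"
  using field_differentiable_def has_field_derivative_at_within by blast
qed

text \<open>A series is an integral over the counting measure, so the preceding lemma
  applies.\<close>

lemma holomorphic_on_suminf:
 fixes f :: "nat \<Rightarrow> complex \<Rightarrow> complex"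
 assumes "open S"
  and hol: "\<And>n. f n holomorphic_on S"
  and dom: "\<And>z0. z0 \<in> S \<Longrightarrow> \<exists>r>0. \<exists>B. summable B \<and> (\<forall>z\<in>ball z0 r \<inter> S. \<forall>n. norm (f n z) \<le> B n)"
 shows "(\<lambda>z. \<Sum>n. f n z) holomorphic_on S"
proof -
 have sum: "\<exists>r>0. \<exists>B. integrable (count_space UNIV) B \<and> 
   (\<forall>z\<in>ball z0 r \<inter> S. \<forall>n\<in>space (count_space UNIV). norm (f n z) \<le> B n)" if z0: "z0 \<in> S" for z0
 proof -
  obtain r B where r: "r > 0" and B: "summable B" and b: "\<forall>z\<in>ball z0 r \<inter> S. \<forall>n. norm (f n z) \<le> B n"
   using dom[OF z0] by blast
  have "norm (B n) = B n" for n
  proof -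
   have le: "norm (f n z0) \<le> B n" using b r z0 by auto
   show ?thesis using order_trans[OF norm_ge_zero le] by simp
  qed
  hence "integrable (count_space UNIV) B" using B by (simp add: integrable_count_space_nat_iff)
  with r b show ?thesis by auto
 qed
 have "(\<lambda>z. \<integral>n. f n z \<partial>count_space UNIV) holomorphic_on S"
  by (rule holomorphic_on_lebesgue_integral[OF \<open>open S\<close> _ _ sum]) (use hol in auto)
 also have "?this \<longleftrightarrow> ?thesis"
 proof (rule holomorphic_cong)
  fix z assume z: "z \<in> S"
  obtain r B where "r > 0" and B: "summable B" and b: "\<forall>z\<in>ball z r \<inter> S. \<forall>n. norm (f n z) \<le> B n"
   using dom[OF z] by blast
  hence "summable (\<lambda>n. norm (f n z))" using z by (intro summable_comparison_test[OF _ B]) auto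
  thus "(\<integral>n. f n z \<partial>count_space UNIV) = (\<Sum>n. f n z)"
   by (intro integral_count_space_nat) (simp add: integrable_count_space_nat_iff)
 qed simp
 finally show ?thesis .
qed

text \<open>Dominated convergence for the partial sums. Only the partial sums have to be bounded;
  the single terms are integrable as differences of consecutive partial sums.\<close>

lemma dominated_sums_integral:
 fixes f :: "nat \<Rightarrow> 'a \<Rightarrow> complex"
 assumes meas: "\<And>n. f n \<in> borel_measurable M"
  and sums: "\<And>x. x \<in> space M \<Longrightarrow> (\<lambda>n. f n x) sums g x"
  and B: "integrable M B"
  and bd: "\<And>N x. x \<in> space M \<Longrightarrow> norm (\<Sum>n<N. f n x) \<le> B x"
 shows "(\<lambda>n. \<integral>x. f n x \<partial>M) sums (\<integral>x. g x \<partial>M)" (is ?P) and "integrable M g" and "integrable M (f n)"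
proof -
 have int: "integrable M (f n)" for n
 proof (rule Bochner_Integration.integrable_bound[OF Bochner_Integration.integrable_add[OF B B] meas])
  show "AE x in M. norm (f n x) \<le> norm (B x + B x)"
  proof (rule AE_I2)
   fix x assume x: "x \<in> space M"
   have "f n x = (\<Sum>k<Suc n. f k x) - (\<Sum>k<n. f k x)" by simp
   hence "norm (f n x) \<le> norm (\<Sum>k<Suc n. f k x) + norm (\<Sum>k<n. f k x)"
    using norm_triangle_ineq4 by metis
   with bd[OF x, of "Suc n"] bd[OF x, of n] show "norm (f n x) \<le> norm (B x + B x)" by simp
  qed
 qed
 show "integrable M (f n)" by (rule int)
 have gm: "g \<in> borel_measurable M"
  by (rule borel_measurable_LIMSEQ_metric[of "\<lambda>N x. \<Sum>n<N. f n x"])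
    (use meas sums in \<open>auto simp: sums_def\<close>)
 have "(\<lambda>N. \<integral>x. (\<Sum>n<N. f n x) \<partial>M) \<longlonglongrightarrow> (\<integral>x. g x \<partial>M)"
  by (rule integral_dominated_convergence[where w = B])
    (use meas gm B bd sums in \<open>auto simp: sums_def\<close>)
 thus ?P
  unfolding sums_def using int by (simp add: Bochner_Integration.integral_sum)
 show "integrable M g"
 proof (rule Bochner_Integration.integrable_bound[OF B gm])
  show "AE x in M. norm (g x) \<le> norm (B x)"
  proof (rule AE_I2)
   fix x assume x: "x \<in> space M"
   have "norm (g x) \<le> B x"
    using sums[OF x] bd[OF x] unfolding sums_def
    by (intro Lim_bounded[OF tendsto_norm]) auto
   thus "norm (g x) \<le> norm (B x)" by simp
  qed
 qed
qed

section \<open>Change of variables on the half line\<close>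

lemma integrable_lebesgue_on_iff:
 fixes f :: "real \<Rightarrow> 'b::euclidean_space"
 assumes "S \<in> sets lebesgue"
 shows "integrable (lebesgue_on S) f \<longleftrightarrow> f absolutely_integrable_on S"
 using assms by (subst integrable_restrict_space) (auto simp: set_integrable_def)

text \<open>The equation between the integrals holds for every \<open>f\<close>: if one side is not
  integrable then neither is the other, and both integrals are 0 by convention.\<close>

lemma lebesgue_on_change_of_variables:
 fixes f :: "real \<Rightarrow> 'b::euclidean_space" and g :: "real \<Rightarrow> real"
 assumes S: "S \<in> sets lebesgue" and gS: "g ` S \<in> sets lebesgue"
  and der: "\<And>x. x \<in> S \<Longrightarrow> (g has_field_derivative h x) (at x within S)"
  and inj: "inj_on g S"
 shows "integrable (lebesgue_on S) (\<lambda>x. \<bar>h x\<bar> *\<^sub>R f (g x)) \<longleftrightarrow> integrable (lebesgue_on (g ` S)) f" (is ?P)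
  and "(\<integral>x. \<bar>h x\<bar> *\<^sub>R f (g x) \<partial>lebesgue_on S) = (\<integral>x. f x \<partial>lebesgue_on (g ` S))" (is ?Q)
proof -
 show *: ?P
  unfolding integrable_lebesgue_on_iff[OF S] integrable_lebesgue_on_iff[OF gS]
  using absolutely_integrable_change_of_variables_real[OF S der inj, of f] by blast
 show ?Q
 proof (cases "integrable (lebesgue_on (g ` S)) f")
  case True
  have "integral S (\<lambda>x. \<bar>h x\<bar> *\<^sub>R f (g x)) = integral (g ` S) f"
   using has_absolute_integral_change_of_variables_real[OF S der inj, of f "integral (g ` S) f"] True
   by (auto simp: integrable_lebesgue_on_iff[OF gS])
  thus ?thesis using True * S gS by (simp add: lebesgue_integral_eq_integral)
 qed (use * in \<open>simp add: not_integrable_integral_eq\<close>)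
qed

lemma lebesgue_on_Ioi_scale:
 fixes f :: "real \<Rightarrow> complex" and k :: real
 assumes k: "k > 0"
 shows "integrable halfline (\<lambda>x. f (k * x)) \<longleftrightarrow> integrable halfline f" (is ?P)
  and "(\<integral>x. f (k * x) \<partial>halfline) = (\<integral>x. f x \<partial>halfline) / of_real k" (is ?Q)
proof -
 let ?A = "\<lambda>x. k *\<^sub>R f (k * x)"
 have im: "(\<lambda>x. k * x) ` {0<..} = {0<..}"
 proof safe
  fix x :: real assume "x > 0"
  thus "x \<in> (\<lambda>x. k * x) ` {0<..}" using k by (intro image_eqI[of _ _ "x / k"]) auto
 qed (use k in auto)
 have der: "\<And>x. x \<in> {0<..} \<Longrightarrow> ((\<lambda>x. k * x) has_field_derivative k) (at x within {0<..})"
  by (auto intro!: derivative_eq_intros)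
 note * = lebesgue_on_change_of_variables[where S = "{0<..}" and g = "\<lambda>x. k * x" and h = "\<lambda>_. k" and f = f, OF _ _ der, unfolded im]
 have "integrable halfline ?A \<longleftrightarrow> integrable halfline f"
  using *(1) k by (simp add: inj_on_def)
 moreover have "integrable halfline ?A \<longleftrightarrow> integrable halfline (\<lambda>x. f (k * x))"
 proof
  assume "integrable halfline ?A"
  hence "integrable halfline (\<lambda>x. (1 / k) *\<^sub>R (k *\<^sub>R f (k * x)))" by (rule integrable_scaleR_right)
  thus "integrable halfline (\<lambda>x. f (k * x))" using k by simp
 qed (rule integrable_scaleR_right)
 ultimately show ?P
  by simp
 have "(\<integral>x. k *\<^sub>R f (k * x) \<partial>halfline) = (\<integral>x. f x \<partial>halfline)"
  using *(2) k by (simp add: inj_on_def)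
 thus ?Q
  using k by (simp add: field_simps scaleR_conv_of_real)
qed

lemma lebesgue_on_inverse:
 fixes f :: "real \<Rightarrow> complex"
 assumes S: "S \<in> sets lebesgue" and T: "T \<in> sets lebesgue" and im: "inverse ` S = T" and pos: "S \<subseteq> {0<..}"
 shows "integrable (lebesgue_on S) (\<lambda>x. f (1 / x) / of_real (x ^ 2)) \<longleftrightarrow> integrable (lebesgue_on T) f" (is ?P)
  and "(\<integral>x. f (1 / x) / of_real (x ^ 2) \<partial>lebesgue_on S) = (\<integral>x. f x \<partial>lebesgue_on T)" (is ?Q)
proof -
 have der: "(inverse has_field_derivative - (inverse x ^ 2)) (at x within S)" if "x \<in> S" for x :: real
  using that pos by (auto intro!: derivative_eq_intros simp: power2_eq_square)
 have inj: "inj_on inverse S" by (simp add: inj_on_def)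
 note * = lebesgue_on_change_of_variables[where f = f, OF S _ der inj, unfolded im, OF T]
 have eq: "\<bar>- (inverse x ^ 2)\<bar> *\<^sub>R f (inverse x) = f (1 / x) / of_real (x ^ 2)" for x :: real
  by (simp add: scaleR_conv_of_real divide_inverse power_inverse mult.commute)
 show ?P
  using *(1) unfolding eq .
 show ?Q
  using *(2) unfolding eq .
qed

lemma inverse_image_Ioi: "inverse ` {0::real<..} = {0<..}"
proof (intro equalityI subsetI)
 fix x :: real assume "x \<in> {0<..}"
 thus "x \<in> inverse ` {0<..}" by (intro image_eqI[of _ _ "inverse x"]) auto
qed auto

lemma inverse_image_Ici_1: "inverse ` {1::real..} = {0<..1}"
proof (intro equalityI subsetI)
 fix x :: real assume "x \<in> {0<..1}"
 thus "x \<in> inverse ` {1..}" by (intro image_eqI[of _ _ "inverse x"]) (auto simp: one_le_inverse)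
next
 fix x :: real assume "x \<in> inverse ` {1..}"
 thus "x \<in> {0<..1}" by (auto simp: inverse_le_1_iff)
qed

lemma has_vector_derivative_powr_of_real:
 assumes "x > 0"
 shows "((\<lambda>x. complex_of_real x powr a) has_vector_derivative a * of_real x powr (a - 1)) (at x within S)"
proof -
 have "((\<lambda>z. z powr a) has_field_derivative a * of_real x powr (a - 1)) (at (of_real x))"
  using assms by (auto intro!: derivative_eq_intros simp: complex_nonpos_Reals_iff)
 thus ?thesis
  using has_vector_derivative_real_field has_vector_derivative_at_within by blast
qed

lemma integrable_powr_exp_real:
 fixes a c :: real
 assumes "a > 0" "c > 0"
 shows "integrable halfline (\<lambda>x. x powr (a - 1) * exp (- (c * x)))"
proof -
 have "integrable halfline (\<lambda>t. norm (complex_of_real t powr (of_real a - 1) / of_real (exp (c * t))))"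
  using absolutely_integrable_Gamma_integral[of "of_real a" c] assms
  by (intro integrable_norm) (simp add: integrable_lebesgue_on_iff)
 thus ?thesis
  by (rule Bochner_Integration.integrable_cong[THEN iffD1, rotated -1])
    (auto simp: norm_divide norm_powr_real_powr exp_minus field_simps)
qed

lemma integrable_powr_exp:
 fixes a c :: complex
 assumes "Re a > 0" "Re c > 0"
 shows "integrable halfline (\<lambda>x. of_real x powr (a - 1) * exp (- (c * of_real x)))"
 by (rule Bochner_Integration.integrable_bound[OF integrable_powr_exp_real[OF assms]])
   (auto intro!: AE_I2 continuous_imp_measurable_on_sets_lebesgue continuous_intros
      simp: norm_mult norm_powr_real_powr complex_nonpos_Reals_iff)

lemma lebesgue_on_ftc:
 fixes F f :: "real \<Rightarrow> complex" and a :: real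
 assumes der: "\<And>x. x > a \<Longrightarrow> (F has_vector_derivative f x) (at x)"
  and cont: "continuous_on {a<..} f"
  and int: "integrable (lebesgue_on {a<..}) f"
  and A: "(F \<longlongrightarrow> A) (at_right a)" and B: "(F \<longlongrightarrow> B) at_top"
 shows "(\<integral>x. f x \<partial>lebesgue_on {a<..}) = B - A"
proof -
 have ae: "f absolutely_integrable_on {a<..}" using int by (simp add: integrable_lebesgue_on_iff)
 \<comment> \<open>The fundamental theorem is used over \<open>lborel\<close>, so Borel
   measurability is taken from the continuity of \<open>f\<close>.\<close>
 have m: "(\<lambda>x. indicator {a<..} x *\<^sub>R f x) \<in> borel_measurable borel"
  using cont by (intro borel_measurable_continuous_on_indicator) auto
 have sl: "set_integrable lborel {a<..} f"
  using ae m unfolding set_integrable_def by (subst (asm) integrable_completion) auto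
 have "(LBINT x=ereal a..\<infinity>. f x) = B - A"
 proof (rule interval_integral_FTC_integrable[where F = F])
  show "isCont f x" if "ereal a < ereal x" "ereal x < \<infinity>" for x
   using cont that by (auto simp: continuous_on_eq_continuous_at)
  show "((F \<circ> real_of_ereal) \<longlongrightarrow> A) (at_right (ereal a))" using A by (simp add: ereal_tendsto_simps)
  show "((F \<circ> real_of_ereal) \<longlongrightarrow> B) (at_left \<infinity>)" using B by (simp add: ereal_tendsto_simps)
 qed (use der sl in auto)
 also have "(LBINT x=ereal a..\<infinity>. f x) = (LBINT x:{a<..}. f x)"
  by (simp add: interval_lebesgue_integral_def)
 also have "\<dots> = integral {a<..} f" by (rule set_borel_integral_eq_integral(2)[OF sl])
 also have "\<dots> = (\<integral>x. f x \<partial>lebesgue_on {a<..})"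
  using int by (simp add: lebesgue_integral_eq_integral)
 finally show ?thesis by simp
qed

lemma islimpt_of_real_Ioi:
 assumes "x > a"
 shows "complex_of_real x islimpt complex_of_real ` {a<..}"
 unfolding islimpt_approachable
proof (intro allI impI)
 fix e :: real assume e: "e > 0"
 show "\<exists>x'\<in>complex_of_real ` {a<..}. x' \<noteq> complex_of_real x \<and> dist x' (complex_of_real x) < e"
 proof (intro bexI conjI)
  show "complex_of_real (x + e / 2) \<noteq> complex_of_real x" unfolding of_real_eq_iff using e by simp
  show "dist (complex_of_real (x + e / 2)) (complex_of_real x) < e"
   unfolding dist_of_real using e by (simp add: dist_real_def)
  show "complex_of_real (x + e / 2) \<in> complex_of_real ` {a<..}" by (rule imageI) (use assms e in simp)
 qed
qed

text \<open>For real positive \<open>c\<close> this is a substitution in Euler's integral. Both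
  sides are holomorphic in \<open>c\<close> on the right half plane, so agreement on the positive
  axis carries over.\<close>

lemma Gamma_integral_scaled:
 fixes a c :: complex
 assumes a: "Re a > 0" and c: "Re c > 0"
 shows "(\<integral>x. of_real x powr (a - 1) * exp (- (c * of_real x)) \<partial>halfline) = Gamma a * c powr (- a)"
proof -
 let ?A = "\<lambda>k halfline. \<integral>x. of_real (k * x) powr (a - 1) * exp (- (1 * of_real (k * x))) \<partial>halfline"
 define F where "F = (\<lambda>c. \<integral>x. of_real x powr (a - 1) * exp (- (c * of_real x)) \<partial>halfline)"
 have "F 1 = integral {0<..} (\<lambda>x. of_real x powr (a - 1) * exp (- (1 * of_real x)))"
  unfolding F_def using integrable_powr_exp[OF a, of 1] by (intro lebesgue_integral_eq_integral) auto
 also have "\<dots> = integral {0<..} (\<lambda>t. of_real t powr (a - 1) / of_real (exp t))"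
  by (intro arg_cong[where f = "integral {0<..}"] ext)
    (auto simp: exp_minus field_simps exp_of_real)
 also have "\<dots> = Gamma a" using Gamma_integral_complex'[OF a] by (rule integral_unique)
 finally have F1: "F 1 = Gamma a" .
 have real: "F (of_real k) = Gamma a * of_real k powr (- a)" if k: "k > 0" for k
 proof -
  have "(?A k halfline) = F 1 / of_real k"
   unfolding F_def by (rule lebesgue_on_Ioi_scale(2)[OF k])
  also have "(?A k halfline)
    = (\<integral>x. of_real k powr (a - 1) * (of_real x powr (a - 1) * exp (- (of_real k * of_real x))) \<partial>halfline)"
   by (intro Bochner_Integration.integral_cong) (use k in \<open>auto simp: powr_times_real\<close>)
  also have "\<dots> = of_real k powr (a - 1) * F (of_real k)" unfolding F_def by (rule integral_mult_right_zero)
  finally have "of_real k powr (a - 1) * F (of_real k) = Gamma a / of_real k" by (simp add: F1)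
  thus ?thesis using k by (simp add: powr_minus powr_diff field_simps)
 qed
 have holF: "F holomorphic_on {c. Re c > 0}"
  unfolding F_def
 proof (rule holomorphic_on_lebesgue_integral)
  show "open {c. Re c > 0}" by (rule open_halfspace_Re_gt)
  fix z :: complex assume z: "z \<in> {c. Re c > 0}"
  show "(\<lambda>x. of_real x powr (a - 1) * exp (- (z * of_real x))) \<in> borel_measurable halfline"
   using integrable_powr_exp[OF a, of z] z by auto
  show "\<exists>r>0. \<exists>B. integrable halfline B \<and>
      (\<forall>w\<in>ball z r \<inter> {c. 0 < Re c}. \<forall>x\<in>space halfline.
       norm (of_real x powr (a - 1) * exp (- (w * of_real x))) \<le> B x)"
  proof (intro exI conjI ballI)
   show "Re z / 2 > 0" using z by simp
   show "integrable halfline (\<lambda>x. x powr (Re a - 1) * exp (- ((Re z / 2) * x)))"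
    using z a by (intro integrable_powr_exp_real) auto
   fix w x assume w: "w \<in> ball z (Re z / 2) \<inter> {c. 0 < Re c}" and x: "x \<in> space halfline"
   have "\<bar>Re z - Re w\<bar> < Re z / 2"
    using w abs_Re_le_cmod[of "z - w"] by (auto simp: dist_norm)
   hence "Re z / 2 \<le> Re w" by linarith
   hence "Re z / 2 * x \<le> Re w * x" using x by (intro mult_right_mono) auto
   thus "norm (of_real x powr (a - 1) * exp (- (w * of_real x))) \<le> x powr (Re a - 1) * exp (- ((Re z / 2) * x))"
    using x by (auto simp: norm_mult norm_powr_real_powr intro!: mult_left_mono)
  qed
 qed (auto intro!: holomorphic_intros)
 have "F c - Gamma a * c powr (- a) = 0"
 proof (rule analytic_continuation[where S = "{c. Re c > 0}" and U = "complex_of_real ` {0<..}" and \<xi> = 1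
      and f = "\<lambda>c. F c - Gamma a * c powr (- a)"])
  show "(\<lambda>c. F c - Gamma a * c powr (- a)) holomorphic_on {c. Re c > 0}"
   using holF by (intro holomorphic_intros) (auto simp: complex_nonpos_Reals_iff)
  show "connected {c. Re c > 0}" by (intro convex_connected convex_halfspace_Re_gt)
 qed (use islimpt_of_real_Ioi[of 0 1] real c in \<open>auto simp: open_halfspace_Re_gt\<close>)
 thus ?thesis unfolding F_def by simp
qed

section \<open>The incomplete Gamma function\<close>

lemma summable_power_fact_norm: "summable (\<lambda>j. norm c ^ j / fact j :: real)" for c :: complex
 using summable_exp_generic[of "norm c"] by (simp add: divide_inverse mult.commute)

text \<open>The lower incomplete Gamma function without the factor \<open>c powr a\<close>, continued to
 all exponents that are not poles.\<close>
definition inc_Gamma_series :: "complex \<Rightarrow> complex \<Rightarrow> complex" where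
 "inc_Gamma_series c a = (\<Sum>j. (- c) ^ j / (fact j * (a + of_nat j)))"

text \<open>The reciprocals of \<open>a + j\<close> tend to 0, hence are bounded; with this bound
  the series below converges like the exponential series.\<close>

lemma inc_Gamma_denominator_bound:
 assumes "a \<notin> \<int>\<^sub>\<le>\<^sub>0"
 obtains K where "K > 0" "\<And>j. 1 / norm (a + of_nat j :: complex) \<le> K"
proof -
 have nz: "a + of_nat j \<noteq> 0" for j
  using assms by (metis add_eq_0_iff2 minus_of_nat_in_nonpos_Ints)
 have "filterlim (\<lambda>j. of_nat j :: complex) at_infinity sequentially" by (rule tendsto_of_nat)
 hence "filterlim (\<lambda>j. a + of_nat j) at_infinity sequentially"
  by (rule tendsto_add_filterlim_at_infinity[OF tendsto_const])
 hence "(\<lambda>j. inverse (a + of_nat j)) \<longlonglongrightarrow> 0"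
  by (rule filterlim_compose[OF tendsto_inverse_0])
 hence "Bseq (\<lambda>j. inverse (a + of_nat j))" using convergent_imp_Bseq convergentI by blast
 then obtain K where "K > 0" "\<And>j. norm (inverse (a + of_nat j)) \<le> K" by (auto simp: Bseq_def)
 thus ?thesis by (intro that[of K]) (auto simp: norm_inverse norm_divide inverse_eq_divide)
qed

lemma summable_inc_Gamma_series:
 assumes "a \<notin> \<int>\<^sub>\<le>\<^sub>0"
 shows "summable (\<lambda>j. norm ((- c) ^ j / (fact j * (a + of_nat j)) :: complex))"
proof -
 obtain K where K: "K > 0" "\<And>j. 1 / norm (a + of_nat j :: complex) \<le> K"
  using inc_Gamma_denominator_bound[OF assms] by blast
 show ?thesis
 proof (rule summable_comparison_test)
  show "summable (\<lambda>j. (norm c ^ j / fact j) * K)" by (intro summable_mult2 summable_power_fact_norm)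
  have "norm ((- c) ^ j / (fact j * (a + of_nat j)) :: complex) = (norm c ^ j / fact j) * (1 / norm (a + of_nat j))" for j
   by (simp add: norm_divide norm_mult norm_power)
  also have "\<dots> j \<le> (norm c ^ j / fact j) * K" for j
   by (intro mult_left_mono K(2)) auto
  finally show "\<exists>N. \<forall>j\<ge>N. norm (norm ((- c) ^ j / (fact j * (a + of_nat j)) :: complex)) \<le> (norm c ^ j / fact j) * K" 
   by auto
 qed
qed

text \<open>Termwise from \<open>a / (a + j) = 1 - j / (a + j)\<close>: the first part sums to
  \<open>exp (- c)\<close>, the second becomes the series at \<open>a + 1\<close> after a shift of
  index. For \<open>Re a > 0\<close> this is integration by parts in the lower incomplete Gamma
  integral.\<close>

lemma inc_Gamma_series_rec:
 assumes a: "a \<notin> \<int>\<^sub>\<le>\<^sub>0"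
 shows "a * inc_Gamma_series c a = exp (- c) + c * inc_Gamma_series c (a + 1)"
proof -
 let ?B = "exp (- c) + c * inc_Gamma_series c (a + 1)"
 let ?A = "\<lambda>j. (- c) ^ j / (fact j * (a + of_nat j))"
 have a1: "a + 1 \<notin> \<int>\<^sub>\<le>\<^sub>0" using a
  by (metis add_diff_cancel_right' nonpos_Ints_diff_Nats Nats_1)
 have nz: "a + of_nat j \<noteq> 0" for j
  using assms by (metis add_eq_0_iff2 minus_of_nat_in_nonpos_Ints)
 have s1: "(\<lambda>j. (- c) ^ j / (fact j * (a + of_nat j))) sums inc_Gamma_series c a"
  unfolding inc_Gamma_series_def using summable_norm_cancel[OF summable_inc_Gamma_series[OF a]] by (rule summable_sums)
 have s2: "(\<lambda>j. (- c) ^ j / (fact j * (a + 1 + of_nat j))) sums inc_Gamma_series c (a + 1)"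
  unfolding inc_Gamma_series_def using summable_norm_cancel[OF summable_inc_Gamma_series[OF a1]] by (rule summable_sums)
 have e: "(\<lambda>j. (- c) ^ j / fact j) sums exp (- c)"
  using exp_converges[of "- c"] by (simp add: scaleR_conv_of_real divide_inverse mult.commute)
 have "(\<lambda>j. of_nat j * (?A j)) sums (- c * inc_Gamma_series c (a + 1) + 0)"
 proof -
  define F where "F = (\<lambda>j. of_nat j * (?A j))"
  have "- c * ((- c) ^ j / (fact j * (a + 1 + of_nat j))) = F (Suc j)" for j
  proof -
   have "(of_nat (Suc j) :: complex) \<noteq> 0" by (rule of_nat_neq_0)
   thus ?thesis by (simp add: F_def add_ac fact_Suc del: of_nat_Suc) (simp add: add_ac)
  qed
  hence "(\<lambda>j. F (Suc j)) sums (- c * inc_Gamma_series c (a + 1))"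
   using sums_mult[OF s2, of "- c"] by simp
  from sums_Suc[OF this] show ?thesis by (simp add: F_def)
 qed
 from sums_diff[OF e this]
 have "(\<lambda>j. (- c) ^ j / fact j - of_nat j * (?A j)) sums ?B"
  by simp
 moreover have "(- c) ^ j / fact j - of_nat j * (?A j) = a * (?A j)" for j
  using nz[of j] by (simp add: divide_simps) (simp add: algebra_simps)
 ultimately have "(\<lambda>j. a * (?A j)) sums ?B"
  by simp
 with sums_mult[OF s1, of a] show ?thesis using sums_unique2 by blast
qed

lemma integrable_lebesgue_on_subset:
 fixes f :: "real \<Rightarrow> 'b::euclidean_space"
 assumes "integrable (lebesgue_on S) f" "S \<in> sets lebesgue" "T \<in> sets lebesgue" "T \<subseteq> S"
 shows "integrable (lebesgue_on T) f"
 using assms set_integrable_subset[of lebesgue S f T] by (simp add: integrable_lebesgue_on_iff)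

lemma lebesgue_on_split:
 fixes f :: "real \<Rightarrow> complex"
 assumes f: "integrable (lebesgue_on {a<..}) f" and "a < b"
 shows "(\<integral>x. f x \<partial>lebesgue_on {a<..}) = (\<integral>x. f x \<partial>lebesgue_on {a<..b}) + (\<integral>x. f x \<partial>lebesgue_on {b<..})"
proof -
 have 1: "integrable (lebesgue_on {a<..b}) f" "integrable (lebesgue_on {b<..}) f"
  by (rule integrable_lebesgue_on_subset[OF f]; use assms(2) in auto)+
 have [simp]: "{a<..b} \<inter> {b<..} = {}" by auto
 have U: "{a<..} = {a<..b} \<union> {b<..}" using assms(2) by auto
 have "integral {a<..} f = integral {a<..b} f + integral {b<..} f"
  unfolding U by (rule integral_Un)
   (use 1 in \<open>auto simp: integrable_lebesgue_on_iff set_lebesgue_integral_eq_integral(1)\<close>)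
 thus ?thesis using f 1 by (simp add: lebesgue_integral_eq_integral)
qed

text \<open>The boundary case \<open>Re c = 0\<close> matters: the Bessel products of the theorem
  correspond to purely imaginary parameters, where the exponential gives no decay and the power has
  to.\<close>

lemma integrable_powr_exp_Ioi_1:
 fixes a c :: complex
 assumes "Re c > 0 \<or> Re c = 0 \<and> Re a < 0"
 shows "integrable (lebesgue_on {1<..}) (\<lambda>t. of_real t powr (a - 1) * exp (- (c * of_real t)))"
proof (cases "Re c > 0")
 case True
 define b where "b = max (Re a) 1"
 have "integrable (lebesgue_on {1<..}) (\<lambda>x. x powr (b - 1) * exp (- (Re c * x)))"
  by (rule integrable_lebesgue_on_subset[OF integrable_powr_exp_real[of b "Re c"]]) (use True in \<open>auto simp: b_def\<close>)
 thus ?thesis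
  by (rule Bochner_Integration.integrable_bound)
    (auto intro!: AE_I2 continuous_imp_measurable_on_sets_lebesgue continuous_intros powr_mono
      simp: norm_mult norm_powr_real_powr b_def)
next
 case False
 with assms have c: "Re c = 0" "Re a < 0" by auto
 have "(\<lambda>x. x powr (Re a - 1)) integrable_on {1<..}"
  using has_integral_powr_to_inf[of "Re a - 1" 1] c 
  by (intro integrable_spike_set[where S = "{1..}" and T = "{1<..}"]) (auto intro: negligible_subset[of "{1}"])
 hence "integrable (lebesgue_on {1<..}) (\<lambda>x. x powr (Re a - 1))"
  by (simp add: integrable_lebesgue_on_iff nonnegative_absolutely_integrable_1)
 thus ?thesis
  by (rule Bochner_Integration.integrable_bound)
    (use c in \<open>auto intro!: AE_I2 continuous_imp_measurable_on_sets_lebesgue continuous_intros powr_mono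
      simp: norm_mult norm_powr_real_powr\<close>)
qed

lemma integral_powr_Ioc:
 assumes "Re b > 0"
 shows "integrable (lebesgue_on {0<..1}) (\<lambda>t. complex_of_real t powr (b - 1))" (is ?P)
  "(\<integral>t. complex_of_real t powr (b - 1) \<partial>lebesgue_on {0<..1}) = 1 / b" (is ?Q)
proof -
 let ?B = "\<lambda>t. complex_of_real t powr b / b"
 let ?A = "\<lambda>t. complex_of_real t powr (b - 1)"
 have "integrable (lebesgue_on {0<..1}) (\<lambda>x. x powr (Re b - 1))"
  using integrable_on_powr_from_0'[of "Re b - 1" 1] assms
  by (simp add: integrable_lebesgue_on_iff nonnegative_absolutely_integrable_1)
 thus *: ?P
  by (rule Bochner_Integration.integrable_bound)
    (auto intro!: AE_I2 continuous_imp_measurable_on_sets_lebesgue continuous_intros simp: norm_powr_real_powr)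
 have "(?A has_integral (of_real 1 powr b / b - of_real 0 powr b / b)) {0..1}"
 proof (rule fundamental_theorem_of_calculus_interior)
  have "b \<noteq> 0" using assms by auto
  show "continuous_on {0..1} ?B" using assms \<open>b \<noteq> 0\<close>
   by (intro continuous_intros) auto
  fix t :: real assume "t \<in> {0<..<1}"
  hence "((\<lambda>t. complex_of_real t powr b * (1 / b)) has_vector_derivative b * of_real t powr (b - 1) * (1 / b)) (at t)"
   by (intro has_vector_derivative_mult_left has_vector_derivative_powr_of_real) auto
  thus "(?B has_vector_derivative complex_of_real t powr (b - 1)) (at t)"
   using \<open>b \<noteq> 0\<close> by simp
 qed auto
 hence "(?A has_integral 1 / b) {0..1}" by simp
 hence "(?A has_integral 1 / b) {0<..1}"
  by (subst has_integral_spike_set_eq[where T = "{0..1}"]) (auto intro: negligible_subset[of "{0}"])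
 thus ?Q
  using * by (simp add: lebesgue_integral_eq_integral integral_unique)
qed

lemma norm_exp_partial_sum_le: "norm (\<Sum>n<N. z ^ n / fact n) \<le> exp (norm (z::complex))"
proof -
 have "norm (\<Sum>n<N. z ^ n / fact n) \<le> (\<Sum>n<N. norm z ^ n / fact n)"
  by (rule order_trans[OF norm_sum]) (simp add: norm_divide norm_power)
 also have "\<dots> \<le> (\<Sum>n. norm z ^ n / fact n)"
  by (rule sum_le_suminf[OF summable_power_fact_norm]) auto
 also have "\<dots> = exp (norm z)" by (simp add: exp_def scaleR_conv_of_real divide_inverse mult.commute)
 finally show ?thesis .
qed

lemma exp_sums_complex: "(\<lambda>n. z ^ n / fact n) sums exp (z::complex)"
 using exp_converges[of z] by (simp add: scaleR_conv_of_real divide_inverse mult.commute)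

text \<open>Expand the exponential and integrate the powers over the unit interval.\<close>

lemma inc_Gamma_lower:
 assumes a: "Re a > 0"
 shows "integrable (lebesgue_on {0<..1}) (\<lambda>t. of_real t powr (a - 1) * exp (- (c * of_real t)))" (is ?P)
  "(\<integral>t. of_real t powr (a - 1) * exp (- (c * of_real t)) \<partial>lebesgue_on {0<..1}) = inc_Gamma_series c a" (is ?Q)
proof -
 let ?A = "lebesgue_on {0<..1}"
 define f where "f = (\<lambda>n t. of_real t powr (a - 1) * ((- (c * complex_of_real t)) ^ n / fact n))"
 have 1: "f n \<in> borel_measurable ?A" for n
  unfolding f_def by (auto intro!: continuous_imp_measurable_on_sets_lebesgue continuous_intros)
 have 2: "(\<lambda>n. f n t) sums (of_real t powr (a - 1) * exp (- (c * of_real t)))" for t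
  unfolding f_def by (intro sums_mult exp_sums_complex)
 have 3: "integrable ?A (\<lambda>t. norm (complex_of_real t powr (a - 1)) * exp (norm c))"
  by (intro integrable_mult_left integrable_norm integral_powr_Ioc a)
 have 4: "norm (\<Sum>n<N. f n t) \<le> norm (complex_of_real t powr (a - 1)) * exp (norm c)" 
  if "t \<in> space ?A" for N t
 proof -
  have "norm (c * of_real t) \<le> norm c * 1" unfolding norm_mult using that by (intro mult_left_mono) auto
  hence "norm (\<Sum>n<N. (- (c * complex_of_real t)) ^ n / fact n) \<le> exp (norm c)"
   using norm_exp_partial_sum_le[of "- (c * complex_of_real t)" N] by (simp add: order_trans)
  thus ?thesis unfolding f_def sum_distrib_left[symmetric] norm_mult by (intro mult_left_mono) auto
 qed
 note D = dominated_sums_integral[OF 1 2 3 4]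
 show ?P
  using D(2) by simp
 have "(\<integral>t. f n t \<partial>lebesgue_on {0<..1}) = (- c) ^ n / (fact n * (a + of_nat n))" for n
 proof -
  have "(\<integral>t. f n t \<partial>lebesgue_on {0<..1}) = (\<integral>t. (- c) ^ n / fact n * complex_of_real t powr (a + of_nat n - 1) \<partial>lebesgue_on {0<..1})"
   unfolding f_def
  proof (intro Bochner_Integration.integral_cong refl)
   fix t :: real assume "t \<in> space ?A"
   hence t: "t > 0" by simp
   have "complex_of_real t powr (a + of_nat n - 1) = of_real t powr (a - 1) * of_real t ^ n"
   proof -
    have "complex_of_real t powr ((a - 1) + of_nat n) = of_real t powr (a - 1) * of_real t powr of_nat n"
     by (rule powr_add)
    thus ?thesis using t by (simp add: powr_nat' algebra_simps)
   qed
   thus "of_real t powr (a - 1) * ((- (c * complex_of_real t)) ^ n / fact n) = (- c) ^ n / fact n * complex_of_real t powr (a + of_nat n - 1)"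
    by (simp only: power_mult_distrib mult_minus_left[symmetric]) simp
  qed
  also have "\<dots> = (- c) ^ n / fact n * (1 / (a + of_nat n))"
   using a by (subst integral_mult_right_zero, subst integral_powr_Ioc) auto
  finally show ?thesis by simp
 qed
 with D(1) show ?Q
  unfolding inc_Gamma_series_def by (simp add: sums_iff)
qed

text \<open>For \<open>Re c > 0\<close> this is \<open>c powr (- a)\<close> times the upper
  incomplete Gamma function. Without that power the integral also makes sense for imaginary
  \<open>c\<close> when \<open>Re a < 0\<close>.\<close>

definition upper_inc :: "complex \<Rightarrow> complex \<Rightarrow> complex" where
 "upper_inc c a = (\<integral>t. of_real t powr (a - 1) * exp (- (c * of_real t)) \<partial>lebesgue_on {1<..})"

lemma tendsto_powr_exp_at_top:
 assumes "Re c > 0"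
 shows "((\<lambda>t. of_real t powr a * exp (- (c * of_real t))) \<longlongrightarrow> 0) at_top"
proof (rule tendsto_norm_zero_cancel, rule Lim_transform_eventually)
 show "((\<lambda>t. t powr Re a * exp (- (Re c * t))) \<longlongrightarrow> 0) at_top" using assms by real_asymp
 show "eventually (\<lambda>t. t powr Re a * exp (- (Re c * t)) = norm (of_real t powr a * exp (- (c * of_real t)))) at_top"
  using eventually_gt_at_top[of 0] by eventually_elim (simp add: norm_mult norm_powr_real_powr)
qed

lemma has_vector_derivative_powr_exp:
 fixes a c :: complex
 assumes "t > 0"
 shows "((\<lambda>t. of_real t powr a * exp (- (c * of_real t))) has_vector_derivative
      (a * (of_real t powr (a - 1) * exp (- (c * of_real t))) - c * (of_real t powr a * exp (- (c * of_real t))))) (at t)"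
proof -
 have "((\<lambda>t. exp (- (c * complex_of_real t))) has_vector_derivative (- c * exp (- (c * of_real t)))) (at t)"
  by (rule has_vector_derivative_real_field[of "\<lambda>z. exp (- (c * z))"]) (auto intro!: derivative_eq_intros)
 from has_vector_derivative_mult[OF has_vector_derivative_powr_of_real[OF assms] this]
 show ?thesis by (simp only: mult_ac mult_minus_left mult_minus_right diff_conv_add_uminus add_ac)
qed

text \<open>Integration by parts with \<open>t powr a * exp (- (c * t))\<close>; the term
  \<open>exp (- c)\<close> is its boundary value at 1.\<close>

lemma upper_inc_rec:
 assumes c: "Re c > 0"
 shows "c * upper_inc c (a + 1) = a * upper_inc c a + exp (- c)"
proof -
 define F where "F = (\<lambda>t. of_real t powr a * exp (- (c * complex_of_real t)))"
 define f where "f = (\<lambda>t. a * (of_real t powr (a - 1) * exp (- (c * complex_of_real t))) - c * (of_real t powr (a + 1 - 1) * exp (- (c * of_real t))))"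
 let ?A = "\<integral>t. f t \<partial>lebesgue_on {1<..}"
 have i: "integrable (lebesgue_on {1<..}) (\<lambda>t. of_real t powr (b - 1) * exp (- (c * of_real t)))" for b
  using c by (intro integrable_powr_exp_Ioi_1) auto
 have "?A = 0 - F 1"
 proof (rule lebesgue_on_ftc)
  show "(F has_vector_derivative f x) (at x)" if "x > 1" for x
   using has_vector_derivative_powr_exp[of x a c] that unfolding F_def f_def by simp
  show "continuous_on {1<..} f" unfolding f_def by (auto intro!: continuous_intros)
  show "integrable (lebesgue_on {1<..}) f" unfolding f_def by (intro Bochner_Integration.integrable_diff integrable_mult_right i)
  have "isCont F 1" unfolding F_def
   by (rule has_vector_derivative_continuous[OF has_vector_derivative_powr_exp]) simp
  thus "(F \<longlongrightarrow> F 1) (at_right 1)" unfolding isCont_def by (rule tendsto_within_subset) simp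
  show "(F \<longlongrightarrow> 0) at_top" unfolding F_def by (rule tendsto_powr_exp_at_top[OF c])
 qed
 also have "?A = a * upper_inc c a - c * upper_inc c (a + 1)"
  unfolding f_def upper_inc_def using i
  by (subst Bochner_Integration.integral_diff[OF integrable_mult_right[OF i] integrable_mult_right[OF i]]) (simp only: integral_mult_right_zero)
 finally show ?thesis by (simp add: F_def algebra_simps)
qed

lemma upper_inc_Gamma_pos:
 assumes a: "Re a > 0" and c: "Re c > 0"
 shows "upper_inc c a = c powr (- a) * Gamma a - inc_Gamma_series c a"
proof -
 have "Gamma a * c powr (- a) = inc_Gamma_series c a + upper_inc c a"
  unfolding Gamma_integral_scaled[OF a c, symmetric] upper_inc_def
  by (subst lebesgue_on_split[OF integrable_powr_exp[OF a c], of 1]) (simp_all add: inc_Gamma_lower[OF a])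
 thus ?thesis by (simp add: algebra_simps)
qed

text \<open>For \<open>Re a > 0\<close> Euler's integral is split at 1. The three terms obey
  matching recurrences under \<open>a\<close> to \<open>a + 1\<close>, which carries the formula to
  the left, one vertical strip at a time.\<close>

lemma upper_inc_Gamma_halfplane:
 assumes "a \<notin> \<int>\<^sub>\<le>\<^sub>0" and c: "Re c > 0"
 shows "upper_inc c a = c powr (- a) * Gamma a - inc_Gamma_series c a" (is ?P)
proof -
 have ?P if "Re a > - real n" "a \<notin> \<int>\<^sub>\<le>\<^sub>0" for n
  using that
 proof (induction n arbitrary: a)
  case 0
  thus ?case using upper_inc_Gamma_pos[OF _ c] by simp
 next
  case (Suc n)
  have a1: "a + 1 \<notin> \<int>\<^sub>\<le>\<^sub>0" using Suc.prems(2)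
   by (metis add_diff_cancel_right' nonpos_Ints_diff_Nats Nats_1)
  have [simp]: "a \<noteq> 0" "c \<noteq> 0" using Suc.prems(2) c by auto
  have IH: "upper_inc c (a + 1) = c powr (- (a + 1)) * Gamma (a + 1) - inc_Gamma_series c (a + 1)"
   by (rule Suc.IH) (use Suc.prems a1 in auto)
  have G: "Gamma (a + 1) = a * Gamma a" using Suc.prems(2) by (rule Gamma_plus1)
  have P: "c * c powr (- (a + 1)) = c powr (- a)"
  proof -
   have "c powr (- (a + 1) + 1) = c powr (- (a + 1)) * c powr 1" by (rule powr_add)
   thus ?thesis by simp
  qed
  have "a * upper_inc c a = c * upper_inc c (a + 1) - exp (- c)" using upper_inc_rec[OF c, of a] by simp
  also have "\<dots> = (c * c powr (- (a + 1))) * (a * Gamma a) - (c * inc_Gamma_series c (a + 1) + exp (- c))"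
   unfolding IH G by (simp add: algebra_simps)
  also have "\<dots> = a * (c powr (- a) * Gamma a - inc_Gamma_series c a)"
   unfolding P using inc_Gamma_series_rec[OF Suc.prems(2), of c] by (simp add: algebra_simps)
  finally show ?case by simp
 qed
 moreover obtain n :: nat where "- Re a < real n" using reals_Archimedean2 by blast
 ultimately show ?thesis using assms(1) by (meson minus_less_iff)
qed

lemma holomorphic_inc_Gamma_series:
 assumes "a \<notin> \<int>\<^sub>\<le>\<^sub>0"
 shows "(\<lambda>c. inc_Gamma_series c a) holomorphic_on UNIV"
 unfolding inc_Gamma_series_def
proof (rule holomorphic_on_suminf)
 obtain K where K: "K > 0" "\<And>j. 1 / norm (a + of_nat j :: complex) \<le> K"
  using inc_Gamma_denominator_bound[OF assms] by blast
 fix z0 :: complex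
 show "\<exists>r>0. \<exists>B. summable B \<and> (\<forall>z\<in>ball z0 r \<inter> UNIV. \<forall>n. norm ((- z) ^ n / (fact n * (a + of_nat n))) \<le> B n)"
 proof (intro exI conjI ballI allI)
  show "summable (\<lambda>j. norm (of_real (norm z0 + 1) :: complex) ^ j / fact j * K)"
   by (intro summable_mult2 summable_power_fact_norm)
  fix z n assume "z \<in> ball z0 1 \<inter> (UNIV :: complex set)"
  hence "norm z \<le> norm (of_real (norm z0 + 1) :: complex)"
   using norm_triangle_ineq4[of z0 "z0 - z"] unfolding norm_of_real by (auto simp: dist_norm)
  hence "norm z ^ n / fact n * (1 / norm (a + of_nat n)) \<le> norm (of_real (norm z0 + 1) :: complex) ^ n / fact n * K"
   by (intro mult_mono divide_right_mono power_mono K) auto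
  thus "norm ((- z) ^ n / (fact n * (a + of_nat n))) \<le> norm (of_real (norm z0 + 1) :: complex) ^ n / fact n * K"
   by (simp add: norm_divide norm_mult norm_power)
 qed simp
next
 have "a + of_nat j \<noteq> 0" for j
  using assms by (metis add_eq_0_iff2 minus_of_nat_in_nonpos_Ints)
 thus "(\<lambda>z. (- z) ^ n / (fact n * (a + of_nat n))) holomorphic_on UNIV" for n
  by (intro holomorphic_intros) auto
qed simp

text \<open>On the imaginary axis the formula is a limit from the right half plane: the extra factor
  \<open>exp (- t / (n + 1))\<close> has norm at most 1, so the integrand at \<open>c\<close> itself
  dominates.\<close>

lemma upper_inc_Gamma:
 assumes a: "a \<notin> \<int>\<^sub>\<le>\<^sub>0" and c: "Re c > 0 \<or> Re c = 0 \<and> c \<noteq> 0 \<and> Re a < 0"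
 shows "upper_inc c a = c powr (- a) * Gamma a - inc_Gamma_series c a"
proof (cases "Re c > 0")
 case False
 with c have c: "Re c = 0" "c \<noteq> 0" "Re a < 0" by auto
 define d where "d = (\<lambda>n::nat. c + of_real (1 / real (Suc n)))"
 let ?A = "\<lambda>n. d n powr (- a) * Gamma a - inc_Gamma_series (d n) a"
 have d: "d \<longlonglongrightarrow> c"
  unfolding d_def using tendsto_add[OF tendsto_const[of c] tendsto_of_real[OF lim_1_over_n[THEN LIMSEQ_Suc]]] by simp
 have "(\<lambda>n. upper_inc (d n) a) \<longlonglongrightarrow> upper_inc c a"
  unfolding upper_inc_def
 proof (rule integral_dominated_convergence)
  show "integrable (lebesgue_on {1<..}) (\<lambda>t. norm (of_real t powr (a - 1) * exp (- (c * complex_of_real t))))"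
   using c by (intro integrable_norm integrable_powr_exp_Ioi_1) auto
  show "(\<lambda>t. of_real t powr (a - 1) * exp (- (c * complex_of_real t))) \<in> borel_measurable (lebesgue_on {1<..})"
   using integrable_powr_exp_Ioi_1[of c a] c by auto
  show "(\<lambda>t. of_real t powr (a - 1) * exp (- (d n * complex_of_real t))) \<in> borel_measurable (lebesgue_on {1<..})" for n
   using integrable_powr_exp_Ioi_1[of "d n" a] c by (auto simp: d_def)
  show "AE t in lebesgue_on {1<..}. norm (of_real t powr (a - 1) * exp (- (d n * complex_of_real t))) \<le> norm (of_real t powr (a - 1) * exp (- (c * complex_of_real t)))" for n
   using c by (auto intro!: AE_I2 mult_left_mono simp: norm_mult d_def)
  show "AE t in lebesgue_on {1<..}. (\<lambda>n. of_real t powr (a - 1) * exp (- (d n * complex_of_real t))) \<longlonglongrightarrow> of_real t powr (a - 1) * exp (- (c * complex_of_real t))"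
   by (intro AE_I2 tendsto_intros d)
 qed
 moreover have "(\<lambda>n. upper_inc (d n) a) = ?A"
  using c by (intro ext upper_inc_Gamma_halfplane a) (simp add: d_def)
 moreover have "?A \<longlonglongrightarrow> c powr (- a) * Gamma a - inc_Gamma_series c a"
 proof -
  \<comment> \<open>A nonzero imaginary number is off the cut, so the principal power is continuous
    there.\<close>
  have cn: "c \<notin> \<real>\<^sub>\<le>\<^sub>0" using c by (auto simp: complex_nonpos_Reals_iff complex_eq_iff)
  hence "(\<lambda>n. d n powr (- a)) \<longlonglongrightarrow> c powr (- a)" by (intro tendsto_powr_complex d tendsto_const)
  moreover have "isCont (\<lambda>c. inc_Gamma_series c a) c"
   using holomorphic_on_imp_continuous_on[OF holomorphic_inc_Gamma_series[OF a]]
   by (simp add: continuous_on_eq_continuous_at)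
  ultimately show ?thesis
   by (intro tendsto_diff tendsto_mult tendsto_const isCont_tendsto_compose[of c "\<lambda>c. inc_Gamma_series c a" d] d)
 qed
 ultimately show ?thesis using LIMSEQ_unique by auto
qed (rule upper_inc_Gamma_halfplane[OF a])

section \<open>The Bessel function K as a moment integral\<close>

lemma infsum_nat_eq_suminf:
 fixes f :: "nat \<Rightarrow> complex"
 assumes "f summable_on UNIV"
 shows "infsum f UNIV = (\<Sum>n. f n)" and "f sums infsum f UNIV"
proof -
 show "f sums infsum f UNIV" using assms by (intro has_sum_imp_sums has_sum_infsum)
 thus "infsum f UNIV = (\<Sum>n. f n)" by (simp add: sums_iff)
qed

lemma summable_on_product_bound:
 fixes f :: "'a \<times> 'b \<Rightarrow> complex" and A :: "'a \<Rightarrow> real" and B :: "'b \<Rightarrow> real"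
 assumes A: "A summable_on S" and B: "B summable_on T"
  and le: "\<And>m j. m \<in> S \<Longrightarrow> j \<in> T \<Longrightarrow> norm (f (m, j)) \<le> A m * B j"
  and nn: "\<And>m. m \<in> S \<Longrightarrow> A m \<ge> 0" "\<And>j. j \<in> T \<Longrightarrow> B j \<ge> 0"
 shows "f summable_on (S \<times> T)"
proof -
 have "(\<lambda>p. A (fst p) * B (snd p)) summable_on Sigma S (\<lambda>_. T)"
 proof (rule summable_on_SigmaI)
  show "((\<lambda>j. A (fst (m, j)) * B (snd (m, j))) has_sum A m * infsum B T) T" for m
   using has_sum_cmult_right[OF has_sum_infsum[OF B], of "A m"] by simp
  show "(\<lambda>m. A m * infsum B T) summable_on S" by (intro summable_on_cmult_left A)
 qed (use nn in auto)
 hence "(\<lambda>p. norm (f p)) summable_on (S \<times> T)"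
  by (rule Infinite_Sum.abs_summable_on_comparison_test') (use le in auto)
 thus ?thesis by (rule abs_summable_summable)
qed

lemma suminf_swap:
 fixes f :: "nat \<times> nat \<Rightarrow> complex"
 assumes f: "f summable_on UNIV"
 shows "(\<lambda>m. \<Sum>j. f (m, j)) sums (\<Sum>j. \<Sum>m. f (m, j))" (is ?P) and "(\<lambda>j. \<Sum>m. f (m, j)) sums (\<Sum>j. \<Sum>m. f (m, j))" (is ?Q)
  and "summable (\<lambda>j. f (m, j))"
proof -
 let ?B = "\<lambda>j. infsum (\<lambda>m. f (m, j)) UNIV"
 let ?A = "\<lambda>m. infsum (\<lambda>j. f (m, j)) UNIV"
 have s: "f summable_on UNIV \<times> UNIV" using f by simp
 have s': "(\<lambda>(m, j). f (m, j)) summable_on UNIV \<times> UNIV" using s by simp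
 have s1: "(\<lambda>j. f (m, j)) summable_on UNIV" for m
  using summable_on_SigmaD1[of "\<lambda>m j. f (m, j)" UNIV "\<lambda>_. UNIV" m] s' by simp
 have sw: "(\<lambda>(j, m). f (m, j)) summable_on UNIV \<times> UNIV"
  using s' summable_on_swap[of "\<lambda>(m, j). f (m, j)" UNIV UNIV] by (simp add: case_prod_unfold)
 have s2: "(\<lambda>m. f (m, j)) summable_on UNIV" for j
  using summable_on_SigmaD1[of "\<lambda>j m. f (m, j)" UNIV "\<lambda>_. UNIV" j] sw by simp
 show "summable (\<lambda>j. f (m, j))" using infsum_nat_eq_suminf(2)[OF s1[of m]] by (simp add: sums_iff)
 have o1: "?A summable_on UNIV"
  using summable_on_Sigma_banach[of "\<lambda>m j. f (m, j)" UNIV "\<lambda>_. UNIV"] s' by simp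
 have o2: "?B summable_on UNIV"
  using summable_on_Sigma_banach[of "\<lambda>j m. f (m, j)" UNIV "\<lambda>_. UNIV"] sw by simp
 have eq: "infsum ?A UNIV = infsum ?B UNIV"
  by (rule infsum_swap_banach[OF s'])
 note i = infsum_nat_eq_suminf(1)[OF s1] infsum_nat_eq_suminf(1)[OF s2]
 have "(\<lambda>j. \<Sum>m. f (m, j)) sums infsum ?B UNIV"
  using infsum_nat_eq_suminf(2)[OF o2] by (simp add: i)
 thus 1: ?Q by (simp add: sums_iff)
 have "infsum ?A UNIV = (\<Sum>j. \<Sum>m. f (m, j))"
  unfolding eq using infsum_nat_eq_suminf(1)[OF o2] by (simp add: i)
 with infsum_nat_eq_suminf(2)[OF o1]
 have "?A sums (\<Sum>j. \<Sum>m. f (m, j))" by simp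
 thus ?P by (simp only: i)
qed

lemma lebesgue_on_Ici_Ioi:
 fixes f :: "real \<Rightarrow> complex"
 shows "integrable (lebesgue_on {a..}) f \<longleftrightarrow> integrable (lebesgue_on {a<..}) f" (is ?P)
  and "(\<integral>x. f x \<partial>lebesgue_on {a..}) = (\<integral>x. f x \<partial>lebesgue_on {a<..})" (is ?Q)
proof -
 have n: "negligible ({a..} - {a<..})" "negligible ({a<..} - {a..})"
  by (auto intro: negligible_subset[of "{a}"])
 have n': "negligible {x \<in> {a..} - {a<..}. g x \<noteq> 0}" "negligible {x \<in> {a<..} - {a..}. g x \<noteq> 0}" for g :: "real \<Rightarrow> complex"
  by (auto intro: negligible_subset[OF n(1)] negligible_subset[OF n(2)])
 show 1: ?P
  by (simp add: integrable_lebesgue_on_iff absolutely_integrable_spike_set_eq[OF n'])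
 show ?Q
 proof (cases "integrable (lebesgue_on {a..}) f")
  case True
  with 1 show ?thesis by (simp add: lebesgue_integral_eq_integral integral_spike_set[OF n'])
 qed (use 1 in \<open>simp add: not_integrable_integral_eq\<close>)
qed

text \<open>Up to a power of \<open>\<mu> / X\<close> this is twice the Bessel function K of order
  \<open>\<nu>\<close> at \<open>2 * sqrt (\<mu> * X)\<close>. At \<open>X = 0\<close> it
  degenerates to a Gamma integral, which lets one expansion of the kernel serve both
  transforms.\<close>

definition bessel_moment :: "complex \<Rightarrow> complex \<Rightarrow> complex \<Rightarrow> complex" where
 "bessel_moment \<mu> X \<nu> = (\<integral>x. of_real x powr (\<nu> - 1) * exp (- (\<mu> * of_real x) - X / of_real x) \<partial>halfline)"

text \<open>Beyond 1 the factor \<open>exp (- b / x)\<close> may be expanded: its partial sums stay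
  below \<open>exp (norm b)\<close>.\<close>

lemma upper_exp_inverse:
 assumes "Re c > 0 \<or> Re c = 0 \<and> Re a < 0"
 shows "integrable (lebesgue_on {1<..}) (\<lambda>x. of_real x powr (a - 1) * exp (- (c * of_real x) - b / of_real x))" (is ?P)
  and "(\<lambda>m. (- b) ^ m / fact m * upper_inc c (a - of_nat m)) sums
      (\<integral>x. of_real x powr (a - 1) * exp (- (c * of_real x) - b / of_real x) \<partial>lebesgue_on {1<..})" (is ?Q)
proof -
 let ?B = "\<lambda>x. - (c * of_real x)"
 let ?A = "lebesgue_on {1<..}"
 define f where "f = (\<lambda>m x. (- b) ^ m / fact m * (complex_of_real x powr (a - of_nat m - 1) * exp (?B x)))"
 have i: "integrable ?A (\<lambda>x. complex_of_real x powr (a - of_nat m - 1) * exp (?B x))" for m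
  using assms by (intro integrable_powr_exp_Ioi_1) auto
 have feq: "f m x = of_real x powr (a - 1) * exp (?B x) * ((- (b / of_real x)) ^ m / fact m)" if "x > 0" for m x
 proof -
  have "complex_of_real x powr (a - of_nat m - 1) = of_real x powr (a - 1 - of_nat m)" by (simp add: algebra_simps)
  also have "\<dots> = of_real x powr (a - 1) / of_real x ^ m" using that by (simp add: powr_diff powr_nat')
  finally show ?thesis unfolding f_def by (simp add: power_divide mult_ac flip: divide_minus_left)
 qed
 have 1: "f m \<in> borel_measurable ?A" for m
  unfolding f_def using i[of m] by auto
 have 2: "(\<lambda>m. f m x) sums (of_real x powr (a - 1) * exp (- (c * of_real x) - b / of_real x))" if "x \<in> space ?A" for x
 proof -
  have "(\<lambda>m. of_real x powr (a - 1) * exp (?B x) * ((- (b / of_real x)) ^ m / fact m)) sums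
    (of_real x powr (a - 1) * exp (?B x) * exp (- (b / of_real x)))" by (intro sums_mult exp_sums_complex)
  thus ?thesis using that by (simp add: feq mult.assoc flip: exp_add)
 qed
 have 3: "integrable ?A (\<lambda>x. norm (of_real x powr (a - 1) * exp (- (c * complex_of_real x))) * exp (norm b))"
  using i[of 0] by (intro integrable_mult_left integrable_norm) simp
 have 4: "norm (\<Sum>m<N. f m x) \<le> norm (of_real x powr (a - 1) * exp (- (c * complex_of_real x))) * exp (norm b)"
  if x: "x \<in> space ?A" for N x
 proof -
  have "norm (b / of_real x) \<le> norm b" using x by (simp add: norm_divide divide_le_eq mult_le_cancel_left1)
  hence "norm (\<Sum>n<N. (- (b / complex_of_real x)) ^ n / fact n) \<le> exp (norm b)"
   using norm_exp_partial_sum_le[of "- (b / complex_of_real x)" N] by (simp add: order_trans)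
  moreover have "(\<Sum>m<N. f m x) = of_real x powr (a - 1) * exp (?B x) * (\<Sum>n<N. (- (b / complex_of_real x)) ^ n / fact n)"
   unfolding sum_distrib_left using x by (intro sum.cong refl feq) auto
  moreover have "norm (P * Q) \<le> norm P * exp (norm b)" if "norm Q \<le> exp (norm b)" for P Q :: complex
   using that by (simp add: norm_mult mult_left_mono)
  ultimately show ?thesis by simp
 qed
 note D = dominated_sums_integral[OF 1 2 3 4]
 show ?P by (rule D(2))
 show ?Q
  using D(1) by (simp add: f_def upper_inc_def)
qed

text \<open>The substitution \<open>x\<close> to \<open>1 / x\<close> exchanges the two exponentials
  and the sign of \<open>a\<close>, which reduces this to the integral beyond 1.\<close>

lemma lower_exp_inverse:
 assumes "Re c > 0 \<or> Re c = 0 \<and> Re a > 0"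
 shows "integrable (lebesgue_on {0<..1}) (\<lambda>x. of_real x powr (a - 1) * exp (- (b * of_real x) - c / of_real x))" (is ?P)
  and "(\<lambda>m. (- b) ^ m / fact m * upper_inc c (- a - of_nat m)) sums
      (\<integral>x. of_real x powr (a - 1) * exp (- (b * of_real x) - c / of_real x) \<partial>lebesgue_on {0<..1})" (is ?Q)
proof -
 let ?A = "\<lambda>x. - (c * of_real x) - b / of_real x"
 define f where "f = (\<lambda>x. complex_of_real x powr (a - 1) * exp (- (b * of_real x) - c / of_real x))"
 have eq: "f (1 / x) / of_real (x ^ 2) = of_real x powr (- a - 1) * exp (?A x)" if "x > 0" for x :: real
 proof -
  have "complex_of_real (1 / x) powr (a - 1) = exp ((a - 1) * of_real (ln (1 / x)))"
   using that by (simp add: powr_def Ln_of_real flip: of_real_divide)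
  also have "\<dots> = exp (- ((a - 1) * of_real (ln x)))" using that by (simp add: ln_div)
  also have "\<dots> = of_real x powr (- (a - 1))" using that by (simp add: powr_def Ln_of_real left_diff_distrib)
  finally have A: "complex_of_real (1 / x) powr (a - 1) = of_real x powr (- (a - 1))" .
  have B: "complex_of_real x powr (- (a - 1)) / of_real x ^ 2 = of_real x powr (- a - 1)"
  proof -
   have "complex_of_real x powr ((- a - 1) + of_nat 2) = of_real x powr (- a - 1) * of_real x powr of_nat 2" by (rule powr_add)
   also have "complex_of_real x powr of_nat 2 = of_real x ^ 2" using that by (intro powr_nat') auto
   finally show ?thesis using that by (simp add: field_simps)
  qed
  have E: "- (b * complex_of_real (1 / x)) - c / complex_of_real (1 / x) = - (c * of_real x) - b / of_real x"
   using that by simp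
  show ?thesis by (simp only: f_def A E of_real_power B[symmetric]) simp
 qed
 have sub: "{1::real..} \<subseteq> {0<..}" by auto
 have m: "inverse ` {1::real..} = {0<..1}" by (rule inverse_image_Ici_1)
 have c': "Re c > 0 \<or> Re c = 0 \<and> Re (- a) < 0" using assms by auto
 have "integrable (lebesgue_on {1..}) (\<lambda>x. f (1 / x) / of_real (x ^ 2)) \<longleftrightarrow> integrable (lebesgue_on {1..}) (\<lambda>x. of_real x powr (- a - 1) * exp (?A x))"
  by (rule Bochner_Integration.integrable_cong) (auto simp: eq simp del: of_real_power)
 also have "\<dots>" using upper_exp_inverse(1)[OF c', of b] by (simp add: lebesgue_on_Ici_Ioi)
 finally show ?P
  using lebesgue_on_inverse(1)[OF _ _ m sub, of f] unfolding f_def by auto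
 have "(\<integral>x. f x \<partial>lebesgue_on {0<..1}) = (\<integral>x. f (1 / x) / of_real (x ^ 2) \<partial>lebesgue_on {1..})"
  by (rule lebesgue_on_inverse(2)[OF _ _ m sub, symmetric]) auto
 also have "\<dots> = (\<integral>x. of_real x powr (- a - 1) * exp (?A x) \<partial>lebesgue_on {1..})"
  by (rule Bochner_Integration.integral_cong) (auto simp: eq simp del: of_real_power)
 also have "\<dots> = (\<integral>x. of_real x powr (- a - 1) * exp (?A x) \<partial>lebesgue_on {1<..})"
  by (rule lebesgue_on_Ici_Ioi)
 finally show ?Q
  using upper_exp_inverse(2)[OF c', of b] by (simp add: f_def)
qed

lemma integrable_bessel_moment:
 assumes "Re \<mu> > 0" "Re X > 0 \<or> Re X = 0 \<and> Re \<nu> > 0"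
 shows "integrable halfline (\<lambda>x. of_real x powr (\<nu> - 1) * exp (- (\<mu> * of_real x) - X / of_real x))"
proof -
 have "{0<..} = {0<..1} \<union> {1::real<..}" by auto
 moreover have "(\<lambda>x. of_real x powr (\<nu> - 1) * exp (- (\<mu> * of_real x) - X / of_real x)) absolutely_integrable_on {0<..1} \<union> {1<..}"
  using lower_exp_inverse(1)[OF assms(2), of \<mu>] upper_exp_inverse(1)[of \<mu> \<nu> X] assms(1)
  by (intro set_integrable_Un) (auto simp: integrable_lebesgue_on_iff)
 ultimately show ?thesis by (simp add: integrable_lebesgue_on_iff)
qed

text \<open>One bound for the nonnegative shifts of \<open>\<nu>\<close> and one for those of
  \<open>- \<nu>\<close> cover all integers.\<close>

lemma complex_nonint_bound:
 assumes "\<nu> \<notin> (\<int> :: complex set)"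
 obtains K where "K > 0" "\<And>i::int. norm (1 / (\<nu> + of_int i)) \<le> K"
proof -
 have "\<nu> \<notin> \<int>\<^sub>\<le>\<^sub>0" "- \<nu> \<notin> \<int>\<^sub>\<le>\<^sub>0" using assms nonpos_Ints_Int by (auto simp: minus_in_Ints_iff)
 then obtain K1 K2 where K: "K1 > 0" "\<And>j. 1 / norm (\<nu> + of_nat j) \<le> K1" "K2 > 0" "\<And>j. 1 / norm (- \<nu> + of_nat j) \<le> K2"
  using inc_Gamma_denominator_bound by metis
 show ?thesis
 proof (rule that[of "max K1 K2"])
  show "norm (1 / (\<nu> + of_int i)) \<le> max K1 K2" for i
  proof (cases "i \<ge> 0")
   case True
   then obtain j where "i = int j" using nonneg_int_cases by blast
   thus ?thesis using K(2)[of j] by (simp add: norm_divide)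
  next
   case False
   then obtain j where j: "i = - int j" by (metis nonneg_int_cases add.inverse_inverse linear neg_0_le_iff_le)
   have "norm (\<nu> + of_int i) = norm (- \<nu> + of_nat j)"
    unfolding j by (metis (no_types, lifting) add_uminus_conv_diff minus_diff_eq norm_minus_cancel of_int_minus of_int_of_nat_eq uminus_add_conv_diff)
   thus ?thesis using K(4)[of j] by (simp add: norm_divide)
  qed
 qed (use K in auto)
qed

text \<open>Split at 1 and expand \<open>exp (- X / x)\<close> above and
  \<open>exp (- \<mu> * x)\<close> below. Each resulting incomplete Gamma value is a complete one
  minus a series. The two double series so subtracted are negatives of each other and cancel,
  leaving only complete Gamma values. That the order is not an integer keeps all denominators away
  from 0.\<close>

lemma bessel_moment_nonint:
 assumes \<mu>: "Re \<mu> > 0" and X: "X \<noteq> 0" "Re X \<ge> 0" and \<nu>: "Re \<nu> > 0" "\<nu> \<notin> \<int>"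
 shows "(\<lambda>m. (- X) ^ m / fact m * (\<mu> powr (of_nat m - \<nu>) * Gamma (\<nu> - of_nat m)) +
       (- \<mu>) ^ m / fact m * (X powr (\<nu> + of_nat m) * Gamma (- \<nu> - of_nat m))) sums bessel_moment \<mu> X \<nu>"
proof -
 let ?G = "\<lambda>m j. fact m * (- \<nu> - of_nat j + of_nat m)"
 let ?F = "\<lambda>j. (- \<mu>) ^ j / fact j"
 let ?D = "\<integral>x. of_real x powr (\<nu> - 1) * exp (- (\<mu> * of_real x) - X / of_real x) \<partial>lebesgue_on {1<..}"
 let ?C = "\<integral>x. of_real x powr (\<nu> - 1) * exp (- (\<mu> * of_real x) - X / of_real x) \<partial>lebesgue_on {0<..1}"
 let ?B = "\<lambda>m. \<nu> - of_nat m"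
 let ?A = "\<lambda>m. - \<nu> - of_nat m"
 \<comment> \<open>The common double series: its row sums are the corrections of the upper part, its
   column sums with opposite sign those of the lower part.\<close>
 define g where "g = (\<lambda>(m, j). (- X) ^ m / fact m * ((- \<mu>) ^ j / (fact j * (\<nu> - of_nat m + of_nat j))))"
 let ?E = "\<lambda>m. (\<Sum>j. g (m, j)) + - (\<Sum>j. g (j, m))"
 have ni: "\<nu> - of_nat m \<notin> \<int>\<^sub>\<le>\<^sub>0" "- \<nu> - of_nat m \<notin> \<int>\<^sub>\<le>\<^sub>0" for m
 proof -
  have "\<nu> - of_nat m \<notin> \<int>" using \<nu>(2) Ints_add[of "\<nu> - of_nat m" "of_nat m"] by auto
  thus "\<nu> - of_nat m \<notin> \<int>\<^sub>\<le>\<^sub>0" using nonpos_Ints_Int by blast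
  have "- \<nu> - of_nat m \<notin> \<int>" using \<nu>(2) Ints_add[of "- \<nu> - of_nat m" "of_nat m"] by (auto simp: minus_in_Ints_iff)
  thus "- \<nu> - of_nat m \<notin> \<int>\<^sub>\<le>\<^sub>0" using nonpos_Ints_Int by blast
 qed
 obtain K where K: "K > 0" "\<And>i::int. norm (1 / (\<nu> + of_int i)) \<le> K" using complex_nonint_bound[OF \<nu>(2)] by blast
 have "g summable_on UNIV \<times> UNIV"
 proof (rule summable_on_product_bound)
  have *: "(\<lambda>j. norm c ^ j / fact j :: real) summable_on UNIV" for c :: complex
   by (rule norm_summable_imp_summable_on) (use summable_power_fact_norm[of c] in simp)
  show "(\<lambda>m. norm X ^ m / fact m :: real) summable_on UNIV" by (rule *)
  show "(\<lambda>j. norm \<mu> ^ j / fact j * K :: real) summable_on UNIV" by (intro summable_on_cmult_left *)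
  show "norm (g (m, j)) \<le> norm X ^ m / fact m * (norm \<mu> ^ j / fact j * K)" for m j
  proof -
   have e: "\<nu> - of_nat m + of_nat j = \<nu> + of_int (int j - int m)" by simp
   have "norm (g (m, j)) = norm X ^ m / fact m * (norm \<mu> ^ j / fact j * norm (1 / (\<nu> + of_int (int j - int m))))"
    by (simp add: g_def e norm_mult norm_divide norm_power del: of_int_diff)
   also have "\<dots> \<le> norm X ^ m / fact m * (norm \<mu> ^ j / fact j * K)"
    by (intro mult_left_mono K) auto
   finally show ?thesis .
  qed
 qed (use K in auto)
 hence g: "g summable_on UNIV" by simp
 define T where "T = (\<Sum>j. \<Sum>m. g (m, j))"
 have in1: "inc_Gamma_series \<mu> (?B m) * ((- X) ^ m / fact m) = (\<Sum>j. g (m, j))" for m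
  unfolding inc_Gamma_series_def g_def using summable_norm_cancel[OF summable_inc_Gamma_series[OF ni(1)]]
  by (subst suminf_mult2) (auto simp: mult_ac)
 have in2: "inc_Gamma_series X (- \<nu> - of_nat j) * (?F j) = - (\<Sum>m. g (m, j))" for j
 proof -
  have "inc_Gamma_series X (- \<nu> - of_nat j) * (?F j) = (\<Sum>m. (- X) ^ m / (?G m j) * (?F j))"
   unfolding inc_Gamma_series_def using summable_norm_cancel[OF summable_inc_Gamma_series[OF ni(2)]]
   by (subst suminf_mult2) auto
  also have "(\<lambda>m. (- X) ^ m / (?G m j) * (?F j)) = (\<lambda>m. - g (m, j))"
  proof
   fix m
   have "- \<nu> - of_nat j + of_nat m = - (\<nu> - of_nat m + of_nat j)" by simp
   thus "(- X) ^ m / (?G m j) * (?F j) = - g (m, j)"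
    by (simp only: g_def split mult_minus_right divide_minus_right mult_minus_left times_divide_eq_right times_divide_eq_left mult_ac divide_divide_eq_left)
  qed
  also have "(\<Sum>m. - g (m, j)) = - (\<Sum>m. g (m, j))"
  proof (rule suminf_minus)
   have "(\<lambda>(m,j). g (m, j)) summable_on UNIV \<times> UNIV" using g by simp
   hence "(\<lambda>(j,m). g (m, j)) summable_on UNIV \<times> UNIV" using summable_on_swap[of "\<lambda>(m,j). g (m,j)" UNIV UNIV] by (simp add: case_prod_unfold)
   hence "(\<lambda>(j,m). g (m, j)) summable_on UNIV" by simp
   from suminf_swap(3)[OF this, of j] show "summable (\<lambda>m. g (m, j))" by simp
  qed
  finally show ?thesis .
 qed
 have A: "(\<lambda>m. (- X) ^ m / fact m * upper_inc \<mu> (?B m)) sums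
      ?D"
  using \<mu> by (intro upper_exp_inverse(2)) auto
 have B: "(\<lambda>m. (- \<mu>) ^ m / fact m * upper_inc X (?A m)) sums
      ?C"
  using X \<nu> by (intro lower_exp_inverse(2)) auto
 have J: "bessel_moment \<mu> X \<nu> = ?C
   + ?D"
  unfolding bessel_moment_def using \<mu> X \<nu>
  by (intro lebesgue_on_split integrable_bessel_moment) auto
 \<comment> \<open>The double series is added by rows and subtracted by columns. The total
   contribution is 0, but within each term it completes both incomplete Gamma values.\<close>
 from sums_add[OF sums_add[OF A B] sums_add[OF suminf_swap(1)[OF g] sums_minus[OF suminf_swap(2)[OF g]]]]
 have "(\<lambda>m. (- X) ^ m / fact m * upper_inc \<mu> (?B m) + (- \<mu>) ^ m / fact m * upper_inc X (?A m)
      + (?E m)) sums bessel_moment \<mu> X \<nu>"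
  unfolding J by (simp add: add_ac)
 also have "(\<lambda>m. (- X) ^ m / fact m * upper_inc \<mu> (?B m) + (- \<mu>) ^ m / fact m * upper_inc X (?A m)
      + (?E m)) = (\<lambda>m. (- X) ^ m / fact m * (\<mu> powr (of_nat m - \<nu>) * Gamma (?B m)) +
       (- \<mu>) ^ m / fact m * (X powr (\<nu> + of_nat m) * Gamma (?A m)))"
 proof
  fix m
  have u1: "upper_inc \<mu> (?B m) = \<mu> powr (- (?B m)) * Gamma (?B m) - inc_Gamma_series \<mu> (?B m)"
   using \<mu> by (intro upper_inc_Gamma ni) auto
  have u2: "upper_inc X (?A m) = X powr (- (?A m)) * Gamma (?A m) - inc_Gamma_series X (?A m)"
   using X \<nu> by (intro upper_inc_Gamma ni) auto
  have e: "- (?B m) = of_nat m - \<nu>" "- (?A m) = \<nu> + of_nat m" by auto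
  show "(- X) ^ m / fact m * upper_inc \<mu> (?B m) + (- \<mu>) ^ m / fact m * upper_inc X (?A m)
      + (?E m) = (- X) ^ m / fact m * (\<mu> powr (of_nat m - \<nu>) * Gamma (?B m)) +
       (- \<mu>) ^ m / fact m * (X powr (\<nu> + of_nat m) * Gamma (?A m))"
   unfolding u1 u2 e in1[symmetric] in2[symmetric] by (simp only: right_diff_distrib mult.commute[of "inc_Gamma_series _ _"]) simp
 qed
 finally show ?thesis .
qed

text \<open>The arguments of the two roots are below pi/4 and at most pi/2 in modulus, so their sum
  does not leave the principal strip.\<close>

lemma Ln_csqrt_mult:
 assumes "\<mu> \<noteq> 0" "X \<noteq> 0" "Re \<mu> > 0"
 shows "Ln (csqrt \<mu> * csqrt X) = (Ln \<mu> + Ln X) / 2"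
proof (rule Ln_unique)
 let ?A = "(Ln \<mu> + Ln X) / 2"
 show "exp ?A = csqrt \<mu> * csqrt X"
  using assms by (simp add: csqrt_exp_Ln add_divide_distrib exp_add)
 have "\<bar>Im (Ln \<mu>)\<bar> < pi / 2" using assms Re_Ln_pos_lt_imp by (simp add: Re_Ln_pos_lt)
 moreover have "- pi < Im (Ln X)" "Im (Ln X) \<le> pi" using assms mpi_less_Im_Ln Im_Ln_le_pi by auto
 ultimately show "- pi < Im ?A" "Im ?A \<le> pi" by auto
qed

text \<open>The reflection formula, with the sign from \<open>sin (pi * (\<nu> - m))\<close>. It
  converts the Gamma values at shifted arguments into the reciprocal Gamma coefficients of Bessel I
  series.\<close>

lemma Gamma_shift_reflect:
 fixes \<nu> :: complex
 assumes "\<nu> \<notin> \<int>"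
 shows "Gamma (\<nu> - of_nat m) = (-1) ^ m * (of_real pi / sin (of_real pi * \<nu>)) * rGamma (- \<nu> + of_nat m + 1)"
proof -
 have s: "sin (of_real pi * \<nu>) \<noteq> 0"
 proof
  assume "sin (of_real pi * \<nu>) = 0"
  then obtain n :: int where "of_real pi * \<nu> = of_real (of_int n * pi)"
   unfolding Complex_Transcendental.sin_eq_0 by auto
  hence "\<nu> = of_int n" by simp
  thus False using assms by simp
 qed
 have "Gamma (\<nu> - of_nat m) * Gamma (1 - (\<nu> - of_nat m)) = of_real pi / sin (of_real pi * (\<nu> - of_nat m))"
  by (rule Gamma_reflection_complex)
 moreover have "sin (of_real pi * (\<nu> - of_nat m)) = (-1) ^ m * sin (of_real pi * \<nu>)"
 proof (induction m)
  case (Suc m)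
  have "sin (of_real pi * (\<nu> - of_nat (Suc m))) = sin (of_real pi * (\<nu> - of_nat m) - of_real pi)"
   by (simp add: algebra_simps)
  thus ?case using Suc by (simp add: sin_diff sin_of_real[symmetric] cos_of_real[symmetric])
 qed simp
 moreover have "Gamma (1 - (\<nu> - of_nat m)) \<noteq> 0"
 proof -
  have "1 - (\<nu> - of_nat m) \<notin> \<int>"
  proof
   assume "1 - (\<nu> - of_nat m) \<in> \<int>"
   hence "1 + of_nat m - (1 - (\<nu> - of_nat m)) \<in> \<int>" by (intro Ints_diff Ints_add) auto
   thus False using assms by simp
  qed
  thus ?thesis by (auto simp: Gamma_eq_zero_iff dest: nonpos_Ints_Int)
 qed
 moreover have "1 - (\<nu> - of_nat m) = - \<nu> + of_nat m + 1" by simp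
 ultimately have G: "Gamma (\<nu> - of_nat m) * Gamma (- \<nu> + of_nat m + 1) = of_real pi / ((-1) ^ m * sin (of_real pi * \<nu>))"
  and nz: "Gamma (- \<nu> + of_nat m + 1) \<noteq> 0" by metis+
 have "((-1::complex) ^ m) * (-1) ^ m = 1" by (simp flip: power_mult_distrib)
 hence "(1::complex) / (-1) ^ m = (-1) ^ m" by (metis eq_divide_imp mult_eq_0_iff zero_neq_one)
 hence "of_real pi / ((-1) ^ m * sin (of_real pi * \<nu>)) = (-1) ^ m * (of_real pi / sin (of_real pi * \<nu>))"
  by (metis divide_divide_eq_left' mult.commute times_divide_eq_left times_divide_eq_right mult.right_neutral)
 with G have "Gamma (\<nu> - of_nat m) * Gamma (- \<nu> + of_nat m + 1) = (-1) ^ m * (of_real pi / sin (of_real pi * \<nu>))" by simp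
 thus ?thesis using nz
  by (simp only: rGamma_inverse_Gamma divide_inverse[symmetric]) (metis nonzero_mult_div_cancel_right)
qed

text \<open>From an index \<open>N\<close> with \<open>Re \<nu> + N \<ge> 0\<close> on, each step
  divides the reciprocal Gamma value by a number of norm at least 1, so the terms are dominated by
  an exponential series.\<close>

lemma summable_bessel_series:
 "summable (\<lambda>m. norm (z ^ m * rGamma (\<nu> + of_nat m + 1) / fact m :: complex))"
proof -
 let ?A = "\<lambda>N. rGamma (\<nu> + of_nat N + 1)"
 obtain N :: nat where N: "- Re \<nu> \<le> real N" using real_arch_simple by blast
 have mono: "norm (rGamma (\<nu> + of_nat (N + m) + 1)) \<le> norm (?A N)" for m
 proof (induction m)
  case (Suc m)
  let ?w = "\<nu> + of_nat (N + m) + 1"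
  have "1 \<le> Re ?w" using N by simp
  hence w: "1 \<le> norm ?w" using complex_Re_le_cmod[of ?w] by linarith
  have "norm (rGamma (?w + 1)) * 1 \<le> norm (rGamma (?w + 1)) * norm ?w"
   by (rule mult_left_mono[OF w]) simp
  also have "\<dots> = norm (rGamma ?w)" using rGamma_plus1[of ?w] by (metis mult.commute norm_mult)
  finally show ?case using Suc by (simp add: add_ac)
 qed simp
 show ?thesis
 proof (rule summable_comparison_test)
  show "summable (\<lambda>m. norm z ^ m / fact m * norm (?A N))"
   by (intro summable_mult2 summable_power_fact_norm)
  show "\<exists>M. \<forall>m\<ge>M. norm (norm (z ^ m * rGamma (\<nu> + of_nat m + 1) / fact m)) \<le> norm z ^ m / fact m * norm (?A N)"
  proof (intro exI allI impI)
   fix m assume "m \<ge> N"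
   then obtain k where k: "m = N + k" using le_Suc_ex by blast
   have "norm z ^ m / fact m * norm (rGamma (\<nu> + of_nat m + 1)) \<le> norm z ^ m / fact m * norm (?A N)"
    unfolding k by (intro mult_left_mono mono) auto
   thus "norm (norm (z ^ m * rGamma (\<nu> + of_nat m + 1) / fact m)) \<le> norm z ^ m / fact m * norm (?A N)"
    by (simp add: norm_mult norm_divide norm_power)
  qed
 qed
qed

text \<open>After reflection the two families of Gamma terms are the series of I at orders
  \<open>- \<nu>\<close> and \<open>\<nu>\<close>. The exponential prefactor is
  \<open>(\<mu> / X)\<close> to the power \<open>\<nu> / 2\<close>, taken with separate logarithms;
  it makes the powers of \<open>\<mu>\<close> and \<open>X\<close> equal, as they are in a function
  of \<open>\<mu> * X\<close>.\<close>

lemma bessel_K_nonint_eq_moment: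
 assumes \<mu>: "Re \<mu> > 0" and X: "X \<noteq> 0" "Re X \<ge> 0" and \<nu>: "Re \<nu> > 0" "\<nu> \<notin> \<int>"
 shows "bessel_K_nonint \<nu> (2 * csqrt \<mu> * csqrt X) = exp (\<nu> * (Ln \<mu> - Ln X) / 2) * bessel_moment \<mu> X \<nu> / 2"
proof -
 let ?D = "\<nu> * Ln X"
 let ?C = "\<nu> * (Ln \<mu> - Ln X) / 2"
 let ?B = "- \<nu> * Ln \<mu>"
 let ?A = "Ln \<mu> + Ln X"
 define w where "w = 2 * csqrt \<mu> * csqrt X"
 let ?F = "\<lambda>m. (w / 2) ^ (2 * m) * rGamma (\<nu> + of_nat m + 1) / fact m"
 let ?E = "\<lambda>m. (w / 2) ^ (2 * m) * rGamma (- \<nu> + of_nat m + 1) / fact m"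
 define C where "C = of_real pi / sin (of_real pi * \<nu>)"
 have [simp]: "\<mu> \<noteq> 0" using \<mu> by auto
 have nz: "csqrt \<mu> * csqrt X \<noteq> 0" using X by simp
 have w2: "w / 2 = csqrt \<mu> * csqrt X" by (simp add: w_def)
 have pw: "(w / 2) powr a = exp (a * ?A / 2)" for a
  unfolding w2 powr_def Ln_csqrt_mult[OF \<open>\<mu> \<noteq> 0\<close> X(1) \<mu>] using X by simp
 have sq: "(w / 2) ^ (2 * m) = (\<mu> * X) ^ m" for m
  unfolding w2 by (simp add: power_mult power_mult_distrib)
 have X': "X powr (\<nu> + of_nat m) = exp ?D * X ^ m" for m
  using X by (simp add: powr_add powr_nat' powr_def exp_of_nat_mult distrib_right exp_add)
 have \<mu>': "\<mu> powr (of_nat m - \<nu>) = exp ?B * \<mu> ^ m" for m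
  by (simp add: powr_def exp_of_nat_mult left_diff_distrib exp_diff exp_minus divide_inverse)
 have ni: "- \<nu> \<notin> \<int>" using \<nu> by (simp add: minus_in_Ints_iff)
 have trm: "(- X) ^ m / fact m * (\<mu> powr (of_nat m - \<nu>) * Gamma (\<nu> - of_nat m)) +
       (- \<mu>) ^ m / fact m * (X powr (\<nu> + of_nat m) * Gamma (- \<nu> - of_nat m)) =
   C * exp ?B * (?E m) -
   C * exp ?D * (?F m)" for m
 proof -
  have s: "(- X) ^ m = (-1) ^ m * X ^ m" "(- \<mu>) ^ m = (-1) ^ m * \<mu> ^ m" by (subst power_minus; simp)+
  have "((-1::complex) ^ m) * (-1) ^ m = 1" by (simp flip: power_mult_distrib)
  hence "((-1::complex) ^ m) * ((-1) ^ m * z) = z" for z by (simp flip: mult.assoc)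
  thus ?thesis unfolding Gamma_shift_reflect[OF \<nu>(2)] Gamma_shift_reflect[OF ni] X' \<mu>' sq s C_def
   by (simp add: power_mult_distrib mult_ac)
 qed
 have series: "(\<lambda>m. C * exp ?B * (?E m) -
   C * exp ?D * (?F m)) sums bessel_moment \<mu> X \<nu>"
  using bessel_moment_nonint[OF assms] unfolding trm .
 define S where "S = (\<lambda>a. \<Sum>m. (w / 2) ^ (2 * m) * rGamma (a + of_nat m + 1) / fact m)"
 have S: "(\<lambda>m. (w / 2) ^ (2 * m) * rGamma (a + of_nat m + 1) / fact m) sums S a" for a
  unfolding S_def sq by (intro summable_sums summable_norm_cancel[OF summable_bessel_series])
 have J: "bessel_moment \<mu> X \<nu> = C * exp ?B * S (- \<nu>) - C * exp ?D * S \<nu>"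
  using sums_unique2[OF series sums_diff[OF sums_mult[OF S] sums_mult[OF S]]] .
 have e: "exp ?C * exp ?B = exp (- \<nu> * ?A / 2)"
  "exp ?C * exp ?D = exp (\<nu> * ?A / 2)"
  by (simp_all only: exp_add[symmetric]) (simp_all add: field_simps)
 have "exp ?C * bessel_moment \<mu> X \<nu> =
   C * (exp (- \<nu> * ?A / 2) * S (- \<nu>)) - C * (exp (\<nu> * ?A / 2) * S \<nu>)"
  unfolding J e[symmetric] by (simp only: right_diff_distrib mult_ac)
 moreover have "bessel_K_nonint \<nu> w = C / 2 * (exp (- \<nu> * ?A / 2) * S (- \<nu>) - exp (\<nu> * ?A / 2) * S \<nu>)"
  unfolding bessel_K_nonint_def bessel_I_def pw S_def C_def by simp
 ultimately show ?thesis unfolding w_def[symmetric] by (simp add: right_diff_distrib)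
qed

lemma powr_between:
 fixes x p a b :: real
 assumes "x > 0" "a \<le> p" "p \<le> b"
 shows "x powr p \<le> x powr a + x powr b"
proof (cases "x \<ge> 1")
 case True
 thus ?thesis using powr_mono[of p b x] assms by (simp add: add_increasing)
next
 case False
 thus ?thesis using powr_mono'[of a p x] assms by (simp add: add_increasing2)
qed

lemma holomorphic_bessel_moment_order:
 assumes \<mu>: "Re \<mu> > 0" and X: "Re X \<ge> 0"
 shows "(\<lambda>\<nu>. bessel_moment \<mu> X \<nu>) holomorphic_on {\<nu>. Re \<nu> > 0}"
 unfolding bessel_moment_def
proof (rule holomorphic_on_lebesgue_integral)
 let ?B = "\<lambda>x. - (Re \<mu> * x)"
 let ?A = "\<lambda>x. - (\<mu> * of_real x) - X / of_real x"
 show "open {\<nu>. Re \<nu> > 0}" by (rule open_halfspace_Re_gt)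
 show "(\<lambda>x. of_real x powr (\<nu> - 1) * exp (?A x)) \<in> borel_measurable halfline"
  if "\<nu> \<in> {\<nu>. Re \<nu> > 0}" for \<nu>
  using integrable_bessel_moment[of \<mu> X \<nu>] assms that by (auto simp: less_eq_real_def)
 show "(\<lambda>z. of_real x powr (z - 1) * exp (?A x)) holomorphic_on {\<nu>. Re \<nu> > 0}"
  if "x \<in> space halfline" for x :: real
  using that by (auto intro!: holomorphic_intros)
 fix z0 :: complex assume z0: "z0 \<in> {\<nu>. Re \<nu> > 0}"
 \<comment> \<open>Within distance \<open>a\<close> of \<open>z0\<close> the real part lies between
   \<open>a\<close> and \<open>3 * a\<close>, which explains the two powers in the majorant.\<close>
 define a where "a = Re z0 / 2"
 show "\<exists>r>0. \<exists>B. integrable halfline B \<and>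
      (\<forall>z\<in>ball z0 r \<inter> {\<nu>. Re \<nu> > 0}. \<forall>x\<in>space halfline.
       norm (of_real x powr (z - 1) * exp (?A x)) \<le> B x)"
 proof (intro exI conjI ballI)
  show "a > 0" using z0 by (simp add: a_def)
  show "integrable halfline (\<lambda>x. x powr (a - 1) * exp (?B x) + x powr (3 * a - 1) * exp (?B x))"
   using \<mu> \<open>a > 0\<close> by (intro Bochner_Integration.integrable_add integrable_powr_exp_real) auto
  fix z x assume z: "z \<in> ball z0 a \<inter> {\<nu>. Re \<nu> > 0}" and x: "x \<in> space halfline"
  have "\<bar>Re z0 - Re z\<bar> < a" using z abs_Re_le_cmod[of "z0 - z"] by (auto simp: dist_norm)
  hence "a \<le> Re z" "Re z \<le> 3 * a" unfolding a_def by linarith+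
  hence "x powr (Re z - 1) \<le> x powr (a - 1) + x powr (3 * a - 1)"
   using x by (intro powr_between) auto
  moreover have "Re (X / of_real x) \<ge> 0" using X x by (simp add: Re_divide_of_real)
  hence "exp (- (Re \<mu> * x) - Re (X / of_real x)) \<le> exp (?B x)" by simp
  ultimately have "x powr (Re z - 1) * exp (- (Re \<mu> * x) - Re (X / of_real x)) \<le> (x powr (a - 1) + x powr (3 * a - 1)) * exp (?B x)"
   by (intro mult_mono) auto
  thus "norm (of_real x powr (z - 1) * exp (?A x)) \<le> x powr (a - 1) * exp (?B x) + x powr (3 * a - 1) * exp (?B x)"
   using x by (simp add: norm_mult norm_powr_real_powr distrib_right)
 qed
qed

text \<open>At an integer order \<open>bessel_K\<close> is a limit over nearby orders, where the
  formula is known, and the moment side is holomorphic in the order, so the limit is its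
  value.\<close>

lemma bessel_K_eq_moment:
 assumes \<mu>: "Re \<mu> > 0" and X: "X \<noteq> 0" "Re X \<ge> 0" and \<nu>: "Re \<nu> > 0"
 shows "bessel_K \<nu> (2 * csqrt \<mu> * csqrt X) = exp (\<nu> * (Ln \<mu> - Ln X) / 2) * bessel_moment \<mu> X \<nu> / 2"
proof (cases "\<nu> \<in> \<int>")
 let ?A = "\<lambda>a. bessel_K_nonint a (2 * csqrt \<mu> * csqrt X)"
 case True
 define g where "g = (\<lambda>\<nu>. exp (\<nu> * (Ln \<mu> - Ln X) / 2) * bessel_moment \<mu> X \<nu> / 2)"
 have "g holomorphic_on {\<nu>. Re \<nu> > 0}"
  unfolding g_def using holomorphic_bessel_moment_order[OF \<mu> X(2)] by (intro holomorphic_intros) auto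
 from holomorphic_on_imp_continuous_on[OF this] have "isCont g \<nu>"
  unfolding continuous_on_eq_continuous_at[OF open_halfspace_Re_gt] using \<nu> by simp
 hence "(g \<longlongrightarrow> g \<nu>) (at \<nu>)" by (simp add: isCont_def)
 moreover have "eventually (\<lambda>a. g a = bessel_K_nonint a (2 * csqrt \<mu> * csqrt X)) (at \<nu>)"
 proof -
  \<comment> \<open>Radius 1 excludes all other integers, radius \<open>Re \<nu>\<close> keeps the
    order in the right half plane.\<close>
  have "eventually (\<lambda>a. a \<in> ball \<nu> (min 1 (Re \<nu>)) - {\<nu>}) (at \<nu>)"
   using \<nu> by (intro eventually_at_in_open) auto
  thus ?thesis
  proof eventually_elim
   case (elim a)
   have "Re a > 0" using elim abs_Re_le_cmod[of "\<nu> - a"] by (auto simp: dist_norm)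
   moreover have "a \<notin> \<int>"
   proof
    assume "a \<in> \<int>"
    then obtain i j where ij: "a = of_int i" "\<nu> = of_int j" using True by (auto elim!: Ints_cases)
    have "dist \<nu> a = \<bar>of_int (j - i)\<bar>" unfolding ij dist_norm of_int_diff[symmetric] norm_of_int ..
    hence "\<bar>of_int (j - i)\<bar> < (1::real)" using elim by simp
    hence "j = i" by linarith
    thus False using elim ij by simp
   qed
   ultimately show ?case unfolding g_def using bessel_K_nonint_eq_moment[OF \<mu> X] by simp
  qed
 qed
 ultimately have "(?A \<longlongrightarrow> g \<nu>) (at \<nu>)"
  using tendsto_cong by fast
 hence "Lim (at \<nu>) ?A = g \<nu>"
  by (intro tendsto_Lim) auto
 thus ?thesis using True by (simp add: bessel_K_def g_def)
qed (use bessel_K_nonint_eq_moment[OF assms] in \<open>simp add: bessel_K_def\<close>)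

section \<open>Poisson summation on the half line\<close>

text \<open>The Fourier series of the second Bernoulli polynomial comes from Abel summation.\<close>

lemma Arg_one_minus_cis:
 assumes "0 < \<theta>" "\<theta> < 2 * pi"
 shows "Arg (1 - cis \<theta>) = (\<theta> - pi) / 2"
proof (rule cis_Arg_unique)
 let ?A = "(\<theta> - pi) / 2"
 have "sin (\<theta> / 2) > 0" using assms by (intro sin_gt_zero) auto
 have "1 - cis \<theta> = of_real (2 * sin (\<theta> / 2)) * cis ?A"
 proof -
  have c: "cos \<theta> = 1 - 2 * (sin (\<theta>/2))\<^sup>2" using cos_double_sin[of "\<theta>/2"] by simp
  have s: "sin \<theta> = 2 * sin (\<theta>/2) * cos (\<theta>/2)" using sin_double[of "\<theta>/2"] by simp
  have c': "cos ?A = sin (\<theta> / 2)" "sin ?A = - cos (\<theta> / 2)"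
   by (simp_all add: diff_divide_distrib cos_diff sin_diff)
  show ?thesis by (simp add: complex_eq_iff c s c' power2_eq_square)
 qed
 thus "sgn (1 - cis \<theta>) = cis ?A"
  using \<open>sin (\<theta> / 2) > 0\<close> by (simp add: sgn_mult sgn_of_real del: of_real_mult)
qed (use assms in auto)

text \<open>The differentiated series, a sine series with weights \<open>1 / j\<close>, is not
  absolutely convergent. Factors \<open>\<rho> ^ j\<close> with \<open>\<rho> < 1\<close> make it
  the imaginary part of a logarithm; this is integrated over \<open>{0..x}\<close> before
  \<open>\<rho>\<close> tends to 1.\<close>

lemma bernoulli2_fourier:
 fixes x :: real
 assumes x: "0 \<le> x" "x \<le> 1"
 shows "(\<lambda>j. cos (2 * pi * real (Suc j) * x) / (real (Suc j))\<^sup>2) sums (pi\<^sup>2 * (x\<^sup>2 - x + 1/6))"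
proof -
 let ?D = "\<lambda>x. pi\<^sup>2 * (x\<^sup>2 - x) - pi\<^sup>2 * (0\<^sup>2 - 0)"
 let ?B = "\<lambda>real n y. 2 * pi * real (Suc n) * y"
 define a where "a = (\<lambda>(y::real) (j::nat). cos (2 * pi * real (Suc j) * y) / (real (Suc j))\<^sup>2)"
 have sq: "summable (\<lambda>j. 1 / (real (Suc j))\<^sup>2)" using inverse_squares_sums by (simp add: sums_iff add.commute)
 have abs_a: "\<bar>a y j\<bar> \<le> 1 / (real (Suc j))\<^sup>2" for y j
  unfolding a_def by (auto simp: abs_mult divide_right_mono)
 have suma: "summable (a y)" for y
  by (rule summable_rabs_cancel, rule summable_comparison_test[OF _ sq]) (use abs_a in auto)
 define G where "G = (\<lambda>(r::real) (y::real). \<Sum>j. a y j * r ^ Suc j)"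
 \<comment> \<open>The shift by 2 keeps all radii strictly between 0 and 1.\<close>
 define r where "r = (\<lambda>n::nat. 1 - 1 / real (n + 2))"
 let ?C = "\<lambda>n y. 1 - of_real (r n) * cis (2 * pi * y)"
 let ?A = "\<lambda>n. \<lambda>y. 2 * pi * Arg (?C n y)"
 have r01: "0 < r n" "r n < 1" for n unfolding r_def by (auto simp: field_simps)
 have r1: "r \<longlonglongrightarrow> 1"
 proof -
  have "(\<lambda>n. 1 - 1 / real (n + 2)) \<longlonglongrightarrow> 1 - 0"
   using LIMSEQ_ignore_initial_segment[OF lim_1_over_n, of 2] by (intro tendsto_intros) auto
  thus ?thesis by (simp add: r_def)
 qed
 have sumG: "summable (\<lambda>j. a y j * \<rho> ^ Suc j)" if "\<bar>\<rho>\<bar> \<le> 1" for y \<rho>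
 proof (rule summable_rabs_cancel, rule summable_comparison_test[OF _ sq])
  have "\<bar>a y j * \<rho> ^ Suc j\<bar> \<le> 1 / (real (Suc j))\<^sup>2 * 1" for j
   unfolding abs_mult power_abs using that by (intro mult_mono abs_a power_le_one) auto
  thus "\<exists>N. \<forall>n\<ge>N. norm \<bar>a y n * \<rho> ^ Suc n\<bar> \<le> 1 / (real (Suc n))\<^sup>2" by auto
 qed
 have G_lim: "(\<lambda>n. G (r n) y) \<longlonglongrightarrow> (\<Sum>j. a y j)" for y
 proof -
  have "uniform_limit {0..1} (\<lambda>N \<rho>. \<Sum>j<N. a y j * \<rho> ^ Suc j) (\<lambda>\<rho>. \<Sum>j. a y j * \<rho> ^ Suc j) sequentially"
  proof (rule Weierstrass_m_test[OF _ sq])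
   fix n :: nat and \<rho> :: real assume "\<rho> \<in> {0..1}"
   hence "\<bar>a y n\<bar> * \<bar>\<rho> ^ Suc n\<bar> \<le> 1 / (real (Suc n))\<^sup>2 * 1"
    unfolding power_abs by (intro mult_mono abs_a power_le_one) auto
   thus "norm (a y n * \<rho> ^ Suc n) \<le> 1 / (real (Suc n))\<^sup>2" by (simp add: abs_mult)
  qed
  hence "continuous_on {0..1} (\<lambda>\<rho>. G \<rho> y)"
   unfolding G_def by (rule uniform_limit_theorem[rotated]) (auto intro!: always_eventually continuous_intros)
  hence "(\<lambda>n. G (r n) y) \<longlonglongrightarrow> G 1 y"
   by (rule continuous_on_tendsto_compose[OF _ r1]) (use r01 in \<open>auto intro!: always_eventually less_imp_le\<close>)
  thus ?thesis by (simp add: G_def)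
 qed
 \<comment> \<open>The derived series is \<open>2 * pi\<close> times the imaginary part of the power
   series of the logarithm at \<open>1 - \<rho> * cis (2 * pi * y)\<close>.\<close>
 have Gder: "((\<lambda>y. G \<rho> y) has_real_derivative 2 * pi * Arg (1 - of_real \<rho> * cis (2 * pi * y))) (at y)"
  if \<rho>: "0 < \<rho>" "\<rho> < 1" for \<rho> y
 proof -
  define b where "b = (\<lambda>(j::nat) y. - (2 * pi) * (sin (2 * pi * real (Suc j) * y) / real (Suc j)) * \<rho> ^ Suc j)"
  have "((\<lambda>y. \<Sum>j. a y j * \<rho> ^ Suc j) has_field_derivative (\<Sum>j. b j y)) (at y)"
  proof (rule has_field_derivative_series'(2)[of UNIV])
   show "((\<lambda>y. a y n * \<rho> ^ Suc n) has_field_derivative b n y) (at y within UNIV)" for n y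
   proof -
    have *: "((\<lambda>y. cos (2 * pi * k * y) / k\<^sup>2 * c) has_field_derivative - (2 * pi) * (sin (2 * pi * k * y) / k) * c) (at y within UNIV)"
     if "k \<noteq> 0" for k c y :: real
     using that by (auto intro!: derivative_eq_intros simp: power2_eq_square field_simps)
    show ?thesis unfolding a_def b_def by (rule *) simp
   qed
   have "uniformly_convergent_on UNIV (\<lambda>n x. \<Sum>i<n. b i x)"
   proof (rule Weierstrass_m_test'[where M = "\<lambda>j. 2 * pi * \<rho> ^ Suc j"])
    fix n :: nat and y :: real
    have "\<bar>sin (?B real n y) / real (Suc n)\<bar> \<le> 1"
     using abs_sin_le_one[of "2 * pi * real (Suc n) * y"] by (simp add: field_simps del: abs_sin_le_one)
    hence "2 * pi * \<bar>sin (?B real n y) / real (Suc n)\<bar> * \<rho> ^ Suc n \<le> 2 * pi * 1 * \<rho> ^ Suc n"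
     using \<rho> by (intro mult_mono) auto
    thus "norm (b n y) \<le> 2 * pi * \<rho> ^ Suc n" using \<rho> by (simp add: b_def abs_mult)
    show "summable (\<lambda>j. 2 * pi * \<rho> ^ Suc j)"
     using summable_mult[OF summable_geometric[of \<rho>], of "2 * pi * \<rho>"] \<rho> by (simp add: mult_ac)
   qed
   thus "uniformly_convergent_on UNIV (\<lambda>n x. \<Sum>i<n. b i x)" .
   show "summable (\<lambda>n. a 0 n * \<rho> ^ Suc n)" using \<rho> by (intro sumG) auto
  qed auto
  also have "(\<Sum>j. b j y) = 2 * pi * Arg (1 - of_real \<rho> * cis (2 * pi * y))"
  proof -
   define z where "z = - (of_real \<rho> * cis (2 * pi * y))"
   have nz: "norm z < 1" using \<rho> by (simp add: z_def norm_mult)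
   have "(\<lambda>n. (-1) ^ Suc n / of_nat n * z ^ n) sums Ln (1 + z)" by (rule Ln_series[OF nz])
   hence "(\<lambda>n. Im ((-1) ^ Suc n / of_nat n * z ^ n)) sums Im (Ln (1 + z))" by (rule sums_Im)
   hence "(\<lambda>n. Im ((-1) ^ Suc (Suc n) / of_nat (Suc n) * z ^ Suc n)) sums Im (Ln (1 + z))"
    by (subst sums_Suc_iff) simp
   moreover have "1 + z \<noteq> 0" using nz by (metis add.inverse_inverse add_eq_0_iff norm_minus_cancel norm_one less_irrefl)
   ultimately have *: "(\<lambda>n. Im ((-1) ^ Suc (Suc n) / of_nat (Suc n) * z ^ Suc n)) sums Arg (1 + z)"
    by (simp add: Arg_eq_Im_Ln)
   have "Im ((-1) ^ Suc (Suc n) / of_nat (Suc n) * z ^ Suc n) = b n y / (2 * pi)" for n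
   proof -
    have im: "Im (- (of_real c * cis t)) = - (c * sin t)" for c t by simp
    have "(-1) ^ Suc (Suc n) / of_nat (Suc n) * z ^ Suc n = - (of_real (\<rho> ^ Suc n / real (Suc n)) * cis (?B real n y))"
    proof -
     have "z ^ Suc n = (-1) ^ Suc n * (of_real \<rho> ^ Suc n * cis (2 * pi * y) ^ Suc n)"
      unfolding z_def by (subst power_minus) (simp only: power_mult_distrib)
     also have "cis (2 * pi * y) ^ Suc n = cis (?B real n y)"
      unfolding Complex.DeMoivre by (simp add: algebra_simps)
     finally have zz: "z ^ Suc n = (-1) ^ Suc n * (of_real \<rho> ^ Suc n * cis (?B real n y))" .
     have "(-1::complex) ^ Suc (Suc n) * (-1) ^ Suc n = -1"
      by (simp flip: power_add mult_2)
     thus ?thesis unfolding zz by (simp add: field_simps)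
    qed
    also have "Im (- (of_real (\<rho> ^ Suc n / real (Suc n)) * cis (?B real n y))) = - (\<rho> ^ Suc n / real (Suc n) * sin (?B real n y))"
     by (rule im)
    finally show ?thesis by (simp add: b_def)
   qed
   hence "(\<lambda>n. 2 * pi * (b n y / (2 * pi))) sums (2 * pi * Arg (1 + z))" using * by (intro sums_mult) simp
   thus ?thesis by (simp add: sums_iff z_def)
  qed
  finally show ?thesis unfolding G_def .
 qed
 have Gint: "((\<lambda>y. 2 * pi * Arg (1 - of_real \<rho> * cis (2 * pi * y))) has_integral (G \<rho> x - G \<rho> 0)) {0..x}"
  if "0 < \<rho>" "\<rho> < 1" for \<rho>
  using x Gder[OF that]
  by (intro fundamental_theorem_of_calculus) (auto simp: has_real_derivative_iff_has_vector_derivative intro: has_vector_derivative_at_within)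
 define L where "L = (\<lambda>y. 2 * pi * Arg (1 - cis (2 * pi * y)))"
 \<comment> \<open>The argument is bounded by pi, so the radius may tend to 1 under the
   integral.\<close>
 have "(\<lambda>n. integral {0..x} (?A n)) \<longlonglongrightarrow> integral {0..x} L"
 proof (rule dominated_convergence(2)[where h = "\<lambda>_. 2 * pi * pi"])
  show "(?A n) integrable_on {0..x}" for n
   using Gint[OF r01] by blast
  show "(\<lambda>_. 2 * pi * pi) integrable_on {0..x}" by (rule integrable_const_ivl)
  show "norm (2 * pi * Arg (?C n y)) \<le> 2 * pi * pi" for n y
   using Arg_bounded[of "1 - of_real (r n) * cis (2 * pi * y)"] by (auto simp: abs_mult)
  show "(\<lambda>n. 2 * pi * Arg (?C n y)) \<longlonglongrightarrow> L y" if y: "y \<in> {0..x}" for y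
  proof (cases "cis (2 * pi * y) = 1")
   \<comment> \<open>Here \<open>L y\<close> is a multiple of \<open>Arg 0\<close>, which is 0 in
     the library and agrees with the argument 0 of the positive reals
     \<open>1 - r n\<close>.\<close>
   case True
   have "Arg (1 - of_real (r n) * 1) = 0" for n
   proof -
    have "Arg (complex_of_real (1 - r n)) = 0" using r01[of n] by (subst Arg_of_real) auto
    thus ?thesis by simp
   qed
   thus ?thesis by (simp add: L_def True Arg_zero)
  next
   case False
   have "1 - cis (2 * pi * y) \<notin> \<real>\<^sub>\<le>\<^sub>0"
   proof
    assume "1 - cis (2 * pi * y) \<in> \<real>\<^sub>\<le>\<^sub>0"
    hence "1 \<le> cos (2 * pi * y)" "sin (2 * pi * y) = 0" by (auto simp: complex_nonpos_Reals_iff)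
    with cos_le_one[of "2 * pi * y"] have "cos (2 * pi * y) = 1" by linarith
    with \<open>sin (2 * pi * y) = 0\<close> False show False by (simp add: complex_eq_iff)
   qed
   moreover have "(\<lambda>n. 1 - of_real (r n) * cis (2 * pi * y)) \<longlonglongrightarrow> 1 - of_real 1 * cis (2 * pi * y)"
    by (intro tendsto_intros r1)
   ultimately show ?thesis unfolding L_def
    using tendsto_compose[OF continuous_at_Arg[unfolded isCont_def]] by (intro tendsto_mult tendsto_const isCont_tendsto_compose[OF continuous_at_Arg]) auto
  qed
 qed
 also have "(\<lambda>n. integral {0..x} (?A n)) = (\<lambda>n. G (r n) x - G (r n) 0)"
  by (simp only: integral_unique[OF Gint[OF r01]])
 finally have lim1: "(\<lambda>n. G (r n) x - G (r n) 0) \<longlonglongrightarrow> integral {0..x} L" .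
 have "(L has_integral (?D x)) {0..x}"
 proof (rule has_integral_spike_finite[where S = "{0, 1}"])
  show "L y = pi * (2 * pi * y - pi)" if "y \<in> {0..x} - {0, 1}" for y
   using that x by (simp add: L_def Arg_one_minus_cis)
  show "((\<lambda>y. pi * (2 * pi * y - pi)) has_integral (?D x)) {0..x}"
   using x by (intro fundamental_theorem_of_calculus)
    (auto intro!: derivative_eq_intros simp: power2_eq_square field_simps simp flip: has_real_derivative_iff_has_vector_derivative)
 qed simp
 hence "integral {0..x} L = pi\<^sup>2 * (x\<^sup>2 - x)" by (simp add: integral_unique)
 with lim1 have "(\<Sum>j. a x j) - (\<Sum>j. a 0 j) = pi\<^sup>2 * (x\<^sup>2 - x)"
  using LIMSEQ_unique[OF lim1 tendsto_diff[OF G_lim G_lim]] by simp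
 \<comment> \<open>The constant of integration is the value at 0, the sum of the inverse
   squares.\<close>
 moreover have "(\<Sum>j. a 0 j) = pi\<^sup>2 / 6"
  using inverse_squares_sums by (simp add: a_def sums_iff add.commute)
 ultimately have "(\<Sum>j. a x j) = pi\<^sup>2 * (x\<^sup>2 - x + 1/6)" by (simp add: algebra_simps)
 thus ?thesis using suma[of x] by (simp add: sums_iff a_def)
qed

section \<open>From the Fourier series to Poisson summation\<close>

lemma integral_truncation_tendsto:
 fixes g :: "real \<Rightarrow> complex"
 assumes g: "integrable halfline g"
 shows "(\<lambda>N::nat. integral {0..real N} g) \<longlonglongrightarrow> (\<integral>x. g x \<partial>halfline)"
proof -
 have "(\<lambda>N. \<integral>x. indicator {..real N} x *\<^sub>R g x \<partial>halfline) \<longlonglongrightarrow> (\<integral>x. g x \<partial>halfline)"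
 proof (rule integral_dominated_convergence[where w = "\<lambda>x. norm (g x)"])
  have m: "{..real N} \<inter> {0<..} \<in> sets halfline" for N
   by (rule sets_restrict_space_iff[THEN iffD2]) auto
  show "(\<lambda>x. indicator {..real N} x *\<^sub>R g x) \<in> borel_measurable halfline" for N
  proof (rule borel_measurable_scaleR)
   show "indicat_real {..real N} \<in> borel_measurable halfline"
    by (rule measurable_restrict_space1, rule borel_measurable_indicator) auto
  qed (use g in auto)
  show "AE x in halfline. (\<lambda>N. indicator {..real N} x *\<^sub>R g x) \<longlonglongrightarrow> g x"
  proof (rule AE_I2)
   fix x :: real
   have "eventually (\<lambda>N. indicator {..real N} x *\<^sub>R g x = g x) sequentially"
    using eventually_ge_at_top[of "nat \<lceil>x\<rceil>"]
    by eventually_elim (auto simp: indicator_def nat_ceiling_le_eq)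
   thus "(\<lambda>N. indicator {..real N} x *\<^sub>R g x) \<longlonglongrightarrow> g x" by (rule tendsto_eventually)
  qed
  show "AE x in halfline. norm (indicator {..real N} x *\<^sub>R g x) \<le> norm (g x)" for N
   by (intro AE_I2) (auto simp: indicator_def)
 qed (use g in auto)
 moreover have "(\<integral>x. indicator {..real N} x *\<^sub>R g x \<partial>halfline) = integral {0..real N} g" for N
 proof -
  have i: "integrable (lebesgue_on {0<..real N}) g"
   by (rule integrable_lebesgue_on_subset[OF g]) auto
  have "(\<integral>x. indicator {..real N} x *\<^sub>R g x \<partial>halfline) = (\<integral>x. indicator {0<..} x *\<^sub>R indicator {..real N} x *\<^sub>R g x \<partial>lebesgue)"
   by (subst integral_restrict_space) auto
  also have "\<dots> = (\<integral>x. indicator {0<..real N} x *\<^sub>R g x \<partial>lebesgue)"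
   by (intro Bochner_Integration.integral_cong) (auto simp: indicator_def)
  also have "\<dots> = (\<integral>x. g x \<partial>lebesgue_on {0<..real N})"
   by (subst integral_restrict_space) auto
  also have "\<dots> = integral {0<..real N} g" using i by (simp add: lebesgue_integral_eq_integral)
  also have "\<dots> = integral {0..real N} g"
   by (rule integral_spike_set) (auto intro: negligible_subset[of "{0}"])
  finally show ?thesis .
 qed
 ultimately show ?thesis by simp
qed

text \<open>Euler-Maclaurin on the half line, with the second periodic Bernoulli function expanded
 into its Fourier series.\<close>

lemma poisson_summation_half_line:
 fixes f f1 f2 :: "real \<Rightarrow> complex"
 assumes d1: "\<And>x. x > 0 \<Longrightarrow> (f has_vector_derivative f1 x) (at x)"
  and d2: "\<And>x. x > 0 \<Longrightarrow> (f1 has_vector_derivative f2 x) (at x)"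
  and c0: "continuous_on {0..} f" and c1: "continuous_on {0..} f1" and c2: "continuous_on {0<..} f2"
  and i0: "integrable halfline f" and i2: "integrable halfline f2"
  and l0: "(f \<longlongrightarrow> 0) at_top" and l1: "(f1 \<longlongrightarrow> 0) at_top"
  and f0: "f 0 = 0"
 shows "(\<lambda>j. \<integral>x. f x * of_real (2 * cos (2 * pi * real (Suc j) * x)) \<partial>halfline) sums
      ((\<Sum>k. f (real (Suc k))) - (\<integral>x. f x \<partial>halfline))" (is ?P)
  and "summable (\<lambda>k. f (real (Suc k)))"
proof -
 let ?I = "\<lambda>real. \<lambda>N. (f1 (real N) - f1 0) / 12 - (\<Sum>k<N. f (real (Suc k))) + f (real N) / 2"
 let ?H = "\<lambda>real j. 1 / (real (Suc j))\<^sup>2"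
 let ?G = "\<lambda>real j x. cos (2 * pi * real (Suc j) * x) / (real (Suc j))\<^sup>2"
 let ?F = "\<integral>x. f x \<partial>halfline"
 let ?E = "\<lambda>real N. (f1 (real N) - f1 0) / 12 - (\<Sum>k<N. f (real (Suc k))) + f (real N) / 2"
 let ?D = "2 * pi\<^sup>2"
 let ?A = "\<lambda>real j x. 1 / ?D * (?G real j x)"
 let ?J = "\<lambda>real. \<lambda>j. \<integral>x. f2 x * of_real (?A real j x) \<partial>halfline"
 \<comment> \<open>The second Bernoulli polynomial at the fractional part.\<close>
 define P where "P = (\<lambda>x::real. (frac x)\<^sup>2 - frac x + 1/6)"
 let ?C = "\<lambda>x. f2 x * of_real (P x / 2) - f x"
 let ?B = "\<integral>x. f2 x * of_real (P x / 2) \<partial>halfline"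
 have Psums: "(\<lambda>j. 1 / ?D * (?G real j x)) sums (P x / 2)" for x
 proof -
  have "cos (2 * pi * real (Suc j) * x) = cos (2 * pi * real (Suc j) * frac x)" for j
  proof -
   have "2 * pi * real (Suc j) * x = 2 * pi * real (Suc j) * frac x + 2 * pi * of_int (int (Suc j) * \<lfloor>x\<rfloor>)"
    by (simp add: frac_def algebra_simps)
   thus ?thesis by (simp add: cos_add del: of_int_mult of_nat_Suc)
  qed
  moreover have "(\<lambda>j. 1 / ?D * (cos (2 * pi * real (Suc j) * frac x) / (real (Suc j))\<^sup>2)) sums (1 / ?D * (pi\<^sup>2 * P x))"
   unfolding P_def by (intro sums_mult bernoulli2_fourier) (auto simp: frac_lt_1 less_imp_le)
  ultimately show ?thesis by simp
 qed
 have sq: "(\<lambda>j. 1 / ?D * (?H real j)) sums (1 / 12)"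
 proof -
  have "(\<lambda>j. 1 / ?D * (?H real j)) sums (1 / ?D * (pi\<^sup>2 / 6))"
   using inverse_squares_sums by (intro sums_mult) (simp add: add.commute)
  thus ?thesis by simp
 qed
 have icos: "integrable halfline (\<lambda>x. g x * of_real (c * cos (\<omega> * x)))"
  if "integrable halfline g" for g :: "real \<Rightarrow> complex" and c \<omega> :: real
 proof (rule Bochner_Integration.integrable_bound)
  show "integrable halfline (\<lambda>x. norm (g x) * \<bar>c\<bar>)" using that by (intro integrable_mult_left integrable_norm)
  have "(\<lambda>x. complex_of_real (c * cos (\<omega> * x))) \<in> borel_measurable halfline"
   by (intro continuous_imp_measurable_on_sets_lebesgue continuous_intros) auto
  thus "(\<lambda>x. g x * of_real (c * cos (\<omega> * x))) \<in> borel_measurable halfline"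
   using that by (intro borel_measurable_times) auto
  have "\<bar>c\<bar> * \<bar>cos (\<omega> * x)\<bar> \<le> \<bar>c\<bar> * 1" for x by (intro mult_left_mono abs_cos_le_one) auto
  thus "AE x in halfline. norm (g x * of_real (c * cos (\<omega> * x))) \<le> norm (norm (g x) * \<bar>c\<bar>)"
   by (intro AE_I2) (auto simp: norm_mult abs_mult intro!: mult_left_mono)
 qed
 \<comment> \<open>Two integrations by parts. The sine removes the boundary term of \<open>f\<close>
   at 0 and both boundary terms vanish at infinity, which leaves \<open>f1 0\<close> and a cosine
   integral of \<open>f2\<close> with the summable weight \<open>1 / (j + 1)^2\<close>.\<close>
 have coeff: "(\<integral>x. f x * of_real (2 * cos (2 * pi * real (Suc j) * x)) \<partial>halfline) =
   - f1 0 * of_real (1 / ?D * (?H real j)) -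
   (\<integral>x. f2 x * of_real (?A real j x) \<partial>halfline)" for j
 proof -
  define \<omega> where "\<omega> = 2 * pi * real (Suc j)"
  have \<omega>: "\<omega> > 0" by (simp add: \<omega>_def)
  define F where "F = (\<lambda>x. f x * of_real (2 / \<omega> * sin (\<omega> * x)) + f1 x * of_real (2 / \<omega>\<^sup>2 * cos (\<omega> * x)))"
  have w2: "2 / \<omega>\<^sup>2 = 1 / ?D * (?H real j)" by (simp add: \<omega>_def power_mult_distrib field_simps del: of_nat_Suc)
  have ii: "integrable halfline (\<lambda>x. f x * of_real (2 * cos (\<omega> * x)))"
     "integrable halfline (\<lambda>x. f2 x * of_real (2 / \<omega>\<^sup>2 * cos (\<omega> * x)))"
   by (intro icos i0 i2)+
  have bnd: "((\<lambda>x. g x * of_real (h x)) \<longlongrightarrow> 0) at_top" if "(g \<longlongrightarrow> 0) at_top" "\<And>x. \<bar>h x\<bar> \<le> K" for g :: "real \<Rightarrow> complex" and h K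
  proof (rule Lim_null_comparison)
   show "((\<lambda>x. norm (g x) * K) \<longlongrightarrow> 0) at_top" using tendsto_mult_right[OF tendsto_norm[OF that(1)], of K] by simp
   show "eventually (\<lambda>x. norm (g x * of_real (h x)) \<le> norm (g x) * K) at_top"
    using that(2) by (auto simp: norm_mult intro!: always_eventually mult_left_mono)
  qed
  have "(\<integral>x. f x * of_real (2 * cos (\<omega> * x)) + f2 x * of_real (2 / \<omega>\<^sup>2 * cos (\<omega> * x)) \<partial>halfline) = 0 - F 0"
  proof (rule lebesgue_on_ftc)
   show "integrable halfline (\<lambda>x. f x * of_real (2 * cos (\<omega> * x)) + f2 x * of_real (2 / \<omega>\<^sup>2 * cos (\<omega> * x)))"
    by (intro Bochner_Integration.integrable_add ii)
   show "continuous_on {0<..} (\<lambda>x. f x * of_real (2 * cos (\<omega> * x)) + f2 x * of_real (2 / \<omega>\<^sup>2 * cos (\<omega> * x)))"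
   proof -
    have "continuous_on {0<..} f" by (rule continuous_on_subset[OF c0]) auto
    thus ?thesis using c2 \<omega> by (intro continuous_intros) auto
   qed
   have "continuous_on {0..} F" unfolding F_def using c0 c1 \<omega> by (intro continuous_intros) auto
   hence "(F \<longlongrightarrow> F 0) (at 0 within {0..})" by (simp add: continuous_on_def)
   thus "(F \<longlongrightarrow> F 0) (at_right 0)" by (rule tendsto_within_subset) auto
   have "\<bar>2 / \<omega> * sin (\<omega> * x)\<bar> \<le> 2 / \<omega>" "\<bar>2 / \<omega>\<^sup>2 * cos (\<omega> * x)\<bar> \<le> 2 / \<omega>\<^sup>2" for x
    using \<omega> by (auto simp: abs_mult divide_right_mono)
   thus "(F \<longlongrightarrow> 0) at_top" unfolding F_def by (intro tendsto_add_zero bnd[OF l0] bnd[OF l1])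
   show "(F has_vector_derivative f x * of_real (2 * cos (\<omega> * x)) + f2 x * of_real (2 / \<omega>\<^sup>2 * cos (\<omega> * x))) (at x)"
    if x: "x > 0" for x
   proof -
    have s: "((\<lambda>x. complex_of_real (2 / \<omega> * sin (\<omega> * x))) has_vector_derivative of_real (2 * cos (\<omega> * x))) (at x)"
     using \<omega> by (intro has_vector_derivative_of_real) (auto intro!: derivative_eq_intros)
    have c: "((\<lambda>x. complex_of_real (2 / \<omega>\<^sup>2 * cos (\<omega> * x))) has_vector_derivative of_real (- (2 / \<omega> * sin (\<omega> * x)))) (at x)"
     using \<omega> by (intro has_vector_derivative_of_real) (auto intro!: derivative_eq_intros simp: power2_eq_square)
    from has_vector_derivative_add[OF has_vector_derivative_mult[OF d1[OF x] s] has_vector_derivative_mult[OF d2[OF x] c]]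
    show ?thesis unfolding F_def by (simp add: algebra_simps)
   qed
  qed
  also have "F 0 = f1 0 * of_real (2 / \<omega>\<^sup>2)" by (simp add: F_def f0)
  finally have "(\<integral>x. f x * of_real (2 * cos (\<omega> * x)) \<partial>halfline) =
    - (f1 0 * of_real (2 / \<omega>\<^sup>2)) - (\<integral>x. f2 x * of_real (2 / \<omega>\<^sup>2 * cos (\<omega> * x)) \<partial>halfline)"
   unfolding Bochner_Integration.integral_add[OF ii] by (simp add: algebra_simps)
  thus ?thesis unfolding w2 by (simp add: \<omega>_def)
 qed
 have "(?J real) sums
      ?B" and iP: "integrable halfline (\<lambda>x. f2 x * of_real (P x / 2))"
 proof -
  have 1: "(\<lambda>x. f2 x * of_real (?A real j x)) \<in> borel_measurable halfline" for j
  proof -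
   have "(\<lambda>x. f2 x * of_real (1 / (2 * pi\<^sup>2 * (real (Suc j))\<^sup>2) * cos (2 * pi * real (Suc j) * x))) \<in> borel_measurable halfline"
    by (rule borel_measurable_integrable[OF icos[OF i2]])
   thus ?thesis by simp
  qed
  have 2: "(\<lambda>j. f2 x * of_real (?A real j x)) sums (f2 x * of_real (P x / 2))" for x
   using Psums by (intro sums_mult) (simp only: sums_of_real_iff)
  have 3: "integrable halfline (\<lambda>x. norm (f2 x) * (1 / 12))" using i2 by auto
  have 4: "norm (\<Sum>j<N. f2 x * of_real (?A real j x)) \<le> norm (f2 x) * (1 / 12)" for N x
  proof -
   have "\<bar>\<Sum>j<N. 1 / ?D * (?G real j x)\<bar> \<le> (\<Sum>j<N. 1 / ?D * (?H real j))"
    by (rule order_trans[OF sum_abs], rule sum_mono) (auto simp: abs_mult intro!: mult_left_mono divide_right_mono)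
   also have "\<dots> \<le> (\<Sum>j. 1 / ?D * (?H real j))"
    by (rule sum_le_suminf) (use sq in \<open>auto simp: sums_iff\<close>)
   also have "\<dots> = 1 / 12" using sq by (simp add: sums_iff)
   finally show ?thesis unfolding sum_distrib_left[symmetric] of_real_sum[symmetric] norm_mult norm_of_real
    by (rule mult_left_mono) auto
  qed
  note D = dominated_sums_integral[OF 1 2 3 4]
  show "(?J real) sums
      ?B" by (rule D(1))
  show "integrable halfline (\<lambda>x. f2 x * of_real (P x / 2))" by (rule D(2))
 qed
 from sums_diff[OF sums_mult[OF sums_of_real[OF sq], of "- f1 0"] this(1)]
 have csums: "(\<lambda>j. \<integral>x. f x * of_real (2 * cos (2 * pi * real (Suc j) * x)) \<partial>halfline) sums
   (- f1 0 / 12 - ?B)"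
  unfolding coeff by simp
 \<comment> \<open>With \<open>b\<close> half the second Bernoulli polynomial and \<open>b1\<close>
   its derivative, \<open>f1 * b - f * b1\<close> is an antiderivative. The values of
   \<open>b\<close> at both ends are 1/12, those of \<open>b1\<close> are -1/2 and 1/2.\<close>
 have step: "(?C has_integral ((f1 (real k + 1) - f1 (real k)) / 12 - (f (real k + 1) + f (real k)) / 2)) {real k..real k + 1}" for k :: nat
 proof -
  define b where "b = (\<lambda>x. ((x - real k)\<^sup>2 - (x - real k) + 1/6) / 2)"
  define b1 where "b1 = (\<lambda>x. (x - real k) - 1/2)"
  have "((\<lambda>x. f2 x * of_real (b x) - f x) has_integral
    ((f1 (real k + 1) * of_real (b (real k + 1)) - f (real k + 1) * of_real (b1 (real k + 1))) -
     (f1 (real k) * of_real (b (real k)) - f (real k) * of_real (b1 (real k))))) {real k..real k + 1}"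
  proof (rule fundamental_theorem_of_calculus_interior)
   have "continuous_on {real k..real k + 1} f" "continuous_on {real k..real k + 1} f1"
    by (rule continuous_on_subset[OF c0] continuous_on_subset[OF c1]; auto)+
   thus "continuous_on {real k..real k + 1} (\<lambda>x. f1 x * of_real (b x) - f x * of_real (b1 x))"
    unfolding b_def b1_def by (intro continuous_intros) auto
   fix x assume "x \<in> {real k<..<real k + 1}"
   hence x: "x > 0" by auto
   have s: "((\<lambda>x. complex_of_real (b x)) has_vector_derivative of_real (b1 x)) (at x)"
    unfolding b_def b1_def by (intro has_vector_derivative_of_real) (auto intro!: derivative_eq_intros simp: field_simps)
   have c: "((\<lambda>x. complex_of_real (b1 x)) has_vector_derivative of_real 1) (at x)"
    unfolding b1_def by (intro has_vector_derivative_of_real) (auto intro!: derivative_eq_intros)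
   from has_vector_derivative_diff[OF has_vector_derivative_mult[OF d2[OF x] s] has_vector_derivative_mult[OF d1[OF x] c]]
   show "((\<lambda>x. f1 x * of_real (b x) - f x * of_real (b1 x)) has_vector_derivative f2 x * of_real (b x) - f x) (at x)"
    by (simp add: algebra_simps)
  qed auto
  also have "((f1 (real k + 1) * of_real (b (real k + 1)) - f (real k + 1) * of_real (b1 (real k + 1))) -
     (f1 (real k) * of_real (b (real k)) - f (real k) * of_real (b1 (real k)))) = (f1 (real k + 1) - f1 (real k)) / 12 - (f (real k + 1) + f (real k)) / 2"
   by (simp add: b_def b1_def field_simps)
  finally show ?thesis
  proof (rule has_integral_spike_finite[of "{real k + 1}", rotated 2])
   fix x assume "x \<in> {real k..real k + 1} - {real k + 1}"
   hence "\<lfloor>x\<rfloor> = int k" by (intro floor_unique) auto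
   hence "frac x = x - real k" by (simp add: frac_def)
   thus "f2 x * of_real (P x / 2) - f x = f2 x * of_real (b x) - f x" by (simp add: P_def b_def)
  qed simp
 qed
 have total: "(?C has_integral (?E real N)) {0..real N}" for N
 proof (induction N)
  case (Suc N)
  have "(?C has_integral 
   ((?E real N) + ((f1 (real N + 1) - f1 (real N)) / 12 - (f (real N + 1) + f (real N)) / 2))) {0..real N + 1}"
   by (rule has_integral_combine[OF _ _ Suc step]) auto
  moreover have "((a - b) / 12 - S + c / 2) + ((d - a) / 12 - (e + c) / 2) = (d - b) / 12 - (S + e) + e / 2" for a b c d e S :: complex
   by (simp add: field_simps)
  moreover have "real N + 1 = real (Suc N)" by simp
  ultimately show ?case by (simp only: sum.lessThan_Suc)
 qed (simp add: f0 has_integral_refl)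
 have "(\<lambda>N. integral {0..real N} ?C) \<longlonglongrightarrow> (\<integral>x. f2 x * of_real (P x / 2) - f x \<partial>halfline)"
  by (intro integral_truncation_tendsto Bochner_Integration.integrable_diff iP i0)
 also have "(\<lambda>N. integral {0..real N} ?C) = (?I real)"
  by (intro ext integral_unique total)
 finally have L: "(?I real) \<longlonglongrightarrow>
   ?B - ?F"
  unfolding Bochner_Integration.integral_diff[OF iP i0] .
 have n0: "(\<lambda>N. f (real N)) \<longlonglongrightarrow> 0" "(\<lambda>N. f1 (real N)) \<longlonglongrightarrow> 0"
  using filterlim_compose[OF l0 filterlim_real_sequentially] filterlim_compose[OF l1 filterlim_real_sequentially] by auto
 have "(\<lambda>N. ((f1 (real N) - f1 0) / 12 + f (real N) / 2) - (?E real N)) \<longlonglongrightarrow>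
   ((0 - f1 0) / 12 + 0 / 2) - (?B - ?F)"
  by (intro tendsto_diff tendsto_add tendsto_divide tendsto_const n0 L) auto
 hence S: "(\<lambda>k. f (real (Suc k))) sums ((- f1 0 / 12 - ?B) + ?F)"
  unfolding sums_def by (simp add: algebra_simps)
 thus "summable (\<lambda>k. f (real (Suc k)))" by (simp add: sums_iff)
 show ?P
  using csums S by (simp add: sums_iff)
qed

section \<open>The entire part of the Bessel function I\<close>

definition bessel_It :: "complex \<Rightarrow> complex \<Rightarrow> complex" where
 "bessel_It \<nu> u = (\<Sum>m. (u / 2) ^ (2 * m) * rGamma (\<nu> + of_nat m + 1) / fact m)"

lemma bessel_I_eq: "bessel_I \<nu> z = (z / 2) powr \<nu> * bessel_It \<nu> z"
 by (simp add: bessel_I_def bessel_It_def)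

lemma bessel_It_sums: "(\<lambda>m. (u / 2) ^ (2 * m) * rGamma (\<nu> + of_nat m + 1) / fact m) sums bessel_It \<nu> u"
 unfolding bessel_It_def power_mult by (intro summable_sums summable_norm_cancel[OF summable_bessel_series])

text \<open>The moments of the arcsine weight on the unit interval. They turn the series of
  \<open>cosh\<close> into the series of \<open>bessel_It 0\<close>.\<close>

lemma Beta_half_half: "Beta (real m + 1/2) (1/2) = pi * fact (2 * m) / (4 ^ m * (fact m)\<^sup>2)"
proof (induction m)
 case 0
 have "Gamma (1/2 :: real) * Gamma (1/2) = pi" by (simp add: Gamma_one_half_real)
 thus ?case by (simp add: Beta_def)
next
 case (Suc m)
 have nz: "real m + 1/2 \<notin> \<int>\<^sub>\<le>\<^sub>0" using nonpos_Ints_nonpos[of "real m + 1/2"] by auto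
 have "(real m + 1/2 + 1/2) * Beta (real m + 1/2 + 1) (1/2) = (real m + 1/2) * Beta (real m + 1/2) (1/2)"
  by (rule Beta_plus1_left[OF nz])
 hence "Beta (real (Suc m) + 1/2) (1/2) = (real m + 1/2) / (real m + 1) * (pi * fact (2 * m) / (4 ^ m * (fact m)\<^sup>2))"
 proof -
  assume *: "(real m + 1/2 + 1/2) * Beta (real m + 1/2 + 1) (1/2) = (real m + 1/2) * Beta (real m + 1/2) (1/2)"
  have gen: "b = a / c * x" if "c * b = a * x" "c \<noteq> 0" for a b c x :: real using that by (simp add: field_simps)
  have "Beta (real m + 1/2 + 1) (1/2) = (real m + 1/2) / (real m + 1/2 + 1/2) * Beta (real m + 1/2) (1/2)"
   by (rule gen[OF *]) simp
  moreover have "real m + 1/2 + 1 = real (Suc m) + 1/2" "real m + 1/2 + 1/2 = real m + 1" by auto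
  ultimately show ?thesis unfolding Suc.IH by simp
 qed
 also have "\<dots> = pi * fact (2 * Suc m) / (4 ^ Suc m * (fact (Suc m))\<^sup>2)"
 proof -
  have e: "fact (2 * Suc m) = (2 * (real m + 1)) * (2 * (real m + 1/2)) * (fact (2 * m) :: real)"
   by (simp add: fact_Suc algebra_simps)
  have e': "fact (Suc m) = (real m + 1) * fact m" by (simp add: add.commute)
  have gen: "b / a * (p * F / (q * f\<^sup>2)) = p * (2 * a * (2 * b) * F) / (4 * q * (a * f)\<^sup>2)" if "a \<noteq> 0" for a b p F q f :: real
   using that by (simp add: power2_eq_square mult_ac)
  show ?thesis unfolding e e' power_Suc by (rule gen) simp
 qed
 finally show ?case .
qed

lemma cosh_sums: "(\<lambda>m. z ^ (2 * m) / fact (2 * m)) sums cosh (z :: 'a :: {real_normed_field, banach})"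
proof -
 let ?A = "\<lambda>n. if even n then z ^ n /\<^sub>R fact n else 0"
 have "?A sums cosh z" by (rule cosh_converges)
 hence "(\<lambda>m. ?A (2 * m)) sums cosh z"
  by (subst sums_mono_reindex[of "\<lambda>m. 2 * m"]) (auto simp: strict_mono_def elim!: evenE)
 thus ?thesis by (simp add: scaleR_conv_of_real divide_inverse mult.commute)
qed

lemma norm_cosh_le: "norm (cosh z) \<le> exp \<bar>Re z\<bar>" for z :: complex
proof -
 have "norm (cosh z) = norm (exp z + exp (- z)) / 2" by (simp add: cosh_field_def norm_divide)
 also have "\<dots> \<le> (exp (Re z) + exp (- Re z)) / 2"
  using norm_triangle_ineq[of "exp z" "exp (- z)"] by simp
 also have "\<dots> \<le> exp \<bar>Re z\<bar>" by (auto simp: abs_if)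
 finally show ?thesis .
qed

text \<open>\<open>pi * bessel_It 0 u\<close> is the integral of \<open>cosh (u * sqrt t)\<close>
  against the arcsine weight of total mass pi. The gain over the power series is a bound in terms of
  \<open>Re u\<close> alone.\<close>

lemma norm_bessel_It_0_le: "norm (bessel_It 0 u) \<le> exp \<bar>Re u\<bar>"
proof -
 let ?E = "\<lambda>t real m. t powr (real m + 1/2 - 1) * (1 - t) powr (1/2 - 1)"
 let ?C = "\<lambda>m. (u / 2) ^ (2 * m) * rGamma (0 + of_nat m + 1) / fact m"
 let ?B = "\<lambda>t. u * of_real (sqrt t)"
 let ?A = "lebesgue_on {0<..<1}"
 define w where "w = (\<lambda>t::real. t powr (1/2 - 1) * (1 - t) powr (1/2 - 1))"
 let ?D = "\<integral>t. of_real (w t) * cosh (?B t) \<partial>lebesgue_on {0<..<1}"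
 have I: "((\<lambda>t. t powr (real m + 1/2 - 1) * (1 - t) powr (1/2 - 1)) has_integral Beta (real m + 1/2) (1/2)) {0<..<1}" for m
  using has_integral_Beta_real[of "real m + 1/2" "1/2"] by (simp add: has_integral_Icc_iff_Ioo)
 have wi: "integrable ?A (\<lambda>t. t powr (real m + 1/2 - 1) * (1 - t) powr (1/2 - 1))" for m
  using I[of m] by (auto simp: integrable_lebesgue_on_iff intro!: nonnegative_absolutely_integrable_1)
 have wv: "(\<integral>t. t powr (real m + 1/2 - 1) * (1 - t) powr (1/2 - 1) \<partial>lebesgue_on {0<..<1}) = pi * fact (2 * m) / (4 ^ m * (fact m)\<^sup>2)" for m
  using wi[of m] I[of m] by (simp add: lebesgue_integral_eq_integral integral_unique Beta_half_half)
 have w0: "integrable ?A w" "(\<integral>t. w t \<partial>lebesgue_on {0<..<1}) = pi"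
  using wi[of 0] wv[of 0] by (simp_all add: w_def)
 have tm: "t powr (real m + 1/2 - 1) * (1 - t) powr (1/2 - 1) = w t * t ^ m" if "t \<in> {0<..<1}" for t m
 proof -
  have "real m + 1/2 - 1 = (1/2 - 1) + real m" by simp
  hence "t powr (real m + 1/2 - 1) = t powr (1/2 - 1) * t powr real m" by (simp only: powr_add)
  thus ?thesis using that by (simp add: w_def powr_realpow)
 qed
 define f where "f = (\<lambda>m t. complex_of_real (w t) * ((?B t) ^ (2 * m) / fact (2 * m)))"
 have feq: "f m t = u ^ (2 * m) / fact (2 * m) * of_real (?E t real m)" if "t \<in> {0<..<1}" for t m
 proof -
  have "complex_of_real (sqrt t) ^ (2 * m) = of_real (t ^ m)" using that by (simp add: power_mult flip: of_real_power)
  thus ?thesis unfolding f_def tm[OF that] by (simp add: power_mult_distrib)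
 qed
 have fi: "integrable ?A (\<lambda>t. u ^ (2 * m) / fact (2 * m) * complex_of_real (?E t real m))" for m
  by (intro integrable_mult_right integrable_of_real wi)
 have 1: "f m \<in> borel_measurable ?A" for m
  using fi[of m] by (subst measurable_cong[OF feq]) auto
 have 2: "(\<lambda>m. f m t) sums (of_real (w t) * cosh (?B t))" for t
  unfolding f_def by (intro sums_mult cosh_sums)
 have 3: "integrable ?A (\<lambda>t. w t * cosh (norm u))" by (intro integrable_mult_left w0)
 have wnn: "w t \<ge> 0" for t by (simp add: w_def)
 have 4: "norm (\<Sum>m<N. f m t) \<le> w t * cosh (norm u)" if t: "t \<in> space ?A" for N t
 proof -
  have s: "(\<lambda>m. norm u ^ (2 * m) / fact (2 * m)) sums cosh (norm u)" by (rule cosh_sums)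
  have "norm (\<Sum>m<N. (?B t) ^ (2 * m) / fact (2 * m)) \<le> (\<Sum>m<N. norm u ^ (2 * m) / fact (2 * m))"
  proof (rule order_trans[OF norm_sum], rule sum_mono)
   fix m
   have "norm u * sqrt t \<le> norm u * 1" using t by (intro mult_left_mono) auto
   hence "(norm u * sqrt t) ^ (2 * m) \<le> norm u ^ (2 * m)" using t by (intro power_mono) auto
   thus "norm ((?B t) ^ (2 * m) / fact (2 * m)) \<le> norm u ^ (2 * m) / fact (2 * m)"
    using t by (simp add: norm_divide norm_power norm_mult divide_right_mono)
  qed
  also have "\<dots> \<le> (\<Sum>m. norm u ^ (2 * m) / fact (2 * m))" by (rule sum_le_suminf) (use s in \<open>auto simp: sums_iff\<close>)
  also have "\<dots> = cosh (norm u)" using s by (simp add: sums_iff)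
  finally show ?thesis unfolding f_def sum_distrib_left[symmetric] norm_mult using wnn by (auto intro: mult_left_mono)
 qed
 note D = dominated_sums_integral[OF 1 2 3 4]
 have "(\<integral>t. f m t \<partial>lebesgue_on {0<..<1}) = of_real pi * (?C m)" for m
 proof -
  have "(\<integral>t. f m t \<partial>lebesgue_on {0<..<1}) = (\<integral>t. u ^ (2 * m) / fact (2 * m) * complex_of_real (?E t real m) \<partial>lebesgue_on {0<..<1})"
   by (intro Bochner_Integration.integral_cong feq) auto
  also have "\<dots> = u ^ (2 * m) / fact (2 * m) * of_real (pi * fact (2 * m) / (4 ^ m * (fact m)\<^sup>2))"
   by (simp only: integral_mult_right_zero integral_complex_of_real wv)
  also have "\<dots> = of_real pi * (?C m)"
  proof -
   have "rGamma (of_nat m + 1 :: complex) = 1 / fact m" by (simp add: rGamma_inverse_Gamma Gamma_fact inverse_eq_divide add.commute)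
   moreover have "(u / 2) ^ (2 * m) = u ^ (2 * m) / 4 ^ m" by (simp add: power_divide power_mult)
   ultimately show ?thesis unfolding add_0_left by (simp only:) (simp add: power2_eq_square mult_ac)
  qed
  finally show ?thesis .
 qed
 with D(1) have "(\<lambda>m. of_real pi * (?C m)) sums 
   ?D" by simp
 with sums_mult[OF bessel_It_sums[of u 0], of "of_real pi"]
 have eq: "of_real pi * bessel_It 0 u = ?D"
  using sums_unique2 by blast
 have "pi * norm (bessel_It 0 u) = norm (of_real pi * bessel_It 0 u)" by (simp add: norm_mult)
 also have "\<dots> \<le> (\<integral>t. w t * exp \<bar>Re u\<bar> \<partial>lebesgue_on {0<..<1})"
  unfolding eq
 proof (rule Bochner_Integration.integral_norm_bound_integral)
  show "integrable ?A (\<lambda>t. w t * exp \<bar>Re u\<bar>)" by (intro integrable_mult_left w0)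
  fix t assume t: "t \<in> space (lebesgue_on {0<..<1::real})"
  have "\<bar>Re u\<bar> * sqrt t \<le> \<bar>Re u\<bar> * 1" using t by (intro mult_left_mono) auto
  hence "norm (cosh (?B t)) \<le> exp \<bar>Re u\<bar>"
   using t by (intro order_trans[OF norm_cosh_le]) (simp add: abs_mult)
  thus "norm (of_real (w t) * cosh (?B t)) \<le> w t * exp \<bar>Re u\<bar>"
   using wnn[of t] by (simp add: norm_mult mult_left_mono)
 qed (rule D(2))
 also have "\<dots> = pi * exp \<bar>Re u\<bar>" by (simp add: w0)
 finally show ?thesis by simp
qed

text \<open>The Beta integral with a complex first and an integer second parameter. Induction on
  \<open>m\<close> uses \<open>(1 - t)^(m + 1) = (1 - t)^m - t * (1 - t)^m\<close>.\<close>

lemma integral_powr_one_minus: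
 assumes "Re \<nu> > 0"
 shows "integrable (lebesgue_on {0<..1}) (\<lambda>t. complex_of_real t powr (\<nu> - 1) * (1 - of_real t) ^ m)" (is ?P)
  "(\<integral>t. complex_of_real t powr (\<nu> - 1) * (1 - of_real t) ^ m \<partial>lebesgue_on {0<..1}) = fact m * Gamma \<nu> * rGamma (\<nu> + of_nat m + 1)" (is ?Q)
proof -
 let ?B = "\<lambda>t. 1 - of_real t"
 let ?A = "lebesgue_on {0<..1}"
 have "integrable ?A (\<lambda>t. complex_of_real t powr (\<nu> - 1) * (?B t) ^ m) \<and>
  (\<integral>t. complex_of_real t powr (\<nu> - 1) * (?B t) ^ m \<partial>lebesgue_on {0<..1}) = fact m / pochhammer \<nu> (Suc m)"
  using assms
 proof (induction m arbitrary: \<nu>)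
  case 0
  thus ?case using integral_powr_Ioc[of \<nu>] by simp
 next
  case (Suc m)
  have \<nu>1: "Re (\<nu> + 1) > 0" using Suc.prems by simp
  have split: "complex_of_real t powr (\<nu> - 1) * (?B t) ^ Suc m = of_real t powr (\<nu> - 1) * (?B t) ^ m - of_real t powr (\<nu> + 1 - 1) * (?B t) ^ m"
   if "t \<in> space ?A" for t
  proof -
   have t: "t > 0" using that by simp
   have "complex_of_real t powr (\<nu> - 1 + 1) = of_real t powr (\<nu> - 1) * of_real t powr 1" by (rule powr_add)
   hence "complex_of_real t powr \<nu> = of_real t powr (\<nu> - 1) * of_real t" using t by simp
   thus ?thesis by (simp add: algebra_simps)
  qed
  note I = Suc.IH[OF Suc.prems] Suc.IH[OF \<nu>1]
  have "integrable ?A (\<lambda>t. complex_of_real t powr (\<nu> - 1) * (?B t) ^ Suc m)"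
   by (subst Bochner_Integration.integrable_cong[OF refl split]) (use I in \<open>auto intro!: Bochner_Integration.integrable_diff\<close>)
  moreover have "(\<integral>t. complex_of_real t powr (\<nu> - 1) * (?B t) ^ Suc m \<partial>lebesgue_on {0<..1}) = fact m / pochhammer \<nu> (Suc m) - fact m / pochhammer (\<nu> + 1) (Suc m)"
   by (subst Bochner_Integration.integral_cong[OF refl split], assumption, subst Bochner_Integration.integral_diff) (use I in auto)
  moreover have "fact m / pochhammer \<nu> (Suc m) - fact m / pochhammer (\<nu> + 1) (Suc m) = fact (Suc m) / pochhammer \<nu> (Suc (Suc m))"
  proof -
   have n0: "\<nu> \<noteq> 0" "\<nu> + 1 + of_nat m \<noteq> 0" using Suc.prems by (auto simp: complex_eq_iff)
   have p: "pochhammer (\<nu> + 1) m \<noteq> 0"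
   proof
    assume "pochhammer (\<nu> + 1) m = 0"
    then obtain k where "\<nu> + 1 = - of_nat k" by (auto simp: pochhammer_eq_0_iff)
    thus False using Suc.prems by (auto simp: complex_eq_iff)
   qed
   have e2: "pochhammer (\<nu> + 1) (Suc m) = pochhammer (\<nu> + 1) m * (\<nu> + 1 + of_nat m)" by (rule pochhammer_Suc)
   have e: "pochhammer \<nu> (Suc m) = \<nu> * pochhammer (\<nu> + 1) m"
    "pochhammer \<nu> (Suc (Suc m)) = \<nu> * (pochhammer (\<nu> + 1) m * (\<nu> + 1 + of_nat m))"
    by (rule pochhammer_rec, simp only: pochhammer_rec[of \<nu> "Suc m"] e2)
   have gen: "F / (a * q) - F / (q * w) = F * (w - a) / (a * (q * w))" if "a \<noteq> 0" "q \<noteq> 0" "w \<noteq> 0" for F a q w :: complex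
   proof -
    have "F / (a * q) = F * w / (a * (q * w))" "F / (q * w) = F * a / (a * (q * w))" using that by simp_all
    thus ?thesis by (simp only: diff_divide_distrib right_diff_distrib)
   qed
   have w: "\<nu> + 1 + of_nat m - \<nu> = of_nat (Suc m)" by simp
   show ?thesis unfolding e e2 gen[OF n0(1) p n0(2)] w by (simp add: mult.commute)
  qed
  ultimately show ?case by simp
 qed
 moreover have "fact m / pochhammer \<nu> (Suc m) = fact m * Gamma \<nu> * rGamma (\<nu> + of_nat m + 1)"
 proof -
  have "\<nu> \<notin> \<int>\<^sub>\<le>\<^sub>0" using assms by (auto elim!: nonpos_Ints_cases)
  hence "pochhammer \<nu> (Suc m) = Gamma (\<nu> + of_nat (Suc m)) / Gamma \<nu>" by (rule pochhammer_Gamma)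
  thus ?thesis by (simp add: rGamma_inverse_Gamma divide_inverse add_ac)
 qed
 ultimately show ?P
  ?Q
  by auto
qed

text \<open>Sonine's integral: \<open>Gamma \<nu> * bessel_It \<nu> u\<close> is the integral of
  \<open>t powr (\<nu> - 1) * bessel_It 0 (u * sqrt (1 - t))\<close> over the unit interval, so the
  bound for order 0 is inherited. Growth governed by \<open>Re u\<close> instead of
  \<open>norm u\<close> is what makes the kernel decay for all complex \<open>\<alpha>\<close> and
  \<open>\<beta>\<close> in the right half plane.\<close>

lemma norm_bessel_It_le:
 assumes \<nu>: "Re \<nu> > 0"
 shows "norm (bessel_It \<nu> u) \<le> norm (rGamma \<nu>) / Re \<nu> * exp \<bar>Re u\<bar>"
proof -
 let ?J = "\<lambda>m. (u / 2) ^ (2 * m) * rGamma (\<nu> + of_nat m + 1) / fact m"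
 let ?I = "of_real (norm u / 2)"
 let ?E = "\<lambda>t. sqrt (1 - t)"
 let ?H = "\<lambda>t. of_real t powr (\<nu> - 1) * bessel_It 0 (u * of_real (?E t))"
 let ?G = "\<lambda>t m. (u / 2 * of_real (?E t)) ^ (2 * m) * rGamma (0 + of_nat m + 1) / fact m"
 let ?C = "\<integral>t. of_real t powr (\<nu> - 1) * bessel_It 0 (u * of_real (?E t)) \<partial>lebesgue_on {0<..1}"
 let ?B = "lebesgue_on {0<..1}"
 let ?A = "\<lambda>t. complex_of_real t powr (\<nu> - 1)"
 let ?F = "\<integral>t. norm (?A t) \<partial>lebesgue_on {0<..1}"
 let ?D = "\<integral>t. norm (?A t) * exp \<bar>Re u\<bar> \<partial>lebesgue_on {0<..1}"
 define f where "f = (\<lambda>m t. complex_of_real t powr (\<nu> - 1) * (?G t m))"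
 have feq: "f m t = (u / 2) ^ (2 * m) * rGamma (of_nat m + 1) / fact m * (complex_of_real t powr (\<nu> - 1) * (1 - of_real t) ^ m)" if "t \<in> space ?B" for m t
 proof -
  have "complex_of_real (?E t) ^ (2 * m) = of_real ((?E t) ^ (2 * m))" by simp
  also have "sqrt (1 - t) ^ (2 * m) = (1 - t) ^ m" using that by (simp add: power_mult)
  finally have "complex_of_real (?E t) ^ (2 * m) = (1 - of_real t) ^ m" by simp
  thus ?thesis unfolding f_def power_mult_distrib[of "u / 2"] by simp
 qed
 have fi: "integrable ?B (\<lambda>t. (u / 2) ^ (2 * m) * rGamma (of_nat m + 1) / fact m * (complex_of_real t powr (\<nu> - 1) * (1 - of_real t) ^ m))" for m
  by (intro integrable_mult_right integral_powr_one_minus \<nu>)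
 have 1: "f m \<in> borel_measurable ?B" for m
  using fi[of m] by (subst measurable_cong[OF feq]) auto
 have 2: "(\<lambda>m. f m t) sums (?H t)" for t
  unfolding f_def using bessel_It_sums[of "u * of_real (?E t)" 0] by (intro sums_mult) simp
 define C where "C = (\<Sum>m. norm (?I\<^sup>2 ^ m * rGamma (0 + of_nat m + 1) / fact m :: complex))"
 have i1: "integrable ?B (\<lambda>t. norm (?A t))"
  by (intro integrable_norm integral_powr_Ioc \<nu>)
 hence 3: "integrable ?B (\<lambda>t. norm (?A t) * C)"
  by (rule integrable_mult_left)
 have 4: "norm (\<Sum>m<N. f m t) \<le> norm (?A t) * C" if t: "t \<in> space ?B" for N t
 proof -
  have "norm (\<Sum>m<N. (u / 2 * of_real (?E t)) ^ (2 * m) * rGamma (0 + of_nat m + 1) / fact m) \<le> (\<Sum>m<N. norm (?I\<^sup>2 ^ m * rGamma (0 + of_nat m + 1) / fact m :: complex))"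
  proof (rule order_trans[OF norm_sum], rule sum_mono)
   fix m
   have "norm u / 2 * sqrt (1 - t) \<le> norm u / 2 * 1" using t by (intro mult_left_mono) auto
   hence "(norm u / 2 * sqrt (1 - t)) ^ (2 * m) \<le> (norm u / 2) ^ (2 * m)" using t by (intro power_mono) auto
   thus "norm (?G t m) \<le> norm (?I\<^sup>2 ^ m * rGamma (0 + of_nat m + 1) / fact m :: complex)"
    using t by (auto simp: norm_divide norm_power norm_mult power_mult intro!: divide_right_mono mult_right_mono)
  qed
  also have "\<dots> \<le> C" unfolding C_def by (rule sum_le_suminf[OF summable_bessel_series]) auto
  finally show ?thesis unfolding f_def sum_distrib_left[symmetric] norm_mult[of _ "sum _ _"] by (auto intro: mult_left_mono)
 qed
 note D = dominated_sums_integral[OF 1 2 3 4]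
 have G: "Gamma \<nu> \<noteq> 0" using \<nu> by (auto simp: Gamma_eq_zero_iff elim!: nonpos_Ints_cases)
 have "(\<integral>t. f m t \<partial>lebesgue_on {0<..1}) = Gamma \<nu> * (?J m)" for m
 proof -
  have "(\<integral>t. f m t \<partial>lebesgue_on {0<..1}) = (u / 2) ^ (2 * m) * rGamma (of_nat m + 1) / fact m * (fact m * Gamma \<nu> * rGamma (\<nu> + of_nat m + 1))"
   unfolding integral_powr_one_minus(2)[OF \<nu>, symmetric] integral_mult_right_zero[symmetric]
   by (intro Bochner_Integration.integral_cong feq) auto
  moreover have "rGamma (of_nat m + 1 :: complex) = 1 / fact m" by (simp add: rGamma_inverse_Gamma Gamma_fact inverse_eq_divide add.commute)
  ultimately show ?thesis by simp
 qed
 with D(1) have "(\<lambda>m. Gamma \<nu> * (?J m)) sums 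
   ?C" by simp
 with sums_mult[OF bessel_It_sums[of u \<nu>], of "Gamma \<nu>"]
 have eq: "Gamma \<nu> * bessel_It \<nu> u = ?C"
  using sums_unique2 by blast
 have "norm (Gamma \<nu>) * norm (bessel_It \<nu> u) = norm (Gamma \<nu> * bessel_It \<nu> u)" by (simp add: norm_mult)
 also have "\<dots> \<le> ?D"
  unfolding eq
 proof (rule Bochner_Integration.integral_norm_bound_integral)
  show "integrable ?B (\<lambda>t. norm (?A t) * exp \<bar>Re u\<bar>)" by (intro integrable_mult_left i1)
  fix t assume t: "t \<in> space (lebesgue_on {0<..1::real})"
  have "\<bar>Re u\<bar> * sqrt (1 - t) \<le> \<bar>Re u\<bar> * 1" using t by (intro mult_left_mono) auto
  hence "norm (bessel_It 0 (u * of_real (?E t))) \<le> exp \<bar>Re u\<bar>"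
   using t by (intro order_trans[OF norm_bessel_It_0_le]) (simp add: abs_mult)
  thus "norm (?H t) \<le> norm (?A t) * exp \<bar>Re u\<bar>"
   unfolding norm_mult by (rule mult_left_mono) auto
 qed (rule D(2))
 also have "?D = exp \<bar>Re u\<bar> / Re \<nu>"
 proof -
  have "complex_of_real ?F = (\<integral>t. of_real (norm (?A t)) \<partial>lebesgue_on {0<..1})"
   by (rule integral_complex_of_real[symmetric])
  also have "\<dots> = (\<integral>t. complex_of_real t powr (of_real (Re \<nu>) - 1) \<partial>lebesgue_on {0<..1})"
  proof (intro Bochner_Integration.integral_cong refl)
   fix t :: real assume "t \<in> space ?B"
   hence t: "t > 0" by simp
   hence "norm (?A t) = t powr (Re \<nu> - 1)" by (simp add: norm_powr_real_powr)
   also have "complex_of_real \<dots> = of_real t powr of_real (Re \<nu> - 1)" using t by (intro powr_of_real[symmetric]) auto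
   finally show "complex_of_real (norm (?A t)) = of_real t powr (of_real (Re \<nu>) - 1)" by simp
  qed
  also have "\<dots> = of_real (1 / Re \<nu>)" using \<nu> by (subst integral_powr_Ioc) auto
  finally have "?F = 1 / Re \<nu>" by (simp only: of_real_eq_iff)
  thus ?thesis by simp
 qed
 finally have "norm (bessel_It \<nu> u) \<le> exp \<bar>Re u\<bar> / Re \<nu> / norm (Gamma \<nu>)" using G
  by (subst pos_le_divide_eq) (auto simp: mult.commute)
 thus ?thesis by (simp add: rGamma_inverse_Gamma norm_inverse divide_inverse mult_ac)
qed

lemma norm_rGamma_shift_le:
 assumes "Re \<nu> \<ge> 0"
 shows "norm (rGamma (\<nu> + of_nat m + 1)) \<le> norm (rGamma (\<nu> + 1))"
proof (induction m)
 case (Suc m)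
 let ?w = "\<nu> + of_nat m + 1"
 have "1 \<le> Re ?w" using assms by simp
 hence w: "1 \<le> norm ?w" using complex_Re_le_cmod[of ?w] by linarith
 have "norm (rGamma (?w + 1)) * 1 \<le> norm (rGamma (?w + 1)) * norm ?w"
  by (rule mult_left_mono[OF w]) simp
 also have "\<dots> = norm (rGamma ?w)" using rGamma_plus1[of ?w] by (metis mult.commute norm_mult)
 finally show ?case using Suc by (simp add: add_ac)
qed simp

lemma holomorphic_bessel_It: "bessel_It \<nu> holomorphic_on UNIV"
proof -
 let ?A = "\<lambda>m. \<nu> + of_nat m + 1"
 have "(\<lambda>u. \<Sum>m. (u / 2) ^ (2 * m) * rGamma (?A m) / fact m) holomorphic_on UNIV"
 proof (rule holomorphic_on_suminf)
  fix z0 :: complex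
  show "\<exists>r>0. \<exists>B. summable B \<and> (\<forall>z\<in>ball z0 r \<inter> UNIV. \<forall>m. norm ((z / 2) ^ (2 * m) * rGamma (?A m) / fact m) \<le> B m)"
  proof (intro exI conjI ballI allI)
   show "summable (\<lambda>m. norm ((of_real ((norm z0 + 1) / 2))\<^sup>2 ^ m * rGamma (?A m) / fact m :: complex))"
    by (rule summable_bessel_series)
   fix z m assume "z \<in> ball z0 1 \<inter> (UNIV :: complex set)"
   hence "norm z / 2 \<le> (norm z0 + 1) / 2" using norm_triangle_ineq4[of z0 "z0 - z"] by (auto simp: dist_norm)
   hence "(norm z / 2) ^ (2 * m) \<le> ((norm z0 + 1) / 2) ^ (2 * m)" by (intro power_mono) auto
   moreover have "norm (complex_of_real ((norm z0 + 1) / 2)) = (norm z0 + 1) / 2" unfolding norm_of_real by simp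
   ultimately show "norm ((z / 2) ^ (2 * m) * rGamma (?A m) / fact m) \<le> norm ((of_real ((norm z0 + 1) / 2))\<^sup>2 ^ m * rGamma (?A m) / fact m :: complex)"
    unfolding norm_divide norm_mult norm_power power_mult[symmetric] by (auto intro!: divide_right_mono mult_right_mono)
  qed simp
 qed (auto intro!: holomorphic_intros)
 thus ?thesis unfolding bessel_It_def .
qed

lemma holomorphic_bessel_It_order: "(\<lambda>\<nu>. bessel_It \<nu> u) holomorphic_on {\<nu>. Re \<nu> > 0}"
 unfolding bessel_It_def
proof (rule holomorphic_on_suminf)
 let ?A = "(u / 2)\<^sup>2"
 show "open {\<nu>. Re \<nu> > 0}" by (rule open_halfspace_Re_gt)
 fix z0 :: complex
 have "bounded ((\<lambda>\<nu>. rGamma (\<nu> + 1)) ` cball z0 1)"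
  by (intro compact_imp_bounded compact_continuous_image holomorphic_on_imp_continuous_on holomorphic_intros) auto
 then obtain K where "\<forall>x\<in>(\<lambda>\<nu>. rGamma (\<nu> + 1)) ` cball z0 1. norm x \<le> K"
  unfolding bounded_iff by blast
 hence K: "\<And>z. z \<in> cball z0 1 \<Longrightarrow> norm (rGamma (z + 1)) \<le> K" by blast
 show "\<exists>r>0. \<exists>B. summable B \<and> (\<forall>z\<in>ball z0 r \<inter> {\<nu>. Re \<nu> > 0}. \<forall>m. norm ((u / 2) ^ (2 * m) * rGamma (z + of_nat m + 1) / fact m) \<le> B m)"
 proof (intro exI conjI ballI allI)
  show "summable (\<lambda>m. norm ?A ^ m / fact m * K)"
   by (intro summable_mult2 summable_power_fact_norm)
  fix z m assume z: "z \<in> ball z0 1 \<inter> {\<nu>. Re \<nu> > 0}"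
  have "norm (rGamma (z + of_nat m + 1)) \<le> K"
   using norm_rGamma_shift_le[of z m] K[of z] z by auto
  hence "norm ?A ^ m / fact m * norm (rGamma (z + of_nat m + 1)) \<le> norm ?A ^ m / fact m * K"
   by (intro mult_left_mono) auto
  thus "norm ((u / 2) ^ (2 * m) * rGamma (z + of_nat m + 1) / fact m) \<le> norm ?A ^ m / fact m * K"
   by (simp add: norm_divide norm_mult norm_power power_mult)
 qed simp
qed (auto intro!: holomorphic_intros)

section \<open>Laguerre polynomials\<close>

text \<open>Each factor \<open>\<nu> + j\<close> has norm at least \<open>j\<close>. Up to a
  constant the coefficients of \<open>bessel_It \<nu>\<close> are thus dominated by those of
  \<open>bessel_It 0\<close>.\<close>

lemma norm_rGamma_shift_fact_le:
 assumes "Re \<nu> \<ge> 0"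
 shows "norm (rGamma (\<nu> + of_nat m + 1)) \<le> norm (rGamma (\<nu> + 1)) / fact m"
proof (induction m)
 case (Suc m)
 let ?w = "\<nu> + of_nat m + 1"
 have "real (Suc m) \<le> Re ?w" using assms by simp
 hence w: "real (Suc m) \<le> norm ?w" using complex_Re_le_cmod[of ?w] by linarith
 have "norm (rGamma (?w + 1)) * real (Suc m) \<le> norm (rGamma (?w + 1)) * norm ?w"
  by (rule mult_left_mono[OF w]) simp
 also have "\<dots> = norm (rGamma ?w)" using rGamma_plus1[of ?w] by (metis mult.commute norm_mult)
 also have "\<dots> \<le> norm (rGamma (\<nu> + 1)) / fact m" by (rule Suc.IH)
 finally have "norm (rGamma (?w + 1)) \<le> norm (rGamma (\<nu> + 1)) / fact m / real (Suc m)"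
  by (subst pos_le_divide_eq) auto
 thus ?case by (simp add: add_ac mult.commute)
qed simp

text \<open>The coefficient of \<open>y ^ m\<close> in
  \<open>(-1) ^ n * rGamma (\<nu> + n + 1)\<close> times the generalized Laguerre polynomial of
  degree \<open>n\<close> and parameter \<open>\<nu>\<close>.\<close>

definition laguerre_coeff :: "complex \<Rightarrow> nat \<Rightarrow> nat \<Rightarrow> complex" where
 "laguerre_coeff \<nu> n m = (if m \<le> n then (-1) ^ (n - m) * rGamma (\<nu> + of_nat m + 1) / (fact (n - m) * fact m) else 0)"

text \<open>The generating function of the Laguerre polynomials, read off the Cauchy product of the
  exponential and the Bessel series. In the bound the exponent is linear in \<open>norm y\<close>
  with a factor that vanishes with \<open>q\<close>, so that for small \<open>q\<close> an
  exponential weight absorbs it.\<close>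

lemma laguerre_expansion_sums:
 "(\<lambda>n. q ^ (2 * n) * (\<Sum>m\<le>n. laguerre_coeff \<nu> n m * y ^ (n + m))) sums (exp (- (q\<^sup>2 * y)) * bessel_It \<nu> (2 * q * y))" (is ?P)
 and laguerre_expansion_bound: "Re \<nu> > 0 \<Longrightarrow> norm (\<Sum>n<N. q ^ (2 * n) * (\<Sum>m\<le>n. laguerre_coeff \<nu> n m * y ^ (n + m))) \<le>
   norm (rGamma (\<nu> + 1)) * exp ((norm q ^ 2 + 2 * norm q) * norm y)"
proof -
 let ?F = "\<lambda>m. norm (q * y) ^ (2 * m) / (fact m * fact m)"
 let ?E = "q\<^sup>2 * y"
 let ?D = "(norm q ^ 2 + 2 * norm q) * norm y"
 let ?C = "2 * norm (q * y)"
 let ?B = "rGamma (\<nu> + 1)"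
 let ?A = "\<Sum>n<N. q ^ (2 * n) * (\<Sum>m\<le>n. laguerre_coeff \<nu> n m * y ^ (n + m))"
 define a where "a = (\<lambda>j. (- ?E) ^ j / fact j)"
 let ?H = "\<Sum>j. norm (a j)"
 define b where "b = (\<lambda>m. (2 * q * y / 2) ^ (2 * m) * rGamma (\<nu> + of_nat m + 1) / fact m)"
 let ?G = "\<Sum>j. norm (b j)"
 have a: "a sums exp (- ?E)" unfolding a_def by (rule exp_sums_complex)
 have b: "b sums bessel_It \<nu> (2 * q * y)" unfolding b_def by (rule bessel_It_sums)
 have an: "summable (\<lambda>j. norm (a j))" unfolding a_def using summable_power_fact_norm[of "q\<^sup>2 * y"] by (simp add: norm_divide norm_power)
 have bn: "summable (\<lambda>j. norm (b j))" unfolding b_def power_mult by (rule summable_bessel_series)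
 have eq: "(\<Sum>i\<le>n. a (n - i) * b i) = q ^ (2 * n) * (\<Sum>m\<le>n. laguerre_coeff \<nu> n m * y ^ (n + m))" for n
  unfolding sum_distrib_left
 proof (rule sum.cong[OF refl])
  fix m assume "m \<in> {..n}"
  then obtain k where n: "n = m + k" using le_iff_add by auto
  have "(- ?E) ^ k = (-1) ^ k * q ^ (2 * k) * y ^ k" by (subst power_minus) (simp add: power_mult_distrib power_mult)
  moreover have "(2 * q * y / 2) ^ (2 * m) = q ^ (2 * m) * y ^ (2 * m)" by (simp add: power_mult_distrib)
  moreover have "q ^ (2 * (m + k)) = q ^ (2 * m) * q ^ (2 * k)" by (simp only: distrib_left power_add)
  moreover have "y ^ (m + k + m) = y ^ (2 * m) * y ^ k" by (simp add: mult_2 power_add)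
  ultimately show "a (n - m) * b m = q ^ (2 * n) * (laguerre_coeff \<nu> n m * y ^ (n + m))"
   unfolding n a_def b_def laguerre_coeff_def by simp
 qed
 have comm: "(\<Sum>i\<le>n. a i * b (n - i)) = (\<Sum>i\<le>n. a (n - i) * b i)" for n
  by (rule sum.reindex_bij_witness[of _ "\<lambda>i. n - i" "\<lambda>i. n - i"]) auto
 have "(\<lambda>n. \<Sum>i\<le>n. a i * b (n - i)) sums ((\<Sum>j. a j) * (\<Sum>j. b j))" by (rule Cauchy_product_sums[OF an bn])
 thus ?P
  using a b by (simp add: comm eq sums_iff)
 show "norm ?A \<le>
   norm ?B * exp ?D" if \<nu>: "Re \<nu> > 0"
 proof -
  have cs: "(\<lambda>n. \<Sum>i\<le>n. norm (a i) * norm (b (n - i))) sums (?H * ?G)"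
   using Cauchy_product_sums[of "\<lambda>j. norm (a j)" "\<lambda>j. norm (b j)"] an bn by simp
  have "norm ?A = norm (\<Sum>n<N. \<Sum>i\<le>n. a i * b (n - i))"
   unfolding eq[symmetric] comm[symmetric] ..
  also have "\<dots> \<le> (\<Sum>n<N. \<Sum>i\<le>n. norm (a i) * norm (b (n - i)))"
   by (intro order_trans[OF norm_sum] sum_mono order_trans[OF norm_sum]) (simp add: norm_mult)
  also have "\<dots> \<le> (\<Sum>n. \<Sum>i\<le>n. norm (a i) * norm (b (n - i)))"
   by (rule sum_le_suminf) (use cs in \<open>auto simp: sums_iff intro!: sum_nonneg\<close>)
  also have "\<dots> = ?H * ?G" using cs by (simp add: sums_iff)
  also have "?H = exp (norm ?E)"
   unfolding a_def exp_def by (simp add: norm_mult norm_inverse norm_power scaleR_conv_of_real divide_inverse mult.commute)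
  also have "?G \<le> norm ?B * exp ?C"
  proof -
   define x where "x = complex_of_real ?C"
   have s0: "(\<lambda>m. (x / 2) ^ (2 * m) * rGamma (0 + of_nat m + 1) / fact m) sums bessel_It 0 x" by (rule bessel_It_sums)
   have t: "(x / 2) ^ (2 * m) * rGamma (0 + of_nat m + 1) / fact m = of_real (?F m)" for m
   proof -
    have "rGamma (0 + of_nat m + 1 :: complex) = 1 / fact m" by (simp add: rGamma_inverse_Gamma Gamma_fact inverse_eq_divide add.commute)
    moreover have "x / 2 = of_real (norm (q * y))" by (simp add: x_def)
    ultimately show ?thesis by simp
   qed
   have s1: "(\<lambda>m. norm (q * y) ^ (2 * m) / (fact m * fact m)) sums Re (bessel_It 0 x)"
    using sums_Re[OF s0] unfolding t Re_complex_of_real .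
   have le: "norm (b m) \<le> norm ?B * (?F m)" for m
   proof -
    have "norm (b m) = norm (q * y) ^ (2 * m) / fact m * norm (rGamma (\<nu> + of_nat m + 1))"
     by (simp add: b_def norm_divide norm_mult norm_power mult.assoc)
    also have "\<dots> \<le> norm (q * y) ^ (2 * m) / fact m * (norm ?B / fact m)"
     by (intro mult_left_mono norm_rGamma_shift_fact_le) (use \<nu> in auto)
    finally show ?thesis by (simp add: mult_ac)
   qed
   have "?G \<le> (\<Sum>m. norm ?B * (?F m))"
    by (rule suminf_le[OF le bn]) (intro summable_mult sums_summable[OF s1])
   also have "\<dots> = norm ?B * Re (bessel_It 0 x)"
    using sums_mult[OF s1] sums_unique by metis
   also have "\<dots> \<le> norm ?B * exp ?C"
   proof (intro mult_left_mono)
    have "Re (bessel_It 0 x) \<le> exp \<bar>Re x\<bar>" using complex_Re_le_cmod norm_bessel_It_0_le order_trans by blast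
    thus "Re (bessel_It 0 x) \<le> exp ?C" by (simp add: x_def)
   qed auto
   finally show ?thesis .
  qed
  finally have "norm ?A \<le> exp (norm ?E) * (norm ?B * exp ?C)"
   by simp
  also have "\<dots> = norm ?B * exp ?D"
  proof -
   have "exp (norm ?E) * exp ?C = exp ?D"
    by (simp add: norm_mult norm_power algebra_simps flip: exp_add)
   thus ?thesis by (simp add: mult_ac)
  qed
  finally show ?thesis .
 qed
qed

text \<open>This and the next recurrence in the degree are shaped to pair with the three-term
  recurrence of the moments: the factor \<open>\<nu> + n + m + 1\<close> occurs in both.\<close>

lemma laguerre_coeff_rec_0:
 "(of_nat n + 1) * (\<nu> + of_nat n + 1) * laguerre_coeff \<nu> (Suc n) 0 = - (\<nu> + of_nat n + 1) * laguerre_coeff \<nu> n 0"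
proof -
 define d where "d = (of_nat n + 1 :: complex)"
 have dn: "d \<noteq> 0" unfolding d_def by (metis of_nat_Suc of_nat_neq_0 add.commute)
 have f: "(fact (Suc n) :: complex) = d * fact n" by (simp add: d_def add.commute)
 define P where "P = (-1) ^ n * rGamma (\<nu> + 1) / (d * fact n)"
 have "laguerre_coeff \<nu> (Suc n) 0 = - P" "laguerre_coeff \<nu> n 0 = d * P"
  using dn f by (simp_all add: laguerre_coeff_def P_def)
 thus ?thesis unfolding d_def[symmetric] by (simp add: algebra_simps)
qed

lemma laguerre_coeff_rec:
 assumes that: "m \<le> n"
 shows "(of_nat n + 1) * (\<nu> + of_nat n + 1) * laguerre_coeff \<nu> (Suc n) (Suc m) =
   laguerre_coeff \<nu> n m - (\<nu> + of_nat n + of_nat m + 2) * laguerre_coeff \<nu> n (Suc m)"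
proof -
  define r where "r = rGamma (\<nu> + of_nat m + 2)"
  define d where "d = (of_nat m + 1 :: complex)"
  have dn: "d \<noteq> 0" unfolding d_def by (metis of_nat_Suc of_nat_neq_0 add.commute)
  have r: "rGamma (\<nu> + of_nat (Suc m) + 1) = r" "rGamma (\<nu> + of_nat m + 1) = (\<nu> + d) * r"
   using rGamma_plus1[of "\<nu> + of_nat m + 1"] by (simp_all add: r_def d_def add_ac)
  have f: "(fact (Suc m) :: complex) = d * fact m" by (simp add: d_def add.commute)
  show ?thesis
  proof (cases "m = n")
   case True
   have rr: "rGamma (\<nu> + of_nat (Suc n) + 1) = r" "rGamma (\<nu> + of_nat n + 1) = (\<nu> + d) * r" "(fact (Suc n) :: complex) = d * fact n"
    using r f unfolding True .
   have "laguerre_coeff \<nu> (Suc n) (Suc n) = r / (d * fact n)" "laguerre_coeff \<nu> n n = (\<nu> + d) * r / fact n" "laguerre_coeff \<nu> n (Suc n) = 0"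
    unfolding laguerre_coeff_def rr by simp_all
   moreover have "of_nat n + 1 = d" "\<nu> + of_nat n + 1 = \<nu> + d" by (simp_all add: d_def True)
   ultimately show ?thesis using dn unfolding True by (simp only:) (simp add: mult_ac)
  next
   case False
   hence "m < n" using that by simp
   then obtain k where "n = Suc (m + k)" using less_imp_Suc_add by blast
   hence k: "n = m + Suc k" by simp
   define e where "e = (of_nat k + 1 :: complex)"
   have en: "e \<noteq> 0" unfolding e_def by (metis of_nat_Suc of_nat_neq_0 add.commute)
   have fk: "(fact (Suc k) :: complex) = e * fact k" by (simp add: e_def add.commute)
   have L1: "laguerre_coeff \<nu> (Suc n) (Suc m) = - ((-1) ^ k * r / (e * fact k * (d * fact m)))"
    unfolding laguerre_coeff_def k using r f fk by (simp del: of_nat_Suc fact_Suc)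
   have L2: "laguerre_coeff \<nu> n m = - ((-1) ^ k * ((\<nu> + d) * r) / (e * fact k * fact m))"
    unfolding laguerre_coeff_def k using r f fk by (simp del: of_nat_Suc fact_Suc)
   have L3: "laguerre_coeff \<nu> n (Suc m) = (-1) ^ k * r / (fact k * (d * fact m))"
    unfolding laguerre_coeff_def k using r f fk by (simp del: of_nat_Suc fact_Suc)
   define P where "P = (-1) ^ k * r / (e * fact k * (d * fact m))"
   have L: "laguerre_coeff \<nu> (Suc n) (Suc m) = - P" "laguerre_coeff \<nu> n m = - (d * (\<nu> + d) * P)" "laguerre_coeff \<nu> n (Suc m) = e * P"
    unfolding L1 L2 L3 P_def using dn en by (simp_all add: field_simps)
   have nn: "of_nat n = d + e - 1" "of_nat m = d - 1" by (simp_all add: k d_def e_def)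
   show ?thesis unfolding L nn by (simp add: algebra_simps)
  qed
 qed

text \<open>Induction on the degree: the recurrence of the coefficients raises the moment indices,
  and the recurrence of the moments then replaces the combination by \<open>Y\<close> times the sum
  of degree \<open>n\<close>. Only the moment of index 0 survives.\<close>

lemma laguerre_moment_recurrence:
 fixes Nf :: "nat \<Rightarrow> complex"
 assumes rec: "\<And>j. Nf (j + 2) = (\<nu> + of_nat j + 1) * Nf (j + 1) + Y * Nf j" and \<nu>: "Re \<nu> > 0"
 shows "(\<Sum>m\<le>n. laguerre_coeff \<nu> n m * Nf (n + m)) = Y ^ n * rGamma (\<nu> + of_nat n + 1) / fact n * Nf 0"
proof (induction n)
 let ?C = "\<lambda>n. of_nat n + 1"
 let ?B = "\<lambda>n m. \<nu> + of_nat n + of_nat m + 1"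
 case (Suc n)
 let ?c = "laguerre_coeff \<nu>"
 let ?E = "\<lambda>n. (\<nu> + of_nat n + of_nat 0 + 1) * ?c n 0 * Nf (n + 0 + 1)"
 let ?D = "\<lambda>n Suc. \<Sum>m\<le>n. (\<nu> + of_nat n + of_nat m + 2) * ?c n (Suc m) * Nf (n + m + 2)"
 let ?A = "\<lambda>n. \<Sum>m\<le>n. ?c n m * Nf (n + m + 2)"
 define w where "w = \<nu> + of_nat n + 1"
 have w: "w \<noteq> 0" using \<nu> by (auto simp: w_def complex_eq_iff)
 have n1: "(of_nat n + 1 :: complex) \<noteq> 0" by (metis of_nat_Suc of_nat_neq_0 add.commute)
 have "(?C n) * w * (\<Sum>m\<le>Suc n. ?c (Suc n) m * Nf (Suc n + m)) =
   (?C n) * w * ?c (Suc n) 0 * Nf (Suc n) + (\<Sum>m\<le>n. (?C n) * w * ?c (Suc n) (Suc m) * Nf (Suc n + Suc m))"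
  unfolding sum.atMost_Suc_shift sum_distrib_left distrib_left by (simp add: mult.assoc)
 also have "(\<Sum>m\<le>n. (?C n) * w * ?c (Suc n) (Suc m) * Nf (Suc n + Suc m)) =
   (\<Sum>m\<le>n. ?c n m * Nf (n + m + 2) - (\<nu> + of_nat n + of_nat m + 2) * ?c n (Suc m) * Nf (n + m + 2))"
  unfolding w_def by (intro sum.cong refl, subst laguerre_coeff_rec) (auto simp: left_diff_distrib)
 also have "\<dots> = (?A n) - (?D n Suc)"
  by (rule sum_subtractf)
 also have "(?C n) * w * ?c (Suc n) 0 * Nf (Suc n) = - (?E n)"
  unfolding w_def laguerre_coeff_rec_0 by (simp add: algebra_simps)
 also have "- (?E n) + ((?A n) - (?D n Suc))
   = (?A n) - (\<Sum>m\<le>Suc n. (?B n m) * ?c n m * Nf (n + m + 1))"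
  unfolding sum.atMost_Suc_shift by (simp add: algebra_simps)
 \<comment> \<open>The last term vanishes because \<open>laguerre_coeff\<close> is 0 beyond the
   degree.\<close>
 also have "(\<Sum>m\<le>Suc n. (?B n m) * ?c n m * Nf (n + m + 1)) = (\<Sum>m\<le>n. (?B n m) * ?c n m * Nf (n + m + 1))"
  by (simp add: laguerre_coeff_def)
 also have "(?A n) - (\<Sum>m\<le>n. (?B n m) * ?c n m * Nf (n + m + 1)) = (\<Sum>m\<le>n. Y * (?c n m * Nf (n + m)))"
  unfolding sum_subtractf[symmetric]
 proof (rule sum.cong[OF refl])
  fix m
  show "?c n m * Nf (n + m + 2) - (?B n m) * ?c n m * Nf (n + m + 1) = Y * (?c n m * Nf (n + m))"
   unfolding rec[of "n + m"] by (simp add: algebra_simps)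
 qed
 also have "\<dots> = Y * (Y ^ n * rGamma (\<nu> + of_nat n + 1) / fact n * Nf 0)" unfolding sum_distrib_left[symmetric] Suc.IH ..
 also have "rGamma (\<nu> + of_nat n + 1) = w * rGamma (\<nu> + of_nat (Suc n) + 1)"
  using rGamma_plus1[of w] by (simp add: w_def add_ac)
 finally have H: "(?C n) * w * (\<Sum>m\<le>Suc n. ?c (Suc n) m * Nf (Suc n + m)) = (?C n) * w * (Y ^ Suc n * rGamma (\<nu> + of_nat (Suc n) + 1) / ((?C n) * fact n) * Nf 0)"
  using n1 by (simp add: mult_ac)
 have X: "(?C n) * w \<noteq> 0" using w n1 by simp
 have fS: "(fact (Suc n) :: complex) = (?C n) * fact n" by (simp add: add.commute)
 show ?case unfolding fS by (rule mult_left_cancel[OF X, THEN iffD1, OF H])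
qed (simp add: laguerre_coeff_def)

text \<open>For Gamma moments the sum is a terminating 2F1 at 1 with parameters \<open>- n\<close>,
  \<open>s + \<nu> + 1 + n\<close> and \<open>\<nu> + 1\<close>, which Chu-Vandermonde
  evaluates.\<close>

lemma laguerre_Gamma_moment:
 assumes \<nu>: "Re \<nu> > 0" and \<kappa>: "Re (s + \<nu> + 1) > 0"
 shows "(\<Sum>m\<le>n. laguerre_coeff \<nu> n m * Gamma (s + \<nu> + 1 + of_nat (n + m))) =
   pochhammer (s + 1) n * Gamma (s + \<nu> + 1 + of_nat n) * rGamma (\<nu> + of_nat n + 1) / fact n"
proof -
 define a where "a = s + \<nu> + 1 + of_nat n"
 let ?B = "\<lambda>m n. pochhammer a m * pochhammer (- of_nat n) m / (of_nat (fact m) * pochhammer (\<nu> + 1) m)"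
 let ?A = "\<lambda>n. (-1) ^ n * rGamma (\<nu> + 1) * Gamma a / fact n"
 have ni: "z \<notin> \<int>\<^sub>\<le>\<^sub>0" if "Re z > 0" for z :: complex using that by (auto elim!: nonpos_Ints_cases)
 have an: "a \<notin> \<int>\<^sub>\<le>\<^sub>0" by (rule ni) (use \<kappa> in \<open>simp add: a_def\<close>)
 have \<nu>n: "\<nu> + 1 \<notin> \<int>\<^sub>\<le>\<^sub>0" by (rule ni) (use \<nu> in simp)
 have poch: "pochhammer (\<nu> + 1) m = Gamma (\<nu> + 1 + of_nat m) / Gamma (\<nu> + 1)" for m by (rule pochhammer_Gamma[OF \<nu>n])
 have G1: "Gamma (\<nu> + 1) \<noteq> 0" using \<nu>n by (simp add: Gamma_eq_zero_iff)
 have G2: "Gamma (\<nu> + 1 + of_nat m) \<noteq> 0" for m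
  using ni[of "\<nu> + 1 + of_nat m"] \<nu> by (simp add: Gamma_eq_zero_iff)
 have pn: "pochhammer (\<nu> + 1) m \<noteq> 0" for m using G1 G2 by (simp add: poch)
 have r: "rGamma (\<nu> + of_nat m + 1) = rGamma (\<nu> + 1) / pochhammer (\<nu> + 1) m" for m
 proof -
  have "Gamma (\<nu> + 1 + of_nat m) = pochhammer (\<nu> + 1) m * Gamma (\<nu> + 1)" using G1 by (simp add: poch)
  moreover have "\<nu> + of_nat m + 1 = \<nu> + 1 + of_nat m" by simp
  ultimately show ?thesis by (simp only: rGamma_inverse_Gamma) (simp add: divide_inverse)
 qed
 have tm: "laguerre_coeff \<nu> n m * Gamma (s + \<nu> + 1 + of_nat (n + m)) =
   (?A n) * (?B m n)" if mn: "m \<le> n" for m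
 proof -
  have "Gamma (s + \<nu> + 1 + of_nat (n + m)) = pochhammer a m * Gamma a"
   using pochhammer_Gamma[OF an, of m] an by (simp add: a_def add_ac Gamma_eq_zero_iff)
  moreover have "pochhammer (- of_nat n) m = ((-1) ^ m * (fact n / fact (n - m)) :: complex)"
  proof -
   have "pochhammer (- of_nat n) m = ((-1) ^ m * fact m * (of_nat n gchoose m) :: complex)"
    by (simp add: gbinomial_pochhammer flip: power_mult_distrib)
   also have "((of_nat n :: complex) gchoose m) = fact n / (fact m * fact (n - m))"
    using that by (simp add: binomial_gbinomial[symmetric] binomial_fact)
   finally show ?thesis by simp
  qed
  moreover have "(-1::complex) ^ (n - m) = (-1) ^ n * (-1) ^ m"
  proof -
   obtain k where "n = m + k" using mn le_Suc_ex by blast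
   thus ?thesis by (simp add: power_add flip: power_mult_distrib)
  qed
  ultimately show ?thesis using mn by (simp add: laguerre_coeff_def r mult_ac)
 qed
 have V: "(\<Sum>m = 0..n. pochhammer a m * pochhammer (- of_nat n) m / (of_nat (fact m) * pochhammer (\<nu> + 1) m)) = pochhammer (\<nu> + 1 - a) n / pochhammer (\<nu> + 1) n"
 proof (rule Vandermonde_pochhammer)
  show "\<forall>i\<in>{0..<n}. \<nu> + 1 \<noteq> - of_nat i" using \<nu> by (auto simp: complex_eq_iff)
 qed
 have p: "pochhammer (\<nu> + 1 - a) n = (-1) ^ n * pochhammer (s + 1) n"
  using pochhammer_minus[of "s + of_nat n" n] by (simp add: a_def algebra_simps)
 have "(\<Sum>m\<le>n. laguerre_coeff \<nu> n m * Gamma (s + \<nu> + 1 + of_nat (n + m))) =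
   (\<Sum>m = 0..n. (?A n) * (?B m n))"
  unfolding atMost_atLeast0 by (intro sum.cong refl tm) auto
 also have "\<dots> = (?A n) * ((-1) ^ n * pochhammer (s + 1) n / pochhammer (\<nu> + 1) n)"
  unfolding sum_distrib_left[symmetric] V p ..
 also have "\<dots> = ((-1) ^ n * (-1) ^ n) * (pochhammer (s + 1) n * Gamma a * (rGamma (\<nu> + 1) / pochhammer (\<nu> + 1) n) / fact n)"
  by (simp add: mult_ac)
 also have "(-1::complex) ^ n * (-1) ^ n = 1" by (simp flip: power_mult_distrib)
 finally show ?thesis by (simp only: r a_def mult_1)
qed

section \<open>The hypergeometric function\<close>

lemma norm_pochhammer_le: "norm (pochhammer (a :: complex) n) \<le> pochhammer (norm a) n"
proof (induction n)
 case (Suc n)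
 have "norm (a + of_nat n) \<le> norm a + real n" using norm_triangle_ineq[of a "of_nat n"] by simp
 moreover have "0 \<le> pochhammer (norm a) n" by (rule order_trans[OF norm_ge_zero Suc.IH])
 ultimately show ?case using Suc by (simp add: pochhammer_Suc norm_mult mult_mono)
qed simp

lemma norm_pochhammer_ge_fact:
 assumes "Re c \<ge> 1"
 shows "norm (pochhammer c n) \<ge> fact n"
proof (induction n)
 case (Suc n)
 have "real (Suc n) \<le> norm (c + of_nat n)" using assms complex_Re_le_cmod[of "c + of_nat n"] by simp
 hence "fact n * real (Suc n) \<le> norm (pochhammer c n) * norm (c + of_nat n)" using Suc by (intro mult_mono) auto
 thus ?case by (simp add: pochhammer_Suc norm_mult mult.commute)
qed simp

definition hyp_majorant :: "real \<Rightarrow> nat \<Rightarrow> real" where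
 "hyp_majorant R n = (pochhammer R n / fact n)\<^sup>2"

text \<open>Numerator symbols are bounded by the one at \<open>R\<close>, while
  \<open>Re c \<ge> 1\<close> makes the denominator symbol at least \<open>fact n\<close>. The
  resulting majorant is uniform in all parameters.\<close>

lemma hyp_term_bound:
 assumes "Re c \<ge> 1" "norm a \<le> R" "norm b \<le> R" "norm x \<le> \<rho>"
 shows "norm (pochhammer a n * pochhammer b n / (pochhammer c n * fact n) * x ^ n) \<le> hyp_majorant R n * \<rho> ^ n"
proof -
 have nn: "0 \<le> pochhammer r n" if "0 \<le> r" for r :: real and n
  using that by (induction n) (auto simp: pochhammer_Suc)
 have mono: "pochhammer r n \<le> pochhammer R n" if "0 \<le> r" "r \<le> R" for r
  using that by (induction n) (auto simp: pochhammer_Suc intro!: mult_mono nn)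
 have "norm (pochhammer a n) \<le> pochhammer R n" "norm (pochhammer b n) \<le> pochhammer R n"
  using norm_pochhammer_le[of a n] norm_pochhammer_le[of b n] mono[of "norm a"] mono[of "norm b"] assms by auto
 moreover have "norm x ^ n \<le> \<rho> ^ n" using assms by (intro power_mono) auto
 moreover have "fact n * fact n \<le> norm (pochhammer c n) * fact n" using norm_pochhammer_ge_fact[OF assms(1), of n] by simp
 moreover have "\<rho> \<ge> 0" using assms(4) norm_ge_zero order_trans by blast
 ultimately have "norm (pochhammer a n) * norm (pochhammer b n) / (norm (pochhammer c n) * fact n) * norm x ^ n \<le> pochhammer R n * pochhammer R n / (fact n * fact n) * \<rho> ^ n"
  by (intro mult_mono frac_le) (auto intro: order_trans[OF norm_ge_zero])
 thus ?thesis by (simp add: norm_mult norm_divide norm_power hyp_majorant_def power2_eq_square)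
qed

lemma summable_hyp_majorant:
 assumes "0 \<le> \<rho>" "\<rho> < 1" "R > 0"
 shows "summable (\<lambda>n. hyp_majorant R n * \<rho> ^ n)"
proof -
 let ?A = "\<lambda>n. (R + real n) / real (Suc n)"
 \<comment> \<open>The ratios of consecutive terms tend to \<open>\<rho>\<close>, so any number
   strictly between \<open>\<rho>\<close> and 1 eventually bounds them.\<close>
 define c where "c = (1 + \<rho>) / 2"
 have c: "c < 1" "\<rho> < c" using assms by (auto simp: c_def)
 have "(\<lambda>n. (?A n)\<^sup>2 * \<rho>) \<longlonglongrightarrow> 1\<^sup>2 * \<rho>"
  by (intro tendsto_intros) real_asymp
 hence "eventually (\<lambda>n. (?A n)\<^sup>2 * \<rho> < c) sequentially"
  using c by (intro order_tendstoD) auto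
 then obtain N where N: "\<And>n. n \<ge> N \<Longrightarrow> (?A n)\<^sup>2 * \<rho> < c"
  by (auto simp: eventually_sequentially)
 show ?thesis
 proof (rule summable_ratio_test[OF c(1)])
  fix n assume n: "n \<ge> N"
  have "hyp_majorant R (Suc n) * \<rho> ^ Suc n = ((?A n)\<^sup>2 * \<rho>) * (hyp_majorant R n * \<rho> ^ n)"
   by (simp add: hyp_majorant_def pochhammer_Suc power_divide power_mult_distrib del: of_nat_Suc)
  also have "\<dots> \<le> c * (hyp_majorant R n * \<rho> ^ n)"
   using N[OF n] assms by (intro mult_right_mono) (auto simp: hyp_majorant_def)
  finally show "norm (hyp_majorant R (Suc n) * \<rho> ^ Suc n) \<le> c * norm (hyp_majorant R n * \<rho> ^ n)"
   using assms by (simp add: hyp_majorant_def)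
 qed
qed

lemma summable_hyp:
 assumes "Re c \<ge> 1" "norm x < 1"
 shows "summable (\<lambda>n. norm (pochhammer a n * pochhammer b n / (pochhammer c n * fact n) * x ^ n :: complex))"
proof (rule summable_comparison_test)
 let ?A = "\<lambda>n. norm (pochhammer a n * pochhammer b n / (pochhammer c n * fact n) * x ^ n)"
 define R where "R = norm a + norm b + 1"
 show "summable (\<lambda>n. hyp_majorant R n * norm x ^ n)"
  using assms by (intro summable_hyp_majorant) (auto simp: R_def add_nonneg_pos)
 show "\<exists>N. \<forall>n\<ge>N. norm (?A n) \<le> hyp_majorant R n * norm x ^ n"
 proof (intro exI allI impI)
  fix n
  show "norm (?A n) \<le> hyp_majorant R n * norm x ^ n"
   unfolding real_norm_def abs_norm_cancel by (rule hyp_term_bound) (use assms in \<open>auto simp: R_def\<close>)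
 qed
qed

lemma hyp2F1_sums:
 assumes "Re c \<ge> 1" "norm x < 1"
 shows "(\<lambda>n. pochhammer a n * pochhammer b n / (pochhammer c n * fact n) * x ^ n) sums hyp2F1 a b c x"
 unfolding hyp2F1_def by (intro summable_sums summable_norm_cancel[OF summable_hyp[OF assms]])

lemma norm_hyp2F1_le:
 assumes "Re c \<ge> 1" "norm a \<le> R" "norm b \<le> R" "norm x \<le> \<rho>" "\<rho> < 1" "R > 0"
 shows "norm (hyp2F1 a b c x) \<le> (\<Sum>n. hyp_majorant R n * \<rho> ^ n)"
proof -
 have "\<rho> \<ge> 0" using assms(4) norm_ge_zero order_trans by blast
 note s = summable_hyp_majorant[OF this assms(5,6)]
 have "norm x < 1" using assms by simp
 have "norm (hyp2F1 a b c x) \<le> (\<Sum>n. norm (pochhammer a n * pochhammer b n / (pochhammer c n * fact n) * x ^ n))"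
  unfolding hyp2F1_def by (rule summable_norm[OF summable_hyp[OF assms(1) \<open>norm x < 1\<close>]])
 also have "\<dots> \<le> (\<Sum>n. hyp_majorant R n * \<rho> ^ n)"
  by (rule suminf_le[OF hyp_term_bound[OF assms(1-4)] summable_hyp[OF assms(1) \<open>norm x < 1\<close>] s])
 finally show ?thesis .
qed

lemma holomorphic_on_pochhammer:
 "a holomorphic_on S \<Longrightarrow> (\<lambda>z. pochhammer (a z) n) holomorphic_on S"
 by (induction n) (auto simp: pochhammer_Suc intro!: holomorphic_intros)

text \<open>All parameters may vary together: on a small closed disc the numerator parameters are
  bounded and the norm of the argument attains a maximum below 1, so one majorant serves the whole
  disc.\<close>

lemma holomorphic_hyp2F1_comp:
 assumes S: "open S" and hol: "a holomorphic_on S" "b holomorphic_on S" "c holomorphic_on S" "x holomorphic_on S"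
  and c: "\<And>z. z \<in> S \<Longrightarrow> Re (c z) \<ge> 1" and x: "\<And>z. z \<in> S \<Longrightarrow> norm (x z) < 1"
 shows "(\<lambda>z. hyp2F1 (a z) (b z) (c z) (x z)) holomorphic_on S"
 unfolding hyp2F1_def
proof (rule holomorphic_on_suminf[OF S])
 let ?A = "\<lambda>z n. pochhammer (a z) n * pochhammer (b z) n / (pochhammer (c z) n * fact n) * x z ^ n"
 have nz: "pochhammer (c z) n \<noteq> 0" if "z \<in> S" for z n
  using norm_pochhammer_ge_fact[OF c[OF that], of n] by (metis fact_gt_zero norm_zero not_less)
 show "(\<lambda>z. pochhammer (a z) n * pochhammer (b z) n / (pochhammer (c z) n * fact n) * x z ^ n) holomorphic_on S" for n
  using nz hol by (intro holomorphic_intros holomorphic_on_pochhammer) auto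
 fix z0 assume z0: "z0 \<in> S"
 obtain r where r: "r > 0" "cball z0 r \<subseteq> S" using S z0 open_contains_cball by blast
 have bdd: "\<exists>K. \<forall>z\<in>cball z0 r. norm (f z) \<le> K" if "f holomorphic_on S" for f :: "complex \<Rightarrow> complex"
 proof -
  have "compact (f ` cball z0 r)" using that r
   by (intro compact_continuous_image holomorphic_on_imp_continuous_on holomorphic_on_subset[OF that]) auto
  from compact_imp_bounded[OF this] obtain K where "\<forall>y\<in>f ` cball z0 r. norm y \<le> K"
   unfolding bounded_iff ..
  thus ?thesis by auto
 qed
 obtain Ka Kb where K: "\<And>z. z \<in> cball z0 r \<Longrightarrow> norm (a z) \<le> Ka" "\<And>z. z \<in> cball z0 r \<Longrightarrow> norm (b z) \<le> Kb"
  using bdd[OF hol(1)] bdd[OF hol(2)] by blast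
 have "continuous_on (cball z0 r) (\<lambda>z. norm (x z))"
  by (intro continuous_on_norm holomorphic_on_imp_continuous_on holomorphic_on_subset[OF hol(4) r(2)])
 then obtain zm where zm: "zm \<in> cball z0 r" "\<And>z. z \<in> cball z0 r \<Longrightarrow> norm (x z) \<le> norm (x zm)"
  using continuous_attains_sup[of "cball z0 r" "\<lambda>z. norm (x z)"] r by (auto simp: less_imp_le)
 define R where "R = \<bar>Ka\<bar> + \<bar>Kb\<bar> + 1"
 show "\<exists>r>0. \<exists>B. summable B \<and> (\<forall>z\<in>ball z0 r \<inter> S. \<forall>n. norm (?A z n) \<le> B n)"
 proof (intro exI conjI ballI allI)
  show "summable (\<lambda>n. hyp_majorant R n * norm (x zm) ^ n)"
   using x[of zm] zm r by (intro summable_hyp_majorant) (auto simp: R_def add_nonneg_pos)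
  fix z n assume z: "z \<in> ball z0 r \<inter> S"
  show "norm (?A z n) \<le> hyp_majorant R n * norm (x zm) ^ n"
   using z K(1)[of z] K(2)[of z] c[of z] zm(2)[of z] by (intro hyp_term_bound) (auto simp: R_def)
 qed (use r in auto)
qed

section \<open>Euler's transformation through formal power series\<close>

lemma hyp_ode_imp_coeffs:
 fixes G :: "complex fps"
 assumes ode: "fps_X * (1 - fps_X) * fps_deriv (fps_deriv G) + (fps_const c - fps_const (a + b + 1) * fps_X) * fps_deriv G - fps_const (a * b) * G = 0"
  and G0: "fps_nth G 0 = 1" and c: "Re c \<ge> 1"
 shows "fps_nth G n = pochhammer a n * pochhammer b n / (pochhammer c n * fact n)"
proof -
 have rec: "(of_nat n + 1) * (c + of_nat n) * fps_nth G (Suc n) = (a + of_nat n) * (b + of_nat n) * fps_nth G n" for n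
 proof -
  have "fps_nth (fps_X * (1 - fps_X) * fps_deriv (fps_deriv G) + (fps_const c - fps_const (a + b + 1) * fps_X) * fps_deriv G - fps_const (a * b) * G) n = 0"
   using ode by simp
  moreover have "fps_X * (1 - fps_X) * fps_deriv (fps_deriv G) = fps_X * fps_deriv (fps_deriv G) - fps_X * (fps_X * fps_deriv (fps_deriv G))"
   by (simp add: algebra_simps)
  ultimately have "fps_nth (fps_X * fps_deriv (fps_deriv G) - fps_X * (fps_X * fps_deriv (fps_deriv G)) + (fps_const c * fps_deriv G - fps_const (a + b + 1) * (fps_X * fps_deriv G)) - fps_const (a * b) * G) n = 0"
   by (simp only: left_diff_distrib mult.assoc)
  thus ?thesis
   by (cases n; cases "n - 1") (simp_all add: algebra_simps)
 qed
 show ?thesis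
 proof (induction n)
  case (Suc n)
  have n1: "(of_nat n + 1 :: complex) \<noteq> 0" by (metis of_nat_Suc of_nat_neq_0 add.commute)
  have cn: "c + of_nat n \<noteq> 0" using c by (auto simp: complex_eq_iff)
  have "fps_nth G (Suc n) = (a + of_nat n) * (b + of_nat n) * fps_nth G n / ((of_nat n + 1) * (c + of_nat n))"
   using rec[of n] n1 cn by (simp add: eq_divide_eq mult.commute)
  also have "\<dots> = pochhammer a (Suc n) * pochhammer b (Suc n) / (pochhammer c (Suc n) * fact (Suc n))"
   unfolding Suc.IH pochhammer_Suc by (simp add: mult_ac add.commute)
  finally show ?case .
 qed (use G0 in simp)
qed

lemma hyp_fps_ode:
 fixes a b c :: complex
 assumes c: "Re c \<ge> 1"
 defines "F \<equiv> Abs_fps (\<lambda>n. pochhammer a n * pochhammer b n / (pochhammer c n * fact n))"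
 shows "fps_X * (1 - fps_X) * fps_deriv (fps_deriv F) + (fps_const c - fps_const (a + b + 1) * fps_X) * fps_deriv F - fps_const (a * b) * F = 0"
proof -
 let ?C = "fps_X * fps_deriv (fps_deriv F)"
 let ?B = "fps_const c * fps_deriv F - fps_const (a + b + 1) * (fps_X * fps_deriv F)"
 let ?A = "fps_X * fps_deriv (fps_deriv F) - fps_X * ?C + ?B - fps_const (a * b) * F"
 have rec: "(of_nat n + 1) * (c + of_nat n) * fps_nth F (Suc n) = (a + of_nat n) * (b + of_nat n) * fps_nth F n" for n
 proof -
  have n1: "(of_nat n + 1 :: complex) \<noteq> 0" by (metis of_nat_Suc of_nat_neq_0 add.commute)
  have cn: "c + of_nat n \<noteq> 0" using c by (auto simp: complex_eq_iff)
  have "(fact (Suc n) :: complex) = (of_nat n + 1) * fact n" by (simp add: add.commute)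
  thus ?thesis using n1 cn by (simp add: F_def pochhammer_Suc mult_ac del: fact_Suc)
 qed
 have "fps_nth ?A n = 0" for n
 proof -
  have "fps_nth ?A n
   = (of_nat n + 1) * (c + of_nat n) * fps_nth F (Suc n) - (a + of_nat n) * (b + of_nat n) * fps_nth F n"
   by (cases n; cases "n - 1") (simp_all add: algebra_simps)
  thus ?thesis using rec[of n] by simp
 qed
 hence "fps_X * fps_deriv (fps_deriv F) - fps_X * ?C + ?B - fps_const (a * b) * F = 0"
  by (intro fps_ext) simp
 moreover have "fps_X * (1 - fps_X) * fps_deriv (fps_deriv F) = fps_X * fps_deriv (fps_deriv F) - fps_X * ?C"
  by (simp add: algebra_simps)
 ultimately show ?thesis by (simp only: left_diff_distrib mult.assoc)
qed

text \<open>\<open>P\<close> plays the role of \<open>(1 - x) powr (a + b - c)\<close>. The product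
  rule gives the hypergeometric equation for \<open>P * F\<close> with parameters
  \<open>c - a\<close> and \<open>c - b\<close>, after one multiplication by \<open>1 - x\<close>,
  which is not a zero divisor.\<close>

lemma fps_of_Euler_ode:
 fixes F P :: "complex fps" and a b c :: complex
 assumes ode: "fps_X * (1 - fps_X) * fps_deriv (fps_deriv F) + (fps_const c - fps_const (a + b + 1) * fps_X) * fps_deriv F - fps_const (a * b) * F = 0"
  and P: "(1 - fps_X) * fps_deriv P = - (fps_const (a + b - c) * P)"
 defines "G \<equiv> P * F"
 shows "fps_X * (1 - fps_X) * fps_deriv (fps_deriv G) + (fps_const c - fps_const ((c - a) + (c - b) + 1) * fps_X) * fps_deriv G - fps_const ((c - a) * (c - b)) * G = 0"
proof -
 define A B C where "A = fps_const a" and "B = fps_const b" and "C = fps_const c"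
 let ?A = "(C - A) + (C - B) + 1"
 define x :: "complex fps" where "x = fps_X"
 define F1 F2 P1 P2 where "F1 = fps_deriv F" and "F2 = fps_deriv F1" and "P1 = fps_deriv P" and "P2 = fps_deriv P1"
 let ?B = "P2 * F + 2 * P1 * F1 + P * F2"
 define r where "r = A + B - C"
 have rc: "fps_const (a + b - c) = r" by (simp add: r_def A_def B_def C_def)
 have ode': "x * (1 - x) * F2 + (C - (A + B + 1) * x) * F1 - A * B * F = 0"
  using ode by (simp add: x_def F2_def F1_def A_def B_def C_def flip: fps_const_add fps_const_mult)
 have P1: "(1 - x) * P1 = - (r * P)" using P unfolding rc by (simp add: x_def P1_def)
 have "fps_deriv ((1 - x) * P1) = fps_deriv (- (r * P))" by (simp only: P1)
 hence P2: "(1 - x) * P2 = P1 - r * P1"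
  by (simp add: x_def P1_def P2_def r_def A_def B_def C_def algebra_simps)
 have G1: "fps_deriv G = P1 * F + P * F1" unfolding G_def P1_def F1_def by simp
 have G2: "fps_deriv (fps_deriv G) = P2 * F + 2 * P1 * F1 + P * F2"
  unfolding G1 by (simp add: P1_def F1_def P2_def F2_def algebra_simps)
 have "(1 - x) * (x * (1 - x) * ?B + (C - ?A * x) * (P1 * F + P * F1) - (C - A) * (C - B) * (P * F)) = 
   x * ((1 - x) * ((1 - x) * P2)) * F + 2 * (x * (1 - x)) * ((1 - x) * P1) * F1 + (1 - x) * P * (x * (1 - x) * F2) +
   (C - ?A * x) * (((1 - x) * P1) * F + (1 - x) * P * F1) - (C - A) * (C - B) * (1 - x) * (P * F)"
  by (simp only: algebra_simps)
 also have "(1 - x) * ((1 - x) * P2) = - (r * P) + r * (r * P)" unfolding P2 by (simp add: right_diff_distrib P1 mult.left_commute)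
 also have "x * (1 - x) * F2 = A * B * F - (C - (A + B + 1) * x) * F1" using ode' by (simp add: algebra_simps)
 also have "x * (- (r * P) + r * (r * P)) * F + 2 * (x * (1 - x)) * ((1 - x) * P1) * F1 + (1 - x) * P * (A * B * F - (C - (A + B + 1) * x) * F1) +
   (C - ?A * x) * (((1 - x) * P1) * F + (1 - x) * P * F1) - (C - A) * (C - B) * (1 - x) * (P * F) = 0"
  unfolding P1 r_def by (simp add: algebra_simps)
 finally have "(1 - x) * (x * (1 - x) * ?B + (C - ?A * x) * (P1 * F + P * F1) - (C - A) * (C - B) * (P * F)) = 0" .
 moreover have "1 - x \<noteq> 0"
 proof
  assume "1 - x = 0"
  hence "fps_nth (1 - x) 0 = 0" by simp
  thus False by (simp add: x_def)
 qed
 ultimately have "x * (1 - x) * ?B + (C - ?A * x) * (P1 * F + P * F1) - (C - A) * (C - B) * (P * F) = 0"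
  by simp
 moreover have "fps_const ((c - a) + (c - b) + 1) = (C - A) + (C - B) + 1" "fps_const ((c - a) * (c - b)) = (C - A) * (C - B)"
  by (simp_all only: A_def B_def C_def fps_const_sub fps_const_add fps_const_mult fps_const_1_eq_1[symmetric])
 ultimately show ?thesis by (simp only: G1[symmetric] G2[symmetric] G_def[symmetric] x_def[symmetric] C_def[symmetric])
qed

text \<open>The product of the binomial series and the hypergeometric series solves the transformed
  equation, whose power series solution is determined by its constant term. This identifies the
  coefficients formally, and a Cauchy product of convergent series transfers the identity to
  values.\<close>

lemma hyp2F1_Euler:
 assumes c: "Re c \<ge> 1" and x: "norm x < 1"
 shows "hyp2F1 (c - a) (c - b) c x = (1 - x) powr (a + b - c) * hyp2F1 a b c x"
proof -
 let ?B = "\<lambda>n. pochhammer c n * fact n"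
 define r where "r = a + b - c"
 define p where "p = (\<lambda>n. (r gchoose n) * (-1) ^ n)"
 define f where "f = (\<lambda>n. pochhammer a n * pochhammer b n / (?B n))"
 let ?A = "\<lambda>n. \<Sum>i\<le>n. (p i * x ^ i) * (f (n - i) * x ^ (n - i))"
 define P where "P = Abs_fps p"
 define F where "F = Abs_fps f"
 have rec: "of_nat (Suc n) * p (Suc n) = (of_nat n - r) * p n" for n
 proof -
  have "of_nat (Suc n) * (r gchoose Suc n) = (r - of_nat n) * (r gchoose n)"
   using gbinomial_mult_1[of r n] by (simp add: left_diff_distrib del: of_nat_Suc)
  hence "of_nat (Suc n) * (r gchoose Suc n) * (-1) ^ Suc n = (r - of_nat n) * (r gchoose n) * (-1) ^ Suc n" by simp
  also have "\<dots> = (of_nat n - r) * p n" by (simp add: p_def algebra_simps)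
  finally show ?thesis by (simp only: p_def mult.assoc)
 qed
 have P: "(1 - fps_X) * fps_deriv P = - (fps_const (a + b - c) * P)"
 proof (rule fps_ext)
  fix n
  show "fps_nth ((1 - fps_X) * fps_deriv P) n = fps_nth (- (fps_const (a + b - c) * P)) n"
   using rec[of n] unfolding left_diff_distrib r_def[symmetric] by (cases n) (simp_all add: P_def algebra_simps)
 qed
 have co: "fps_nth (P * F) n = pochhammer (c - a) n * pochhammer (c - b) n / (?B n)" for n
 proof (rule hyp_ode_imp_coeffs[OF fps_of_Euler_ode[OF _ P] _ c])
  show "fps_X * (1 - fps_X) * fps_deriv (fps_deriv F) + (fps_const c - fps_const (a + b + 1) * fps_X) * fps_deriv F - fps_const (a * b) * F = 0"
   unfolding F_def f_def by (rule hyp_fps_ode[OF c])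
  show "fps_nth (P * F) 0 = 1" by (simp add: P_def F_def p_def f_def)
 qed
 have ps: "(\<lambda>n. p n * x ^ n) sums (1 - x) powr r"
 proof -
  have "(\<lambda>n. (r gchoose n) * (- x) ^ n) sums (1 + (- x)) powr r" using x by (intro gen_binomial_complex) auto
  moreover have "(- x) ^ n = (-1) ^ n * x ^ n" for n by (rule power_minus)
  ultimately show ?thesis by (simp add: p_def mult_ac)
 qed
 have pn: "summable (\<lambda>n. norm (p n * x ^ n))"
 proof -
  \<comment> \<open>Convergence at a real point beyond \<open>norm x\<close> yields absolute
    convergence at \<open>x\<close>.\<close>
  obtain y where y: "norm x < y" "y < 1" using x dense by blast
  have "summable (\<lambda>n. p n * of_real y ^ n)"
  proof -
   have "norm (- complex_of_real y) < 1" using y le_less_trans[OF norm_ge_zero y(1)] by simp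
   from gen_binomial_complex[OF this, of r] have "summable (\<lambda>n. (r gchoose n) * (- complex_of_real y) ^ n)" by (rule sums_summable)
   moreover have "(- complex_of_real y) ^ n = (-1) ^ n * of_real y ^ n" for n by (rule power_minus)
   ultimately show ?thesis by (simp add: p_def mult_ac)
  qed
  thus ?thesis using y le_less_trans[OF norm_ge_zero y(1)] by (intro powser_insidea[of p "complex_of_real y" x]) auto
 qed
 have fs: "(\<lambda>n. f n * x ^ n) sums hyp2F1 a b c x" unfolding f_def by (rule hyp2F1_sums[OF c x])
 have fn: "summable (\<lambda>n. norm (f n * x ^ n))" unfolding f_def by (rule summable_hyp[OF c x])
 have "?A sums ((\<Sum>n. p n * x ^ n) * (\<Sum>n. f n * x ^ n))"
  by (rule Cauchy_product_sums[OF pn fn])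
 also have "?A = (\<lambda>n. pochhammer (c - a) n * pochhammer (c - b) n / (?B n) * x ^ n)"
 proof
  fix n
  have "(\<Sum>i\<le>n. (p i * x ^ i) * (f (n - i) * x ^ (n - i))) = (\<Sum>i\<le>n. p i * f (n - i)) * x ^ n"
   unfolding sum_distrib_right
  proof (rule sum.cong[OF refl])
   fix i assume "i \<in> {..n}"
   hence "x ^ n = x ^ i * x ^ (n - i)" by (simp flip: power_add)
   thus "(p i * x ^ i) * (f (n - i) * x ^ (n - i)) = p i * f (n - i) * x ^ n" by simp
  qed
  also have "(\<Sum>i\<le>n. p i * f (n - i)) = fps_nth (P * F) n" by (simp add: fps_mult_nth P_def F_def atMost_atLeast0)
  finally show "(\<Sum>i\<le>n. (p i * x ^ i) * (f (n - i) * x ^ (n - i))) = pochhammer (c - a) n * pochhammer (c - b) n / (?B n) * x ^ n"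
   unfolding co .
 qed
 finally show ?thesis using ps fs by (simp add: sums_iff hyp2F1_def r_def)
qed

section \<open>Integrals of products of Bessel functions\<close>

lemma csqrt_sector:
 assumes "Re a > 0"
 shows "\<bar>Im (csqrt a)\<bar> < Re (csqrt a)"
proof -
 have "Re ((csqrt a)\<^sup>2) > 0" using assms by simp
 hence "(Im (csqrt a))\<^sup>2 < (Re (csqrt a))\<^sup>2" by (simp add: power2_eq_square)
 hence "\<bar>Im (csqrt a)\<bar> < \<bar>Re (csqrt a)\<bar>" using power2_less_imp_less[of "\<bar>Im (csqrt a)\<bar>" "\<bar>Re (csqrt a)\<bar>"] by simp
 thus ?thesis using csqrt_principal[of a] by auto
qed

lemma sector_add: "\<bar>Im A\<bar> < Re A \<Longrightarrow> \<bar>Im B\<bar> < Re B \<Longrightarrow> \<bar>Im (A + B)\<bar> < Re (A + B)"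
 by (simp add: abs_if split: if_splits)

lemma sector_square: "\<bar>Im A\<bar> < Re A \<Longrightarrow> Re (A\<^sup>2) > 0"
 using power2_strict_mono[of "\<bar>Im A\<bar>" "Re A"] by (simp add: power2_eq_square)

text \<open>Two points of the sector enclose an angle below pi/2, so their inner product is positive
  and the difference is shorter than the sum.\<close>

lemma sector_quotient:
 assumes "\<bar>Im A\<bar> < Re A" "\<bar>Im B\<bar> < Re B"
 shows "norm ((A - B) / (A + B)) < 1" and "A + B \<noteq> 0"
proof -
 show nz: "A + B \<noteq> 0" using assms by (auto simp: complex_eq_iff)
 have "\<bar>Im A * Im B\<bar> < Re A * Re B" unfolding abs_mult using assms by (intro mult_strict_mono) auto
 hence "0 < Re A * Re B + Im A * Im B" by (simp add: abs_if split: if_splits)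
 hence "(norm (A - B))\<^sup>2 < (norm (A + B))\<^sup>2"
  unfolding cmod_power2 by (simp add: power2_eq_square algebra_simps)
 hence "norm (A - B) < norm (A + B)" by (rule power2_less_imp_less) simp
 thus "norm ((A - B) / (A + B)) < 1" using nz by (simp add: norm_divide)
qed

text \<open>The exponent is \<open>- (Re a + Re b) + \<bar>Re a - Re b\<bar>\<close>, which is minus
  twice the minimum: the kernel decays for every pair in the right half plane.\<close>

lemma kernel_bound:
 assumes "Re \<nu> > 0" "x \<ge> 0"
 shows "norm (exp (- ((a + b) * of_real x)) * bessel_It \<nu> ((a - b) * of_real x)) \<le>
      norm (rGamma \<nu>) / Re \<nu> * exp (- (2 * min (Re a) (Re b) * x))"
proof -
 have "norm (exp (- ((a + b) * of_real x)) * bessel_It \<nu> ((a - b) * of_real x)) \<le>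
   exp (- ((Re a + Re b) * x)) * (norm (rGamma \<nu>) / Re \<nu> * exp \<bar>(Re a - Re b) * x\<bar>)"
  unfolding norm_mult using norm_bessel_It_le[OF assms(1), of "(a - b) * of_real x"] by (intro mult_mono) auto
 also have "\<dots> = norm (rGamma \<nu>) / Re \<nu> * exp (- ((Re a + Re b) * x) + \<bar>(Re a - Re b) * x\<bar>)"
  unfolding exp_add by (simp only: mult_ac)
 also have "- ((Re a + Re b) * x) + \<bar>(Re a - Re b) * x\<bar> = - (2 * min (Re a) (Re b) * x)"
 proof -
  have "\<bar>(Re a - Re b) * x\<bar> = \<bar>Re a - Re b\<bar> * x" using assms(2) by (simp add: abs_mult)
  moreover have "\<bar>Re a - Re b\<bar> = Re a + Re b - 2 * min (Re a) (Re b)" by auto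
  ultimately show ?thesis by (simp add: algebra_simps)
 qed
 finally show ?thesis .
qed

lemma bessel_It_comp_continuous [continuous_intros]:
 "continuous_on S f \<Longrightarrow> continuous_on S (\<lambda>x. bessel_It \<nu> (f x))"
 using continuous_on_compose2[OF holomorphic_on_imp_continuous_on[OF holomorphic_bessel_It], of S f \<nu>] by auto

lemma bessel_It_comp_holomorphic [holomorphic_intros]:
 "f holomorphic_on S \<Longrightarrow> (\<lambda>x. bessel_It \<nu> (f x)) holomorphic_on S"
 using holomorphic_on_compose_gen[of f S "bessel_It \<nu>" UNIV] holomorphic_bessel_It by (simp add: comp_def)

lemma kernel_holomorphic:
 assumes b: "Re b > 0" and \<nu>: "Re \<nu> > 0"
  and m: "\<omega> \<in> borel_measurable halfline"
  and le: "\<And>x. x > 0 \<Longrightarrow> norm (\<omega> x) \<le> x powr (\<sigma> - 1)" and \<sigma>: "\<sigma> > 0"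
 shows "(\<lambda>a. \<integral>x. \<omega> x * (exp (- ((a + b) * of_real x)) * bessel_It \<nu> ((a - b) * of_real x)) \<partial>halfline) holomorphic_on {a. Re a > 0}"
proof (rule holomorphic_on_lebesgue_integral)
 let ?A = "\<lambda>z x. exp (- ((z + b) * of_real x)) * bessel_It \<nu> ((z - b) * of_real x)"
 show "open {a. Re a > 0}" by (rule open_halfspace_Re_gt)
 show "(\<lambda>x. \<omega> x * (?A z x)) \<in> borel_measurable halfline" for z
  by (intro borel_measurable_times m continuous_imp_measurable_on_sets_lebesgue continuous_intros) auto
 show "(\<lambda>z. \<omega> x * (?A z x)) holomorphic_on {a. Re a > 0}" for x
  by (intro holomorphic_intros)
 fix z0 :: complex assume z0: "z0 \<in> {a. Re a > 0}"
 define d where "d = 2 * min (Re z0 / 2) (Re b)"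
 define K where "K = norm (rGamma \<nu>) / Re \<nu>"
 have K: "K \<ge> 0" using \<nu> by (simp add: K_def)
 show "\<exists>r>0. \<exists>B. integrable halfline B \<and> (\<forall>z\<in>ball z0 r \<inter> {a. Re a > 0}. \<forall>x\<in>space halfline.
   norm (\<omega> x * (?A z x)) \<le> B x)"
 proof (intro exI conjI ballI)
  show "Re z0 / 2 > 0" using z0 by simp
  show "integrable halfline (\<lambda>x. K * (x powr (\<sigma> - 1) * exp (- (d * x))))"
   using z0 b \<sigma> by (intro integrable_mult_right integrable_powr_exp_real) (auto simp: d_def)
  fix z x assume z: "z \<in> ball z0 (Re z0 / 2) \<inter> {a. 0 < Re a}" and x: "x \<in> space halfline"
  have "\<bar>Re z0 - Re z\<bar> < Re z0 / 2" using z abs_Re_le_cmod[of "z0 - z"] by (auto simp: dist_norm)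
  hence "d \<le> 2 * min (Re z) (Re b)" unfolding d_def by linarith
  hence "exp (- (2 * min (Re z) (Re b) * x)) \<le> exp (- (d * x))" using x by (simp add: mult_right_mono)
  from mult_left_mono[OF this K]
  have "norm (?A z x) \<le> K * exp (- (d * x))"
   using kernel_bound[OF \<nu>, of x z b] x unfolding K_def[symmetric] by simp
  hence "norm (\<omega> x * (?A z x)) \<le> x powr (\<sigma> - 1) * (K * exp (- (d * x)))"
   unfolding norm_mult[of "\<omega> x"] using le[of x] x by (intro mult_mono) auto
  thus "norm (\<omega> x * (?A z x)) \<le> K * (x powr (\<sigma> - 1) * exp (- (d * x)))"
   by (simp add: mult_ac)
 qed
qed

text \<open>Termwise integration of the Laguerre expansion at \<open>y = \<mu> * x\<close>. The
  assumption on \<open>\<mu>\<close> says that the growth permitted by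
  \<open>laguerre_expansion_bound\<close> is slower than the decay of
  \<open>exp (- \<mu> * x)\<close>; the surplus is \<open>d\<close> below.\<close>

lemma kernel_expansion:
 assumes \<mu>: "Re \<mu> > norm \<mu> * ((norm q)\<^sup>2 + 2 * norm q)" and \<nu>: "Re \<nu> > 0"
  and X: "Re X \<ge> 0" and \<kappa>: "Re \<kappa> > 0"
 shows "(\<lambda>n. q ^ (2 * n) * (\<Sum>m\<le>n. laguerre_coeff \<nu> n m * (\<mu> ^ (n + m) * bessel_moment \<mu> X (\<kappa> + of_nat (n + m))))) sums
   (\<integral>x. of_real x powr (\<kappa> - 1) * exp (- X / of_real x) * (exp (- (\<mu> * (1 + q\<^sup>2) * of_real x)) * bessel_It \<nu> (2 * q * \<mu> * of_real x)) \<partial>halfline)"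
proof -
 let ?E = "\<lambda>x. exp (- (\<mu> * (1 + q\<^sup>2) * of_real x)) * bessel_It \<nu> (2 * q * \<mu> * of_real x)"
 let ?D = "(norm q)\<^sup>2 + 2 * norm q"
 let ?C = "Re \<kappa> - 1"
 let ?B = "\<lambda>x. \<mu> * of_real x"
 let ?A = "\<lambda>x. exp (- (q\<^sup>2 * (?B x))) * bessel_It \<nu> (2 * q * (?B x))"
 have \<mu>0: "Re \<mu> > 0" using \<mu> by (smt (verit) mult_nonneg_nonneg norm_ge_zero zero_le_power2)
 define d where "d = Re \<mu> - norm \<mu> * ?D"
 have d: "d > 0" using \<mu> by (simp add: d_def)
 have Xc: "Re X > 0 \<or> Re X = 0 \<and> Re k > 0" if "Re k > 0" for k using X that by auto
 define w where "w = (\<lambda>x. of_real x powr (\<kappa> - 1) * exp (- (?B x) - X / of_real x))"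
 define f where "f = (\<lambda>n x. w x * (q ^ (2 * n) * (\<Sum>m\<le>n. laguerre_coeff \<nu> n m * (?B x) ^ (n + m))))"
 have wi: "integrable halfline (\<lambda>x. w x * of_real x ^ k)" 
  and wm: "(\<integral>x. w x * of_real x ^ k \<partial>halfline) = bessel_moment \<mu> X (\<kappa> + of_nat k)" for k
 proof -
  have e: "w x * of_real x ^ k = of_real x powr (\<kappa> + of_nat k - 1) * exp (- (?B x) - X / of_real x)" if "x \<in> space halfline" for x
  proof -
   have "complex_of_real x powr (\<kappa> - 1 + of_nat k) = of_real x powr (\<kappa> - 1) * of_real x powr of_nat k" by (rule powr_add)
   moreover have "complex_of_real x powr of_nat k = of_real x ^ k" using that by (intro powr_nat') auto
   moreover have "\<kappa> - 1 + of_nat k = \<kappa> + of_nat k - 1" by simp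
   ultimately show ?thesis by (simp add: w_def mult_ac)
  qed
  show "integrable halfline (\<lambda>x. w x * of_real x ^ k)"
   by (subst Bochner_Integration.integrable_cong[OF refl e], assumption, rule integrable_bessel_moment[OF \<mu>0 Xc]) (use \<kappa> in simp)
  show "(\<integral>x. w x * of_real x ^ k \<partial>halfline) = bessel_moment \<mu> X (\<kappa> + of_nat k)"
   unfolding bessel_moment_def by (intro Bochner_Integration.integral_cong refl e)
 qed
 have feq: "f n x = (\<Sum>m\<le>n. (q ^ (2 * n) * (laguerre_coeff \<nu> n m * \<mu> ^ (n + m))) * (w x * of_real x ^ (n + m)))" for n x
  unfolding f_def by (simp add: sum_distrib_left power_mult_distrib mult_ac)
 have fi: "integrable halfline (f n)" for n
  unfolding feq by (intro Bochner_Integration.integrable_sum integrable_mult_right wi)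
 have 1: "f n \<in> borel_measurable halfline" for n using fi by auto
 have 2: "(\<lambda>n. f n x) sums (w x * (?A x))" for x
  unfolding f_def by (intro sums_mult laguerre_expansion_sums)
 define K where "K = norm (rGamma (\<nu> + 1))"
 have 3: "integrable halfline (\<lambda>x. K * (x powr ?C * exp (- (d * x))))"
  using \<kappa> d by (intro integrable_mult_right integrable_powr_exp_real) auto
 have 4: "norm (\<Sum>n<N. f n x) \<le> K * (x powr ?C * exp (- (d * x)))" if x: "x \<in> space halfline" for N x
 proof -
  have x0: "x > 0" using x by simp
  have "norm (w x) = x powr ?C * exp (- (Re \<mu> * x) - Re X / x)"
   using x0 by (simp add: w_def norm_mult norm_powr_real_powr Re_divide_of_real)
  also have "\<dots> \<le> x powr ?C * exp (- (Re \<mu> * x))" using X x0 by (intro mult_left_mono) auto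
  finally have wx: "norm (w x) \<le> x powr ?C * exp (- (Re \<mu> * x))" .
  have "norm (\<Sum>n<N. f n x) \<le> (x powr ?C * exp (- (Re \<mu> * x))) * (K * exp (?D * norm (?B x)))"
   unfolding f_def sum_distrib_left[symmetric] norm_mult[of "w x"] K_def
   by (intro mult_mono wx laguerre_expansion_bound \<nu>) auto
  also have "\<dots> = K * (x powr ?C * (exp (- (Re \<mu> * x)) * exp (?D * norm (?B x))))"
   by (simp add: mult_ac)
  also have "exp (- (Re \<mu> * x)) * exp (?D * norm (?B x)) = exp (- (d * x))"
   using x0 by (simp add: d_def norm_mult algebra_simps flip: exp_add)
  finally show ?thesis .
 qed
 have "(\<integral>x. f n x \<partial>halfline) = q ^ (2 * n) * (\<Sum>m\<le>n. laguerre_coeff \<nu> n m * (\<mu> ^ (n + m) * bessel_moment \<mu> X (\<kappa> + of_nat (n + m))))" for n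
 proof -
  have "(\<integral>x. f n x \<partial>halfline) = (\<Sum>m\<le>n. (q ^ (2 * n) * (laguerre_coeff \<nu> n m * \<mu> ^ (n + m))) * bessel_moment \<mu> X (\<kappa> + of_nat (n + m)))"
   unfolding feq wm[symmetric] integral_mult_right_zero[symmetric]
   by (intro Bochner_Integration.integral_sum integrable_mult_right wi)
  thus ?thesis by (simp add: sum_distrib_left mult_ac)
 qed
 moreover have "(\<integral>x. w x * (?A x) \<partial>halfline) =
   (\<integral>x. of_real x powr (\<kappa> - 1) * exp (- X / of_real x) * (?E x) \<partial>halfline)"
 proof (intro Bochner_Integration.integral_cong refl)
  fix x
  have "exp (- (?B x) - X / of_real x) * exp (- (q\<^sup>2 * (?B x))) = exp (- X / of_real x) * exp (- (\<mu> * (1 + q\<^sup>2) * of_real x))"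
   by (simp add: algebra_simps flip: exp_add)
  thus "w x * (?A x) =
   of_real x powr (\<kappa> - 1) * exp (- X / of_real x) * (?E x)"
   unfolding w_def by (simp add: mult.assoc)
 qed
 ultimately show ?thesis using dominated_sums_integral(1)[OF 1 2 3 4] by simp
qed

text \<open>The derivative of \<open>x powr k * exp (- \<mu> * x - X / x)\<close> has integral 0,
  since the function vanishes at both ends. Up to powers of \<open>\<mu>\<close> it is the
  recurrence required by \<open>laguerre_moment_recurrence\<close>.\<close>

lemma bessel_moment_rec:
 assumes \<mu>: "Re \<mu> > 0" and X: "Re X \<ge> 0" and k: "Re k > 1"
 shows "\<mu> * bessel_moment \<mu> X (k + 1) = k * bessel_moment \<mu> X k + X * bessel_moment \<mu> X (k - 1)"
proof -
 let ?A = "(\<lambda>x. x powr Re k * exp (- (Re \<mu> * x))) \<longlongrightarrow> 0"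
 define E where "E = (\<lambda>x. exp (- (\<mu> * of_real x) - X / complex_of_real x))"
 define F where "F = (\<lambda>x. of_real x powr k * E x)"
 let ?B = "\<lambda>x. norm (F x) \<le> x powr Re k * exp (- (Re \<mu> * x))"
 define f where "f = (\<lambda>x. k * (of_real x powr (k - 1) * E x) + X * (of_real x powr (k - 1 - 1) * E x) - \<mu> * (of_real x powr (k + 1 - 1) * E x))"
 have i: "integrable halfline (\<lambda>x. of_real x powr (j - 1) * E x)" if "Re j > 0" for j
  unfolding E_def using X that by (intro integrable_bessel_moment[OF \<mu>]) auto
 have Em: "bessel_moment \<mu> X j = (\<integral>x. of_real x powr (j - 1) * E x \<partial>halfline)" for j
  by (simp add: bessel_moment_def E_def)
 have ii: "integrable halfline (\<lambda>x. of_real x powr (k - 1) * E x)" "integrable halfline (\<lambda>x. of_real x powr (k - 1 - 1) * E x)"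
  "integrable halfline (\<lambda>x. of_real x powr (k + 1 - 1) * E x)"
  using k by (intro i; simp)+
 have nF: "norm (F x) \<le> x powr Re k * exp (- (Re \<mu> * x))" if "x > 0" for x
 proof -
  have "norm (F x) = x powr Re k * exp (- (Re \<mu> * x) - Re X / x)"
   using that by (simp add: F_def E_def norm_mult norm_powr_real_powr Re_divide_of_real)
  also have "\<dots> \<le> x powr Re k * exp (- (Re \<mu> * x))" using X that by (intro mult_left_mono) auto
  finally show ?thesis .
 qed
 have "(\<integral>x. f x \<partial>halfline) = 0 - 0"
 proof (rule lebesgue_on_ftc)
  show "(F has_vector_derivative f x) (at x)" if x: "x > 0" for x
  proof -
   have e: "(E has_vector_derivative ((- \<mu> + X / of_real x ^ 2) * E x)) (at x)"
   proof -
    have "((\<lambda>z. exp (- (\<mu> * z) - X / z)) has_field_derivative ((- \<mu> + X / of_real x ^ 2) * exp (- (\<mu> * of_real x) - X / of_real x))) (at (of_real x))"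
     using x by (auto intro!: derivative_eq_intros simp: power2_eq_square)
    thus ?thesis unfolding E_def by (rule has_vector_derivative_real_field)
   qed
   have p: "complex_of_real x powr (k - 1 - 1) = of_real x powr k / of_real x ^ 2"
   proof -
    have "complex_of_real x powr (k - of_nat 2) = of_real x powr k / of_real x powr of_nat 2" by (rule powr_diff)
    moreover have "complex_of_real x powr of_nat 2 = of_real x ^ 2" using x by (intro powr_nat') auto
    moreover have "k - of_nat 2 = k - 1 - 1" by simp
    ultimately show ?thesis by simp
   qed
   have "f x = of_real x powr k * ((- \<mu> + X / of_real x ^ 2) * E x) + k * of_real x powr (k - 1) * E x"
    unfolding f_def p by (simp add: algebra_simps)
   thus ?thesis using has_vector_derivative_mult[OF has_vector_derivative_powr_of_real[OF x, of k] e] by (simp add: F_def)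
  qed
  show "continuous_on {0<..} f" unfolding f_def E_def by (auto intro!: continuous_intros)
  show "integrable halfline f" unfolding f_def
   by (intro Bochner_Integration.integrable_diff Bochner_Integration.integrable_add integrable_mult_right ii)
  show "(F \<longlongrightarrow> 0) (at_right 0)"
  proof (rule Lim_null_comparison)
   show "eventually ?B (at_right 0)"
    using eventually_at_right_less[of 0] by eventually_elim (rule nF)
   show "?A (at_right 0)" using k by real_asymp
  qed
  show "(F \<longlongrightarrow> 0) at_top"
  proof (rule Lim_null_comparison)
   show "eventually ?B at_top"
    using eventually_gt_at_top[of 0] by eventually_elim (rule nF)
   show "?A at_top" using \<mu> by real_asymp
  qed
 qed
 also have "(\<integral>x. f x \<partial>halfline) = k * bessel_moment \<mu> X k + X * bessel_moment \<mu> X (k - 1) - \<mu> * bessel_moment \<mu> X (k + 1)"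
  unfolding f_def Em integral_mult_right_zero[symmetric]
  by (simp only: Bochner_Integration.integral_diff[OF Bochner_Integration.integrable_add[OF integrable_mult_right[OF ii(1)] integrable_mult_right[OF ii(2)]] integrable_mult_right[OF ii(3)]]
    Bochner_Integration.integral_add[OF integrable_mult_right[OF ii(1)] integrable_mult_right[OF ii(2)]])
 finally show ?thesis by (simp add: algebra_simps)
qed

lemma holomorphic_bessel_moment_mu:
 assumes X: "Re X \<ge> 0" and \<nu>: "Re \<nu> > 0"
 shows "(\<lambda>\<mu>. bessel_moment \<mu> X \<nu>) holomorphic_on {\<mu>. Re \<mu> > 0}"
 unfolding bessel_moment_def
proof (rule holomorphic_on_lebesgue_integral)
 let ?A = "\<lambda>z x. - (z * of_real x) - X / of_real x"
 show "open {\<mu>. Re \<mu> > 0}" by (rule open_halfspace_Re_gt)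
 show "(\<lambda>x. of_real x powr (\<nu> - 1) * exp (?A z x)) \<in> borel_measurable halfline"
  if "z \<in> {\<mu>. Re \<mu> > 0}" for z
  using integrable_bessel_moment[of z X \<nu>] assms that by (auto simp: less_eq_real_def)
 show "(\<lambda>z. of_real x powr (\<nu> - 1) * exp (?A z x)) holomorphic_on {\<mu>. Re \<mu> > 0}"
  if "x \<in> space halfline" for x :: real
  using that by (auto intro!: holomorphic_intros)
 fix z0 :: complex assume z0: "z0 \<in> {\<mu>. Re \<mu> > 0}"
 show "\<exists>r>0. \<exists>B. integrable halfline B \<and>
      (\<forall>z\<in>ball z0 r \<inter> {\<mu>. Re \<mu> > 0}. \<forall>x\<in>space halfline.
       norm (of_real x powr (\<nu> - 1) * exp (?A z x)) \<le> B x)"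
 proof (intro exI conjI ballI)
  show "Re z0 / 2 > 0" using z0 by simp
  show "integrable halfline (\<lambda>x. x powr (Re \<nu> - 1) * exp (- (Re z0 / 2 * x)))"
   using z0 \<nu> by (intro integrable_powr_exp_real) auto
  fix z x assume z: "z \<in> ball z0 (Re z0 / 2) \<inter> {\<mu>. Re \<mu> > 0}" and x: "x \<in> space halfline"
  have "\<bar>Re z0 - Re z\<bar> < Re z0 / 2" using z abs_Re_le_cmod[of "z0 - z"] by (auto simp: dist_norm)
  hence "Re z0 / 2 \<le> Re z" by linarith
  hence "Re z0 / 2 * x \<le> Re z * x" using x by (intro mult_right_mono) auto
  moreover have "Re X / x \<ge> 0" using X x by simp
  ultimately have "- (Re z * x) - Re X / x \<le> - (Re z0 / 2 * x)" by linarith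
  thus "norm (of_real x powr (\<nu> - 1) * exp (?A z x)) \<le> x powr (Re \<nu> - 1) * exp (- (Re z0 / 2 * x))"
   using x by (auto simp: norm_mult norm_powr_real_powr Re_divide_of_real intro!: mult_left_mono)
 qed
qed

text \<open>Both parameter integrals below are computed by expanding in powers of the quotient near
 \<open>a = b\<close>, and then continuing analytically in \<open>a\<close>.\<close>

lemma kernel_identity:
 fixes R :: "complex \<Rightarrow> complex"
 assumes b: "Re b > 0" and a: "Re a > 0" and \<nu>: "Re \<nu> > 0" and X: "Re X \<ge> 0" and \<kappa>: "Re \<kappa> > 0"
  and R: "R holomorphic_on {a. Re a > 0}"
  and near: "\<And>a q \<mu>. Re a > 0 \<Longrightarrow> Re \<mu> > 0 \<Longrightarrow> q = (csqrt a - csqrt b) / (csqrt a + csqrt b) \<Longrightarrow> \<mu> = (csqrt a + csqrt b)\<^sup>2 / 2 \<Longrightarrow>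
    (\<lambda>n. q ^ (2 * n) * (\<Sum>m\<le>n. laguerre_coeff \<nu> n m * (\<mu> ^ (n + m) * bessel_moment \<mu> X (\<kappa> + of_nat (n + m))))) sums R a"
 shows "(\<integral>x. of_real x powr (\<kappa> - 1) * exp (- X / of_real x) * (exp (- ((a + b) * of_real x)) * bessel_It \<nu> ((a - b) * of_real x)) \<partial>halfline) = R a"
proof -
 define F where "F = (\<lambda>a. \<integral>x. of_real x powr (\<kappa> - 1) * exp (- X / of_real x) * (exp (- ((a + b) * of_real x)) * bessel_It \<nu> ((a - b) * of_real x)) \<partial>halfline)"
 define H where "H = {a::complex. Re a > 0}"
 have oH: "open H" unfolding H_def by (rule open_halfspace_Re_gt)
 have holF: "F holomorphic_on H"
  unfolding F_def H_def
 proof (rule kernel_holomorphic[OF b \<nu> _ _ \<kappa>])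
  show "(\<lambda>x. complex_of_real x powr (\<kappa> - 1) * exp (- X / of_real x)) \<in> borel_measurable halfline"
   by (intro continuous_imp_measurable_on_sets_lebesgue continuous_intros) auto
  show "norm (complex_of_real x powr (\<kappa> - 1) * exp (- X / of_real x)) \<le> x powr (Re \<kappa> - 1)" if "x > 0" for x
   using that X by (simp add: norm_mult norm_powr_real_powr Re_divide_of_real mult_left_le)
 qed
 define A where "A = (\<lambda>a. csqrt a)"
 define q where "q = (\<lambda>a. (csqrt a - csqrt b) / (csqrt a + csqrt b))"
 let ?B = "\<lambda>a. (norm (q a))\<^sup>2 + 2 * norm (q a)"
 define \<mu> where "\<mu> = (\<lambda>a. (csqrt a + csqrt b)\<^sup>2 / 2)"
 let ?A = "\<lambda>a. Re (\<mu> a) - norm (\<mu> a) * (?B a)"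
 have nz: "csqrt a + csqrt b \<noteq> 0" if "a \<in> H" for a
  using sector_quotient(2)[OF csqrt_sector csqrt_sector] that b by (auto simp: H_def)
 have cs: "continuous_on H csqrt"
 proof -
  have "(\<lambda>a. csqrt a) holomorphic_on H"
   unfolding H_def by (intro holomorphic_intros) (auto simp: complex_nonpos_Reals_iff)
  thus ?thesis using holomorphic_on_imp_continuous_on by simp
 qed
 have cont: "continuous_on H ?A"
  unfolding \<mu>_def q_def using cs nz by (intro continuous_intros) auto
 \<comment> \<open>The points where the expansion may be integrated termwise. At
   \<open>a = b\<close> the quotient \<open>q\<close> is 0 and the condition reduces to
   \<open>Re \<mu> > 0\<close>, so this open set is a neighbourhood of \<open>b\<close>.\<close>
 define U where "U = {a \<in> H. Re (\<mu> a) - norm (\<mu> a) * (?B a) > 0}"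
 have "open (?A -` {0<..} \<inter> H)"
  using cont oH by (auto simp: continuous_on_open_vimage)
 also have "?A -` {0<..} \<inter> H = U"
  unfolding U_def by auto
 finally have oU: "open U" .
 have bU: "b \<in> U" using b unfolding U_def H_def \<mu>_def q_def by (simp add: power_mult_distrib flip: mult_2)
 have eqU: "F a = R a" if "a \<in> U" for a
 proof -
  have aH: "Re a > 0" and small: "Re (\<mu> a) > norm (\<mu> a) * (?B a)" using that by (auto simp: U_def H_def)
  have \<mu>0: "Re (\<mu> a) > 0" using sector_square[OF sector_add[OF csqrt_sector[OF aH] csqrt_sector[OF b]]] by (simp add: \<mu>_def)
  have nz': "csqrt a + csqrt b \<noteq> 0" using nz[of a] aH by (simp add: H_def)
  \<comment> \<open>The parameters \<open>\<mu>\<close> and \<open>q\<close> are chosen for this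
    identity and for \<open>e2\<close>: they put the kernel into the form of the Laguerre generating
    function.\<close>
  have e1: "\<mu> a * (1 + (q a)\<^sup>2) = a + b"
  proof -
   have "\<mu> a * (1 + (q a)\<^sup>2) = ((csqrt a + csqrt b)\<^sup>2 + (csqrt a - csqrt b)\<^sup>2) / 2"
    unfolding \<mu>_def q_def using nz' by (simp add: power_divide field_simps)
   also have "\<dots> = (csqrt a)\<^sup>2 + (csqrt b)\<^sup>2" by (simp add: power2_eq_square algebra_simps)
   finally show ?thesis by simp
  qed
  have e2: "2 * q a * \<mu> a = a - b"
  proof -
   have "2 * q a * \<mu> a = (csqrt a - csqrt b) * (csqrt a + csqrt b)"
    unfolding \<mu>_def q_def using nz' by (simp add: power2_eq_square)
   also have "\<dots> = (csqrt a)\<^sup>2 - (csqrt b)\<^sup>2" by (simp add: power2_eq_square algebra_simps)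
   finally show ?thesis by simp
  qed
  from kernel_expansion[OF small \<nu> X \<kappa>] 
  have "(\<lambda>n. q a ^ (2 * n) * (\<Sum>m\<le>n. laguerre_coeff \<nu> n m * (\<mu> a ^ (n + m) * bessel_moment (\<mu> a) X (\<kappa> + of_nat (n + m))))) sums F a"
   unfolding e1 e2 F_def .
  with near[OF aH \<mu>0, of "q a"] show ?thesis using sums_unique2 unfolding q_def \<mu>_def by blast
 qed
 have "F a - R a = 0"
 proof (rule analytic_continuation_open[of U H "\<lambda>a. F a - R a" "\<lambda>_. 0"])
  show "connected H" unfolding H_def by (intro convex_connected convex_halfspace_Re_gt)
  show "(\<lambda>a. F a - R a) holomorphic_on H" using holF R unfolding H_def by (intro holomorphic_intros)
 qed (use oU oH bU eqU a in \<open>auto simp: U_def H_def\<close>)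
 thus ?thesis unfolding F_def by simp
qed

text \<open>With exponent \<open>\<nu>\<close> the scaled moments
  \<open>\<mu> ^ j * bessel_moment \<mu> X (\<nu> + j)\<close> satisfy the recurrence with
  \<open>Y = \<mu> * X\<close>. Each inner sum is then one term of the Bessel I series times the
  moment of index 0, and the double integral structure of the product of I and K never
  appears.\<close>

lemma IK_integral:
 assumes b: "Re b > 0" and a: "Re a > 0" and \<nu>: "Re \<nu> > 0" and X: "Re X \<ge> 0"
 shows "(\<integral>x. of_real x powr (\<nu> - 1) * exp (- X / of_real x) * (exp (- ((a + b) * of_real x)) * bessel_It \<nu> ((a - b) * of_real x)) \<partial>halfline) =
  bessel_It \<nu> (of_real (sqrt 2) * (csqrt a - csqrt b) * csqrt X) * bessel_moment ((csqrt a + csqrt b)\<^sup>2 / 2) X \<nu>"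
proof (rule kernel_identity[OF b a \<nu> X \<nu>, where R = "\<lambda>a. bessel_It \<nu> (of_real (sqrt 2) * (csqrt a - csqrt b) * csqrt X) * bessel_moment ((csqrt a + csqrt b)\<^sup>2 / 2) X \<nu>"])
 let ?C = "\<lambda>j. \<nu> + of_nat j + 1"
 let ?B = "\<lambda>n \<mu>. \<Sum>m\<le>n. laguerre_coeff \<nu> n m * (\<mu> ^ (n + m) * bessel_moment \<mu> X (\<nu> + of_nat (n + m)))"
 let ?A = "\<lambda>a. (csqrt a + csqrt b)\<^sup>2 / 2"
 have mm: "(\<lambda>a. bessel_moment ((csqrt a + csqrt b)\<^sup>2 / 2) X \<nu>) holomorphic_on {a. Re a > 0}"
 proof -
  have "((\<lambda>\<mu>. bessel_moment \<mu> X \<nu>) \<circ> ?A) holomorphic_on {a. Re a > 0}"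
  proof (rule holomorphic_on_compose_gen[OF _ holomorphic_bessel_moment_mu[OF X \<nu>]])
   show "?A holomorphic_on {a. Re a > 0}"
    by (intro holomorphic_intros) (auto simp: complex_nonpos_Reals_iff)
   show "?A ` {a. Re a > 0} \<subseteq> {\<mu>. Re \<mu> > 0}"
    using sector_square[OF sector_add[OF csqrt_sector csqrt_sector[OF b]]] by auto
  qed
  thus ?thesis by (simp add: comp_def)
 qed
 show "(\<lambda>a. bessel_It \<nu> (of_real (sqrt 2) * (csqrt a - csqrt b) * csqrt X) * bessel_moment ((csqrt a + csqrt b)\<^sup>2 / 2) X \<nu>) holomorphic_on {a. Re a > 0}"
  by (intro holomorphic_intros mm) (auto simp: complex_nonpos_Reals_iff)
 fix a q \<mu> assume aq: "Re a > 0" "Re \<mu> > 0" "q = (csqrt a - csqrt b) / (csqrt a + csqrt b)" "\<mu> = (csqrt a + csqrt b)\<^sup>2 / 2"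
 have nz: "csqrt a + csqrt b \<noteq> 0" by (rule sector_quotient(2)[OF csqrt_sector[OF aq(1)] csqrt_sector[OF b]])
 \<comment> \<open>Fixed by the requirement that \<open>(u / 2)^2\<close> equal
   \<open>q^2 * \<mu> * X\<close>, the quantity that occurs in the collapsed sums.\<close>
 define u where "u = of_real (sqrt 2) * (csqrt a - csqrt b) * csqrt X"
 have u2: "(u / 2)\<^sup>2 = q\<^sup>2 * (\<mu> * X)"
 proof -
  have "(u / 2)\<^sup>2 = (complex_of_real (sqrt 2))\<^sup>2 * (csqrt a - csqrt b)\<^sup>2 * X / 4" by (simp add: u_def power_mult_distrib power_divide)
  also have "(complex_of_real (sqrt 2))\<^sup>2 = 2" by (simp flip: of_real_power)
  finally show ?thesis unfolding aq(3,4) using nz by (simp add: power_divide)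
 qed
 define Nf where "Nf = (\<lambda>j. \<mu> ^ j * bessel_moment \<mu> X (\<nu> + of_nat j))"
 have rec: "Nf (j + 2) = (?C j) * Nf (j + 1) + (\<mu> * X) * Nf j" for j
 proof -
  have "\<mu> * bessel_moment \<mu> X (\<nu> + of_nat j + 1 + 1) = (?C j) * bessel_moment \<mu> X (?C j) + X * bessel_moment \<mu> X (\<nu> + of_nat j + 1 - 1)"
   using \<nu> by (intro bessel_moment_rec aq(2) X) simp
  hence r: "\<mu> * bessel_moment \<mu> X (\<nu> + of_nat (j + 2)) = (?C j) * bessel_moment \<mu> X (\<nu> + of_nat (j + 1)) + X * bessel_moment \<mu> X (\<nu> + of_nat j)"
   by (simp add: add_ac)
  have "Nf (j + 2) = \<mu> ^ (j + 1) * (\<mu> * bessel_moment \<mu> X (\<nu> + of_nat (j + 2)))" by (simp add: Nf_def)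
  also have "\<dots> = (?C j) * Nf (j + 1) + (\<mu> * X) * Nf j" unfolding r by (simp add: Nf_def algebra_simps)
  finally show ?thesis .
 qed
 have "q ^ (2 * n) * (?B n \<mu>) =
   (u / 2) ^ (2 * n) * rGamma (\<nu> + of_nat n + 1) / fact n * bessel_moment \<mu> X \<nu>" for n
  using laguerre_moment_recurrence[of Nf \<nu> "\<mu> * X" n, OF rec \<nu>]
  by (simp add: Nf_def power_mult u2 power_mult_distrib)
 thus "(\<lambda>n. q ^ (2 * n) * (?B n \<mu>)) sums
   (bessel_It \<nu> (of_real (sqrt 2) * (csqrt a - csqrt b) * csqrt X) * bessel_moment ((csqrt a + csqrt b)\<^sup>2 / 2) X \<nu>)"
  using sums_mult2[OF bessel_It_sums[of u \<nu>], of "bessel_moment \<mu> X \<nu>"] unfolding u_def aq(4) by simp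
qed

text \<open>The case \<open>X = 0\<close> with exponent \<open>s + \<nu> + 1\<close>: the moments
  are Gamma values, so \<open>laguerre_Gamma_moment\<close> collapses the inner sums to the
  coefficients of a hypergeometric series in \<open>q^2\<close>.\<close>

lemma Laplace_integral:
 assumes b: "Re b > 0" and a: "Re a > 0" and \<nu>: "Re \<nu> > 0" and \<kappa>: "Re (s + \<nu> + 1) > 0"
 shows "(\<integral>x. of_real x powr (s + \<nu>) * (exp (- ((a + b) * of_real x)) * bessel_It \<nu> ((a - b) * of_real x)) \<partial>halfline) =
  ((csqrt a + csqrt b)\<^sup>2 / 2) powr (- (s + \<nu> + 1)) * Gamma (s + \<nu> + 1) * rGamma (\<nu> + 1) *
   hyp2F1 (s + \<nu> + 1) (s + 1) (\<nu> + 1) (((csqrt a - csqrt b) / (csqrt a + csqrt b))\<^sup>2)"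
proof -
 let ?E = "\<lambda>a b. csqrt a + csqrt b"
 let ?D = "\<lambda>a b. (csqrt a - csqrt b) / (?E a b)"
 let ?C = "\<lambda>j. s + \<nu> + 1 + of_nat j"
 let ?B = "\<lambda>n \<mu>. \<Sum>m\<le>n. laguerre_coeff \<nu> n m * (\<mu> ^ (n + m) * bessel_moment \<mu> 0 (s + \<nu> + 1 + of_nat (n + m)))"
 let ?A = "s + \<nu> + 1"
 define R where "R = (\<lambda>a. ((?E a b)\<^sup>2 / 2) powr (- ?A) * Gamma ?A * rGamma (\<nu> + 1) *
   hyp2F1 ?A (s + 1) (\<nu> + 1) ((?D a b)\<^sup>2))"
 have nz: "csqrt a + csqrt b \<noteq> 0" if "Re a > 0" for a by (rule sector_quotient(2)[OF csqrt_sector[OF that] csqrt_sector[OF b]])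
 have q1: "norm ((?D a b)\<^sup>2) < 1" if "Re a > 0" for a
  using sector_quotient(1)[OF csqrt_sector[OF that] csqrt_sector[OF b]] unfolding norm_power by (simp add: power_less_one_iff)
 have "(\<integral>x. of_real x powr (?A - 1) * exp (- 0 / of_real x) * (exp (- ((a + b) * of_real x)) * bessel_It \<nu> ((a - b) * of_real x)) \<partial>halfline) = R a"
 proof (rule kernel_identity[OF b a \<nu> _ \<kappa>])
  show "R holomorphic_on {a. Re a > 0}"
   unfolding R_def
  proof (intro holomorphic_on_mult holomorphic_on_const)
   show "(\<lambda>a. ((?E a b)\<^sup>2 / 2) powr (- ?A)) holomorphic_on {a. Re a > 0}"
   proof (intro holomorphic_intros)
    fix a assume a: "a \<in> {a. Re a > 0}"
    show "a \<notin> \<real>\<^sub>\<le>\<^sub>0" using a by (auto simp: complex_nonpos_Reals_iff)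
    have "Re ((?E a b)\<^sup>2 / 2) > 0" using sector_square[OF sector_add[OF csqrt_sector csqrt_sector[OF b]]] a by simp
    thus "(?E a b)\<^sup>2 / 2 \<notin> \<real>\<^sub>\<le>\<^sub>0" by (auto simp: complex_nonpos_Reals_iff)
   qed auto
   show "(\<lambda>a. hyp2F1 ?A (s + 1) (\<nu> + 1) ((?D a b)\<^sup>2)) holomorphic_on {a. Re a > 0}"
   proof (rule holomorphic_hyp2F1_comp)
    show "(\<lambda>a. (?D a b)\<^sup>2) holomorphic_on {a. Re a > 0}"
     using nz by (intro holomorphic_intros) (auto simp: complex_nonpos_Reals_iff)
   qed (use q1 \<nu> in \<open>auto simp: open_halfspace_Re_gt\<close>)
  qed
  fix a q \<mu> assume aq: "Re a > 0" "Re \<mu> > 0" "q = (csqrt a - csqrt b) / (?E a b)" "\<mu> = (?E a b)\<^sup>2 / 2"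
  have ni: "z \<notin> \<int>\<^sub>\<le>\<^sub>0" if "Re z > 0" for z :: complex using that by (auto elim!: nonpos_Ints_cases)
  have mom: "\<mu> ^ j * bessel_moment \<mu> 0 (?C j) = \<mu> powr (- ?A) * Gamma (?C j)" for j
  proof -
   have "bessel_moment \<mu> 0 (?C j) = Gamma (?C j) * \<mu> powr (- (?C j))"
    unfolding bessel_moment_def using Gamma_integral_scaled[of "s + \<nu> + 1 + of_nat j" \<mu>] \<kappa> aq(2) by simp
   moreover have "\<mu> powr (- ?A) = \<mu> powr (- (?C j)) * \<mu> ^ j"
   proof -
    have "\<mu> powr (- (?C j) + of_nat j) = \<mu> powr (- (?C j)) * \<mu> powr of_nat j" by (rule powr_add)
    moreover have "\<mu> powr of_nat j = \<mu> ^ j" using aq(2) by (intro powr_nat') auto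
    moreover have "- (?C j) + of_nat j = - ?A" by simp
    ultimately show ?thesis by simp
   qed
   ultimately show ?thesis by simp
  qed
  have tm: "q ^ (2 * n) * (?B n \<mu>) =
    (\<mu> powr (- ?A) * Gamma ?A * rGamma (\<nu> + 1)) * (pochhammer ?A n * pochhammer (s + 1) n / (pochhammer (\<nu> + 1) n * fact n) * (q\<^sup>2) ^ n)" for n
  proof -
   have "(?B n \<mu>) = \<mu> powr (- ?A) * (\<Sum>m\<le>n. laguerre_coeff \<nu> n m * Gamma (s + \<nu> + 1 + of_nat (n + m)))"
    unfolding mom by (simp add: sum_distrib_left mult_ac)
   also have "\<dots> = \<mu> powr (- ?A) * (pochhammer (s + 1) n * Gamma (s + \<nu> + 1 + of_nat n) * rGamma (\<nu> + of_nat n + 1) / fact n)"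
    unfolding laguerre_Gamma_moment[OF \<nu> \<kappa>] ..
   also have "Gamma (s + \<nu> + 1 + of_nat n) = pochhammer ?A n * Gamma ?A"
    using pochhammer_Gamma[OF ni[OF \<kappa>], of n] ni[OF \<kappa>] by (simp add: Gamma_eq_zero_iff)
   also have "rGamma (\<nu> + of_nat n + 1) = rGamma (\<nu> + 1) / pochhammer (\<nu> + 1) n"
   proof -
    have n1: "\<nu> + 1 \<notin> \<int>\<^sub>\<le>\<^sub>0" "\<nu> + 1 + of_nat n \<notin> \<int>\<^sub>\<le>\<^sub>0" using \<nu> by (intro ni; simp)+
    have "Gamma (\<nu> + 1 + of_nat n) = pochhammer (\<nu> + 1) n * Gamma (\<nu> + 1)"
     using pochhammer_Gamma[OF n1(1), of n] n1 by (simp add: Gamma_eq_zero_iff)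
    moreover have "\<nu> + of_nat n + 1 = \<nu> + 1 + of_nat n" by simp
    ultimately show ?thesis by (simp only: rGamma_inverse_Gamma) (simp add: divide_inverse)
   qed
   finally show ?thesis unfolding power_mult[of q] by (simp add: mult_ac)
  qed
  have "norm (q\<^sup>2) < 1" using q1[OF aq(1)] aq(3) by simp
  from sums_mult[OF hyp2F1_sums[OF _ this, of "\<nu> + 1" "s + \<nu> + 1" "s + 1"], of "\<mu> powr (- ?A) * Gamma ?A * rGamma (\<nu> + 1)"]
  show "(\<lambda>n. q ^ (2 * n) * (?B n \<mu>)) sums R a"
   unfolding tm R_def aq(4)[symmetric] aq(3)[symmetric] using \<nu> by simp
 qed simp
 thus ?thesis by (simp add: R_def)
qed

section \<open>The zeta function\<close>

text \<open>The nonzero periods of the exponential have modulus at least \<open>2 * pi\<close>,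
  which exceeds 6.\<close>

lemma exp_eq_1_small:
 assumes "exp z = 1" "norm z < 6"
 shows "z = (0 :: complex)"
proof -
 obtain n :: int where n: "Re z = 0" "Im z = of_int (2 * n) * pi" using assms(1) unfolding exp_eq_1 by auto
 have "n = 0"
 proof (rule ccontr)
  assume "n \<noteq> 0"
  hence "1 \<le> \<bar>real_of_int n\<bar>" by linarith
  hence "2 * pi * 1 \<le> 2 * pi * \<bar>real_of_int n\<bar>" by (intro mult_left_mono) auto
  also have "\<dots> = \<bar>Im z\<bar>" using n by (simp add: abs_mult)
  also have "\<dots> \<le> norm z" by (rule abs_Im_le_cmod)
  finally show False using assms(2) pi_gt3 by simp
 qed
 thus ?thesis using n by (simp add: complex_eq_iff)
qed

text \<open>\<open>z / (exp z - 1)\<close> with its singularity at 0 removed. The form as an inverse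
  lets holomorphy follow from the removable singularity of \<open>(exp z - 1) / z\<close>, which has
  no zero in the disc of radius 6.\<close>

definition bose :: "complex \<Rightarrow> complex" where
 "bose z = inverse (if z = 0 then 1 else (exp z - 1) / z)"

lemma bose_eq: "z \<noteq> 0 \<Longrightarrow> bose z = z / (exp z - 1)"
 by (simp add: bose_def)

lemma holomorphic_bose: "bose holomorphic_on ball 0 6"
proof -
 have "(\<lambda>z::complex. if z = 0 then 1 else (exp z - 1) / z) holomorphic_on ball 0 6"
 proof (rule pole_theorem_open_0[of "\<lambda>z. exp z - 1" _ 0])
  have d: "((\<lambda>z::complex. exp z - 1) has_field_derivative 1) (at 0)" by (auto intro!: derivative_eq_intros)
  have "deriv (\<lambda>z::complex. exp z - 1) 0 = 1" by (rule DERIV_imp_deriv[OF d])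
  thus "(if (0::complex) = 0 then (1::complex) else (exp 0 - 1) / 0) = deriv (\<lambda>z. exp z - 1) 0" by simp
 qed (auto intro!: holomorphic_intros)
 thus ?thesis unfolding bose_def
  by (rule holomorphic_on_inverse) (use exp_eq_1_small in \<open>auto split: if_splits\<close>)
qed

text \<open>These are the Bernoulli numbers divided by factorials.\<close>

definition bose_coeff :: "nat \<Rightarrow> complex" where
 "bose_coeff n = (deriv ^^ n) bose 0 / fact n"

lemma bose_coeff_0: "bose_coeff 0 = 1"
 by (simp add: bose_coeff_def bose_def)

lemma bose_sums: "norm z < 6 \<Longrightarrow> (\<lambda>n. bose_coeff n * z ^ n) sums bose z"
 using holomorphic_power_series[OF holomorphic_bose, of z] by (simp add: bose_coeff_def)

lemma summable_bose_coeff: "summable (\<lambda>n. norm (bose_coeff n))"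
proof -
 have "summable (\<lambda>n. bose_coeff n * (2::complex) ^ n)" using bose_sums[of 2] by (auto simp: sums_iff)
 thus ?thesis using powser_insidea[of bose_coeff 2 1] by simp
qed

definition zeta_upper :: "complex \<Rightarrow> complex" where
 "zeta_upper s = (\<integral>x. of_real x powr (s - 1) / of_real (exp x - 1) \<partial>lebesgue_on {1<..})"

text \<open>Zeta without its pole part: the integral of \<open>x powr (s - 1) / (exp x - 1)\<close>
  is split at 1, the lower part is expanded in Bernoulli numbers, everything is multiplied by
  \<open>rGamma s\<close>, and the term with \<open>1 / (s - 1)\<close> is left out. The factor
  \<open>pochhammer s n * rGamma (s + n + 1)\<close> stands for \<open>rGamma s / (s + n)\<close>
  and has no singularity at \<open>s = - n\<close>.\<close>

definition zeta_entire :: "complex \<Rightarrow> complex" where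
 "zeta_entire s = rGamma s * zeta_upper s + (\<Sum>n. bose_coeff (Suc n) * (pochhammer s n * rGamma (s + of_nat n + 1)))"

text \<open>A single bound that covers both the pole at 0 and the decay at infinity, from
  \<open>exp x - 1 = (exp (x / 2) - 1) * (exp (x / 2) + 1)\<close>.\<close>

lemma inverse_exp_minus_1_le:
 assumes "x > (0::real)"
 shows "1 / (exp x - 1) \<le> 2 * exp (- (x / 2)) / x"
proof -
 have "x / 2 * exp (x / 2) \<le> (exp (x / 2) - 1) * (exp (x / 2) + 1)"
 proof (rule mult_mono)
  show "x / 2 \<le> exp (x / 2) - 1" using exp_ge_add_one_self[of "x / 2"] by linarith
 qed (use assms in auto)
 also have "\<dots> = exp x - 1" by (simp add: algebra_simps flip: exp_add)
 finally have "1 / (exp x - 1) \<le> 1 / (x / 2 * exp (x / 2))"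
  using assms by (intro divide_left_mono mult_pos_pos) auto
 thus ?thesis by (simp add: exp_minus field_simps)
qed

lemma holomorphic_zeta_upper: "zeta_upper holomorphic_on UNIV"
proof -
 let ?A = "\<lambda>x z. complex_of_real x powr (z - 1) / of_real (exp x - 1)"
 have "(\<lambda>s. \<integral>x. of_real x powr (s - 1) / of_real (exp x - 1) \<partial>lebesgue_on {1<..}) holomorphic_on UNIV"
 proof (rule holomorphic_on_lebesgue_integral)
  show "(\<lambda>x. complex_of_real x powr (s - 1) / of_real (exp x - 1)) \<in> borel_measurable (lebesgue_on {1<..})" for s
   by (intro continuous_imp_measurable_on_sets_lebesgue continuous_intros) auto
  show "(\<lambda>s. complex_of_real x powr (s - 1) / of_real (exp x - 1)) holomorphic_on UNIV" if "x \<in> space (lebesgue_on {1<..})" for x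
   using that by (intro holomorphic_intros) auto
  fix z0 :: complex
  define b where "b = \<bar>Re z0\<bar> + 2"
  show "\<exists>r>0. \<exists>B. integrable (lebesgue_on {1<..}) B \<and> (\<forall>z\<in>ball z0 r \<inter> UNIV. \<forall>x\<in>space (lebesgue_on {1<..}).
    norm (?A x z) \<le> B x)"
  proof (intro exI conjI ballI)
   show "integrable (lebesgue_on {1<..}) (\<lambda>x. 2 * (x powr (b - 1) * exp (- (1 / 2 * x))))"
    by (rule integrable_mult_right, rule integrable_lebesgue_on_subset[OF integrable_powr_exp_real[of b "1/2"]]) (auto simp: b_def)
   fix z x assume z: "z \<in> ball z0 1 \<inter> UNIV" and x: "x \<in> space (lebesgue_on {1::real<..})"
   have x1: "x > 1" using x by simp
   have "\<bar>Re z0 - Re z\<bar> < 1" using z abs_Re_le_cmod[of "z0 - z"] by (auto simp: dist_norm)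
   hence p: "x powr (Re z - 1) \<le> x powr (b - 1)" using x1 by (intro powr_mono) (auto simp: b_def)
   have "2 * exp (- (x / 2)) / x \<le> 2 * exp (- (x / 2))" using x1 by (simp add: divide_le_eq)
   hence q: "1 / (exp x - 1) \<le> 2 * exp (- (x / 2))" using inverse_exp_minus_1_le[of x] x1 by linarith
   have "norm (?A x z) = x powr (Re z - 1) * (1 / (exp x - 1))"
    using x1 by (simp add: norm_divide norm_powr_real_powr del: of_real_diff)
   also have "\<dots> \<le> x powr (b - 1) * (2 * exp (- (x / 2)))" using x1 by (intro mult_mono p q) auto
   finally show "norm (?A x z) \<le> 2 * (x powr (b - 1) * exp (- (1 / 2 * x)))"
    by (simp add: mult_ac)
  qed simp
 qed simp
 thus ?thesis unfolding zeta_upper_def .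
qed

lemma pochhammer_rGamma_shift: "(s + of_nat n) * (pochhammer s n * rGamma (s + of_nat n + 1)) = rGamma s"
proof (induction n)
 case 0
 show ?case using rGamma_plus1[of s] by simp
next
 case (Suc n)
 have "(s + of_nat (Suc n)) * rGamma (s + of_nat (Suc n) + 1) = rGamma (s + of_nat n + 1)"
  using rGamma_plus1[of "s + of_nat n + 1"] by (simp add: add_ac)
 hence "(s + of_nat (Suc n)) * (pochhammer s (Suc n) * rGamma (s + of_nat (Suc n) + 1)) = pochhammer s (Suc n) * rGamma (s + of_nat n + 1)"
  by (metis mult.left_commute)
 also have "\<dots> = rGamma s" using Suc by (simp add: pochhammer_Suc mult_ac)
 finally show ?case .
qed

lemma holomorphic_bounded_on_cball:
 assumes "f holomorphic_on UNIV"
 obtains K :: real where "\<And>z. z \<in> cball z0 r \<Longrightarrow> norm (f z :: complex) \<le> K"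
proof -
 have "compact (f ` cball z0 r)"
  by (intro compact_continuous_image holomorphic_on_imp_continuous_on holomorphic_on_subset[OF assms]) auto
 from compact_imp_bounded[OF this] obtain K where "\<forall>y\<in>f ` cball z0 r. norm y \<le> K" unfolding bounded_iff ..
 thus ?thesis by (intro that[of K]) auto
qed

lemma holomorphic_zeta_entire: "zeta_entire holomorphic_on UNIV"
proof -
 let ?B = "\<lambda>n. \<lambda>s. bose_coeff (Suc n) * (pochhammer s n * rGamma (s + of_nat n + 1))"
 let ?A = "\<lambda>z n. pochhammer z n * rGamma (z + of_nat n + 1)"
 let ?C = "\<lambda>n z. bose_coeff (Suc n) * (?A z n)"
 have "(\<lambda>s. \<Sum>n. bose_coeff (Suc n) * (pochhammer s n * rGamma (s + of_nat n + 1))) holomorphic_on UNIV"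
 proof (rule holomorphic_on_suminf)
  have h: "(?B n) holomorphic_on UNIV" for n
   by (intro holomorphic_intros holomorphic_on_pochhammer)
  thus "(?B n) holomorphic_on UNIV" for n .
  fix z0 :: complex
  obtain K where K: "\<And>z. z \<in> cball z0 1 \<Longrightarrow> norm (rGamma z) \<le> K"
   using holomorphic_bounded_on_cball[of rGamma z0 1] holomorphic_rGamma by blast
  have "\<exists>C. \<forall>z\<in>cball z0 1. norm (?C n z) \<le> C" for n
   using holomorphic_bounded_on_cball[OF h[of n], of z0 1] by metis
  then obtain C where C: "\<And>n z. z \<in> cball z0 1 \<Longrightarrow> norm (?C n z) \<le> C n"
   by metis
  \<comment> \<open>From this index on \<open>norm (z + n) \<ge> 1\<close> throughout the disc, so
    the identity of \<open>pochhammer_rGamma_shift\<close> gives a bound independent of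
    \<open>n\<close>; the earlier terms are bounded by compactness.\<close>
  define N where "N = nat \<lceil>norm z0 + 2\<rceil>"
  show "\<exists>r>0. \<exists>B. summable B \<and> (\<forall>z\<in>ball z0 r \<inter> UNIV. \<forall>n. norm (?C n z) \<le> B n)"
  proof (intro exI conjI ballI allI)
   have "summable (\<lambda>n. norm (bose_coeff (Suc n)) * K)"
    using summable_bose_coeff by (intro summable_mult2) (subst summable_Suc_iff)
   thus "summable (\<lambda>n. if n < N then C n else norm (bose_coeff (Suc n)) * K)"
    by (rule summable_cong[THEN iffD1, rotated]) (auto simp: eventually_sequentially intro!: exI[of _ N])
   fix z n assume "z \<in> ball z0 1 \<inter> (UNIV :: complex set)"
   hence z: "z \<in> cball z0 1" by simp
   show "norm (?C n z) \<le> (if n < N then C n else norm (bose_coeff (Suc n)) * K)"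
   proof (cases "n < N")
    case False
    have "norm z \<le> norm z0 + 1" using z norm_triangle_ineq4[of z0 "z0 - z"] by (auto simp: dist_norm)
    moreover have "norm z0 + 2 \<le> real n" using False real_nat_ceiling_ge[of "norm z0 + 2"] unfolding N_def[symmetric] by linarith
    moreover have "norm (of_nat n :: complex) \<le> norm (z + of_nat n) + norm z" using norm_triangle_ineq4[of "z + of_nat n" z] by simp
    ultimately have ge: "1 \<le> norm (z + of_nat n)" by simp
    have "norm (?A z n) * 1 \<le> norm (?A z n) * norm (z + of_nat n)"
     by (rule mult_left_mono[OF ge]) simp
    also have "\<dots> = norm (rGamma z)" using pochhammer_rGamma_shift[of z n] by (metis mult.commute norm_mult)
    also have "\<dots> \<le> K" by (rule K[OF z])
    finally show ?thesis using False by (simp add: norm_mult mult_left_mono)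
   qed (use C[OF z] in simp)
  qed simp
 qed simp
 thus ?thesis unfolding zeta_entire_def using holomorphic_zeta_upper by (intro holomorphic_intros) auto
qed

text \<open>Riemann's representation: the geometric series under the integral gives
  \<open>Gamma s\<close> times the Dirichlet series, and splitting the integral at 1 gives the
  continued expression.\<close>

lemma zeta_Dirichlet:
 assumes s: "Re s > 1"
 shows "(\<lambda>n. 1 / of_nat (Suc n) powr s) sums (rGamma s / (s - 1) + zeta_entire s)"
proof -
 define g where "g = (\<lambda>x. complex_of_real x powr (s - 1) / of_real (exp x - 1))"
 define f where "f = (\<lambda>n x. complex_of_real x powr (s - 1) * exp (- (of_nat (Suc n) * of_real x)))"
 have G: "Gamma s \<noteq> 0" using s by (auto simp: Gamma_eq_zero_iff elim!: nonpos_Ints_cases)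
 have fi: "integrable halfline (f n)" for n unfolding f_def using s by (intro integrable_powr_exp) auto
 have fv: "(\<integral>x. f n x \<partial>halfline) = Gamma s * (1 / of_nat (Suc n) powr s)" for n
  unfolding f_def using s by (subst Gamma_integral_scaled) (auto simp: powr_minus divide_inverse)
 have 1: "f n \<in> borel_measurable halfline" for n using fi[of n] by auto
 have ex: "exp (- (of_nat (Suc n) * complex_of_real x)) = of_real (exp (- x) * exp (- x) ^ n)" for n x
  by (simp add: exp_of_nat_mult[symmetric] exp_of_real[symmetric] algebra_simps flip: exp_add)
 have 2: "(\<lambda>n. f n x) sums g x" if "x \<in> space halfline" for x
 proof -
  have x: "x > 0" using that by simp
  have "(\<lambda>n. exp (- x) * exp (- x) ^ n) sums (exp (- x) * (1 / (1 - exp (- x))))"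
   using x by (intro sums_mult geometric_sums) auto
  also have "exp (- x) * (1 / (1 - exp (- x))) = 1 / (exp x - 1)" using x by (simp add: exp_minus field_simps)
  finally have "(\<lambda>n. complex_of_real x powr (s - 1) * of_real (exp (- x) * exp (- x) ^ n)) sums (of_real x powr (s - 1) * of_real (1 / (exp x - 1)))"
   by (intro sums_mult) (simp only: sums_of_real_iff)
  thus ?thesis unfolding f_def g_def ex by simp
 qed
 have 3: "integrable halfline (\<lambda>x. 2 * (x powr ((Re s - 1) - 1) * exp (- (1 / 2 * x))))"
  using s by (intro integrable_mult_right integrable_powr_exp_real) auto
 have 4: "norm (\<Sum>n<N. f n x) \<le> 2 * (x powr ((Re s - 1) - 1) * exp (- (1 / 2 * x)))" if "x \<in> space halfline" for N x
 proof -
  have x: "x > 0" using that by simp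
  have "(\<Sum>n<N. exp (- x) * exp (- x) ^ n) \<le> (\<Sum>n. exp (- x) * exp (- x) ^ n)"
   using x by (intro sum_le_suminf summable_mult summable_geometric) auto
  also have "\<dots> = exp (- x) * (1 / (1 - exp (- x)))" using x by (subst suminf_mult) (auto simp: suminf_geometric intro!: summable_geometric)
  also have "\<dots> = 1 / (exp x - 1)" using x by (simp add: exp_minus field_simps)
  also have "\<dots> \<le> 2 * exp (- (x / 2)) / x" by (rule inverse_exp_minus_1_le[OF x])
  finally have le: "(\<Sum>n<N. exp (- x) * exp (- x) ^ n) \<le> 2 * exp (- (x / 2)) / x" .
  have "norm (\<Sum>n<N. f n x) = x powr (Re s - 1) * (\<Sum>n<N. exp (- x) * exp (- x) ^ n)"
  proof -
   have "0 \<le> (\<Sum>n<N. exp (- x) * exp (- x) ^ n)" by (intro sum_nonneg) auto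
   hence "norm (complex_of_real (\<Sum>n<N. exp (- x) * exp (- x) ^ n)) = (\<Sum>n<N. exp (- x) * exp (- x) ^ n)"
    by (simp only: norm_of_real abs_of_nonneg)
   moreover have "norm (complex_of_real x powr (s - 1)) = x powr (Re s - 1)" using x by (simp add: norm_powr_real_powr)
   ultimately show ?thesis
    unfolding f_def ex sum_distrib_left[symmetric] of_real_sum[symmetric] norm_mult[of "_ powr _"] by simp
  qed
  also have "\<dots> \<le> x powr (Re s - 1) * (2 * exp (- (x / 2)) / x)" by (rule mult_left_mono[OF le]) simp
  also have "\<dots> = 2 * (x powr ((Re s - 1) - 1) * exp (- (1 / 2 * x)))" using x by (simp add: powr_diff power2_eq_square)
  finally show ?thesis .
 qed
 note D = dominated_sums_integral[OF 1 2 3 4]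
 have gi: "integrable halfline g" by (rule D(2))
 have up: "(\<integral>x. g x \<partial>lebesgue_on {1<..}) = zeta_upper s" unfolding g_def zeta_upper_def ..
 have low: "(\<integral>x. g x \<partial>lebesgue_on {0<..1}) = (\<Sum>n. bose_coeff n / (s + of_nat n - 1))" and lows: "summable (\<lambda>n. bose_coeff n / (s + of_nat n - 1))"
 proof -
  define h where "h = (\<lambda>n x. bose_coeff n * complex_of_real x powr (s + of_nat n - 1 - 1))"
  have hi: "integrable (lebesgue_on {0<..1}) (h n)" for n unfolding h_def using s by (intro integrable_mult_right integral_powr_Ioc) simp
  have heq: "h n x = of_real x powr (s - 1 - 1) * (bose_coeff n * of_real x ^ n)" if "x > 0" for n x
  proof -
   have "complex_of_real x powr (s - 1 - 1 + of_nat n) = of_real x powr (s - 1 - 1) * of_real x powr of_nat n" by (rule powr_add)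
   moreover have "complex_of_real x powr of_nat n = of_real x ^ n" using that by (intro powr_nat') auto
   moreover have "s + of_nat n - 1 - 1 = s - 1 - 1 + of_nat n" by simp
   ultimately show ?thesis unfolding h_def by (simp only: mult_ac)
  qed
  have 1: "h n \<in> borel_measurable (lebesgue_on {0<..1})" for n using hi[of n] by auto
  have 2: "(\<lambda>n. h n x) sums g x" if "x \<in> space (lebesgue_on {0<..1})" for x
  proof -
   have x: "x > 0" "x \<le> 1" using that by auto
   have "(\<lambda>n. of_real x powr (s - 1 - 1) * (bose_coeff n * of_real x ^ n)) sums (of_real x powr (s - 1 - 1) * bose (of_real x))"
    using x by (intro sums_mult bose_sums) simp
   moreover have "complex_of_real x powr (s - 1 - 1) * bose (of_real x) = g x"
    using x by (simp add: g_def bose_eq powr_diff exp_of_real power2_eq_square)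
   ultimately show ?thesis by (simp add: heq[OF x(1)])
  qed
  have 3: "integrable (lebesgue_on {0<..1}) (\<lambda>x. norm (complex_of_real x powr (s - 1 - 1)) * (\<Sum>n. norm (bose_coeff n)))"
   using s by (intro integrable_mult_left integrable_norm integral_powr_Ioc) simp
  have 4: "norm (\<Sum>n<N. h n x) \<le> norm (complex_of_real x powr (s - 1 - 1)) * (\<Sum>n. norm (bose_coeff n))" if "x \<in> space (lebesgue_on {0<..1})" for N x
  proof -
   have x: "x > 0" "x \<le> 1" using that by auto
   have "norm (\<Sum>n<N. bose_coeff n * of_real x ^ n) \<le> (\<Sum>n<N. norm (bose_coeff n))"
    using x by (intro order_trans[OF norm_sum] sum_mono) (auto simp: norm_mult norm_power power_le_one mult_left_le)
   also have "\<dots> \<le> (\<Sum>n. norm (bose_coeff n))" by (rule sum_le_suminf[OF summable_bose_coeff]) auto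
   finally have le: "norm (\<Sum>n<N. bose_coeff n * of_real x ^ n) \<le> (\<Sum>n. norm (bose_coeff n))" .
   have "(\<Sum>n<N. h n x) = of_real x powr (s - 1 - 1) * (\<Sum>n<N. bose_coeff n * of_real x ^ n)"
    unfolding sum_distrib_left by (intro sum.cong refl heq x)
   thus ?thesis using le by (simp add: norm_mult mult_left_mono)
  qed
  have v: "(\<integral>x. h n x \<partial>lebesgue_on {0<..1}) = bose_coeff n / (s + of_nat n - 1)" for n
   unfolding h_def integral_mult_right_zero using s by (subst integral_powr_Ioc(2)) auto
  from dominated_sums_integral(1)[OF 1 2 3 4] show "(\<integral>x. g x \<partial>lebesgue_on {0<..1}) = (\<Sum>n. bose_coeff n / (s + of_nat n - 1))"
   "summable (\<lambda>n. bose_coeff n / (s + of_nat n - 1))"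
   unfolding v by (simp_all add: sums_iff)
 qed
 have total: "(\<integral>x. g x \<partial>halfline) = (\<Sum>n. bose_coeff n / (s + of_nat n - 1)) + zeta_upper s"
  using lebesgue_on_split[OF gi, of 1] by (simp add: up low)
 \<comment> \<open>The term of index 0 carries the pole at \<open>s = 1\<close>.\<close>
 have shift: "(\<Sum>n. bose_coeff n / (s + of_nat n - 1)) = 1 / (s - 1) + (\<Sum>n. bose_coeff (Suc n) / (s + of_nat n))"
  using suminf_split_head[OF lows] by (simp add: bose_coeff_0)
 have s1: "summable (\<lambda>n. bose_coeff (Suc n) / (s + of_nat n))"
  using lows by (subst (asm) summable_Suc_iff[symmetric]) simp
 have "rGamma s * (\<Sum>n. bose_coeff (Suc n) / (s + of_nat n)) = (\<Sum>n. bose_coeff (Suc n) * (pochhammer s n * rGamma (s + of_nat n + 1)))"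
 proof (subst suminf_mult[OF s1, symmetric], rule arg_cong[of _ _ suminf], rule ext)
  fix n
  have "s + of_nat n \<noteq> 0" using s by (auto simp: complex_eq_iff)
  moreover have "a * (c / b) = c * d" if "b * d = a" "b \<noteq> 0" for a b c d :: complex
   using that by auto
  ultimately show "rGamma s * (bose_coeff (Suc n) / (s + of_nat n)) = bose_coeff (Suc n) * (pochhammer s n * rGamma (s + of_nat n + 1))"
   using pochhammer_rGamma_shift[of s n] by blast
 qed
 hence key: "rGamma s * (\<integral>x. g x \<partial>halfline) = rGamma s / (s - 1) + zeta_entire s"
  unfolding total shift zeta_entire_def by (simp add: algebra_simps)
 have "(\<lambda>n. Gamma s * (1 / of_nat (Suc n) powr s)) sums (\<integral>x. g x \<partial>halfline)"
  using D(1) unfolding fv .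
 hence "(\<lambda>n. rGamma s * (Gamma s * (1 / of_nat (Suc n) powr s))) sums (rGamma s * (\<integral>x. g x \<partial>halfline))"
  by (rule sums_mult)
 also have "(\<lambda>n. rGamma s * (Gamma s * (1 / of_nat (Suc n) powr s))) = (\<lambda>n. 1 / of_nat (Suc n) powr s)"
  using G by (simp add: rGamma_inverse_Gamma)
 finally show ?thesis unfolding key .
qed

text \<open>\<open>zeta\<close> is a choice term; the explicit continuation shows that the choice is
  not empty, which makes the defining properties available.\<close>

lemma zeta_spec: "zeta holomorphic_on - {1}" "Re s > 1 \<Longrightarrow> (\<lambda>n. 1 / of_nat (Suc n) powr s) sums zeta s"
proof -
 have "(\<lambda>s. rGamma s / (s - 1) + zeta_entire s) holomorphic_on - {1}"
  by (intro holomorphic_intros holomorphic_on_subset[OF holomorphic_zeta_entire]) auto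
 hence ex: "\<exists>f. f holomorphic_on - {1} \<and> (\<forall>s. Re s > 1 \<longrightarrow> (\<lambda>n. 1 / of_nat (Suc n) powr s) sums f s)"
  using zeta_Dirichlet by blast
 from someI_ex[OF ex] show "zeta holomorphic_on - {1}" "Re s > 1 \<Longrightarrow> (\<lambda>n. 1 / of_nat (Suc n) powr s) sums zeta s"
  unfolding zeta_def by auto
qed

text \<open>The plane without the point 1 is connected, so agreement on \<open>Re s > 1\<close>
  determines the chosen function.\<close>

lemma zeta_eq:
 assumes "s \<noteq> 1"
 shows "zeta s = rGamma s / (s - 1) + zeta_entire s"
proof -
 let ?A = "\<lambda>s. rGamma s / (s - 1) + zeta_entire s"
 have "zeta s - (?A s) = 0"
 proof (rule analytic_continuation_open[of "{s. Re s > 1}" "- {1}" "\<lambda>s. zeta s - (?A s)" "\<lambda>_. 0"])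
  show "(\<lambda>s. zeta s - (?A s)) holomorphic_on - {1}"
   by (intro holomorphic_intros zeta_spec holomorphic_on_subset[OF holomorphic_zeta_entire]; simp)
  show "connected (- {1::complex})" using connected_punctured_universe[of "1::complex"] by simp
  show "{s. Re s > 1} \<noteq> {}" by (auto intro!: exI[of _ 2])
  show "zeta s - (?A s) = 0" if "s \<in> {s. Re s > 1}" for s
   using that sums_unique2[OF zeta_spec(2) zeta_Dirichlet, of s] by simp
 qed (use assms in \<open>auto simp: open_halfspace_Re_gt\<close>)
 thus ?thesis by simp
qed

section \<open>The branch of the quotient power\<close>

lemma Arg_csqrt: "a \<noteq> 0 \<Longrightarrow> Arg (csqrt a) = Arg a / 2"
proof -
 assume a: "a \<noteq> 0"
 have "Ln (csqrt a) = Ln a / 2"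
 proof (rule Ln_unique)
  show "exp (Ln a / 2) = csqrt a" using a by (simp add: csqrt_exp_Ln)
  show "- pi < Im (Ln a / 2)" "Im (Ln a / 2) \<le> pi" using mpi_less_Im_Ln[OF a] Im_Ln_le_pi[OF a] by auto
 qed
 thus ?thesis using a by (simp add: Arg_eq_Im_Ln)
qed

lemma abs_Arg_less_half_pi: "z \<noteq> 0 \<Longrightarrow> \<bar>Arg z\<bar> < pi / 2 \<longleftrightarrow> Re z > 0"
 using Re_Ln_pos_lt[of z] by (simp add: Arg_eq_Im_Ln)

lemma sector_iff_Arg: "z \<noteq> 0 \<and> \<bar>Arg z\<bar> < pi / 4 \<longleftrightarrow> \<bar>Im z\<bar> < Re z"
proof
 assume z: "\<bar>Im z\<bar> < Re z"
 hence z0: "z \<noteq> 0" by auto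
 have "csqrt (z\<^sup>2) = z" using z by (intro csqrt_unique) auto
 moreover have "\<bar>Arg (z\<^sup>2)\<bar> < pi / 2" using abs_Arg_less_half_pi[of "z\<^sup>2"] sector_square[OF z] z0 by simp
 ultimately show "z \<noteq> 0 \<and> \<bar>Arg z\<bar> < pi / 4" using Arg_csqrt[of "z\<^sup>2"] z0 by simp
next
 assume z: "z \<noteq> 0 \<and> \<bar>Arg z\<bar> < pi / 4"
 hence "Re z > 0" using abs_Arg_less_half_pi[of z] pi_gt_zero by (simp add: abs_if split: if_splits)
 hence c: "csqrt (z\<^sup>2) = z" by (intro csqrt_unique) auto
 have "\<bar>Arg (z\<^sup>2)\<bar> < pi / 2" using Arg_csqrt[of "z\<^sup>2"] z unfolding c abs_less_iff by simp
 hence "Re (z\<^sup>2) > 0" using abs_Arg_less_half_pi[of "z\<^sup>2"] z by simp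
 thus "\<bar>Im z\<bar> < Re z" using csqrt_sector[of "z\<^sup>2"] unfolding c by simp
qed

lemma zw_region_eq: "zw_region = {(z, w). \<bar>Im z\<bar> < Re z \<and> \<bar>Im w\<bar> < Re w \<and> Re z > Re w}"
 unfolding zw_region_def using sector_iff_Arg by auto

lemma sector_Ln: "\<bar>Im z\<bar> < Re z \<Longrightarrow> \<bar>Im (Ln z)\<bar> < pi / 4"
 using sector_iff_Arg[of z] by (auto simp: Arg_eq_Im_Ln)

lemma shifted_root_sector: "\<bar>Im z\<bar> < Re z \<Longrightarrow> \<bar>Im (shifted_root t z)\<bar> < Re (shifted_root t z)"
 unfolding shifted_root_def by (rule csqrt_sector) (use sector_square in simp)

lemma shifted_root_square: "(shifted_root t z)\<^sup>2 = z\<^sup>2 + \<i> * of_real t"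
 by (simp add: shifted_root_def)

text \<open>If \<open>(z - w) * (z + w)\<close> were a real \<open>r \<le> 0\<close>, then
  \<open>Re (z - w)\<close> would be \<open>r * Re (1 / (z + w))\<close>, which is not
  positive.\<close>

lemma zw_difference_not_nonpos:
 assumes "\<bar>Im z\<bar> < Re z" "\<bar>Im w\<bar> < Re w" "Re z > Re w"
 shows "z\<^sup>2 - w\<^sup>2 \<notin> \<real>\<^sub>\<le>\<^sub>0"
proof
 assume "z\<^sup>2 - w\<^sup>2 \<in> \<real>\<^sub>\<le>\<^sub>0"
 then obtain r where r: "z\<^sup>2 - w\<^sup>2 = of_real r" "r \<le> 0" by (auto elim!: nonpos_Reals_cases)
 have zw: "Re (z + w) > 0" using assms by auto
 have nz: "z + w \<noteq> 0"
 proof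
  assume "z + w = 0"
  hence "Re (z + w) = 0" by simp
  thus False using zw by simp
 qed
 have "(z - w) * (z + w) = of_real r" using r by (simp add: power2_eq_square algebra_simps)
 hence "z - w = of_real r / (z + w)" using nz by (simp add: eq_divide_eq)
 hence "Re (z - w) = Re (of_real r * (1 / (z + w)))" by simp
 also have "\<dots> = r * Re (1 / (z + w))" unfolding times_complex.sel Re_complex_of_real Im_complex_of_real by simp
 finally have "Re (z - w) = r * Re (1 / (z + w))" .
 moreover have "Re (1 / (z + w)) > 0"
 proof -
  have "Re (1 / u) = Re u / (norm u)\<^sup>2" for u :: complex by (simp add: Re_divide cmod_power2)
  moreover have "Re (z + w) / (norm (z + w))\<^sup>2 > 0" by (intro divide_pos_pos zw) (simp add: nz)
  ultimately show ?thesis by (simp only:)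
 qed
 ultimately have "Re (z - w) \<le> 0" using r(2) by (simp add: mult_le_0_iff)
 thus False using assms by simp
qed

text \<open>With \<open>Z\<close> and \<open>W\<close> the shifted roots,
  \<open>Z^2 - W^2 = z^2 - w^2\<close>, hence the quotient is
  \<open>(z^2 - w^2) / (Z + W)^2\<close>. On the region neither \<open>z^2 - w^2\<close> nor
  \<open>Z + W\<close> meets the cut, so the principal logarithms combine to a holomorphic logarithm
  of the quotient on the whole region.\<close>

definition root_quot_branch :: "real \<Rightarrow> complex \<Rightarrow> complex \<times> complex \<Rightarrow> complex" where
 "root_quot_branch t \<nu> = (\<lambda>(z, w). exp (\<nu> * (Ln (z\<^sup>2 - w\<^sup>2) - 2 * Ln (shifted_root t z + shifted_root t w))))"

lemma sector_not_nonpos: "\<bar>Im z\<bar> < Re z \<Longrightarrow> z \<notin> \<real>\<^sub>\<le>\<^sub>0"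
 by (auto simp: complex_nonpos_Reals_iff)

lemma shifted_root_sum_not_nonpos:
 "\<bar>Im z\<bar> < Re z \<Longrightarrow> \<bar>Im w\<bar> < Re w \<Longrightarrow> shifted_root t z + shifted_root t w \<notin> \<real>\<^sub>\<le>\<^sub>0"
 by (intro sector_not_nonpos sector_add shifted_root_sector)

lemma shifted_root_arg_not_nonpos: "\<bar>Im z\<bar> < Re z \<Longrightarrow> z\<^sup>2 + \<i> * of_real t \<notin> \<real>\<^sub>\<le>\<^sub>0"
 using sector_square[of z] by (auto simp: complex_nonpos_Reals_iff)

text \<open>For real \<open>x > y > 0\<close> the first logarithm is real and the second has
  imaginary part below pi/4 in modulus, so their combination is the principal logarithm.\<close>

lemma root_quot_branch_real:
 assumes "0 < y" "y < x"
 shows "root_quot_branch t \<nu> (of_real x, of_real y) = root_quot t (of_real x) (of_real y) powr \<nu>"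
proof -
 let ?A = "x\<^sup>2 - y\<^sup>2"
 define Z W where "Z = shifted_root t (of_real x)" and "W = shifted_root t (of_real y)"
 let ?B = "Ln (of_real ?A) - 2 * Ln (Z + W)"
 have s: "\<bar>Im Z\<bar> < Re Z" "\<bar>Im W\<bar> < Re W" unfolding Z_def W_def using assms by (intro shifted_root_sector; simp)+
 have S: "\<bar>Im (Z + W)\<bar> < Re (Z + W)" by (rule sector_add[OF s])
 have nz: "Z + W \<noteq> 0" using S by (auto simp: complex_eq_iff)
 have d: "x\<^sup>2 - y\<^sup>2 > 0" using assms by (simp add: power_strict_mono)
 have "Z\<^sup>2 - W\<^sup>2 = of_real ?A" unfolding Z_def W_def shifted_root_square by simp
 hence "(Z - W) * (Z + W) = of_real ?A" by (simp add: power2_eq_square algebra_simps)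
 moreover have "(Z - W) / (Z + W) = ((Z - W) * (Z + W)) / (Z + W)\<^sup>2" using nz by (simp add: power2_eq_square)
 ultimately have q: "(Z - W) / (Z + W) = of_real ?A / (Z + W)\<^sup>2" by simp
 have ln: "Ln (of_real ?A / (Z + W)\<^sup>2) = Ln (of_real ?A) - 2 * Ln (Z + W)"
 proof (rule Ln_unique)
  have "exp (2 * Ln (Z + W)) = (Z + W)\<^sup>2" using nz by (simp add: exp_double)
  thus "exp ?B = of_real ?A / (Z + W)\<^sup>2"
   using d by (simp add: exp_diff del: of_real_diff)
  have "Im (Ln (of_real ?A)) = 0" using d by (simp add: Ln_of_real del: of_real_diff)
  thus "- pi < Im ?B" "Im ?B \<le> pi"
   using sector_Ln[OF S] by auto
 qed
 have "of_real ?A / (Z + W)\<^sup>2 \<noteq> 0" using d nz by (simp del: of_real_diff)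
 thus ?thesis unfolding root_quot_branch_def root_quot_def Z_def[symmetric] W_def[symmetric] q
  by (simp only: powr_def ln split if_False) (simp add: Z_def W_def)
qed

lemma continuous_on_csqrt_comp:
 assumes "continuous_on S f" "\<And>x. x \<in> S \<Longrightarrow> f x \<notin> \<real>\<^sub>\<le>\<^sub>0"
 shows "continuous_on S (\<lambda>x. csqrt (f x))"
proof (rule continuous_on_compose2[OF _ assms(1)])
 have "(\<lambda>z. csqrt z) holomorphic_on - \<real>\<^sub>\<le>\<^sub>0" by (intro holomorphic_intros) auto
 thus "continuous_on (- \<real>\<^sub>\<le>\<^sub>0) csqrt" using holomorphic_on_imp_continuous_on by simp
qed (use assms(2) in auto)

lemma root_quot_branch_holomorphic2: "holomorphic2_on (root_quot_branch t \<nu>) zw_region"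
 unfolding holomorphic2_on_def
proof (intro conjI allI)
 have "continuous_on zw_region (\<lambda>p. exp (\<nu> * (Ln ((fst p)\<^sup>2 - (snd p)\<^sup>2) - 2 * Ln (csqrt ((fst p)\<^sup>2 + \<i> * of_real t) + csqrt ((snd p)\<^sup>2 + \<i> * of_real t)))))"
  by (intro continuous_intros continuous_on_csqrt_comp)
    (auto simp: zw_region_eq zw_difference_not_nonpos shifted_root_arg_not_nonpos shifted_root_sum_not_nonpos[unfolded shifted_root_def])
 thus "continuous_on zw_region (root_quot_branch t \<nu>)"
  by (simp add: root_quot_branch_def shifted_root_def case_prod_unfold)
 show "(\<lambda>z. root_quot_branch t \<nu> (z, w)) holomorphic_on {z. (z, w) \<in> zw_region}" for w
  unfolding root_quot_branch_def shifted_root_def split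
  by (intro holomorphic_intros)
    (auto simp: zw_region_eq zw_difference_not_nonpos shifted_root_arg_not_nonpos shifted_root_sum_not_nonpos[unfolded shifted_root_def])
 show "(\<lambda>w. root_quot_branch t \<nu> (z, w)) holomorphic_on {w. (z, w) \<in> zw_region}" for z
  unfolding root_quot_branch_def shifted_root_def split
  by (intro holomorphic_intros)
    (auto simp: zw_region_eq zw_difference_not_nonpos shifted_root_arg_not_nonpos shifted_root_sum_not_nonpos[unfolded shifted_root_def])
qed

lemma convex_sector: "convex {z. \<bar>Im z\<bar> < Re z}" and open_sector: "open {z. \<bar>Im z\<bar> < Re z}"
proof -
 have eq: "{z. \<bar>Im z\<bar> < Re z} = {z. Re ((1 + \<i>) * z) > 0} \<inter> {z. Re ((1 - \<i>) * z) > 0}" by auto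
 have "convex {z. Re (c * z) > 0}" for c
 proof -
  have "Re (c * z) = inner (cnj c) z" for z by (simp add: inner_complex_def)
  thus ?thesis using convex_halfspace_gt[of 0 "cnj c"] by simp
 qed
 thus "convex {z. \<bar>Im z\<bar> < Re z}" unfolding eq by (intro convex_Int)
 show "open {z. \<bar>Im z\<bar> < Re z}" by (intro open_Collect_less continuous_intros)
qed

lemma identity_on_real_segment:
 assumes f: "f holomorphic_on S" and S: "open S" "connected S" and zero: "\<And>x. a < x \<Longrightarrow> x < b \<Longrightarrow> f (of_real x) = 0"
  and x: "a < x0" "x0 < b" "of_real x0 \<in> S" and sub: "\<And>x. a < x \<Longrightarrow> x < b \<Longrightarrow> complex_of_real x \<in> S" and z: "z \<in> S"
 shows "f z = 0"
proof (rule analytic_continuation[OF f S _ x(3) _ _ z])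
 show "complex_of_real ` {a<..<b} \<subseteq> S" using sub by auto
 show "complex_of_real x0 islimpt complex_of_real ` {a<..<b}"
  unfolding islimpt_approachable
 proof (intro allI impI)
  fix e :: real assume e: "e > 0"
  define d where "d = min (e / 2) ((b - x0) / 2)"
  have d: "d > 0" "d < e" "d < b - x0" using e x by (auto simp: d_def min_def)
  show "\<exists>x'\<in>complex_of_real ` {a<..<b}. x' \<noteq> complex_of_real x0 \<and> dist x' (complex_of_real x0) < e"
  proof (intro bexI conjI)
   show "complex_of_real (x0 + d) \<noteq> complex_of_real x0" unfolding of_real_eq_iff using d by simp
   show "dist (complex_of_real (x0 + d)) (complex_of_real x0) < e"
    unfolding dist_of_real using d by (simp add: dist_real_def)
   show "complex_of_real (x0 + d) \<in> complex_of_real ` {a<..<b}" by (rule imageI) (use x d in simp)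
  qed
 qed
qed (use zero in auto)

text \<open>The explicit branch shows that a continuation exists. Uniqueness uses one variable at a
  time, because holomorphy in two variables is given as separate holomorphy.\<close>

lemma root_quot_powr_eq:
 assumes zw: "(z, w) \<in> zw_region"
 shows "root_quot_powr t \<nu> (z, w) = root_quot_branch t \<nu> (z, w)"
proof -
 define Q where "Q = (\<lambda>P. holomorphic2_on P zw_region \<and>
   (\<forall>x y :: real. 0 < y \<and> y < x \<longrightarrow> P (of_real x, of_real y) = root_quot t (of_real x) (of_real y) powr \<nu>))"
 have "Q (root_quot_branch t \<nu>)" unfolding Q_def using root_quot_branch_holomorphic2 root_quot_branch_real by auto
 hence "Q (SOME P. Q P)" by (rule someI[of Q "root_quot_branch t \<nu>"])
 moreover have "root_quot_powr t \<nu> = (SOME P. Q P)" unfolding root_quot_powr_def Q_def ..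
 ultimately have Q: "Q (root_quot_powr t \<nu>)" by simp
 define D where "D = (\<lambda>p. root_quot_powr t \<nu> p - root_quot_branch t \<nu> p)"
 have hol1: "(\<lambda>z. D (z, w)) holomorphic_on {z. (z, w) \<in> zw_region}" for w
  using Q root_quot_branch_holomorphic2[of t \<nu>] unfolding D_def Q_def holomorphic2_on_def by (intro holomorphic_intros) auto
 have hol2: "(\<lambda>w. D (z, w)) holomorphic_on {w. (z, w) \<in> zw_region}" for z
  using Q root_quot_branch_holomorphic2[of t \<nu>] unfolding D_def Q_def holomorphic2_on_def by (intro holomorphic_intros) auto
 have real: "D (of_real x, of_real y) = 0" if "0 < y" "y < x" for x y
  using Q that root_quot_branch_real[of y x t \<nu>] unfolding D_def Q_def by simp
 \<comment> \<open>Continuation in \<open>z\<close> from the real segment beyond a fixed real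
   \<open>y\<close>.\<close>
 have step1: "D (z, of_real y) = 0" if "0 < y" "\<bar>Im z\<bar> < Re z" "y < Re z" for z y
 proof (rule identity_on_real_segment[where f = "\<lambda>z. D (z, complex_of_real y)" and z = z and a = y and b = "y + 2" and ?x0.0 = "y + 1"])
  have eq: "{z. (z, complex_of_real y) \<in> zw_region} = {z. \<bar>Im z\<bar> < Re z} \<inter> {z. Re z > y}"
   using that(1) by (auto simp: zw_region_eq)
  show "(\<lambda>z. D (z, of_real y)) holomorphic_on {z. (z, complex_of_real y) \<in> zw_region}" by (rule hol1)
  show "open {z. (z, complex_of_real y) \<in> zw_region}" unfolding eq by (intro open_Int open_sector open_halfspace_Re_gt)
  show "connected {z. (z, complex_of_real y) \<in> zw_region}" unfolding eq
   by (intro convex_connected convex_Int convex_sector convex_halfspace_Re_gt)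
 qed (use that real in \<open>auto simp: zw_region_eq\<close>)
 have zw': "\<bar>Im z\<bar> < Re z" "\<bar>Im w\<bar> < Re w" "Re w < Re z" using zw by (auto simp: zw_region_eq)
 \<comment> \<open>Continuation in \<open>w\<close> for fixed \<open>z\<close>, from the real
   segment below \<open>Re z\<close>, where the previous step gives the zeros.\<close>
 have "D (z, w) = 0"
 proof (rule identity_on_real_segment[where f = "\<lambda>w. D (z, w)" and z = w and a = 0 and b = "Re z" and ?x0.0 = "Re z / 2"])
  have eq: "{w. (z, w) \<in> zw_region} = {w. \<bar>Im w\<bar> < Re w} \<inter> {w. Re w < Re z}"
   using zw' by (auto simp: zw_region_eq)
  show "(\<lambda>w. D (z, w)) holomorphic_on {w. (z, w) \<in> zw_region}" by (rule hol2)
  show "open {w. (z, w) \<in> zw_region}" unfolding eq by (intro open_Int open_sector open_halfspace_Re_lt)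
  show "connected {w. (z, w) \<in> zw_region}" unfolding eq
   by (intro convex_connected convex_Int convex_sector convex_halfspace_Re_lt)
 qed (use zw' step1 in \<open>auto simp: zw_region_eq\<close>)
 thus ?thesis by (simp add: D_def)
qed

section \<open>The two integral transforms\<close>

lemma csqrt_of_real_mult:
 assumes "r > 0" "Re a > 0"
 shows "csqrt (of_real r * a) = of_real (sqrt r) * csqrt a"
proof (rule csqrt_unique)
 let ?A = "of_real (sqrt r) * csqrt a"
 show "?A\<^sup>2 = of_real r * a"
  using assms by (simp add: power_mult_distrib flip: of_real_power)
 have "Re (csqrt a) > 0" using csqrt_sector[OF assms(2)] abs_ge_zero le_less_trans by blast
 thus "0 < Re ?A \<or> Re ?A = 0 \<and> 0 \<le> Im ?A"
  using assms by simp
qed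

lemma eps8_eq: "eps8 = cis (pi / 4)"
 by (simp add: eps8_def cis_conv_exp)

lemma eps8_power2: "eps8\<^sup>2 = \<i>" "(cnj eps8)\<^sup>2 = - \<i>"
proof -
 show *: "eps8\<^sup>2 = \<i>" unfolding eps8_eq Complex.DeMoivre by simp
 have "(cnj eps8)\<^sup>2 = cnj (eps8\<^sup>2)" by simp
 thus "(cnj eps8)\<^sup>2 = - \<i>" unfolding * by simp
qed

lemma Re_eps8_pos: "Re eps8 > 0"
 unfolding eps8_eq by (simp add: cos_45)

lemma csqrt_imaginary:
 assumes "r > 0"
 shows "csqrt (of_real r * \<i>) = of_real (sqrt r) * eps8" and "csqrt (- (of_real r * \<i>)) = of_real (sqrt r) * cnj eps8"
 using assms Re_eps8_pos
 by (intro csqrt_unique; simp add: power_mult_distrib eps8_power2 flip: of_real_power)+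

lemma Ln_mult_of_small:
 assumes "a \<noteq> 0" "b \<noteq> 0" "\<bar>Im (Ln a) + Im (Ln b)\<bar> < pi"
 shows "Ln (a * b) = Ln a + Ln b"
 using assms by (intro Ln_unique) (auto simp: exp_add abs_less_iff)

lemma Ln_of_real_mult: "r > 0 \<Longrightarrow> a \<noteq> 0 \<Longrightarrow> Ln (of_real r * a) = of_real (ln r) + Ln a"
 by (intro Ln_unique) (auto simp: exp_add mpi_less_Im_Ln Im_Ln_le_pi exp_of_real)

lemma half_plane_Ln: "Re z > 0 \<Longrightarrow> \<bar>Im (Ln z)\<bar> < pi / 2"
 using Re_Ln_pos_lt[of z] by (cases "z = 0") auto

locale bessel_pair =
 fixes \<alpha> \<beta> :: complex
 assumes Re_\<alpha>: "Re \<alpha> > 0" and Re_\<beta>: "Re \<beta> > 0" and Re_less: "Re (csqrt \<beta>) < Re (csqrt \<alpha>)"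
begin

abbreviation root_diff :: complex where "root_diff \<equiv> csqrt \<alpha> - csqrt \<beta>"
abbreviation root_sum :: complex where "root_sum \<equiv> csqrt \<alpha> + csqrt \<beta>"

definition bessel_psi :: "complex \<Rightarrow> complex \<Rightarrow> complex" where
 "bessel_psi \<nu> x = exp (- (of_real pi * (\<alpha> + \<beta>) * x)) * bessel_It \<nu> (of_real pi * (\<alpha> - \<beta>) * x)"

definition psi_inverse_transform :: "complex \<Rightarrow> complex \<Rightarrow> complex" where
 "psi_inverse_transform \<nu> X = (\<integral>x. of_real x powr (\<nu> - 1) * exp (- X / of_real x) * bessel_psi \<nu> (of_real x) \<partial>halfline)"

definition psi_transform :: "complex \<Rightarrow> complex \<Rightarrow> real \<Rightarrow> complex" where
 "psi_transform s \<nu> t = (\<integral>x. of_real x powr (s + \<nu>) * exp (- (2 * of_real pi * \<i> * of_real t * of_real x)) * bessel_psi \<nu> (of_real x) \<partial>halfline)"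

lemma sectors: "\<bar>Im (csqrt \<alpha>)\<bar> < Re (csqrt \<alpha>)" "\<bar>Im (csqrt \<beta>)\<bar> < Re (csqrt \<beta>)"
 using csqrt_sector Re_\<alpha> Re_\<beta> by auto

lemma sqrt_diff_nonzero: "root_diff \<noteq> 0"
 using Re_less by (metis eq_iff_diff_eq_0 less_irrefl)

lemma sqrt_sum_nonzero: "root_sum \<noteq> 0"
 using sector_quotient(2)[OF sectors] .

lemma diff_nonzero: "\<alpha> - \<beta> \<noteq> 0"
 using Re_less by auto

text \<open>The difference of the roots has argument below pi/2 and their sum below pi/4 in modulus,
  so the logarithms add without a jump.\<close>

lemma Ln_diff: "Ln (\<alpha> - \<beta>) = Ln root_diff + Ln root_sum"
proof -
 have "\<alpha> - \<beta> = (csqrt \<alpha>)\<^sup>2 - (csqrt \<beta>)\<^sup>2" by simp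
 also have "\<dots> = root_diff * root_sum" by (simp only: power2_eq_square) (simp only: algebra_simps)
 also have "Ln \<dots> = Ln root_diff + Ln root_sum"
 proof (rule Ln_mult_of_small[OF sqrt_diff_nonzero sqrt_sum_nonzero])
  have "\<bar>Im (Ln root_diff)\<bar> < pi / 2" using Re_less by (intro half_plane_Ln) simp
  moreover have "\<bar>Im (Ln root_sum)\<bar> < pi / 4" by (intro sector_Ln sector_add sectors)
  ultimately show "\<bar>Im (Ln root_diff) + Im (Ln root_sum)\<bar> < pi" by linarith
 qed
 finally show ?thesis .
qed

lemma Ln_quot: "Ln (root_diff / root_sum) = Ln root_diff - Ln root_sum"
proof (rule Ln_unique)
 let ?A = "Ln root_diff - Ln root_sum"
 show "exp ?A = root_diff / root_sum"
  using sqrt_diff_nonzero sqrt_sum_nonzero by (simp add: exp_diff)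
 have "\<bar>Im (Ln root_diff)\<bar> < pi / 2" using Re_less by (intro half_plane_Ln) simp
 moreover have "\<bar>Im (Ln root_sum)\<bar> < pi / 4" by (intro sector_Ln sector_add sectors)
 ultimately show "- pi < Im ?A" "Im ?A \<le> pi"
  by auto
qed

text \<open>The power \<open>(pi * (\<alpha> - \<beta>) / 2) powr \<nu>\<close>: for
  \<open>x > 0\<close>, \<open>amp \<nu> * x powr \<nu>\<close> is the branching factor of
  \<open>bessel_I \<nu>\<close> at \<open>pi * (\<alpha> - \<beta>) * x\<close>.\<close>

definition amp :: "complex \<Rightarrow> complex" where
 "amp \<nu> = exp (\<nu> * (Ln (\<alpha> - \<beta>) + of_real (ln (pi / 2))))"

lemma csqrt_pi: "csqrt (of_real pi * \<alpha>) = of_real (sqrt pi) * csqrt \<alpha>" "csqrt (of_real pi * \<beta>) = of_real (sqrt pi) * csqrt \<beta>"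
 using Re_\<alpha> Re_\<beta> by (simp_all add: csqrt_of_real_mult)

lemma psi_inverse_transform_eq:
 assumes \<nu>: "Re \<nu> > 0" and X: "Re X \<ge> 0"
 shows "psi_inverse_transform \<nu> X = bessel_It \<nu> (of_real (sqrt (2 * pi)) * root_diff * csqrt X) *
   bessel_moment (of_real pi * root_sum\<^sup>2 / 2) X \<nu>"
proof -
 let ?B = "of_real pi * \<beta>"
 let ?A = "of_real pi * \<alpha>"
 have ab: "Re ?A > 0" "Re ?B > 0" using Re_\<alpha> Re_\<beta> by simp_all
 have e1: "of_real (sqrt 2) * (csqrt ?A - csqrt ?B) * csqrt X = of_real (sqrt (2 * pi)) * root_diff * csqrt X"
  unfolding csqrt_pi by (simp add: real_sqrt_mult algebra_simps)
 have "(complex_of_real (sqrt pi))\<^sup>2 = of_real pi" by (simp flip: of_real_power)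
 hence e2: "(csqrt ?A + csqrt ?B)\<^sup>2 / 2 = of_real pi * root_sum\<^sup>2 / 2"
  unfolding csqrt_pi distrib_left[symmetric] power_mult_distrib by simp
 show ?thesis
  using IK_integral[OF ab(2,1) \<nu> X] unfolding e1 e2
  by (simp add: psi_inverse_transform_def bessel_psi_def algebra_simps)
qed

lemma Ln_sqrt_sum: "Ln (of_real pi * root_sum\<^sup>2 / 2) = of_real (ln (pi / 2)) + 2 * Ln root_sum"
proof -
 have "Ln (root_sum\<^sup>2) = Ln root_sum + Ln root_sum"
  unfolding power2_eq_square
 proof (rule Ln_mult_of_small[OF sqrt_sum_nonzero sqrt_sum_nonzero])
  have "\<bar>Im (Ln root_sum)\<bar> < pi / 4" by (intro sector_Ln sector_add sectors)
  thus "\<bar>Im (Ln root_sum) + Im (Ln root_sum)\<bar> < pi" by linarith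
 qed
 moreover have "of_real pi * root_sum\<^sup>2 / 2 = of_real (pi / 2) * root_sum\<^sup>2" by simp
 ultimately show ?thesis using sqrt_sum_nonzero Ln_of_real_mult[of "pi / 2" "root_sum\<^sup>2"] by simp
qed

lemma Re_mu_pos: "Re (of_real pi * root_sum\<^sup>2 / 2) > 0"
 using sector_square[OF sector_add[OF sectors]] by simp

lemma csqrt_mu: "csqrt (of_real pi * root_sum\<^sup>2 / 2) = of_real (sqrt (pi / 2)) * root_sum"
proof (rule csqrt_unique)
 let ?A = "of_real (sqrt (pi / 2)) * root_sum"
 have "(complex_of_real (sqrt (pi / 2)))\<^sup>2 = of_real (pi / 2)" unfolding of_real_power[symmetric] by simp
 thus "?A\<^sup>2 = of_real pi * root_sum\<^sup>2 / 2"
  by (simp add: power_mult_distrib)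
 have "Re root_sum > 0" using sectors by auto
 thus "0 < Re ?A \<or> Re ?A = 0 \<and> 0 \<le> Im ?A"
  by simp
qed

text \<open>The moment form of K and the entire part of I multiply to the inverse transform at
  \<open>X\<close>. The remaining powers of \<open>n\<close>, of \<open>eps8\<close> and of the
  roots cancel except for \<open>amp \<nu>\<close>, once every logarithm of a product is known to
  split.\<close>

lemma bessel_IK_eq_transform:
 assumes \<nu>: "Re \<nu> > 0" and n: "n > 0" and e: "e = eps8 \<and> X = of_real (2 * pi * real n) * \<i> \<or> e = cnj eps8 \<and> X = - (of_real (2 * pi * real n) * \<i>)"
 shows "bessel_I \<nu> (2 * of_real pi * e * (csqrt (of_nat n * \<alpha>) - csqrt (of_nat n * \<beta>)))
    * bessel_K \<nu> (2 * of_real pi * e * (csqrt (of_nat n * \<alpha>) + csqrt (of_nat n * \<beta>))) = amp \<nu> / 2 * psi_inverse_transform \<nu> X"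
proof -
 let ?C = "of_nat n * \<alpha>"
 let ?B = "2 * pi * real n"
 define \<mu> where "\<mu> = of_real pi * root_sum\<^sup>2 / 2"
 let ?A = "\<nu> * (Ln \<mu> - Ln X) / 2"
 have r: "2 * pi * real n > 0" using n by simp
 \<comment> \<open>The eighth root of unity enters as the direction of the principal root of the
   imaginary frequency \<open>X\<close>.\<close>
 have cX: "csqrt X = of_real (sqrt ?B) * e" using e csqrt_imaginary[OF r] by auto
 have X: "X \<noteq> 0" "Re X = 0" using e n by auto
 have sn: "csqrt ?C = of_real (sqrt (real n)) * csqrt \<alpha>" "csqrt (of_nat n * \<beta>) = of_real (sqrt (real n)) * csqrt \<beta>"
  using csqrt_of_real_mult[of "real n" \<alpha>] csqrt_of_real_mult[of "real n" \<beta>] n Re_\<alpha> Re_\<beta> by simp_all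
 have s2: "sqrt (2 * pi) * sqrt ?B = 2 * pi * sqrt (real n)"
  by (simp add: real_sqrt_mult) (metis abs_of_nonneg mult.assoc mult.left_commute pi_ge_zero real_sqrt_mult_self zero_le_numeral)
 define z where "z = 2 * of_real pi * e * (csqrt ?C - csqrt (of_nat n * \<beta>))"
 define w where "w = 2 * of_real pi * e * (csqrt ?C + csqrt (of_nat n * \<beta>))"
 have z: "of_real (sqrt (2 * pi)) * root_diff * csqrt X = z"
 proof -
  have "of_real (sqrt (2 * pi)) * root_diff * csqrt X = of_real (sqrt (2 * pi) * sqrt ?B) * e * root_diff"
   unfolding cX by (simp only: of_real_mult mult_ac)
  thus ?thesis unfolding s2 z_def sn by (simp add: algebra_simps)
 qed
 have w: "2 * csqrt \<mu> * csqrt X = w"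
 proof -
  have "2 * sqrt (pi / 2) = sqrt (2 * pi)" by (simp add: real_sqrt_divide real_sqrt_mult) (simp add: field_simps flip: power2_eq_square)
  hence c: "complex_of_real (sqrt (2 * pi)) = 2 * of_real (sqrt (pi / 2))" by (metis of_real_mult of_real_numeral)
  have "2 * csqrt \<mu> * csqrt X = of_real (sqrt (2 * pi) * sqrt ?B) * e * root_sum"
   unfolding \<mu>_def csqrt_mu cX of_real_mult[of "sqrt (2 * pi)"] c by (simp only: mult_ac)
  thus ?thesis unfolding s2 w_def sn by (simp add: algebra_simps)
 qed
 have \<mu>0: "Re \<mu> > 0" unfolding \<mu>_def by (rule Re_mu_pos)
 have K: "bessel_K \<nu> w = exp ?A * bessel_moment \<mu> X \<nu> / 2"
  unfolding w[symmetric] using X by (intro bessel_K_eq_moment \<mu>0 \<nu>) auto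
 have LX: "Ln (csqrt X) = Ln X / 2" "\<bar>Im (Ln X)\<bar> \<le> pi / 2"
 proof -
  show "\<bar>Im (Ln X)\<bar> \<le> pi / 2" using Re_Ln_pos_le[of X] X by auto
  thus "Ln (csqrt X) = Ln X / 2" using X pi_gt_zero by (intro Ln_unique) (auto simp: csqrt_exp_Ln simp del: pi_gt_zero)
 qed
 have zn: "z \<noteq> 0" using X sqrt_diff_nonzero unfolding z[symmetric] by simp
 have lnz: "Ln (z / 2) = of_real (ln (sqrt (2 * pi) / 2)) + (Ln root_diff + Ln X / 2)"
 proof -
  have "z / 2 = of_real (sqrt (2 * pi) / 2) * (root_diff * csqrt X)" unfolding z[symmetric] by simp
  moreover have "Ln (root_diff * csqrt X) = Ln root_diff + Ln (csqrt X)"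
  proof (rule Ln_mult_of_small[OF sqrt_diff_nonzero])
   have "\<bar>Im (Ln root_diff)\<bar> < pi / 2" using Re_less by (intro half_plane_Ln) simp
   moreover have "\<bar>Im (Ln (csqrt X))\<bar> \<le> pi / 4" unfolding LX(1) using LX(2) by simp
   ultimately show "\<bar>Im (Ln root_diff) + Im (Ln (csqrt X))\<bar> < pi" by linarith
  qed (use X in simp)
  ultimately show ?thesis using Ln_of_real_mult[of "sqrt (2 * pi) / 2" "root_diff * csqrt X"] X sqrt_diff_nonzero LX by simp
 qed
 have lnr: "ln (sqrt (2 * pi) / 2) = ln (pi / 2) / 2"
 proof -
  have "sqrt (2 * pi) / 2 = sqrt (pi / 2)" by (simp add: real_sqrt_divide real_sqrt_mult) (simp add: field_simps)
  thus ?thesis by (simp add: ln_sqrt)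
 qed
 have "bessel_I \<nu> z * bessel_K \<nu> w = exp (\<nu> * Ln (z / 2)) * exp ?A / 2 * (bessel_It \<nu> z * bessel_moment \<mu> X \<nu>)"
  unfolding K bessel_I_eq using zn by (simp add: powr_def)
 also have "exp (\<nu> * Ln (z / 2)) * exp ?A = amp \<nu>"
  unfolding amp_def exp_add[symmetric] lnz lnr \<mu>_def Ln_sqrt_sum Ln_diff
  by (intro arg_cong[of _ _ exp]) (simp add: field_simps)
 also have "bessel_It \<nu> z * bessel_moment \<mu> X \<nu> = psi_inverse_transform \<nu> X"
  using psi_inverse_transform_eq[OF \<nu>, of X] X unfolding z \<mu>_def by simp
 finally show ?thesis unfolding z_def w_def .
qed

text \<open>The summand \<open>\<A>\<close> without the factor \<open>(\<alpha> - \<beta>) powr \<nu>\<close>.\<close>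

definition reduced_A :: "complex \<Rightarrow> complex \<Rightarrow> real \<Rightarrow> complex" where
 "reduced_A s \<nu> t = (let Z = csqrt (\<alpha> + \<i> * of_real t); W = csqrt (\<beta> + \<i> * of_real t) in
   exp (- (1 + 2 * s) * (Ln Z + Ln W) + (2 * s - 2 * \<nu>) * Ln (Z + W)) *
   hyp2F1 (\<nu> - s) (- s) (\<nu> + 1) (((Z - W) / (Z + W))\<^sup>2))"

lemma shifted_sectors: 
 "\<bar>Im (csqrt (\<alpha> + \<i> * of_real t))\<bar> < Re (csqrt (\<alpha> + \<i> * of_real t))"
 "\<bar>Im (csqrt (\<beta> + \<i> * of_real t))\<bar> < Re (csqrt (\<beta> + \<i> * of_real t))"
 using Re_\<alpha> Re_\<beta> by (intro csqrt_sector; simp)+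

text \<open>Both shifted roots and their sum lie in the sector, so all principal powers in
  \<open>\<A>\<close> are exponentials of the same three logarithms; the only other ingredient is
  the continued branch of the quotient power.\<close>

lemma A_eq_reduced: "\<A> s \<nu> (csqrt \<alpha>) (csqrt \<beta>) t = exp (\<nu> * Ln (\<alpha> - \<beta>)) * reduced_A s \<nu> t"
proof -
 define Z W where "Z = csqrt (\<alpha> + \<i> * of_real t)" and "W = csqrt (\<beta> + \<i> * of_real t)"
 let ?B = "\<nu> * (Ln (\<alpha> - \<beta>) - 2 * Ln (Z + W))"
 let ?A = "Ln (Z + W) - (Ln Z + Ln W)"
 have ZW: "\<bar>Im Z\<bar> < Re Z" "\<bar>Im W\<bar> < Re W" unfolding Z_def W_def by (rule shifted_sectors)+
 have S: "\<bar>Im (Z + W)\<bar> < Re (Z + W)" by (rule sector_add[OF ZW])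
 have nz: "Z \<noteq> 0" "W \<noteq> 0" "Z + W \<noteq> 0" using ZW S by (auto simp: complex_eq_iff)
 have sr: "shifted_root t (csqrt \<alpha>) = Z" "shifted_root t (csqrt \<beta>) = W" by (simp_all add: shifted_root_def Z_def W_def)
 have mem: "(csqrt \<alpha>, csqrt \<beta>) \<in> zw_region" using sectors Re_less by (simp add: zw_region_eq)
 have rq: "root_quot_powr t \<nu> (csqrt \<alpha>, csqrt \<beta>) = exp ?B"
  unfolding root_quot_powr_eq[OF mem] by (simp add: root_quot_branch_def sr)
 have sum: "1 / Z + 1 / W = (Z + W) / (Z * W)" using nz by (simp add: field_simps)
 have ln: "Ln ((Z + W) / (Z * W)) = Ln (Z + W) - (Ln Z + Ln W)"
 proof (rule Ln_unique)
  show "exp ?A = (Z + W) / (Z * W)" using nz by (simp add: exp_diff exp_add)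
  show "- pi < Im ?A" "Im ?A \<le> pi"
   using sector_Ln[OF S] sector_Ln[OF ZW(1)] sector_Ln[OF ZW(2)] by auto
 qed
 have p: "(1 / Z + 1 / W) powr (2 * s) = exp (2 * s * ?A)"
  unfolding sum powr_def ln using nz by simp
 have i: "1 / (Z * W) = exp (- (Ln Z + Ln W))" unfolding exp_minus exp_add using nz by (simp add: field_simps)
 have "\<A> s \<nu> (csqrt \<alpha>) (csqrt \<beta>) t = exp (- (Ln Z + Ln W)) * exp (2 * s * ?A) * exp ?B *
   hyp2F1 (\<nu> - s) (- s) (\<nu> + 1) (((Z - W) / (Z + W))\<^sup>2)"
  unfolding \<A>_def rq root_quot_def sr p i ..
 also have "exp (- (Ln Z + Ln W)) * exp (2 * s * ?A) * exp ?B =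
   exp (\<nu> * Ln (\<alpha> - \<beta>)) * exp (- (1 + 2 * s) * (Ln Z + Ln W) + (2 * s - 2 * \<nu>) * Ln (Z + W))"
  unfolding exp_add[symmetric] by (intro arg_cong[of _ _ exp]) (simp add: algebra_simps)
 finally show ?thesis unfolding reduced_A_def Let_def Z_def[symmetric] W_def[symmetric] by (simp only: mult.assoc)
qed

text \<open>The constant in front of the last series of the theorem, with its powers written as
  exponentials; \<open>Acoeff_eq\<close> gives the usual form.\<close>

definition Acoeff :: "complex \<Rightarrow> complex \<Rightarrow> complex" where
 "Acoeff s \<nu> = Gamma (s + \<nu> + 1) * rGamma (\<nu> + 1) * exp (- (3 * s + 2) * of_real (ln 2) - (s + 1) * of_real (ln pi))"

text \<open>The oscillating factor shifts \<open>\<alpha>\<close> and \<open>\<beta>\<close> both by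
  \<open>\<i> * t\<close> and leaves their difference unchanged, so the transform is a Laplace
  integral at shifted parameters, after a scaling by pi.\<close>

lemma psi_transform_eq:
 assumes \<nu>: "Re \<nu> > 0" and u: "Re (s + \<nu> + 1) > 0"
 shows "amp \<nu> / 2 * psi_transform s \<nu> t = Acoeff s \<nu> * exp (\<nu> * Ln (\<alpha> - \<beta>)) * reduced_A s \<nu> t"
proof -
 let ?F = "\<beta> + \<i> * of_real t"
 let ?C = "- (s + \<nu>) * of_real (ln pi)"
 let ?B = "s + \<nu> + 1"
 let ?G = "- ?B * of_real (ln pi)"
 define Z W where "Z = csqrt (\<alpha> + \<i> * of_real t)" and "W = csqrt ?F"
 let ?H = "(Z + W)\<^sup>2 / 2"
 let ?D = "2 * Ln (Z + W) - of_real (ln 2)"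
 let ?A = "2 * of_real (ln 2) + (Ln Z + Ln W) - 2 * Ln (Z + W)"
 have ZW: "\<bar>Im Z\<bar> < Re Z" "\<bar>Im W\<bar> < Re W" unfolding Z_def W_def by (rule shifted_sectors)+
 have S: "\<bar>Im (Z + W)\<bar> < Re (Z + W)" by (rule sector_add[OF ZW])
 have nz: "Z \<noteq> 0" "W \<noteq> 0" "Z + W \<noteq> 0" using ZW S by (auto simp: complex_eq_iff)
 define q where "q = (Z - W) / (Z + W)"
 have q1: "norm (q\<^sup>2) < 1" using sector_quotient(1)[OF ZW] unfolding q_def norm_power by (simp add: power_less_one_iff)
 define f where "f = (\<lambda>x. of_real x powr (s + \<nu>) * (exp (- ((\<alpha> + \<i> * of_real t + ?F) * complex_of_real x)) * bessel_It \<nu> ((\<alpha> + \<i> * of_real t - ?F) * of_real x)))"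
 let ?E = "\<integral>x. f x \<partial>halfline"
 have L: "?E = ?H powr (- ?B) * Gamma ?B * rGamma (\<nu> + 1) * hyp2F1 ?B (s + 1) (\<nu> + 1) (q\<^sup>2)"
  unfolding f_def Z_def W_def q_def using Re_\<alpha> Re_\<beta> by (intro Laplace_integral \<nu> u) simp_all
 have "psi_transform s \<nu> t = (\<integral>x. exp ?C * f (pi * x) \<partial>halfline)"
  unfolding psi_transform_def
 proof (rule Bochner_Integration.integral_cong[OF refl])
  fix x :: real assume "x \<in> space halfline"
  hence x: "x > 0" by simp
  have "complex_of_real (pi * x) powr (s + \<nu>) = exp ((s + \<nu>) * of_real (ln pi)) * of_real x powr (s + \<nu>)"
   using x by (simp add: powr_def Ln_of_real ln_mult distrib_left exp_add flip: of_real_mult)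
  moreover have "exp ?C * exp ((s + \<nu>) * complex_of_real (ln pi)) = 1"
   unfolding exp_add[symmetric] by (simp add: algebra_simps)
  ultimately have e1: "exp ?C * complex_of_real (pi * x) powr (s + \<nu>) = of_real x powr (s + \<nu>)"
   by simp
  have e2: "exp (- ((\<alpha> + \<i> * of_real t + ?F) * complex_of_real (pi * x))) = exp (- (2 * of_real pi * \<i> * of_real t * of_real x)) * exp (- (of_real pi * (\<alpha> + \<beta>) * of_real x))"
   unfolding exp_add[symmetric] by (intro arg_cong[of _ _ exp]) (simp add: algebra_simps)
  have e3: "(\<alpha> + \<i> * of_real t - ?F) * complex_of_real (pi * x) = of_real pi * (\<alpha> - \<beta>) * of_real x"
   by (simp add: algebra_simps)
  show "of_real x powr (s + \<nu>) * exp (- (2 * of_real pi * \<i> * of_real t * of_real x)) * bessel_psi \<nu> (of_real x) = exp ?C * f (pi * x)"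
   unfolding f_def bessel_psi_def e2 e3 e1[symmetric] by (simp only: mult_ac)
 qed
 also have "\<dots> = exp ?C * (?E / of_real pi)"
  unfolding integral_mult_right_zero by (subst lebesgue_on_Ioi_scale(2)) auto
 also have "\<dots> = exp ?G * ?E"
 proof -
  have "exp ?G = exp ?C / of_real pi"
  proof -
   have "- ?B * of_real (ln pi) = - (s + \<nu>) * of_real (ln pi) - complex_of_real (ln pi)" by (simp add: algebra_simps)
   thus ?thesis by (simp only: exp_diff exp_of_real) simp
  qed
  thus ?thesis by simp
 qed
 finally have Pt: "psi_transform s \<nu> t = exp ?G * ?E" .
 have S2: "?H powr (- ?B) = exp (- ?B * ?D)"
 proof -
  have "Ln ?H = 2 * Ln (Z + W) - of_real (ln 2)"
  proof (rule Ln_unique)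
   show "exp ?D = (Z + W)\<^sup>2 / 2" using nz by (simp add: exp_diff exp_double exp_of_real)
   show "- pi < Im ?D" "Im ?D \<le> pi"
    using sector_Ln[OF S] by auto
  qed
  thus ?thesis using nz by (simp add: powr_def)
 qed
 \<comment> \<open>The power of \<open>1 - q^2 = 4 * Z * W / (Z + W)^2\<close> supplied by Euler's
   transformation is the source of the factor \<open>(Z * W)\<close> to the power
   \<open>- (1 + 2 * s)\<close>.\<close>
 have oq: "(1 - q\<^sup>2) powr (- 2 * s - 1) = exp ((- 2 * s - 1) * ?A)"
 proof -
  have "1 - q\<^sup>2 = ((Z + W)\<^sup>2 - (Z - W)\<^sup>2) / (Z + W)\<^sup>2" unfolding q_def power_divide using nz by (simp add: diff_divide_distrib)
  also have "(Z + W)\<^sup>2 - (Z - W)\<^sup>2 = 4 * Z * W" by (simp add: power2_eq_square algebra_simps)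
  finally have eq: "1 - q\<^sup>2 = 4 * Z * W / (Z + W)\<^sup>2" .
  have "Ln (4 * Z * W / (Z + W)\<^sup>2) = 2 * of_real (ln 2) + (Ln Z + Ln W) - 2 * Ln (Z + W)"
  proof (rule Ln_unique)
   have "exp (2 * complex_of_real (ln 2)) = 4" by (simp add: exp_double exp_of_real)
   thus "exp ?A = 4 * Z * W / (Z + W)\<^sup>2" using nz by (simp add: exp_diff exp_add exp_double)
   show "- pi < Im ?A" "Im ?A \<le> pi"
    using sector_Ln[OF S] sector_Ln[OF ZW(1)] sector_Ln[OF ZW(2)] by auto
  qed
  thus ?thesis unfolding eq using nz by (simp add: powr_def)
 qed
 \<comment> \<open>Euler's transformation exchanges the parameters produced by the Laplace integral
   for those of the summand.\<close>
 have hyp: "hyp2F1 ?B (s + 1) (\<nu> + 1) (q\<^sup>2) = (1 - q\<^sup>2) powr (- 2 * s - 1) * hyp2F1 (\<nu> - s) (- s) (\<nu> + 1) (q\<^sup>2)"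
 proof -
  have "hyp2F1 ?B (s + 1) (\<nu> + 1) (q\<^sup>2) = hyp2F1 ((\<nu> + 1) - (\<nu> - s)) ((\<nu> + 1) - (- s)) (\<nu> + 1) (q\<^sup>2)"
   unfolding hyp2F1_def by (simp add: mult_ac add_ac)
  also have "\<dots> = (1 - q\<^sup>2) powr (\<nu> - s + - s - (\<nu> + 1)) * hyp2F1 (\<nu> - s) (- s) (\<nu> + 1) (q\<^sup>2)"
   using \<nu> q1 by (intro hyp2F1_Euler) auto
  also have "\<nu> - s + - s - (\<nu> + 1) = - 2 * s - 1" by simp
  finally show ?thesis .
 qed
 have "amp \<nu> / 2 * psi_transform s \<nu> t = Gamma ?B * rGamma (\<nu> + 1) * 
   (amp \<nu> / 2 * exp ?G * exp (- ?B * ?D) *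
    exp ((- 2 * s - 1) * ?A)) * hyp2F1 (\<nu> - s) (- s) (\<nu> + 1) (q\<^sup>2)"
  unfolding Pt L S2 hyp oq by (simp add: mult_ac)
 also have "amp \<nu> / 2 * exp ?G * exp (- ?B * ?D) *
    exp ((- 2 * s - 1) * ?A) =
   exp (- (3 * s + 2) * of_real (ln 2) - (s + 1) * of_real (ln pi)) * exp (\<nu> * Ln (\<alpha> - \<beta>)) * exp (- (1 + 2 * s) * (Ln Z + Ln W) + (2 * s - 2 * \<nu>) * Ln (Z + W))"
 proof -
  have "amp \<nu> / 2 = exp (\<nu> * (Ln (\<alpha> - \<beta>) + (of_real (ln pi) - of_real (ln 2)))) * exp (- of_real (ln 2))"
   by (simp add: amp_def ln_div exp_minus exp_of_real)
  thus ?thesis unfolding exp_add[symmetric] by (simp only:) (simp add: algebra_simps flip: exp_add)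
 qed
 finally show ?thesis unfolding Acoeff_def reduced_A_def Let_def Z_def[symmetric] W_def[symmetric] q_def by (simp only: mult_ac)
qed

text \<open>At \<open>X = 0\<close> only the constant term of the Bessel series and a Gamma integral
  remain, with \<open>rGamma (\<nu> + 1) * Gamma \<nu> = 1 / \<nu>\<close>.\<close>

lemma psi_inverse_transform_0:
 assumes \<nu>: "Re \<nu> > 0"
 shows "amp \<nu> / 2 * psi_inverse_transform \<nu> 0 = (root_diff / root_sum) powr \<nu> / (2 * \<nu>)"
proof -
 define \<mu> where "\<mu> = of_real pi * root_sum\<^sup>2 / 2"
 have \<mu>0: "Re \<mu> > 0" unfolding \<mu>_def by (rule Re_mu_pos)
 have \<nu>n: "\<nu> \<noteq> 0" using \<nu> by auto
 have "bessel_It \<nu> 0 = rGamma (\<nu> + 1)"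
 proof -
  have "(\<lambda>m. (0 / 2 :: complex) ^ (2 * m) * rGamma (\<nu> + of_nat m + 1) / fact m) sums ((0 / 2) ^ (2 * 0) * rGamma (\<nu> + of_nat 0 + 1) / fact 0)"
   by (rule sums_finite[of "{0}", simplified]) auto
  thus ?thesis using sums_unique2[OF bessel_It_sums[of 0 \<nu>]] by simp
 qed
 moreover have "bessel_moment \<mu> 0 \<nu> = Gamma \<nu> * \<mu> powr (- \<nu>)"
  unfolding bessel_moment_def using Gamma_integral_scaled[OF \<nu> \<mu>0] by simp
 ultimately have e: "psi_inverse_transform \<nu> 0 = rGamma (\<nu> + 1) * (Gamma \<nu> * \<mu> powr (- \<nu>))"
  using psi_inverse_transform_eq[OF \<nu>, of 0] by (simp add: \<mu>_def)
 have G: "rGamma (\<nu> + 1) * Gamma \<nu> = 1 / \<nu>"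
 proof -
  have "\<nu> \<notin> \<int>\<^sub>\<le>\<^sub>0" using \<nu> by (auto elim!: nonpos_Ints_cases)
  hence "Gamma (\<nu> + 1) = \<nu> * Gamma \<nu>" "Gamma \<nu> \<noteq> 0" by (auto simp: Gamma_plus1 Gamma_eq_zero_iff)
  thus ?thesis using \<nu>n by (simp add: rGamma_inverse_Gamma field_simps)
 qed
 have "\<mu> \<noteq> 0" using \<mu>0 by auto
 hence p: "\<mu> powr (- \<nu>) = exp (- \<nu> * (of_real (ln (pi / 2)) + 2 * Ln root_sum))"
  by (simp add: powr_def \<mu>_def Ln_sqrt_sum)
 have "amp \<nu> * \<mu> powr (- \<nu>) = exp (\<nu> * (Ln root_diff - Ln root_sum))"
  unfolding amp_def p exp_add[symmetric] Ln_diff by (intro arg_cong[of _ _ exp]) (simp add: algebra_simps)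
 also have "\<dots> = (root_diff / root_sum) powr \<nu>"
  using sqrt_diff_nonzero sqrt_sum_nonzero by (simp add: powr_def Ln_quot)
 finally have "amp \<nu> / 2 * psi_inverse_transform \<nu> 0 = (rGamma (\<nu> + 1) * Gamma \<nu>) * (root_diff / root_sum) powr \<nu> / 2"
  unfolding e by (simp add: mult_ac)
 thus ?thesis unfolding G by simp
qed

end

section \<open>Poisson summation of the lattice terms\<close>

lemma continuous_on_Ici_of_at_right:
 fixes f :: "real \<Rightarrow> 'a::topological_space"
 assumes "continuous_on {0<..} f" "(f \<longlongrightarrow> f 0) (at_right 0)"
 shows "continuous_on {0..} f"
 unfolding continuous_on_def
proof
 fix x :: real assume x: "x \<in> {0..}"
 show "(f \<longlongrightarrow> f x) (at x within {0..})"
 proof (cases "x = 0")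
  case True thus ?thesis using assms(2) by (simp add: at_within_Ici_at_right)
 next
  case False
  hence "isCont f x" using assms(1) x by (auto simp: continuous_on_eq_continuous_at)
  thus ?thesis unfolding isCont_def by (rule tendsto_within_subset) auto
 qed
qed

lemma powr_times_decay:
 fixes H :: "real \<Rightarrow> complex"
 assumes H: "continuous_on {0<..} H" "\<And>x. x > 0 \<Longrightarrow> norm (H x) \<le> C * exp (- (\<delta> * x))" and \<delta>: "\<delta> > 0"
 shows integrable_powr_times_decay: "Re a > - 1 \<Longrightarrow> integrable halfline (\<lambda>x. of_real x powr a * H x)"
  and powr_times_decay_at_top: "((\<lambda>x. of_real x powr a * H x) \<longlongrightarrow> 0) at_top" (is ?Q)
  and powr_times_decay_at_0: "Re a > 0 \<Longrightarrow> ((\<lambda>x. of_real x powr a * H x) \<longlongrightarrow> 0) (at_right 0)"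
  and continuous_powr_times_decay: "continuous_on {0<..} (\<lambda>x. of_real x powr a * H x)" (is ?S)
proof -
 let ?C = "\<lambda>x. of_real x powr a * H x"
 let ?B = "\<lambda>x. of_real x powr a * H x"
 let ?A = "\<lambda>x. x powr (Re a) * exp (- (\<delta> * x))"
 let ?D = "(\<lambda>x. C * (?A x)) \<longlongrightarrow> 0"
 have bd: "norm (?C x) \<le> C * (?A x)" if "x > 0" for x
 proof -
  have "norm (?C x) \<le> x powr (Re a) * (C * exp (- (\<delta> * x)))"
   unfolding norm_mult using that H(2)[OF that] by (intro mult_mono) (auto simp: norm_powr_real_powr)
  thus ?thesis by (simp add: mult_ac)
 qed
 show c: ?S
  by (intro continuous_intros H) auto
 show "integrable halfline ?B" if "Re a > - 1"
 proof (rule Bochner_Integration.integrable_bound)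
  show "integrable halfline (\<lambda>x. C * (?A x))"
   using integrable_powr_exp_real[of "Re a + 1" \<delta>] that \<delta> by (intro integrable_mult_right) simp
  show "?B \<in> borel_measurable halfline"
   by (rule continuous_imp_measurable_on_sets_lebesgue[OF c]) auto
  show "AE x in halfline. norm (?C x) \<le> norm (C * (?A x))"
   using bd by (intro AE_I2) (simp, smt (verit))
 qed
 show ?Q
 proof (rule Lim_null_comparison)
  show "\<forall>\<^sub>F x in at_top. norm (?C x) \<le> C * (?A x)"
   using eventually_gt_at_top[of 0] by eventually_elim (rule bd)
  show "?D at_top"
   using \<delta> by (intro tendsto_mult_right_zero) real_asymp
 qed
 show "(?B \<longlongrightarrow> 0) (at_right 0)" if a: "Re a > 0"
 proof (rule Lim_null_comparison)
  show "\<forall>\<^sub>F x in at_right 0. norm (?C x) \<le> C * (?A x)"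
   using eventually_at_right_less[of 0] by eventually_elim (rule bd)
  show "?D (at_right 0)"
   using \<delta> a by (intro tendsto_mult_right_zero) real_asymp
 qed
qed

lemma inverse_powr_times_decay:
 fixes H :: "real \<Rightarrow> complex"
 assumes H: "continuous_on {0<..} H" "\<And>x. x > 0 \<Longrightarrow> norm (H x) \<le> C * exp (- (\<delta> * x))" and \<delta>: "\<delta> > 0"
 shows integrable_inverse_powr_times_decay: "Re r > 1 \<Longrightarrow> integrable halfline (\<lambda>y. of_real y powr (- r) * H (1 / y))"
  and inverse_powr_times_decay_at_top: "Re r > 0 \<Longrightarrow> ((\<lambda>y. of_real y powr (- r) * H (1 / y)) \<longlongrightarrow> 0) at_top"
  and inverse_powr_times_decay_at_0: "((\<lambda>y. of_real y powr (- r) * H (1 / y)) \<longlongrightarrow> 0) (at_right 0)" (is ?R)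
  and continuous_inverse_powr_times_decay: "continuous_on {0<..} (\<lambda>y. of_real y powr (- r) * H (1 / y))" (is ?S)
proof -
 let ?D = "\<lambda>y. of_real y powr (- r) * H (1 / y)"
 let ?B = "\<lambda>y. of_real y powr (- r) * H (1 / y)"
 let ?A = "\<lambda>y. y powr (- Re r) * exp (- (\<delta> * (1 / y)))"
 let ?C = "(\<lambda>y. C * (?A y)) \<longlongrightarrow> 0"
 have bd: "norm (?B y) \<le> C * (?A y)" if "y > 0" for y
 proof -
  have "norm (?B y) \<le> y powr (- Re r) * (C * exp (- (\<delta> * (1 / y))))"
   unfolding norm_mult using that H(2)[of "1 / y"] by (intro mult_mono) (auto simp: norm_powr_real_powr)
  thus ?thesis by (simp add: mult_ac)
 qed
 show c: ?S
  by (intro continuous_intros continuous_on_compose2[OF H(1)]) auto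
 show "integrable halfline ?D" if "Re r > 1"
 proof -
  define f where "f = (\<lambda>x::real. of_real x powr (r - 2) * H x)"
  have "integrable halfline f" unfolding f_def using that
   by (intro integrable_powr_times_decay[OF H \<delta>]) auto
  hence "integrable halfline (\<lambda>y. f (1 / y) / of_real (y ^ 2))"
   by (subst lebesgue_on_inverse(1)[OF _ _ inverse_image_Ioi]) auto
  moreover have "f (1 / y) / of_real (y ^ 2) = of_real y powr (- r) * H (1 / y)" if "y \<in> {0<..}" for y
  proof -
   have "complex_of_real (1 / y) powr (r - 2) = of_real y powr (2 - r)"
    using that by (simp add: powr_def Ln_of_real ln_div flip: of_real_divide) (simp add: algebra_simps)
   also have "\<dots> = of_real y powr (- r) * of_real (y ^ 2)"
    using that powr_add[of "complex_of_real y" "- r" 2] by simp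
   finally show ?thesis unfolding f_def using that by simp
  qed
  ultimately show ?thesis by (subst Bochner_Integration.integrable_cong[OF refl]) (auto simp del: of_real_power)
 qed
 show "(?D \<longlongrightarrow> 0) at_top" if r: "Re r > 0"
 proof (rule Lim_null_comparison)
  show "\<forall>\<^sub>F y in at_top. norm (?B y) \<le> C * (?A y)"
   using eventually_gt_at_top[of 0] by eventually_elim (rule bd)
  show "?C at_top"
   using \<delta> r by (intro tendsto_mult_right_zero) real_asymp
 qed
 show ?R
 proof (rule Lim_null_comparison)
  show "\<forall>\<^sub>F y in at_right 0. norm (?B y) \<le> C * (?A y)"
   using eventually_at_right_less[of 0] by eventually_elim (rule bd)
  show "?C (at_right 0)"
   using \<delta> by (intro tendsto_mult_right_zero) real_asymp
 qed
qed

text \<open>\<open>Re u > 1\<close> makes the function and its derivative vanish at 0 and keeps the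
  second derivative, of order \<open>x powr (u - 2)\<close>, integrable there. Infinity is settled
  by the exponential decay.\<close>

lemma poisson_powr_times_decay:
 fixes G G1 G2 :: "real \<Rightarrow> complex"
 assumes d: "\<And>x. x > 0 \<Longrightarrow> (G has_vector_derivative G1 x) (at x)" "\<And>x. x > 0 \<Longrightarrow> (G1 has_vector_derivative G2 x) (at x)"
  and c: "continuous_on {0<..} G2" and \<delta>: "\<delta> > 0"
  and b: "\<And>x. x > 0 \<Longrightarrow> norm (G x) \<le> C * exp (- (\<delta> * x))" "\<And>x. x > 0 \<Longrightarrow> norm (G1 x) \<le> C * exp (- (\<delta> * x))" "\<And>x. x > 0 \<Longrightarrow> norm (G2 x) \<le> C * exp (- (\<delta> * x))"
  and u: "Re u > 1"
 shows "(\<lambda>j. \<integral>x. of_real x powr u * G x * of_real (2 * cos (2 * pi * real (Suc j) * x)) \<partial>halfline) sums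
      ((\<Sum>k. of_real (real (Suc k)) powr u * G (real (Suc k))) - (\<integral>x. of_real x powr u * G x \<partial>halfline))" (is ?P)
  and "summable (\<lambda>k. of_real (real (Suc k)) powr u * G (real (Suc k)))" (is ?Q)
proof -
 let ?A = "\<lambda>x. of_real x powr u * G x"
 have cG: "continuous_on {0<..} G" "continuous_on {0<..} G1"
  using d by (auto intro!: has_vector_derivative_continuous continuous_at_imp_continuous_on)
 note T0 = powr_times_decay[OF cG(1) b(1) \<delta>] and T1 = powr_times_decay[OF cG(2) b(2) \<delta>] and T2 = powr_times_decay[OF c b(3) \<delta>]
 define f1 where "f1 = (\<lambda>x. of_real x powr u * G1 x + u * (of_real x powr (u - 1) * G x))"
 let ?B = "(\<lambda>x. f1 x) \<longlongrightarrow> 0"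
 define f2 where "f2 = (\<lambda>x. (of_real x powr u * G2 x + u * (of_real x powr (u - 1) * G1 x)) + u * (of_real x powr (u - 1) * G1 x + (u - 1) * (of_real x powr (u - 1 - 1) * G x)))"
 have D: "((\<lambda>x. of_real x powr a * K x) has_vector_derivative (of_real x powr a * K' x + a * (of_real x powr (a - 1) * K x))) (at x)"
  if "x > 0" "(K has_vector_derivative K' x) (at x)" for a :: complex and x K K'
  using has_vector_derivative_mult[OF has_vector_derivative_powr_of_real[OF that(1)] that(2)] by (simp add: mult_ac)
 have lim0: "?B (at_right 0)" unfolding f1_def using u
  by (intro tendsto_add_zero tendsto_mult_right_zero T0 T1) auto
 have limt: "?B at_top" unfolding f1_def using u
  by (intro tendsto_add_zero tendsto_mult_right_zero T0 T1)
 have n1: "(?A has_vector_derivative f1 x) (at x)" if "x > 0" for x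
   unfolding f1_def by (rule D[where K = G and K' = G1, OF that d(1)[OF that]])
 have n2: "(f1 has_vector_derivative f2 x) (at x)" if "x > 0" for x
   unfolding f1_def f2_def 
   by (intro has_vector_derivative_add has_vector_derivative_mult_right D that d)
 have n3: "continuous_on {0..} ?A"
   by (rule continuous_on_Ici_of_at_right) (use T0(3,4) u in auto)
 have "f1 0 = 0" by (simp add: f1_def)
 hence n7: "continuous_on {0..} f1"
   by (intro continuous_on_Ici_of_at_right) (use lim0 in \<open>auto simp: f1_def intro!: continuous_on_add continuous_on_mult_left T0(4) T1(4)\<close>)
 have n4: "continuous_on {0<..} f2"
   unfolding f2_def by (intro continuous_on_add continuous_on_mult_left T0(4) T1(4) T2(4))
 have n5: "integrable halfline ?A" using u by (intro T0) auto
 have n6: "integrable halfline f2"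
   unfolding f2_def using u by (intro Bochner_Integration.integrable_add integrable_mult_right T0 T1 T2) auto
 show ?P
  and ?Q
  by (rule poisson_summation_half_line[OF n1 n2 n3 n7 n4 n5 n6 T0(2) limt]; simp)+
qed

text \<open>Here the roles of the ends are exchanged: the factor in \<open>1 / y\<close> is
  exponentially small at 0, and at infinity \<open>Re r > 1\<close> provides the
  integrability.\<close>

lemma poisson_inverse_powr_times_decay:
 fixes G G1 G2 :: "real \<Rightarrow> complex"
 assumes d: "\<And>x. x > 0 \<Longrightarrow> (G has_vector_derivative G1 x) (at x)" "\<And>x. x > 0 \<Longrightarrow> (G1 has_vector_derivative G2 x) (at x)"
  and c: "continuous_on {0<..} G2" and \<delta>: "\<delta> > 0"
  and b: "\<And>x. x > 0 \<Longrightarrow> norm (G x) \<le> C * exp (- (\<delta> * x))" "\<And>x. x > 0 \<Longrightarrow> norm (G1 x) \<le> C * exp (- (\<delta> * x))" "\<And>x. x > 0 \<Longrightarrow> norm (G2 x) \<le> C * exp (- (\<delta> * x))"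
  and r: "Re r > 1"
 shows "(\<lambda>j. \<integral>y. of_real y powr (- r) * G (1 / y) * of_real (2 * cos (2 * pi * real (Suc j) * y)) \<partial>halfline) sums
      ((\<Sum>k. of_real (real (Suc k)) powr (- r) * G (1 / real (Suc k))) - (\<integral>y. of_real y powr (- r) * G (1 / y) \<partial>halfline))"
  and "summable (\<lambda>k. of_real (real (Suc k)) powr (- r) * G (1 / real (Suc k)))"
proof -
 have cG: "continuous_on {0<..} G" "continuous_on {0<..} G1"
  using d by (auto intro!: has_vector_derivative_continuous continuous_at_imp_continuous_on)
 note T0 = inverse_powr_times_decay[OF cG(1) b(1) \<delta>] and T1 = inverse_powr_times_decay[OF cG(2) b(2) \<delta>] and T2 = inverse_powr_times_decay[OF c b(3) \<delta>]
 \<comment> \<open>The derivative of \<open>y powr (- a) * K (1 / y)\<close>. It is a combination of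
   expressions of the same form with \<open>a\<close> raised by 1 and 2, so the second derivative
   comes from the same rule.\<close>
 define D where "D = (\<lambda>a (K :: real \<Rightarrow> complex) (K1 :: real \<Rightarrow> complex) y. - (a * (complex_of_real y powr (- (a + 1)) * K (1 / y))) - complex_of_real y powr (- (a + 2)) * K1 (1 / y))"
 define f1 where "f1 = D r G G1"
 have f1_eq: "f1 = (\<lambda>y. - (r * (complex_of_real y powr (- (r + 1)) * G (1 / y))) - complex_of_real y powr (- (r + 2)) * G1 (1 / y))"
  by (simp add: f1_def D_def)
 define f2 where "f2 = (\<lambda>y. - (r * D (r + 1) G G1 y) - D (r + 2) G1 G2 y)"
 have D: "((\<lambda>y. of_real y powr (- a) * K (1 / y)) has_vector_derivative D a K K' y) (at y)"
  if y: "y > 0" and K: "\<And>x. x > 0 \<Longrightarrow> (K has_vector_derivative K' x) (at x)" for a :: complex and y K K'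
 proof -
  have "((\<lambda>y. 1 / y) has_vector_derivative (- 1 / y\<^sup>2)) (at y)"
   unfolding has_real_derivative_iff_has_vector_derivative[symmetric]
   using y by (auto intro!: derivative_eq_intros simp: power2_eq_square)
  from vector_diff_chain_at[OF this K[of "1 / y"]] have "((\<lambda>y. K (1 / y)) has_vector_derivative ((- 1 / y\<^sup>2) *\<^sub>R K' (1 / y))) (at y)"
   using y by (simp add: o_def)
  from has_vector_derivative_mult[OF has_vector_derivative_powr_of_real[OF y, of "- a"] this]
  have "((\<lambda>y. of_real y powr (- a) * K (1 / y)) has_vector_derivative
   of_real y powr (- a) * ((- 1 / y\<^sup>2) *\<^sub>R K' (1 / y)) + - a * of_real y powr (- a - 1) * K (1 / y)) (at y)" .
  moreover have "complex_of_real y powr (- (a + 2)) = of_real y powr (- a) / of_real (y\<^sup>2)"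
   using y powr_diff[of "complex_of_real y" "- a" 2] by simp
  hence "D a K K' y = of_real y powr (- a) * ((- 1 / y\<^sup>2) *\<^sub>R K' (1 / y)) + - a * of_real y powr (- a - 1) * K (1 / y)"
   by (simp add: D_def scaleR_conv_of_real algebra_simps)
  ultimately show ?thesis by simp
 qed
 have lim0: "(f1 \<longlongrightarrow> 0) (at_right 0)" 
 proof -
  have "((\<lambda>y. - (r * (complex_of_real y powr (- (r + 1)) * G (1 / y))) - complex_of_real y powr (- (r + 2)) * G1 (1 / y)) \<longlongrightarrow> - (r * 0) - 0) (at_right 0)"
   by (intro tendsto_diff tendsto_minus tendsto_mult tendsto_const T0(3) T1(3))
  thus ?thesis by (simp add: f1_def D_def)
 qed
 have limt: "(f1 \<longlongrightarrow> 0) at_top" 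
 proof -
  have "((\<lambda>y. - (r * (complex_of_real y powr (- (r + 1)) * G (1 / y))) - complex_of_real y powr (- (r + 2)) * G1 (1 / y)) \<longlongrightarrow> - (r * 0) - 0) at_top"
   using r by (intro tendsto_diff tendsto_minus tendsto_mult tendsto_const T0(2) T1(2)) auto
  thus ?thesis by (simp add: f1_def D_def)
 qed
 have n1: "((\<lambda>y. of_real y powr (- r) * G (1 / y)) has_vector_derivative f1 x) (at x)" if "x > 0" for x
   unfolding f1_def by (rule D[where K = G and K' = G1, OF that d(1)])
 have n2: "(f1 has_vector_derivative f2 x) (at x)" if "x > 0" for x
   unfolding f1_eq f2_def
   by (intro has_vector_derivative_diff has_vector_derivative_minus has_vector_derivative_mult_right D that d)
 have n3: "continuous_on {0..} (\<lambda>y. of_real y powr (- r) * G (1 / y))"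
   by (rule continuous_on_Ici_of_at_right) (use T0(3,4) in auto)
 have "f1 0 = 0" by (simp add: f1_def D_def)
  moreover have "continuous_on {0<..} f1"
   unfolding f1_def D_def by (intro continuous_on_diff continuous_on_minus continuous_on_mult_left T0(4) T1(4))
 ultimately have n7: "continuous_on {0..} f1"
   by (intro continuous_on_Ici_of_at_right) (use lim0 in auto)
 have n4: "continuous_on {0<..} f2"
   unfolding f2_def D_def by (intro continuous_on_diff continuous_on_minus continuous_on_mult_left T0(4) T1(4) T2(4))
 have n5: "integrable halfline (\<lambda>y. of_real y powr (- r) * G (1 / y))" using r by (intro T0) auto
 have n6: "integrable halfline f2"
   unfolding f2_def D_def using r by (intro Bochner_Integration.integrable_diff Bochner_Integration.integrable_minus integrable_mult_right T0 T1 T2) auto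
 show "(\<lambda>j. \<integral>y. of_real y powr (- r) * G (1 / y) * of_real (2 * cos (2 * pi * real (Suc j) * y)) \<partial>halfline) sums
      ((\<Sum>k. of_real (real (Suc k)) powr (- r) * G (1 / real (Suc k))) - (\<integral>y. of_real y powr (- r) * G (1 / y) \<partial>halfline))"
  and "summable (\<lambda>k. of_real (real (Suc k)) powr (- r) * G (1 / real (Suc k)))"
  using r by (intro poisson_summation_half_line[OF n1 n2 n3 n7 n4 n5 n6 T0(2) limt]; simp)+
qed

section \<open>Poisson summation of the double series in either variable\<close>

context bessel_pair
begin

lemma holomorphic_bessel_psi: "bessel_psi \<nu> holomorphic_on UNIV"
 unfolding bessel_psi_def[abs_def] by (intro holomorphic_intros)

lemma has_vector_derivative_bessel_psi:
 "((\<lambda>x. of_real c ^ j * (deriv ^^ j) (bessel_psi \<nu>) (of_real (c * x))) has_vector_derivative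
   of_real c ^ Suc j * (deriv ^^ Suc j) (bessel_psi \<nu>) (of_real (c * x))) (at x)"
proof -
 let ?f = "(deriv ^^ j) (bessel_psi \<nu>)"
 have "?f holomorphic_on UNIV" by (intro holomorphic_higher_deriv holomorphic_bessel_psi) auto
 hence "(?f has_field_derivative deriv ?f w) (at w)" for w by (rule holomorphic_derivI) auto
 from DERIV_chain2[OF this, of "\<lambda>z. of_real c * z" "of_real c" "of_real x"]
 have "((\<lambda>z. ?f (of_real c * z)) has_field_derivative deriv ?f (of_real c * of_real x) * of_real c) (at (of_real x))"
  by (auto intro!: derivative_eq_intros)
 from has_vector_derivative_real_field[OF this, of UNIV]
 have "((\<lambda>x. ?f (of_real (c * x))) has_vector_derivative deriv ?f (of_real (c * x)) * of_real c) (at x)"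
  by simp
 from has_vector_derivative_mult_right[OF this, of "of_real c ^ j"] show ?thesis by (simp add: mult_ac)
qed

lemma continuous_on_bessel_psi_deriv:
 "continuous_on S (\<lambda>x. of_real c ^ j * (deriv ^^ j) (bessel_psi \<nu>) (of_real (c * x)))"
 by (intro continuous_at_imp_continuous_on ballI has_vector_derivative_continuous[OF has_vector_derivative_bessel_psi])

definition decay :: real where "decay = 2 * pi * min (Re \<alpha>) (Re \<beta>)"

lemma decay_pos: "decay > 0"
 using Re_\<alpha> Re_\<beta> by (simp add: decay_def)

text \<open>Cauchy's inequality on unit discs: a displacement of size 1 changes the exponents by a
  bounded amount, so the derivatives decay at the same rate as the function.\<close>

lemma bessel_psi_deriv_decay:
 assumes \<nu>: "Re \<nu> > 0"
 shows "\<exists>C>0. \<forall>j\<le>2. \<forall>x\<ge>0. norm ((deriv ^^ j) (bessel_psi \<nu>) (of_real x)) \<le> C * exp (- (decay * x))"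
proof -
 let ?C = "\<lambda>x. min (Re \<alpha>) (Re \<beta>) * x"
 let ?B = "\<lambda>z. pi * Re ((\<alpha> + \<beta>) * z)"
 let ?A = "\<lambda>z. of_real pi * (\<alpha> - \<beta>) * z"
 define K where "K = norm (rGamma \<nu>) / Re \<nu> + 1"
 \<comment> \<open>An upper bound for the change of \<open>Re (\<alpha> * z)\<close> and
   \<open>Re (\<beta> * z)\<close> within a unit disc.\<close>
 define L where "L = norm \<alpha> + norm \<beta>"
 have K: "K > 0" using \<nu> by (simp add: K_def add_nonneg_pos)
 define C where "C = 2 * (K * exp (2 * pi * L))"
 have B: "norm (bessel_psi \<nu> z) \<le> K * exp (2 * pi * L) * exp (- (decay * x))" if x: "x \<ge> 0" and z: "norm (of_real x - z) \<le> 1" for x z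
 proof -
  have low: "Re (c * z) \<ge> min (Re \<alpha>) (Re \<beta>) * x - L" if "min (Re \<alpha>) (Re \<beta>) \<le> Re c" "norm c \<le> L" for c
  proof -
   have "Re (c * (of_real x - z)) \<le> norm c * norm (of_real x - z)" by (metis complex_Re_le_cmod norm_mult)
   also have "\<dots> \<le> L * 1" using z that by (intro mult_mono) (auto simp: L_def)
   finally have "Re (c * z) \<ge> Re c * x - L" by (simp add: algebra_simps)
   thus ?thesis using mult_right_mono[OF that(1) x] by linarith
  qed
  have l: "Re (\<alpha> * z) \<ge> min (Re \<alpha>) (Re \<beta>) * x - L" "Re (\<beta> * z) \<ge> min (Re \<alpha>) (Re \<beta>) * x - L"
   by (intro low; simp add: L_def)+
  have "norm (bessel_psi \<nu> z) = exp (- (?B z)) * norm (bessel_It \<nu> (?A z))"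
   by (simp add: bessel_psi_def norm_mult algebra_simps)
  also have "\<dots> \<le> exp (- (?B z)) * (K * exp \<bar>Re (?A z)\<bar>)"
   using norm_bessel_It_le[OF \<nu>, of "of_real pi * (\<alpha> - \<beta>) * z"]
   by (intro mult_left_mono) (auto simp: K_def distrib_right intro: order_trans)
  also have "\<dots> = K * exp (- (?B z) + \<bar>Re (?A z)\<bar>)"
   by (simp only: exp_add mult_ac)
  also have "Re (?A z) = pi * (Re (\<alpha> * z) - Re (\<beta> * z))" by (simp add: algebra_simps)
  also have "- (?B z) + \<bar>pi * (Re (\<alpha> * z) - Re (\<beta> * z))\<bar> = pi * (- (Re (\<alpha> * z) + Re (\<beta> * z)) + \<bar>Re (\<alpha> * z) - Re (\<beta> * z)\<bar>)"
   unfolding abs_mult by (simp add: algebra_simps)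
  also have "K * exp \<dots> \<le> K * exp (pi * (2 * L - 2 * (?C x)))"
  proof -
   have "- (Re (\<alpha> * z) + Re (\<beta> * z)) + \<bar>Re (\<alpha> * z) - Re (\<beta> * z)\<bar> \<le> 2 * L - 2 * (?C x)"
    using l by linarith
   thus ?thesis using K by (intro mult_left_mono) auto
  qed
  also have "pi * (2 * L - 2 * (?C x)) = 2 * pi * L + - (decay * x)" by (simp add: decay_def algebra_simps)
  finally show ?thesis by (simp only: exp_add mult.assoc)
 qed
 show ?thesis
 proof (intro exI[of _ C] conjI allI impI)
  show "C > 0" using K by (simp add: C_def)
 next
  fix j :: nat and x :: real assume j: "j \<le> 2" and x: "x \<ge> 0"
  have "norm ((deriv ^^ j) (bessel_psi \<nu>) (of_real x)) \<le> fact j * (K * exp (2 * pi * L) * exp (- (decay * x))) / 1 ^ j"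
  proof (rule Cauchy_inequality)
   show "bessel_psi \<nu> holomorphic_on ball (of_real x) 1" by (rule holomorphic_on_subset[OF holomorphic_bessel_psi]) auto
   show "continuous_on (cball (of_real x) 1) (bessel_psi \<nu>)"
    by (rule holomorphic_on_imp_continuous_on, rule holomorphic_on_subset[OF holomorphic_bessel_psi]) auto
  qed (use B[OF x] in auto)
  also have "\<dots> \<le> 2 * (K * exp (2 * pi * L) * exp (- (decay * x)))"
  proof -
   have "fact j \<le> (2::real)" using fact_mono[OF j, where 'a = real] by (simp add: numeral_2_eq_2)
   thus ?thesis using K by (simp add: mult_right_mono)
  qed
  finally show "norm ((deriv ^^ j) (bessel_psi \<nu>) (of_real x)) \<le> C * exp (- (decay * x))" by (simp add: C_def mult_ac)
 qed
qed

lemma scaled_bessel_psi_decay: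
 assumes \<nu>: "Re \<nu> > 0" and c: "c > 0"
 shows "\<exists>C. \<forall>j\<le>2. \<forall>x>0. norm (of_real c ^ j * (deriv ^^ j) (bessel_psi \<nu>) (of_real (c * x))) \<le> C * exp (- (decay * c * x))"
proof -
 obtain C where "C > 0" and C': "\<forall>j\<le>2. \<forall>x\<ge>0. norm ((deriv ^^ j) (bessel_psi \<nu>) (of_real x)) \<le> C * exp (- (decay * x))"
  using bessel_psi_deriv_decay[OF \<nu>] by (elim exE conjE)
 show ?thesis
 proof (intro exI[of _ "(1 + c) ^ 2 * C"] allI impI)
  fix j :: nat and x :: real assume j: "j \<le> 2" and x: "x > 0"
  have "c ^ j \<le> (1 + c) ^ j" using c by (intro power_mono) auto
  also have "\<dots> \<le> (1 + c) ^ 2" using c j by (intro power_increasing) auto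
  finally have "c ^ j * norm ((deriv ^^ j) (bessel_psi \<nu>) (of_real (c * x))) \<le> (1 + c) ^ 2 * (C * exp (- (decay * (c * x))))"
   using C'[rule_format, OF j, of "c * x"] c x by (intro mult_mono) auto
  thus "norm (of_real c ^ j * (deriv ^^ j) (bessel_psi \<nu>) (of_real (c * x))) \<le> (1 + c) ^ 2 * C * exp (- (decay * c * x))"
   using c by (simp add: norm_mult norm_power mult_ac)
 qed
qed

definition lattice_term :: "complex \<Rightarrow> complex \<Rightarrow> nat \<Rightarrow> nat \<Rightarrow> complex" where
 "lattice_term s \<nu> d k = of_real (real d) powr (s + \<nu>) * of_real (real k) powr (- (1 + \<nu>)) * bessel_psi \<nu> (of_real (real d / real k))"

text \<open>For fixed \<open>k\<close> the substitution \<open>x = k * y\<close> turns the frequency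
  \<open>j + 1\<close> into the multiple \<open>(j + 1) * k\<close>, with weight
  \<open>k powr s\<close>. Summing over \<open>k\<close> later produces the divisor sums.\<close>

lemma lattice_sum_first:
 assumes \<nu>: "Re \<nu> > 0" and u: "Re (s + \<nu>) > 1" and k: "k > 0"
 shows "(\<lambda>j. of_real (real k) powr s * (psi_transform s \<nu> (real (Suc j * k)) + psi_transform s \<nu> (- real (Suc j * k)))) sums
   ((\<Sum>d. lattice_term s \<nu> (Suc d) k) - of_real (real k) powr s * psi_transform s \<nu> 0)"
proof -
 let ?C = "\<lambda>w. \<integral>y. of_real y powr (s + \<nu>) * bessel_psi \<nu> (of_real y) * w y \<partial>halfline"
 let ?B = "s + \<nu> + 1"
 define c where "c = 1 / real k"
 let ?F = "\<lambda>x w. of_real (c * x) powr (s + \<nu>) * bessel_psi \<nu> (of_real (c * x)) * w (c * x)"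
 have c: "c > 0" using k by (simp add: c_def)
 define G where "G = (\<lambda>j x. of_real c ^ j * (deriv ^^ j) (bessel_psi \<nu>) (of_real (c * x)))"
 let ?E = "\<lambda>w. \<integral>x. of_real x powr (s + \<nu>) * G 0 x * w (c * x) \<partial>halfline"
 let ?D = "\<integral>x. of_real x powr (s + \<nu>) * G 0 x \<partial>halfline"
 let ?A = "\<lambda>real j. \<integral>x. of_real x powr (s + \<nu>) * G 0 x * of_real (2 * cos (2 * pi * real (Suc j) * x)) \<partial>halfline"
 obtain C where "\<forall>j\<le>2. \<forall>x>0. norm (G j x) \<le> C * exp (- (decay * c * x))"
  unfolding G_def using scaled_bessel_psi_decay[OF \<nu> c] by (elim exE)
 hence C: "j \<le> 2 \<Longrightarrow> x > 0 \<Longrightarrow> norm (G j x) \<le> C * exp (- (decay * c * x))" for j x by simp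
 obtain C0 where "\<forall>j\<le>2. \<forall>x\<ge>0. norm ((deriv ^^ j) (bessel_psi \<nu>) (of_real x)) \<le> C0 * exp (- (decay * x))"
  using bessel_psi_deriv_decay[OF \<nu>] by (elim exE conjE)
 hence C0: "norm (bessel_psi \<nu> (of_real x)) \<le> C0 * exp (- (decay * x))" if "x \<ge> 0" for x
  using that by (metis funpow_0 zero_le)
 have G0: "G 0 x = bessel_psi \<nu> (of_real (c * x))" for x by (simp add: G_def)
 have n0: "decay * c > 0" using decay_pos c by simp
 have n1: "(G 0 has_vector_derivative G 1 x) (at x)" for x using has_vector_derivative_bessel_psi[of c 0] by (simp add: G_def)
 have n2: "(G 1 has_vector_derivative G 2 x) (at x)" for x using has_vector_derivative_bessel_psi[of c 1] by (simp add: G_def numeral_2_eq_2)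
 have n3: "continuous_on {0<..} (G 2)" unfolding G_def by (rule continuous_on_bessel_psi_deriv)
 have n4: "norm (G 0 x) \<le> C * exp (- (decay * c * x))" "norm (G 1 x) \<le> C * exp (- (decay * c * x))" "norm (G 2 x) \<le> C * exp (- (decay * c * x))" if "x > 0" for x
  using C[OF _ that] by simp_all
 have P: "(\<lambda>j. \<integral>x. of_real x powr (s + \<nu>) * G 0 x * of_real (2 * cos (2 * pi * real (Suc j) * x)) \<partial>halfline) sums
      ((\<Sum>k. of_real (real (Suc k)) powr (s + \<nu>) * G 0 (real (Suc k))) - ?D)"
  and S: "summable (\<lambda>k. of_real (real (Suc k)) powr (s + \<nu>) * G 0 (real (Suc k)))"
  using u by (intro poisson_powr_times_decay[OF n1 n2 n3 n0 n4]; simp)+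
 have I: "(?E w) =
   of_real (real k) powr ?B * (?C w)" for w :: "real \<Rightarrow> complex"
 proof -
  have "(?E w) =
   (\<integral>x. of_real (real k) powr (s + \<nu>) * (?F x w) \<partial>halfline)"
  proof (rule Bochner_Integration.integral_cong[OF refl])
   fix x assume "x \<in> space halfline"
   hence x: "x > 0" by simp
   have "complex_of_real x = of_real (real k) * of_real (c * x)" using k by (simp add: c_def)
   also have "\<dots> powr (s + \<nu>) = of_real (real k) powr (s + \<nu>) * of_real (c * x) powr (s + \<nu>)"
    by (rule powr_times_real) (use c x in auto)
   finally show "of_real x powr (s + \<nu>) * G 0 x * w (c * x) = of_real (real k) powr (s + \<nu>) * (?F x w)"
    by (simp only: G0 mult.assoc)
  qed
  also have "\<dots> = of_real (real k) powr (s + \<nu>) * ((?C w) / of_real c)"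
   unfolding integral_mult_right_zero using lebesgue_on_Ioi_scale(2)[OF c, of "\<lambda>y. of_real y powr (s + \<nu>) * bessel_psi \<nu> (of_real y) * w y"] by simp
  finally show ?thesis using k by (simp add: c_def powr_add mult_ac)
 qed
 have int: "integrable halfline (\<lambda>x. of_real x powr (s + \<nu>) * (exp (- (2 * of_real pi * \<i> * of_real t * of_real x)) * bessel_psi \<nu> (of_real x)))" for t
 proof (rule integrable_powr_times_decay[OF _ _ decay_pos])
  show "continuous_on {0<..} (\<lambda>x. exp (- (2 * of_real pi * \<i> * of_real t * complex_of_real x)) * bessel_psi \<nu> (of_real x))"
   using continuous_on_bessel_psi_deriv[of "{0<..}" 1 0] by (intro continuous_intros) simp
  show "norm (exp (- (2 * of_real pi * \<i> * of_real t * complex_of_real x)) * bessel_psi \<nu> (of_real x)) \<le> C0 * exp (- (decay * x))" if "x > 0" for x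
   using C0[of x] that by (simp add: norm_mult)
 qed (use u in simp)
 have I0: "?D = of_real (real k) powr ?B * psi_transform s \<nu> 0"
  using I[of "\<lambda>_. 1"] by (simp add: psi_transform_def)
 have Ij: "(?A real j) =
   of_real (real k) powr ?B * (psi_transform s \<nu> (real (Suc j * k)) + psi_transform s \<nu> (- real (Suc j * k)))" for j
 proof -
  define N where "N = real (Suc j * k)"
  have e: "2 * pi * real (Suc j) * x = 2 * pi * N * (c * x)" for x using k by (simp add: N_def c_def field_simps)
  have "(?A real j) =
   of_real (real k) powr ?B * (\<integral>y. of_real y powr (s + \<nu>) * bessel_psi \<nu> (of_real y) * of_real (2 * cos (2 * pi * N * y)) \<partial>halfline)"
   unfolding e by (rule I)
  also have "(\<integral>y. of_real y powr (s + \<nu>) * bessel_psi \<nu> (of_real y) * of_real (2 * cos (2 * pi * N * y)) \<partial>halfline) =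
   (\<integral>x. of_real x powr (s + \<nu>) * (exp (- (2 * of_real pi * \<i> * of_real N * of_real x)) * bessel_psi \<nu> (of_real x)) +
      of_real x powr (s + \<nu>) * (exp (- (2 * of_real pi * \<i> * of_real (- N) * of_real x)) * bessel_psi \<nu> (of_real x)) \<partial>halfline)"
  proof (rule Bochner_Integration.integral_cong[OF refl])
   fix y :: real
   define A where "A = complex_of_real y powr (s + \<nu>)"
   have "complex_of_real (2 * cos (2 * pi * N * y)) = exp (- (2 * of_real pi * \<i> * of_real N * of_real y)) + exp (- (2 * of_real pi * \<i> * of_real (- N) * of_real y))"
    by (simp add: cos_of_real[symmetric] cos_exp_eq mult_ac del: cos_of_real)
   thus "complex_of_real y powr (s + \<nu>) * bessel_psi \<nu> (of_real y) * of_real (2 * cos (2 * pi * N * y)) =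
     of_real y powr (s + \<nu>) * (exp (- (2 * of_real pi * \<i> * of_real N * of_real y)) * bessel_psi \<nu> (of_real y)) +
      of_real y powr (s + \<nu>) * (exp (- (2 * of_real pi * \<i> * of_real (- N) * of_real y)) * bessel_psi \<nu> (of_real y))"
    unfolding A_def[symmetric] by (simp only: distrib_left mult_ac)
  qed
  also have "\<dots> = psi_transform s \<nu> N + psi_transform s \<nu> (- N)"
   by (subst Bochner_Integration.integral_add[OF int int]) (simp add: psi_transform_def mult.assoc)
  finally show ?thesis unfolding N_def .
 qed
 define K where "K = complex_of_real (real k) powr (- (1 + \<nu>))"
 have L: "K * (of_real (real (Suc d)) powr (s + \<nu>) * G 0 (real (Suc d))) = lattice_term s \<nu> (Suc d) k" for d
  by (simp add: lattice_term_def G0 K_def c_def mult_ac)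
 have kk: "K * (of_real (real k) powr ?B * z) = of_real (real k) powr s * z" for z
 proof -
  have "K * of_real (real k) powr ?B = of_real (real k) powr (- (1 + \<nu>) + ?B)" unfolding K_def by (rule powr_add[symmetric])
  thus ?thesis by (simp add: mult.assoc[symmetric])
 qed
 from sums_mult[OF P, of K] show ?thesis
  unfolding Ij I0 right_diff_distrib suminf_mult[OF S, symmetric] L kk .
qed

text \<open>For fixed \<open>d\<close> the substitution \<open>x = d / y\<close> turns the cosine
  into the two kernels \<open>exp (- X / y)\<close> with imaginary \<open>X\<close> of opposite
  sign, at the multiples \<open>(j + 1) * d\<close> and with weight \<open>d powr s\<close>.\<close>

lemma lattice_sum_second:
 assumes \<nu>: "Re \<nu> > 0" and d: "d > 0"
 shows "(\<lambda>j. of_real (real d) powr s * (psi_inverse_transform \<nu> (of_real (2 * pi * real (Suc j * d)) * \<i>) + psi_inverse_transform \<nu> (- (of_real (2 * pi * real (Suc j * d)) * \<i>)))) sums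
   ((\<Sum>k. lattice_term s \<nu> d (Suc k)) - of_real (real d) powr s * psi_inverse_transform \<nu> 0)"
proof -
 let ?B = "\<lambda>real j d. \<integral>y. of_real y powr (\<nu> - 1) * bessel_psi \<nu> (of_real y) * of_real (2 * cos (2 * pi * real (Suc j * d) * (1 / y))) \<partial>halfline"
 let ?A = "- (1 + \<nu>)"
 define c where "c = real d"
 have c: "c > 0" using d by (simp add: c_def)
 define G where "G = (\<lambda>j x. of_real c ^ j * (deriv ^^ j) (bessel_psi \<nu>) (of_real (c * x)))"
 let ?E = "\<lambda>w. \<integral>x. of_real x powr ?A * G 0 (1 / x) * w (x / c) \<partial>halfline"
 let ?D = "\<integral>x. of_real x powr ?A * G 0 (1 / x) \<partial>halfline"
 let ?C = "\<lambda>real j. \<integral>x. of_real x powr ?A * G 0 (1 / x) * of_real (2 * cos (2 * pi * real (Suc j) * x)) \<partial>halfline"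
 obtain C where "\<forall>j\<le>2. \<forall>x>0. norm (G j x) \<le> C * exp (- (decay * c * x))"
  unfolding G_def using scaled_bessel_psi_decay[OF \<nu> c] by (elim exE)
 hence C: "j \<le> 2 \<Longrightarrow> x > 0 \<Longrightarrow> norm (G j x) \<le> C * exp (- (decay * c * x))" for j x by simp
 obtain C0 where "\<forall>j\<le>2. \<forall>x\<ge>0. norm ((deriv ^^ j) (bessel_psi \<nu>) (of_real x)) \<le> C0 * exp (- (decay * x))"
  using bessel_psi_deriv_decay[OF \<nu>] by (elim exE conjE)
 hence C0: "norm (bessel_psi \<nu> (of_real x)) \<le> C0 * exp (- (decay * x))" if "x \<ge> 0" for x
  using that by (metis funpow_0 zero_le)
 have G0: "G 0 x = bessel_psi \<nu> (of_real (c * x))" for x by (simp add: G_def)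
 have n0: "decay * c > 0" using decay_pos c by simp
 have n1: "(G 0 has_vector_derivative G 1 x) (at x)" for x using has_vector_derivative_bessel_psi[of c 0] by (simp add: G_def)
 have n2: "(G 1 has_vector_derivative G 2 x) (at x)" for x using has_vector_derivative_bessel_psi[of c 1] by (simp add: G_def numeral_2_eq_2)
 have n3: "continuous_on {0<..} (G 2)" unfolding G_def by (rule continuous_on_bessel_psi_deriv)
 have n4: "norm (G 0 x) \<le> C * exp (- (decay * c * x))" "norm (G 1 x) \<le> C * exp (- (decay * c * x))" "norm (G 2 x) \<le> C * exp (- (decay * c * x))" if "x > 0" for x
  using C[OF _ that] by simp_all
 have P: "(\<lambda>j. \<integral>x. of_real x powr ?A * G 0 (1 / x) * of_real (2 * cos (2 * pi * real (Suc j) * x)) \<partial>halfline) sums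
      ((\<Sum>k. of_real (real (Suc k)) powr ?A * G 0 (1 / real (Suc k))) - ?D)"
  and S: "summable (\<lambda>k. of_real (real (Suc k)) powr ?A * G 0 (1 / real (Suc k)))"
  using \<nu> by (intro poisson_inverse_powr_times_decay[OF n1 n2 n3 n0 n4]; simp)+
 have I: "(?E w) =
   of_real c powr (- \<nu>) * (\<integral>y. of_real y powr (\<nu> - 1) * bessel_psi \<nu> (of_real y) * w (1 / y) \<partial>halfline)" for w :: "real \<Rightarrow> complex"
 proof -
  define f where "f = (\<lambda>y. of_real y powr (\<nu> - 1) * bessel_psi \<nu> (of_real y) * w (1 / y))"
  have "(?E w) =
    (\<integral>x. of_real c powr (1 - \<nu>) * f (c * (1 / x)) / of_real (x ^ 2) \<partial>halfline)"
  proof (rule Bochner_Integration.integral_cong[OF refl])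
   fix x assume "x \<in> space halfline"
   hence x: "x > 0" by simp
   have "complex_of_real (c * (1 / x)) powr (\<nu> - 1) = exp ((\<nu> - 1) * of_real (ln c - ln x))"
    using c x by (simp add: powr_def Ln_of_real ln_div flip: of_real_divide)
   moreover have "complex_of_real c powr (1 - \<nu>) = exp ((1 - \<nu>) * of_real (ln c))" 
    using c by (simp add: powr_def Ln_of_real)
   moreover have "complex_of_real x powr ?A = exp (- (1 + \<nu>) * of_real (ln x))" using x by (simp add: powr_def Ln_of_real)
   moreover have "exp (- (1 + \<nu>) * complex_of_real (ln x)) = exp ((1 - \<nu>) * of_real (ln c)) * exp ((\<nu> - 1) * of_real (ln c - ln x)) / of_real (x ^ 2)"
   proof -
    have e: "complex_of_real (x ^ 2) = exp (2 * of_real (ln x))" using x by (simp add: exp_double exp_of_real)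
    show ?thesis unfolding e exp_add[symmetric] exp_diff[symmetric] by (intro arg_cong[of _ _ exp]) (simp add: algebra_simps)
   qed
   ultimately have "complex_of_real x powr ?A = of_real c powr (1 - \<nu>) * complex_of_real (c * (1 / x)) powr (\<nu> - 1) / of_real (x ^ 2)"
    by simp
   thus "of_real x powr ?A * G 0 (1 / x) * w (x / c) = of_real c powr (1 - \<nu>) * f (c * (1 / x)) / of_real (x ^ 2)"
    unfolding f_def G0 by simp
  qed
  also have "\<dots> = (\<integral>x. of_real c powr (1 - \<nu>) * f (c * x) \<partial>halfline)"
   using lebesgue_on_inverse(2)[OF _ _ inverse_image_Ioi, of "\<lambda>x. of_real c powr (1 - \<nu>) * f (c * x)"] by simp
  also have "\<dots> = of_real c powr (1 - \<nu>) * ((\<integral>y. f y \<partial>halfline) / of_real c)"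
   unfolding integral_mult_right_zero lebesgue_on_Ioi_scale(2)[OF c] ..
  also have "of_real c powr (1 - \<nu>) = of_real c powr (- \<nu>) * complex_of_real c"
   using c powr_add[of "complex_of_real c" "- \<nu>" 1] by simp
  finally show ?thesis unfolding f_def using c by simp
 qed
 have int: "integrable halfline (\<lambda>x. of_real x powr (\<nu> - 1) * (exp (- X / of_real x) * bessel_psi \<nu> (of_real x)))" if X: "Re X = 0" for X
 proof (rule integrable_powr_times_decay[OF _ _ decay_pos])
  show "continuous_on {0<..} (\<lambda>x. exp (- X / complex_of_real x) * bessel_psi \<nu> (of_real x))"
   using continuous_on_bessel_psi_deriv[of "{0<..}" 1 0] by (intro continuous_intros) auto
  show "norm (exp (- X / complex_of_real x) * bessel_psi \<nu> (of_real x)) \<le> C0 * exp (- (decay * x))" if "x > 0" for x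
   using C0[of x] that X by (simp add: norm_mult Re_divide_of_real)
 qed (use \<nu> in simp)
 have I0: "?D = of_real c powr (- \<nu>) * psi_inverse_transform \<nu> 0"
  using I[of "\<lambda>_. 1"] by (simp add: psi_inverse_transform_def)
 have Ij: "(?C real j) =
   of_real c powr (- \<nu>) * (psi_inverse_transform \<nu> (of_real (2 * pi * real (Suc j * d)) * \<i>) + psi_inverse_transform \<nu> (- (of_real (2 * pi * real (Suc j * d)) * \<i>)))" for j
 proof -
  define X where "X = of_real (2 * pi * real (Suc j * d)) * \<i>"
  have X: "Re X = 0" "Re (- X) = 0" by (simp_all add: X_def)
  have e: "2 * pi * real (Suc j) * x = 2 * pi * real (Suc j * d) * (x / c)" for x using d by (simp add: c_def field_simps)
  have "(?C real j) =
   of_real c powr (- \<nu>) * (?B real j d)"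
   unfolding e by (rule I)
  also have "(?B real j d) =
   (\<integral>x. of_real x powr (\<nu> - 1) * (exp (- X / of_real x) * bessel_psi \<nu> (of_real x)) +
      of_real x powr (\<nu> - 1) * (exp (- (- X) / of_real x) * bessel_psi \<nu> (of_real x)) \<partial>halfline)"
  proof (rule Bochner_Integration.integral_cong[OF refl])
   fix y :: real
   define A where "A = complex_of_real y powr (\<nu> - 1)"
   define \<theta> where "\<theta> = 2 * pi * real (Suc j * d) * (1 / y)"
   have "X / of_real y = \<i> * of_real \<theta>" by (simp add: X_def \<theta>_def)
   hence "complex_of_real (2 * cos \<theta>) = exp (- X / of_real y) + exp (- (- X) / of_real y)"
    by (simp add: cos_of_real[symmetric] cos_exp_eq mult_ac del: cos_of_real)
   thus "complex_of_real y powr (\<nu> - 1) * bessel_psi \<nu> (of_real y) * of_real (2 * cos (2 * pi * real (Suc j * d) * (1 / y))) =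
     of_real y powr (\<nu> - 1) * (exp (- X / of_real y) * bessel_psi \<nu> (of_real y)) +
      of_real y powr (\<nu> - 1) * (exp (- (- X) / of_real y) * bessel_psi \<nu> (of_real y))"
    unfolding A_def[symmetric] \<theta>_def[symmetric] by (simp only: distrib_left mult_ac)
  qed
  also have "\<dots> = psi_inverse_transform \<nu> X + psi_inverse_transform \<nu> (- X)"
   by (subst Bochner_Integration.integral_add[OF int[OF X(1)] int[OF X(2)]]) (simp add: psi_inverse_transform_def mult.assoc)
  finally show ?thesis unfolding X_def .
 qed
 define K where "K = complex_of_real c powr (s + \<nu>)"
 have L: "K * (of_real (real (Suc k)) powr ?A * G 0 (1 / real (Suc k))) = lattice_term s \<nu> d (Suc k)" for k
  by (simp add: lattice_term_def G0 K_def c_def mult_ac)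
 have kk: "K * (of_real c powr (- \<nu>) * z) = of_real (real d) powr s * z" for z
 proof -
  have "K * of_real c powr (- \<nu>) = of_real c powr (s + \<nu> + - \<nu>)" unfolding K_def by (rule powr_add[symmetric])
  thus ?thesis by (simp add: mult.assoc[symmetric] c_def)
 qed
 from sums_mult[OF P, of K] show ?thesis
  unfolding Ij I0 right_diff_distrib suminf_mult[OF S, symmetric] L kk .
qed

end

section \<open>Divisor sums and decay of the Bessel products\<close>

lemma infsum_double_nat:
 fixes f :: "nat \<times> nat \<Rightarrow> complex"
 assumes f: "f summable_on UNIV"
 shows "(\<lambda>m. \<Sum>j. f (m, j)) sums infsum f UNIV"
proof -
 let ?A = "\<lambda>m. infsum (\<lambda>j. f (m, j)) UNIV"
 have f': "(\<lambda>(x, y). f (x, y)) summable_on UNIV \<times> UNIV" using f by simp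
 have row: "(\<lambda>j. f (m, j)) summable_on UNIV" for m
  using summable_on_Sigma_banach[OF f'] summable_on_SigmaD1[of "\<lambda>m j. f (m, j)" UNIV "\<lambda>_. UNIV" m] f by simp
 have "?A summable_on UNIV"
  using summable_on_Sigma_banach[OF f'] by simp
 from infsum_nat_eq_suminf(2)[OF this] have "?A sums infsum ?A UNIV" .
 moreover have "infsum ?A UNIV = infsum f UNIV"
  using infsum_Sigma'_banach[OF f'] by simp
 ultimately show ?thesis by (simp add: infsum_nat_eq_suminf(1)[OF row])
qed

text \<open>Pairs of positive integers correspond to a product together with its first factor as a
  divisor.\<close>

lemma sums_divisor_pairs:
 fixes f :: "nat \<Rightarrow> nat \<Rightarrow> complex"
 assumes f: "(\<lambda>(d, j). f (Suc d) (Suc j)) summable_on UNIV"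
 shows "(\<lambda>n. \<Sum>d | d dvd Suc n. f d (Suc n div d)) sums infsum (\<lambda>(d, j). f (Suc d) (Suc j)) UNIV"
proof -
 let ?h = "\<lambda>(d, j). f (Suc d) (Suc j)"
 let ?S = "Sigma (UNIV :: nat set) (\<lambda>n. {d. d dvd Suc n})"
 \<comment> \<open>All indices start at 0, so the pair \<open>(d, j)\<close> stands for the factors
   \<open>d + 1\<close> and \<open>j + 1\<close> and goes to their product minus 1.\<close>
 let ?p = "\<lambda>(d, j). (Suc d * Suc j - 1, Suc d)"
 have "bij_betw ?p (UNIV :: (nat \<times> nat) set) ?S"
 proof (rule bij_betwI[of _ _ _ "\<lambda>(n, d). (d - 1, Suc n div d - 1)"])
  show "?p \<in> UNIV \<rightarrow> ?S" by (auto simp del: mult_Suc mult_Suc_right)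
  show "(case ?p x of (n, d) \<Rightarrow> (d - 1, Suc n div d - 1)) = x" for x
   by (cases x) (simp add: nonzero_mult_div_cancel_left del: mult_Suc mult_Suc_right)
  show "?p (case y of (n, d) \<Rightarrow> (d - 1, Suc n div d - 1)) = y" if "y \<in> ?S" for y
  proof -
   obtain n d where y: "y = (n, d)" "d dvd Suc n" using \<open>y \<in> ?S\<close> by auto
   then obtain k where k: "Suc n = d * k" by (elim dvdE)
   hence "d > 0" "k > 0" by (metis mult_is_0 nat.distinct(1) neq0_conv)+
   hence "Suc n div d = k" "Suc (d - 1) = d" "Suc (k - 1) = k" using k by auto
   thus ?thesis unfolding y(1) by (simp only: prod.case k[symmetric]) simp
  qed
 qed auto
 from has_sum_reindex_bij_betw[OF this, of "\<lambda>(n, d). f d (Suc n div d)" "infsum ?h UNIV"]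
 have "((\<lambda>(n, d). f d (Suc n div d)) has_sum infsum ?h UNIV) ?S \<longleftrightarrow> ((\<lambda>x. (case ?p x of (n, d) \<Rightarrow> f d (Suc n div d))) has_sum infsum ?h UNIV) UNIV"
  by simp
 moreover have "(\<lambda>x. (case ?p x of (n, d) \<Rightarrow> f d (Suc n div d))) = ?h"
  by (auto simp: fun_eq_iff nonzero_mult_div_cancel_left simp del: mult_Suc mult_Suc_right)
 ultimately have S: "((\<lambda>(n, d). f d (Suc n div d)) has_sum infsum ?h UNIV) ?S"
  using f by simp
 have "((\<lambda>n. \<Sum>d | d dvd Suc n. f d (Suc n div d)) has_sum infsum ?h UNIV) UNIV"
  by (rule has_sum_SigmaD[OF S]) (auto intro!: has_sum_finiteI)
 thus ?thesis by (rule has_sum_imp_sums)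
qed

lemma summable_on_nat_of_nonneg:
 fixes f :: "nat \<Rightarrow> real"
 assumes "summable f" "\<And>n. f n \<ge> 0"
 shows "f summable_on UNIV"
 using assms by (intro norm_summable_imp_summable_on) simp

lemma summable_Suc_powr: "p > 1 \<Longrightarrow> summable (\<lambda>n. real (Suc n) powr (- p))"
 using summable_Suc_iff[of "\<lambda>n. real n powr (- p)"] by (simp add: summable_real_powr_iff)

lemma summable_divisor_majorant:
 assumes "p > 1" "q > 1"
 shows "summable (\<lambda>n. \<Sum>d | d dvd Suc n. real d powr (- p) * real (Suc n div d) powr (- q))"
proof -
 define f where "f = (\<lambda>d m. complex_of_real (real d powr (- p) * real m powr (- q)))"
 have "(\<lambda>(d, j). f (Suc d) (Suc j)) summable_on UNIV \<times> UNIV"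
  by (rule summable_on_product_bound[of "\<lambda>d. real (Suc d) powr (- p)" _ "\<lambda>j. real (Suc j) powr (- q)"])
    (auto simp: f_def norm_mult simp del: of_nat_Suc intro!: summable_on_nat_of_nonneg summable_Suc_powr assms)
 hence "summable (\<lambda>n. \<Sum>d | d dvd Suc n. f d (Suc n div d))"
  using sums_divisor_pairs[of f] by (auto simp: sums_iff)
 moreover have "(\<Sum>d | d dvd Suc n. f d (Suc n div d)) = of_real (\<Sum>d | d dvd Suc n. real d powr (- p) * real (Suc n div d) powr (- q))" for n
  by (simp add: f_def)
 ultimately show ?thesis by (simp only: summable_complex_of_real)
qed

text \<open>The power of \<open>n\<close> is distributed over the two factors \<open>d\<close> and
  \<open>n div d\<close>, which leaves a divisor sum of a product majorant.\<close>

lemma norm_divisor_sigma_le: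
 assumes n: "n > 0" and F: "norm F \<le> C * real n powr (- q)" and C: "C \<ge> 0"
 shows "norm (divisor_sigma s n * F) \<le> C * (\<Sum>d | d dvd n. real d powr (- (q - Re s)) * real (n div d) powr (- q))"
proof -
 have "norm (divisor_sigma s n) \<le> (\<Sum>d | d dvd n. norm (of_nat d powr s))"
  unfolding divisor_sigma_def by (rule norm_sum)
 hence "norm (divisor_sigma s n * F) \<le> (\<Sum>d | d dvd n. norm (of_nat d powr s)) * (C * real n powr (- q))"
  unfolding norm_mult using F by (intro mult_mono) (auto intro: sum_nonneg)
 also have "\<dots> = (\<Sum>d | d dvd n. C * (norm (of_nat d powr s) * real n powr (- q)))"
  by (simp add: sum_distrib_right sum_distrib_left mult_ac)
 also have "\<dots> = (\<Sum>d | d dvd n. C * (real d powr (- (q - Re s)) * real (n div d) powr (- q)))"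
 proof (rule sum.cong[OF refl])
  fix d assume "d \<in> {d. d dvd n}"
  then obtain k where k: "n = d * k" by auto
  hence d: "d > 0" "k > 0" using n by auto
  have "norm (complex_of_nat d powr s) = real d powr Re s"
   using norm_powr_real_powr[of "of_nat d" s] by simp
  moreover have "real n powr (- q) = real d powr (- q) * real (n div d) powr (- q)"
   using d by (simp add: k powr_mult)
  moreover have "real d powr Re s * real d powr (- q) = real d powr (- (q - Re s))" by (simp add: powr_add[symmetric])
  ultimately show "C * (norm (complex_of_nat d powr s) * real n powr (- q)) = C * (real d powr (- (q - Re s)) * real (n div d) powr (- q))"
   by (simp only: mult.assoc[symmetric])
 qed
 finally show ?thesis by (simp add: sum_distrib_left)
qed

text \<open>With \<open>n = (j + 1) * (d + 1)\<close> the terms are bounded by the product of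
  \<open>(d + 1) powr (Re s - p)\<close> and \<open>(j + 1) powr (- p)\<close>, both summable, so
  the double series may be regrouped by the value of the product.\<close>

lemma sigma_double_series:
 assumes F: "\<And>n. n > 0 \<Longrightarrow> norm (F n) \<le> C * real n powr (- p)" and C: "C \<ge> 0" and p: "p > 1" "p - Re s > 1"
 shows "summable (\<lambda>n. divisor_sigma s (Suc n) * F (Suc n))" (is ?P)
  and "(\<lambda>d. \<Sum>j. of_real (real (Suc d)) powr s * F (Suc j * Suc d)) sums (\<Sum>n. divisor_sigma s (Suc n) * F (Suc n))" (is ?Q)
  and "summable (\<lambda>j. of_real (real (Suc d)) powr s * F (Suc j * Suc d))" (is ?R)
proof -
 define f where "f = (\<lambda>d m. of_real (real d) powr s * F (m * d))"
 have "(\<lambda>(d, j). f (Suc d) (Suc j)) summable_on UNIV \<times> UNIV"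
 proof (rule summable_on_product_bound[of "\<lambda>d. C * real (Suc d) powr (- (p - Re s))" _ "\<lambda>j. real (Suc j) powr (- p)"])
  show "(\<lambda>d. C * real (Suc d) powr (- (p - Re s))) summable_on UNIV" "(\<lambda>j. real (Suc j) powr (- p)) summable_on UNIV"
   using p C by (intro summable_on_nat_of_nonneg summable_mult summable_Suc_powr; simp)+
  fix d j :: nat
  have "norm (f (Suc d) (Suc j)) \<le> real (Suc d) powr Re s * (C * real (Suc j * Suc d) powr (- p))"
   unfolding f_def norm_mult using norm_powr_real_powr[of "of_real (real (Suc d))" s] F[of "Suc j * Suc d"]
   by (intro mult_mono) auto
  also have "real (Suc j * Suc d) powr (- p) = real (Suc j) powr (- p) * real (Suc d) powr (- p)"
   unfolding of_nat_mult by (rule powr_mult)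
  also have "real (Suc d) powr Re s * (C * (real (Suc j) powr (- p) * real (Suc d) powr (- p))) = C * (real (Suc d) powr Re s * real (Suc d) powr (- p)) * real (Suc j) powr (- p)"
   by (simp only: mult_ac)
  also have "real (Suc d) powr Re s * real (Suc d) powr (- p) = real (Suc d) powr (- (p - Re s))" by (simp add: powr_add[symmetric])
  finally show "norm (case (d, j) of (d, j) \<Rightarrow> f (Suc d) (Suc j)) \<le> C * real (Suc d) powr (- (p - Re s)) * real (Suc j) powr (- p)" by simp
 qed (use C in auto)
 hence S: "(\<lambda>(d, j). f (Suc d) (Suc j)) summable_on UNIV" by simp
 have D: "(\<Sum>d | d dvd Suc n. f d (Suc n div d)) = divisor_sigma s (Suc n) * F (Suc n)" for n
  unfolding divisor_sigma_def f_def by (subst sum_distrib_right, rule sum.cong) auto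
 note 1 = sums_divisor_pairs[OF S, unfolded D]
 show ?P using 1 by (rule sums_summable)
 show ?Q
  using infsum_double_nat[OF S] sums_unique[OF 1] by (simp add: f_def)
 show ?R
  using suminf_swap(3)[OF S, of d] by (simp add: f_def)
qed

lemma zeta_sums_powr:
 assumes "Re s > 1"
 shows "(\<lambda>n. of_real (real (Suc n)) powr (- s)) sums zeta s"
 using zeta_spec(2)[OF assms] by (simp add: powr_minus inverse_eq_divide)

text \<open>The Dirichlet series of a divisor sum factors into two zeta values: the inner sum over
  \<open>j\<close> is \<open>zeta w\<close> times a power of \<open>d\<close>.\<close>

lemma ramanujan_dirichlet_series:
 assumes "Re w > 1" "Re (w - s) > 1"
 shows "(\<lambda>n. divisor_sigma s (Suc n) * of_real (real (Suc n)) powr (- w)) sums (zeta w * zeta (w - s))"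
proof -
 let ?A = "\<lambda>d. real (Suc d)"
 let ?B = "\<lambda>d. zeta w * of_real (?A d) powr (- (w - s))"
 define F where "F = (\<lambda>n. of_real (real n) powr (- w))"
 let ?C = "\<Sum>n. divisor_sigma s (Suc n) * F (Suc n)"
 have F: "norm (F n) \<le> 1 * real n powr (- Re w)" if "n > 0" for n
  using norm_powr_real_powr[of "of_real (real n)" "- w"] by (simp add: F_def)
 note S = sigma_double_series[of F 1 "Re w" s, OF F]
 have "(\<Sum>j. of_real (?A d) powr s * F (Suc j * Suc d)) = zeta w * of_real (?A d) powr (- (w - s))" for d
 proof (rule sums_unique[symmetric])
  have "of_real (?A d) powr s * F (Suc j * Suc d) = of_real (real (Suc j)) powr (- w) * of_real (?A d) powr (- (w - s))" for j
  proof -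
   have "F (Suc j * Suc d) = of_real (real (Suc j)) powr (- w) * of_real (?A d) powr (- w)"
    unfolding F_def of_nat_mult of_real_mult by (rule powr_times_real) auto
   moreover have "of_real (?A d) powr s * of_real (?A d) powr (- w) = complex_of_real (?A d) powr (- (w - s))"
    unfolding powr_add[symmetric] by simp
   ultimately show ?thesis
    by (metis (no_types) mult.commute mult.left_commute)
  qed
  thus "(\<lambda>j. of_real (?A d) powr s * F (Suc j * Suc d)) sums (zeta w * of_real (?A d) powr (- (w - s)))"
   using sums_mult2[OF zeta_sums_powr[OF assms(1)], of "of_real (?A d) powr (- (w - s))"] by simp
 qed
 hence "?B sums ?C"
  using S(2) assms by simp
 moreover have "?B sums (zeta w * zeta (w - s))"
  by (intro sums_mult zeta_sums_powr assms)
 ultimately have "?C = zeta w * zeta (w - s)" by (rule sums_unique2)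
 moreover have "summable (\<lambda>n. divisor_sigma s (Suc n) * F (Suc n))" using S(1) assms by simp
 ultimately show ?thesis unfolding F_def by (metis summable_sums)
qed

section \<open>Exponential decay of the Bessel products\<close>

context bessel_pair
begin

text \<open>In the product the factor I grows like \<open>exp (\<bar>Re z1\<bar> * sqrt n)\<close>
  and K decays like \<open>exp (- Re w1 * sqrt n)\<close>; the difference of the rates is positive.
  The constants are uniform for \<open>Re \<nu> \<ge> a\<close> and
  \<open>norm \<nu> \<le> R\<close>, as holomorphy of the series in the order requires.\<close>

lemma psi_inverse_transform_decay:
 assumes e: "e = eps8 \<and> \<sigma> = \<i> \<or> e = cnj eps8 \<and> \<sigma> = - \<i>" and a: "a > 0"
 shows "\<exists>C\<ge>0. \<exists>c>0. \<forall>\<nu> n. Re \<nu> \<ge> a \<longrightarrow> norm \<nu> \<le> R \<longrightarrow> n > 0 \<longrightarrow>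
   norm (psi_inverse_transform \<nu> (of_real (2 * pi * real n) * \<sigma>)) \<le> C * real n powr R * exp (- (c * sqrt (real n)))"
proof -
 let ?E = "\<bar>R\<bar> + a - 1"
 let ?C = "\<lambda>n. 2 * pi * real n"
 define \<mu> where "\<mu> = of_real pi * root_sum\<^sup>2 / 2"
 define w1 where "w1 = 2 * of_real pi * root_sum * e"
 let ?B = "\<lambda>n. - (Re w1 * sqrt (real n))"
 let ?A = "\<lambda>x. x powr (a - 1) * exp (- (Re w1 / 2 * x)) + x powr ?E * exp (- (Re w1 / 2 * x))"
 define z1 where "z1 = 2 * of_real pi * root_diff * e"
 let ?D = "\<lambda>n. \<bar>Re z1\<bar> * sqrt (real n)"
 define c where "c = Re w1 - \<bar>Re z1\<bar>"
 have \<mu>0: "Re \<mu> > 0" unfolding \<mu>_def by (rule Re_mu_pos)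
 \<comment> \<open>A rotation by 45 degrees keeps the open sector inside the right half
   plane.\<close>
 have rot: "Re (v * e) > 0" if "\<bar>Im v\<bar> < Re v" for v
 proof -
  have "Re (v * e) = (Re v - Im v) / sqrt 2 \<or> Re (v * e) = (Re v + Im v) / sqrt 2"
   using e by (auto simp: eps8_eq cos_45 sin_45 field_simps)
  moreover have "(Re v - Im v) / sqrt 2 > 0" "(Re v + Im v) / sqrt 2 > 0" using that by auto
  ultimately show ?thesis by metis
 qed
 \<comment> \<open>\<open>w1 + z1\<close> and \<open>w1 - z1\<close> are \<open>4 * pi * e\<close>
   times the two square roots, so both have positive real part.\<close>
 have c: "c > 0"
 proof -
  have "Re (w1 + z1) = 4 * pi * Re (csqrt \<alpha> * e)" "Re (w1 - z1) = 4 * pi * Re (csqrt \<beta> * e)"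
   unfolding w1_def z1_def by (simp_all add: algebra_simps)
  hence "Re w1 + Re z1 > 0" "Re w1 - Re z1 > 0" using rot[OF sectors(1)] rot[OF sectors(2)] by simp_all
  thus ?thesis unfolding c_def by linarith
 qed
 have w1: "Re w1 > 0" using c unfolding c_def by linarith
 obtain G where G: "\<And>\<nu>. \<nu> \<in> cball 0 R \<Longrightarrow> norm (rGamma \<nu> :: complex) \<le> G"
  using holomorphic_bounded_on_cball[of rGamma 0 R] by (metis holomorphic_rGamma)
 define J where "J = (\<integral>x. (?A x) \<partial>halfline)"
 have Ji: "integrable halfline (\<lambda>x. (?A x))"
  using w1 a by (intro Bochner_Integration.integrable_add integrable_powr_exp_real) auto
 have J0: "J \<ge> 0" unfolding J_def by (intro integral_nonneg_AE AE_I2) auto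
 define M0 where "M0 = norm (Ln \<mu>) + \<bar>ln (2 * pi)\<bar> + pi"
 let ?F = "\<bar>R\<bar> * M0"
 define C where "C = \<bar>G\<bar> / a * exp ?F * exp (Re w1) * J"
 have M0: "M0 \<ge> 0" by (simp add: M0_def)
 have C0: "C \<ge> 0" unfolding C_def using a J0 by simp
 have main: "norm (psi_inverse_transform \<nu> (of_real (?C n) * \<sigma>)) \<le> C * real n powr R * exp (- (c * sqrt (real n)))"
  if \<nu>: "Re \<nu> \<ge> a" "norm \<nu> \<le> R" and n: "n > 0" for \<nu> n
 proof -
  define X where "X = of_real (?C n) * \<sigma>"
  have r: "2 * pi * real n > 0" using n by simp
  have R: "R \<ge> 0" using \<nu>(2) norm_ge_zero[of \<nu>] by linarith
  have cX: "csqrt X = of_real (sqrt (?C n)) * e" using e csqrt_imaginary[OF r] by (auto simp: X_def)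
  have X: "X \<noteq> 0" "Re X = 0" using e n by (auto simp: X_def)
  have \<nu>0: "Re \<nu> > 0" using \<nu> a by simp
  define z where "z = of_real (sqrt (2 * pi)) * root_diff * csqrt X"
  define w where "w = 2 * csqrt \<mu> * csqrt X"
  have s2: "sqrt (2 * pi) * sqrt (?C n) = 2 * pi * sqrt (real n)"
   by (simp add: real_sqrt_mult) (metis abs_of_nonneg mult.assoc mult.left_commute pi_ge_zero real_sqrt_mult_self zero_le_numeral)
  have z: "z = of_real (sqrt (real n)) * z1"
  proof -
   have "z = of_real (sqrt (2 * pi) * sqrt (?C n)) * e * root_diff"
    unfolding z_def cX by (simp only: of_real_mult mult_ac)
   thus ?thesis unfolding s2 z1_def by (simp add: algebra_simps)
  qed
  have w: "w = of_real (sqrt (real n)) * w1"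
  proof -
   have "2 * sqrt (pi / 2) = sqrt (2 * pi)" by (simp add: real_sqrt_divide real_sqrt_mult) (simp add: field_simps flip: power2_eq_square)
   hence c: "complex_of_real (sqrt (2 * pi)) = 2 * of_real (sqrt (pi / 2))" by (metis of_real_mult of_real_numeral)
   have "w = of_real (sqrt (2 * pi) * sqrt (?C n)) * e * root_sum"
    unfolding w_def \<mu>_def csqrt_mu cX of_real_mult[of "sqrt (2 * pi)"] c by (simp only: mult_ac)
   thus ?thesis unfolding s2 w1_def by (simp add: algebra_simps)
  qed
  have sn: "sqrt (real n) \<ge> 1" using n by simp
  have Rew: "Re w = sqrt (real n) * Re w1" unfolding w by simp
  hence w0: "Re w > 0" using w1 n by simp
  \<comment> \<open>K depends only on the product of the two parameters of the moment. Taking both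
    equal to \<open>w / 2\<close> replaces the purely oscillating factor
    \<open>exp (- X / x)\<close> by the decaying exponent
    \<open>- (w / 2) * (x + 1 / x)\<close>.\<close>
  have "exp (\<nu> * (Ln \<mu> - Ln X) / 2) * bessel_moment \<mu> X \<nu> / 2 = bessel_moment (w / 2) (w / 2) \<nu> / 2"
  proof -
   have "bessel_K \<nu> w = exp (\<nu> * (Ln \<mu> - Ln X) / 2) * bessel_moment \<mu> X \<nu> / 2"
    unfolding w_def using X by (intro bessel_K_eq_moment \<mu>0 \<nu>0) auto
   moreover have "bessel_K \<nu> (2 * csqrt (w / 2) * csqrt (w / 2)) = exp (\<nu> * (Ln (w / 2) - Ln (w / 2)) / 2) * bessel_moment (w / 2) (w / 2) \<nu> / 2"
    using w0 by (intro bessel_K_eq_moment \<nu>0) auto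
   moreover have "2 * csqrt (w / 2) * csqrt (w / 2) = w" by (simp add: mult.assoc flip: power2_eq_square)
   ultimately show ?thesis by simp
  qed
  hence mom: "bessel_moment \<mu> X \<nu> = exp (- (\<nu> * (Ln \<mu> - Ln X) / 2)) * bessel_moment (w / 2) (w / 2) \<nu>"
   by (simp add: exp_minus field_simps)
  have b1: "norm (exp (- (\<nu> * (Ln \<mu> - Ln X) / 2))) \<le> exp ?F * real n powr R"
  proof -
   have "Ln X = of_real (ln (?C n)) + Ln \<sigma>"
    unfolding X_def using e by (intro Ln_of_real_mult r) auto
   hence "norm (Ln X) \<le> \<bar>ln (?C n)\<bar> + norm (Ln \<sigma>)" by (metis norm_of_real norm_triangle_ineq)
   moreover have "norm (Ln \<sigma>) \<le> pi" using e by (auto simp: norm_mult)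
   moreover have "ln (?C n) = ln (2 * pi) + ln (real n)" using n by (simp add: ln_mult)
   moreover have "ln (real n) \<ge> 0" using n by simp
   ultimately have LX: "norm (Ln X) \<le> \<bar>ln (2 * pi)\<bar> + ln (real n) + pi" by linarith
   have "norm (exp (- (\<nu> * (Ln \<mu> - Ln X) / 2))) \<le> exp (norm (- (\<nu> * (Ln \<mu> - Ln X) / 2)))" by (rule norm_exp)
   also have "norm (- (\<nu> * (Ln \<mu> - Ln X) / 2)) = norm \<nu> * norm (Ln \<mu> - Ln X) / 2" by (simp add: norm_mult)
   also have "\<dots> \<le> R * (M0 + ln (real n)) / 2"
    using \<nu>(2) LX norm_triangle_ineq4[of "Ln \<mu>" "Ln X"] R unfolding M0_def by (intro divide_right_mono mult_mono) auto
   also have "\<dots> \<le> R * (M0 + ln (real n))" using R M0 n by simp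
   also have "exp (R * (M0 + ln (real n))) = exp ?F * real n powr R"
    using n R by (simp add: powr_def exp_add distrib_left)
   finally show ?thesis by simp
  qed
  have b2: "norm (bessel_moment (w / 2) (w / 2) \<nu>) \<le> exp (Re w1) * exp (?B n) * J"
  proof -
   have "norm (bessel_moment (w / 2) (w / 2) \<nu>) \<le> (\<integral>x. exp (Re w1) * exp (?B n) * (?A x) \<partial>halfline)"
    unfolding bessel_moment_def
   proof (rule Bochner_Integration.integral_norm_bound_integral)
    show "integrable halfline (\<lambda>x. complex_of_real x powr (\<nu> - 1) * exp (- (w / 2 * complex_of_real x) - w / 2 / complex_of_real x))"
     using w0 by (intro integrable_bessel_moment) auto
    fix x assume "x \<in> space halfline"
    hence x: "x > 0" by simp
    have "norm (complex_of_real x powr (\<nu> - 1)) = x powr (Re \<nu> - 1)" using x by (simp add: norm_powr_real_powr)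
    also have "\<dots> \<le> x powr (a - 1) + x powr ?E"
     using \<nu> complex_Re_le_cmod[of \<nu>] a by (intro powr_between x) auto
    finally have p: "norm (complex_of_real x powr (\<nu> - 1)) \<le> x powr (a - 1) + x powr ?E" .
    have "norm (exp (- (w / 2 * complex_of_real x) - w / 2 / complex_of_real x)) = exp (- (Re w / 2 * (x + 1 / x)))"
     by (simp add: Re_divide_of_real algebra_simps)
    also have "\<dots> \<le> exp (Re w1 - Re w1 * sqrt (real n) - Re w1 / 2 * x)"
    proof -
     \<comment> \<open>Of \<open>sqrt n * (x + 1 / x)\<close> the part with coefficient
       \<open>sqrt n - 1\<close> is bounded below by a constant and gives the decay in
       \<open>n\<close>; the remaining part keeps the integral over \<open>x\<close> finite.\<close>
     have "x + 1 / x \<ge> 2" using x sum_squares_ge_zero[of "x - 1" 0] by (simp add: field_simps power2_eq_square)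
     hence "(sqrt (real n) - 1) * (x + 1 / x) \<ge> (sqrt (real n) - 1) * 2" using sn by (intro mult_left_mono) auto
     hence "sqrt (real n) * (x + 1 / x) \<ge> 2 * sqrt (real n) - 2 + x" using x by (simp add: algebra_simps) (smt (verit) divide_pos_pos)
     hence "Re w1 / 2 * (sqrt (real n) * (x + 1 / x)) \<ge> Re w1 / 2 * (2 * sqrt (real n) - 2 + x)" using w1 by (intro mult_left_mono) auto
     moreover have "Re w / 2 * (x + 1 / x) = Re w1 / 2 * (sqrt (real n) * (x + 1 / x))" unfolding Rew by simp
     moreover have "Re w1 / 2 * (2 * sqrt (real n) - 2 + x) = - (Re w1 - Re w1 * sqrt (real n) - Re w1 / 2 * x)" by (simp add: algebra_simps)
     ultimately show ?thesis by (simp only: exp_le_cancel_iff)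
    qed
    also have "\<dots> = exp (Re w1) * exp (?B n) * exp (- (Re w1 / 2 * x))"
     by (simp add: exp_add[symmetric])
    finally have "norm (complex_of_real x powr (\<nu> - 1) * exp (- (w / 2 * complex_of_real x) - w / 2 / complex_of_real x)) \<le>
     (x powr (a - 1) + x powr ?E) * (exp (Re w1) * exp (?B n) * exp (- (Re w1 / 2 * x)))"
     unfolding norm_mult by (intro mult_mono p) auto
    thus "norm (complex_of_real x powr (\<nu> - 1) * exp (- (w / 2 * complex_of_real x) - w / 2 / complex_of_real x)) \<le>
     exp (Re w1) * exp (?B n) * (?A x)"
     by (simp only: distrib_left distrib_right mult_ac)
   qed (intro integrable_mult_right Ji)
   thus ?thesis unfolding J_def by simp
  qed
  have b3: "norm (bessel_It \<nu> z) \<le> \<bar>G\<bar> / a * exp (?D n)"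
  proof -
   have "norm (bessel_It \<nu> z) \<le> norm (rGamma \<nu>) / Re \<nu> * exp \<bar>Re z\<bar>" by (rule norm_bessel_It_le[OF \<nu>0])
   also have "\<dots> \<le> \<bar>G\<bar> / a * exp \<bar>Re z\<bar>"
    using G[of \<nu>] \<nu> a by (intro mult_right_mono frac_le) auto
   also have "\<bar>Re z\<bar> = \<bar>Re z1\<bar> * sqrt (real n)" unfolding z by (simp add: abs_mult)
   finally show ?thesis .
  qed
  have "norm (psi_inverse_transform \<nu> X) = norm (bessel_It \<nu> z) * (norm (exp (- (\<nu> * (Ln \<mu> - Ln X) / 2))) * norm (bessel_moment (w / 2) (w / 2) \<nu>))"
   unfolding psi_inverse_transform_eq[OF \<nu>0 eq_refl[OF X(2)[symmetric]]] z_def[symmetric] \<mu>_def[symmetric] mom norm_mult ..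
  also have "\<dots> \<le> (\<bar>G\<bar> / a * exp (?D n)) * ((exp ?F * real n powr R) * (exp (Re w1) * exp (?B n) * J))"
   using a J0 by (intro mult_mono b1 b2 b3) auto
  also have "\<dots> = C * real n powr R * (exp (?D n) * exp (?B n))"
   unfolding C_def by (simp only: mult_ac)
  also have "exp (?D n) * exp (?B n) = exp (- (c * sqrt (real n)))"
   unfolding exp_add[symmetric] c_def by (simp add: algebra_simps)
  finally show ?thesis unfolding X_def .
 qed
 show ?thesis using main C0 c by blast
qed

lemma psi_inverse_transform_decay_powr:
 assumes e: "\<sigma> = \<i> \<or> \<sigma> = - \<i>" and a: "a > 0"
 shows "\<exists>C\<ge>0. \<forall>\<nu> n. Re \<nu> \<ge> a \<longrightarrow> norm \<nu> \<le> R \<longrightarrow> n > 0 \<longrightarrow>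
   norm (psi_inverse_transform \<nu> (of_real (2 * pi * real n) * \<sigma>)) \<le> C * real n powr (- A)"
proof -
 let ?A = "\<lambda>c n. - (c * sqrt (real n))"
 obtain C c where C: "C \<ge> 0" "c > 0" and b: "\<forall>\<nu> n. Re \<nu> \<ge> a \<longrightarrow> norm \<nu> \<le> R \<longrightarrow> n > 0 \<longrightarrow>
   norm (psi_inverse_transform \<nu> (of_real (2 * pi * real n) * \<sigma>)) \<le> C * real n powr R * exp (?A c n)"
  using psi_inverse_transform_decay[OF _ a, of "if \<sigma> = \<i> then eps8 else cnj eps8" \<sigma> R] e by auto
 have "(\<lambda>n. real n powr (R + A) * exp (?A c n)) \<longlonglongrightarrow> 0" using C(2) by real_asymp
 hence "Bseq (\<lambda>n. real n powr (R + A) * exp (?A c n))" by (intro convergent_imp_Bseq convergentI)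
 then obtain K where K: "K > 0" "\<And>n. norm (real n powr (R + A) * exp (?A c n)) \<le> K" by (auto simp: Bseq_def)
 have "norm (psi_inverse_transform \<nu> (of_real (2 * pi * real n) * \<sigma>)) \<le> C * K * real n powr (- A)"
  if "Re \<nu> \<ge> a" "norm \<nu> \<le> R" "n > 0" for \<nu> n
 proof -
  have "real n powr R = real n powr (R + A) * real n powr (- A)" unfolding powr_add[symmetric] by simp
  hence "C * real n powr R * exp (?A c n) = C * (real n powr (R + A) * exp (?A c n)) * real n powr (- A)"
   by (simp only: mult_ac)
  also have "\<dots> \<le> C * K * real n powr (- A)"
   using C K(2)[of n] by (intro mult_right_mono mult_left_mono) auto
  finally show ?thesis using b that by (meson order_trans)
 qed
 thus ?thesis using C K(1) by (intro exI[of _ "C * K"]) auto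
qed

end

section \<open>Asymptotics of the hypergeometric summand\<close>

lemma Ln_imaginary: "t \<noteq> 0 \<Longrightarrow> Ln (\<i> * of_real t) = of_real (ln \<bar>t\<bar>) + of_real (sgn t * (pi / 2)) * \<i>"
proof (rule Ln_unique)
 let ?A = "of_real (ln \<bar>t\<bar>) + of_real (sgn t * (pi / 2)) * \<i>"
 assume t: "t \<noteq> 0"
 have "exp ?A = of_real \<bar>t\<bar> * cis (sgn t * (pi / 2))"
  using t by (simp add: exp_add exp_of_real cis_conv_exp mult_ac)
 also have "\<dots> = \<i> * of_real t"
  using t by (cases "t > 0") (auto simp: complex_eq_iff)
 finally show "exp ?A = \<i> * of_real t" .
 have "Im ?A = pi / 2 \<or> Im ?A = - (pi / 2)"
  using t by (auto simp: sgn_if)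
 thus "- pi < Im ?A" "Im ?A \<le> pi"
  using pi_gt_zero by linarith+
qed

lemma norm_exp_Ln_imaginary:
 assumes t: "t \<noteq> 0"
 shows "norm (exp (- w * Ln (\<i> * of_real t))) \<le> exp (pi / 2 * \<bar>Im w\<bar>) * \<bar>t\<bar> powr (- Re w)"
proof -
 have "Re (- w * Ln (\<i> * of_real t)) = - Re w * ln \<bar>t\<bar> + Im w * sgn t * (pi / 2)"
  using t by (simp add: Ln_imaginary)
 also have "\<dots> \<le> - Re w * ln \<bar>t\<bar> + pi / 2 * \<bar>Im w\<bar>"
 proof -
  have "Im w * sgn t \<le> \<bar>Im w\<bar>" by (auto simp: sgn_if)
  hence "Im w * sgn t * (pi / 2) \<le> \<bar>Im w\<bar> * (pi / 2)" by (intro mult_right_mono) auto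
  thus ?thesis by (simp add: mult.commute)
 qed
 finally have "exp (Re (- w * Ln (\<i> * of_real t))) \<le> exp (- Re w * ln \<bar>t\<bar> + pi / 2 * \<bar>Im w\<bar>)" by (simp only: exp_le_cancel_iff)
 also have "\<dots> = exp (pi / 2 * \<bar>Im w\<bar>) * \<bar>t\<bar> powr (- Re w)" using t by (simp add: exp_add[symmetric] powr_def)
 finally show ?thesis unfolding norm_exp_eq_Re .
qed

lemma hyp2F1_0: "hyp2F1 a b c 0 = 1"
proof -
 have "(\<lambda>n. pochhammer a n * pochhammer b n / (pochhammer c n * fact n) * 0 ^ n) sums
   (\<Sum>n\<in>{0}. pochhammer a n * pochhammer b n / (pochhammer c n * fact n) * 0 ^ n)"
  by (rule sums_finite) auto
 thus ?thesis unfolding hyp2F1_def by (simp add: sums_iff)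
qed

lemma norm_exp_le:
 fixes w :: complex
 assumes "norm w \<le> x"
 shows "norm (exp w) \<le> exp x"
 using norm_exp[of w] assms exp_le_cancel_iff order_trans by blast

lemma norm_exp_two_terms_le:
 fixes p q L M :: complex
 assumes "norm p \<le> P" "norm q \<le> Q" "norm L \<le> A" "norm M \<le> B"
 shows "norm (exp (- p * L + q * M)) \<le> exp (P * A + Q * B)"
proof (rule norm_exp_le)
 have "norm (- p * L + q * M) \<le> norm (- p * L) + norm (q * M)" by (rule norm_triangle_ineq)
 also have "\<dots> \<le> P * A + Q * B"
  unfolding norm_mult norm_minus_cancel
  using assms order_trans[OF norm_ge_zero assms(1)] order_trans[OF norm_ge_zero assms(2)] by (intro add_mono mult_mono) auto
 finally show "norm (- p * L + q * M) \<le> P * A + Q * B" .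
qed

section \<open>Expansion of the summand at infinity, uniform in the parameters\<close>

context bessel_pair
begin

text \<open>What is left of \<open>reduced_A\<close> when \<open>X = \<i> * t\<close> is factored
  out of \<open>\<alpha> + X\<close> and \<open>\<beta> + X\<close>, as a function of
  \<open>v = 1 / X\<close>. It is holomorphic at \<open>v = 0\<close>, so its value there gives the
  leading term at infinity.\<close>

definition A_profile :: "complex \<Rightarrow> complex \<Rightarrow> complex \<Rightarrow> complex" where
 "A_profile s \<nu> v = (let a = csqrt (1 + \<alpha> * v); b = csqrt (1 + \<beta> * v) in
   exp (- (1 + 2 * s) * (Ln a + Ln b) + (2 * s - 2 * \<nu>) * Ln (a + b)) *
   hyp2F1 (\<nu> - s) (- s) (\<nu> + 1) (((a - b) / (a + b))\<^sup>2))"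

text \<open>Chosen so that \<open>\<alpha> * v\<close> and \<open>\<beta> * v\<close> have norm at
  most 1/2, which keeps \<open>1 + \<alpha> * v\<close> and \<open>1 + \<beta> * v\<close> in the
  right half plane.\<close>

definition profile_radius :: real where "profile_radius = 1 / (2 * (norm \<alpha> + norm \<beta> + 1))"

lemma profile_radius_pos: "profile_radius > 0"
 by (simp add: profile_radius_def add_nonneg_pos)

lemma profile_sectors:
 assumes "norm v \<le> profile_radius"
 shows "\<bar>Im (csqrt (1 + \<alpha> * v))\<bar> < Re (csqrt (1 + \<alpha> * v))" (is ?P) "\<bar>Im (csqrt (1 + \<beta> * v))\<bar> < Re (csqrt (1 + \<beta> * v))" (is ?Q)
  "1 + \<alpha> * v \<notin> \<real>\<^sub>\<le>\<^sub>0" (is ?R) "1 + \<beta> * v \<notin> \<real>\<^sub>\<le>\<^sub>0" (is ?S)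
proof -
 have *: "Re (1 + c * v) > 0" if "norm c \<le> norm \<alpha> + norm \<beta>" for c
 proof -
  have "norm (c * v) \<le> (norm \<alpha> + norm \<beta> + 1) * profile_radius"
   unfolding norm_mult using that assms by (intro mult_mono) auto
  also have "\<dots> = 1 / 2" unfolding profile_radius_def using add_nonneg_pos[of "norm \<alpha> + norm \<beta>" 1] by (simp add: field_simps)
  finally have "\<bar>Re (c * v)\<bar> \<le> 1 / 2" using abs_Re_le_cmod[of "c * v"] by linarith
  moreover have "Re (1 + c * v) = 1 + Re (c * v)" by (simp only: plus_complex.sel one_complex.sel)
  ultimately show ?thesis by linarith
 qed
 have p: "Re (1 + \<alpha> * v) > 0" "Re (1 + \<beta> * v) > 0" by (intro *; simp)+
 show ?P by (rule csqrt_sector[OF p(1)])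
 show ?Q by (rule csqrt_sector[OF p(2)])
 show ?R ?S
  using p unfolding complex_nonpos_Reals_iff by linarith+
qed

text \<open>The root of \<open>\<i> * t\<close> has argument at most pi/4 in modulus and the profile
  roots less than pi/4, so roots and logarithms of the products split. Collecting the powers of
  \<open>\<i> * t\<close> gives the exponent \<open>- (1 + s + \<nu>)\<close>.\<close>

lemma reduced_A_eq_profile:
 assumes t: "t \<noteq> 0" and v: "norm (1 / (\<i> * of_real t)) \<le> profile_radius"
 shows "reduced_A s \<nu> t = exp (- (1 + s + \<nu>) * Ln (\<i> * of_real t)) * A_profile s \<nu> (1 / (\<i> * of_real t))"
proof -
 define X where "X = \<i> * complex_of_real t"
 have X: "X \<noteq> 0" using t by (simp add: X_def)
 define a where "a = csqrt (1 + \<alpha> * (1 / X))"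
 define b where "b = csqrt (1 + \<beta> * (1 / X))"
 have sec: "\<bar>Im a\<bar> < Re a" "\<bar>Im b\<bar> < Re b" unfolding a_def b_def using profile_sectors[OF v[folded X_def]] by auto
 have sab: "\<bar>Im (a + b)\<bar> < Re (a + b)" by (rule sector_add[OF sec])
 have nz: "a \<noteq> 0" "b \<noteq> 0" "a + b \<noteq> 0" using sec sab by (auto simp: complex_eq_iff)
 define c where "c = csqrt X"
 have cn: "c \<noteq> 0" using X by (simp add: c_def)
 have Lc: "Ln c = Ln X / 2" "\<bar>Im (Ln c)\<bar> \<le> pi / 4"
 proof -
  have i: "\<bar>Im (Ln X)\<bar> \<le> pi / 2" unfolding X_def using t by (simp add: Ln_imaginary abs_mult abs_sgn_eq)
  show "Ln c = Ln X / 2" unfolding c_def using i X pi_gt_zero by (intro Ln_unique) (auto simp: csqrt_exp_Ln simp del: pi_gt_zero)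
  have "\<bar>Im (Ln X / 2)\<bar> \<le> pi / 4" using i by simp
  thus "\<bar>Im (Ln c)\<bar> \<le> pi / 4" unfolding \<open>Ln c = Ln X / 2\<close> .
 qed
 have Lm: "Ln (c * d) = Ln X / 2 + Ln d" if "\<bar>Im d\<bar> < Re d" for d
 proof -
  have "d \<noteq> 0" using that by auto
  moreover have "\<bar>Im (Ln c) + Im (Ln d)\<bar> < pi" using Lc(2) sector_Ln[OF that] by linarith
  ultimately show ?thesis using Ln_mult_of_small[OF cn, of d] Lc(1) by simp
 qed
 have root: "csqrt (g + X) = c * csqrt (1 + g * (1 / X))" if s: "\<bar>Im (csqrt (1 + g * (1 / X)))\<bar> < Re (csqrt (1 + g * (1 / X)))" for g
 proof (rule csqrt_unique)
  show "(c * csqrt (1 + g * (1 / X)))\<^sup>2 = g + X" using X by (simp add: power_mult_distrib c_def distrib_left)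
  let ?d = "csqrt (1 + g * (1 / X))"
  have "?d \<noteq> 0" using s abs_ge_zero[of "Im ?d"] by (metis less_le_not_le zero_complex.sel(1) zero_complex.sel(2) abs_zero)
  hence ne: "c * ?d \<noteq> 0" using cn by simp
  have "\<bar>Im (Ln (c * ?d))\<bar> < pi / 2" 
   unfolding Lm[OF s] Lc(1)[symmetric] plus_complex.sel using Lc(2) sector_Ln[OF s] by linarith
  hence "Re (c * ?d) > 0" using Re_Ln_pos_lt[OF ne] by simp
  thus "0 < Re (c * ?d) \<or> Re (c * ?d) = 0 \<and> 0 \<le> Im (c * ?d)" ..
 qed
 have Z: "csqrt (\<alpha> + \<i> * of_real t) = c * a" and W: "csqrt (\<beta> + \<i> * of_real t) = c * b"
  using root[of \<alpha>] root[of \<beta>] sec unfolding a_def b_def X_def by simp_all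
 have cd: "c * a + c * b = c * (a + b)" by (simp add: distrib_left)
 have q: "(c * a - c * b) / (c * (a + b)) = (a - b) / (a + b)"
  using cn by (simp flip: right_diff_distrib)
 have "reduced_A s \<nu> t = exp (- (1 + 2 * s) * (Ln (c * a) + Ln (c * b)) + (2 * s - 2 * \<nu>) * Ln (c * (a + b))) *
   hyp2F1 (\<nu> - s) (- s) (\<nu> + 1) (((a - b) / (a + b))\<^sup>2)"
  unfolding reduced_A_def Let_def Z W cd q ..
 also have "- (1 + 2 * s) * (Ln (c * a) + Ln (c * b)) + (2 * s - 2 * \<nu>) * Ln (c * (a + b)) =
   - (1 + s + \<nu>) * Ln X + (- (1 + 2 * s) * (Ln a + Ln b) + (2 * s - 2 * \<nu>) * Ln (a + b))"
  unfolding Lm[OF sec(1)] Lm[OF sec(2)] Lm[OF sab] by (simp add: field_simps)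
 finally show ?thesis
  unfolding A_profile_def Let_def X_def[symmetric] a_def[symmetric] b_def[symmetric] by (simp only: exp_add mult.assoc)
qed

lemma holomorphic_A_profile:
 assumes "Re \<nu> \<ge> 0"
 shows "A_profile s \<nu> holomorphic_on ball 0 profile_radius"
proof -
 let ?B = "\<lambda>v. 1 + \<beta> * v"
 let ?A = "\<lambda>v. 1 + \<alpha> * v"
 have nz: "csqrt (?A v) + csqrt (?B v) \<noteq> 0" "csqrt (?A v) + csqrt (?B v) \<notin> \<real>\<^sub>\<le>\<^sub>0"
  "csqrt (?A v) \<notin> \<real>\<^sub>\<le>\<^sub>0" "csqrt (?B v) \<notin> \<real>\<^sub>\<le>\<^sub>0" if "v \<in> ball 0 profile_radius" for v
 proof -
  have v: "norm v \<le> profile_radius" using that by simp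
  note S = profile_sectors(1,2)[OF v]
  show "csqrt (?A v) + csqrt (?B v) \<noteq> 0" by (rule sector_quotient(2)[OF S])
  show "csqrt (?A v) + csqrt (?B v) \<notin> \<real>\<^sub>\<le>\<^sub>0" by (rule sector_not_nonpos[OF sector_add[OF S]])
  show "csqrt (?A v) \<notin> \<real>\<^sub>\<le>\<^sub>0" "csqrt (?B v) \<notin> \<real>\<^sub>\<le>\<^sub>0" by (rule sector_not_nonpos[OF S(1)], rule sector_not_nonpos[OF S(2)])
 qed
 have nR: "1 + \<alpha> * v \<notin> \<real>\<^sub>\<le>\<^sub>0" "1 + \<beta> * v \<notin> \<real>\<^sub>\<le>\<^sub>0" if "v \<in> ball 0 profile_radius" for v
  using profile_sectors[of v] that by auto
 have q: "norm (((csqrt (?A v) - csqrt (?B v)) / (csqrt (?A v) + csqrt (?B v)))\<^sup>2) < 1" if "v \<in> ball 0 profile_radius" for v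
  unfolding norm_power using sector_quotient(1)[OF profile_sectors(1,2)[of v]] that by (simp add: power_less_one_iff)
 show ?thesis
  unfolding A_profile_def[abs_def] Let_def
  by (intro holomorphic_on_mult holomorphic_hyp2F1_comp holomorphic_intros open_ball nz nR q)
    (use assms in auto)
qed

text \<open>The logarithms and the hypergeometric argument do not involve \<open>s\<close> and
  \<open>\<nu>\<close>, so compactness in \<open>v\<close> bounds them; the exponents and the
  hypergeometric parameters are controlled by \<open>R\<close>.\<close>

lemma A_profile_bounded:
 assumes r: "r < profile_radius"
 shows "\<exists>M\<ge>0. \<forall>s \<nu> v. norm s \<le> R \<longrightarrow> norm \<nu> \<le> R \<longrightarrow> Re \<nu> \<ge> 0 \<longrightarrow> norm v \<le> r \<longrightarrow> norm (A_profile s \<nu> v) \<le> M"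
proof (cases "R \<ge> 0 \<and> r \<ge> 0")
 case True
 define a where "a = (\<lambda>v. csqrt (1 + \<alpha> * v))"
 define b where "b = (\<lambda>v. csqrt (1 + \<beta> * v))"
 have sec: "\<bar>Im (a v)\<bar> < Re (a v)" "\<bar>Im (b v)\<bar> < Re (b v)" "1 + \<alpha> * v \<notin> \<real>\<^sub>\<le>\<^sub>0" "1 + \<beta> * v \<notin> \<real>\<^sub>\<le>\<^sub>0" if "v \<in> cball 0 r" for v
  using profile_sectors[of v] that r by (auto simp: a_def b_def)
 have nz: "a v + b v \<noteq> 0" "a v + b v \<notin> \<real>\<^sub>\<le>\<^sub>0" "a v \<notin> \<real>\<^sub>\<le>\<^sub>0" "b v \<notin> \<real>\<^sub>\<le>\<^sub>0" if "v \<in> cball 0 r" for v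
  using sec[OF that] sector_quotient(2) sector_not_nonpos sector_add by blast+
 have ca: "continuous_on (cball 0 r) a" "continuous_on (cball 0 r) b"
  unfolding a_def b_def using sec by (auto intro!: continuous_on_csqrt_comp continuous_intros)
 have "continuous_on (cball 0 r) (\<lambda>v. norm (Ln (a v) + Ln (b v)))" "continuous_on (cball 0 r) (\<lambda>v. norm (Ln (a v + b v)))"
   "continuous_on (cball 0 r) (\<lambda>v. norm (((a v - b v) / (a v + b v))\<^sup>2))"
  using nz by (auto intro!: continuous_intros ca)
 note cont = this
 obtain v1 where v1: "\<forall>v\<in>cball 0 r. norm (Ln (a v) + Ln (b v)) \<le> norm (Ln (a v1) + Ln (b v1))"
  using continuous_attains_sup[OF _ _ cont(1)] True by auto
 obtain v2 where v2: "\<forall>v\<in>cball 0 r. norm (Ln (a v + b v)) \<le> norm (Ln (a v2 + b v2))"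
  using continuous_attains_sup[OF _ _ cont(2)] True by auto
 obtain v3 where v3: "v3 \<in> cball 0 r" "\<forall>v\<in>cball 0 r. norm (((a v - b v) / (a v + b v))\<^sup>2) \<le> norm (((a v3 - b v3) / (a v3 + b v3))\<^sup>2)"
  using continuous_attains_sup[OF _ _ cont(3)] True by auto
 define \<rho> where "\<rho> = norm (((a v3 - b v3) / (a v3 + b v3))\<^sup>2)"
 have \<rho>: "\<rho> < 1" unfolding \<rho>_def norm_power using sector_quotient(1)[OF sec(1,2)[OF v3(1)]] by (simp add: power_less_one_iff)
 define E where "E = exp ((1 + 2 * R) * norm (Ln (a v1) + Ln (b v1)) + 4 * R * norm (Ln (a v2 + b v2)))"
 define H where "H = \<bar>\<Sum>n. hyp_majorant (2 * R + 1) n * \<rho> ^ n\<bar>"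
 have "norm (A_profile s \<nu> v) \<le> E * H" if sv: "norm s \<le> R" "norm \<nu> \<le> R" "Re \<nu> \<ge> 0" "norm v \<le> r" for s \<nu> v
 proof -
  have v: "v \<in> cball 0 r" using sv by simp
  have n1: "norm (1 + 2 * s) \<le> 1 + 2 * R" using norm_triangle_ineq[of 1 "2 * s"] sv by (simp add: norm_mult)
  have n2: "norm (2 * s - 2 * \<nu>) \<le> 4 * R" using norm_triangle_ineq4[of "2 * s" "2 * \<nu>"] sv by (simp add: norm_mult)
  have n3: "norm (\<nu> - s) \<le> 2 * R + 1" using norm_triangle_ineq4[of \<nu> s] sv by simp
  have 1: "norm (exp (- (1 + 2 * s) * (Ln (a v) + Ln (b v)) + (2 * s - 2 * \<nu>) * Ln (a v + b v))) \<le> E"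
   unfolding E_def using n1 n2 v1[rule_format, OF v] v2[rule_format, OF v] True by (intro norm_exp_two_terms_le) auto
  have 2: "norm (hyp2F1 (\<nu> - s) (- s) (\<nu> + 1) (((a v - b v) / (a v + b v))\<^sup>2)) \<le> H"
  proof -
   have "norm (hyp2F1 (\<nu> - s) (- s) (\<nu> + 1) (((a v - b v) / (a v + b v))\<^sup>2)) \<le> (\<Sum>n. hyp_majorant (2 * R + 1) n * \<rho> ^ n)"
    using sv n3 \<rho> v3(2)[rule_format, OF v] True by (intro norm_hyp2F1_le) (auto simp: \<rho>_def)
   thus ?thesis unfolding H_def by linarith
  qed
  have "norm (A_profile s \<nu> v) = norm (exp (- (1 + 2 * s) * (Ln (a v) + Ln (b v)) + (2 * s - 2 * \<nu>) * Ln (a v + b v))) *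
    norm (hyp2F1 (\<nu> - s) (- s) (\<nu> + 1) (((a v - b v) / (a v + b v))\<^sup>2))"
   unfolding A_profile_def Let_def a_def b_def norm_mult ..
  also have "\<dots> \<le> E * H" by (rule mult_mono[OF 1 2]) (auto simp: E_def)
  finally show ?thesis .
 qed
 moreover have "E * H \<ge> 0" by (simp add: E_def H_def)
 ultimately show ?thesis by blast
next
 case False
 hence "\<not> (norm (s :: complex) \<le> R \<and> norm (v :: complex) \<le> r)" for s v
  using norm_ge_zero[of s] norm_ge_zero[of v] by linarith
 thus ?thesis by (intro exI[of _ 0]) auto
qed

definition A_lead :: "complex \<Rightarrow> complex \<Rightarrow> real \<Rightarrow> complex" where
 "A_lead s \<nu> t = exp (- (1 + s + \<nu>) * Ln (\<i> * of_real t)) * exp ((2 * s - 2 * \<nu>) * of_real (ln 2))"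

lemma A_profile_0: "A_profile s \<nu> 0 = exp ((2 * s - 2 * \<nu>) * of_real (ln 2))"
proof -
 have "Ln (2 :: complex) = of_real (ln 2)" using Ln_of_real[of 2] by simp
 thus ?thesis by (simp add: A_profile_def hyp2F1_0)
qed

lemma reduced_A_bounded_at:
 "\<exists>C\<ge>0. \<forall>s \<nu>. norm s \<le> R \<longrightarrow> norm \<nu> \<le> R \<longrightarrow> Re \<nu> \<ge> 0 \<longrightarrow> norm (reduced_A s \<nu> t) \<le> C"
proof (cases "R \<ge> 0")
 case True
 define Z W where "Z = csqrt (\<alpha> + \<i> * of_real t)" and "W = csqrt (\<beta> + \<i> * of_real t)"
 define \<rho> where "\<rho> = norm (((Z - W) / (Z + W))\<^sup>2)"
 have \<rho>: "\<rho> < 1" unfolding \<rho>_def norm_power Z_def W_def using sector_quotient(1)[OF shifted_sectors, of t] by (simp add: power_less_one_iff)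
 define E where "E = exp ((1 + 2 * R) * norm (Ln Z + Ln W) + 4 * R * norm (Ln (Z + W)))"
 define H where "H = \<bar>\<Sum>n. hyp_majorant (2 * R + 1) n * \<rho> ^ n\<bar>"
 have "norm (reduced_A s \<nu> t) \<le> E * H" if sv: "norm s \<le> R" "norm \<nu> \<le> R" "Re \<nu> \<ge> 0" for s \<nu>
 proof -
  have n1: "norm (1 + 2 * s) \<le> 1 + 2 * R" using norm_triangle_ineq[of 1 "2 * s"] sv by (simp add: norm_mult)
  have n2: "norm (2 * s - 2 * \<nu>) \<le> 4 * R" using norm_triangle_ineq4[of "2 * s" "2 * \<nu>"] sv by (simp add: norm_mult)
  have n3: "norm (\<nu> - s) \<le> 2 * R + 1" using norm_triangle_ineq4[of \<nu> s] sv by simp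
  have 1: "norm (exp (- (1 + 2 * s) * (Ln Z + Ln W) + (2 * s - 2 * \<nu>) * Ln (Z + W))) \<le> E"
   unfolding E_def using n1 n2 True by (intro norm_exp_two_terms_le) auto
  have "norm (hyp2F1 (\<nu> - s) (- s) (\<nu> + 1) (((Z - W) / (Z + W))\<^sup>2)) \<le> (\<Sum>n. hyp_majorant (2 * R + 1) n * \<rho> ^ n)"
   using sv n3 \<rho> True by (intro norm_hyp2F1_le) (auto simp: \<rho>_def)
  hence 2: "norm (hyp2F1 (\<nu> - s) (- s) (\<nu> + 1) (((Z - W) / (Z + W))\<^sup>2)) \<le> H" unfolding H_def by linarith
  have "norm (reduced_A s \<nu> t) = norm (exp (- (1 + 2 * s) * (Ln Z + Ln W) + (2 * s - 2 * \<nu>) * Ln (Z + W))) *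
    norm (hyp2F1 (\<nu> - s) (- s) (\<nu> + 1) (((Z - W) / (Z + W))\<^sup>2))"
   unfolding reduced_A_def Let_def Z_def W_def norm_mult ..
  also have "\<dots> \<le> E * H" by (rule mult_mono[OF 1 2]) (auto simp: E_def)
  finally show ?thesis .
 qed
 moreover have "E * H \<ge> 0" by (simp add: E_def H_def)
 ultimately show ?thesis by blast
next
 case False
 hence "\<not> norm (s :: complex) \<le> R" for s using norm_ge_zero[of s] by linarith
 thus ?thesis by (intro exI[of _ 0]) auto
qed

text \<open>The profile differs from its value at 0 by at most a constant times
  \<open>norm v = 1 / \<bar>t\<bar>\<close>, with Cauchy's inequality for the derivative; this gains
  one power over the leading term, uniformly in \<open>s\<close> and \<open>\<nu>\<close>.\<close>

lemma reduced_A_asymptotics_large: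
 "\<exists>C\<ge>0. \<exists>N. \<forall>s \<nu> t. norm s \<le> R \<longrightarrow> norm \<nu> \<le> R \<longrightarrow> Re \<nu> \<ge> 0 \<longrightarrow> \<bar>t\<bar> \<ge> N \<longrightarrow> t \<noteq> 0 \<longrightarrow>
   norm (reduced_A s \<nu> t - A_lead s \<nu> t) \<le> C * \<bar>t\<bar> powr (- (2 + Re (s + \<nu>)))"
proof -
 let ?B = "\<lambda>s \<nu> t. - (1 + s + \<nu>) * Ln (\<i> * of_real t)"
 let ?A = "pi * \<bar>R\<bar>"
 define r where "r = profile_radius / 2"
 have r: "r > 0" "r < profile_radius" using profile_radius_pos by (auto simp: r_def)
 obtain M where M: "M \<ge> 0" and Mb: "\<forall>s \<nu> v. norm s \<le> R \<longrightarrow> norm \<nu> \<le> R \<longrightarrow> Re \<nu> \<ge> 0 \<longrightarrow> norm v \<le> r \<longrightarrow> norm (A_profile s \<nu> v) \<le> M"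
  using A_profile_bounded[OF r(2), of R] by (elim exE conjE)
 define C where "C = exp ?A * (M / (r / 2))"
 have C0: "C \<ge> 0" using M r by (simp add: C_def)
 have "norm (reduced_A s \<nu> t - A_lead s \<nu> t) \<le> C * \<bar>t\<bar> powr (- (2 + Re (s + \<nu>)))"
  if sv: "norm s \<le> R" "norm \<nu> \<le> R" "Re \<nu> \<ge> 0" and t: "\<bar>t\<bar> \<ge> 2 / r + 1" "t \<noteq> 0" for s \<nu> t
 proof -
  define v where "v = 1 / (\<i> * complex_of_real t)"
  have nv: "norm v = 1 / \<bar>t\<bar>" by (simp add: v_def norm_divide norm_mult)
  have "1 / \<bar>t\<bar> < r / 2"
  proof -
   have "2 / r < \<bar>t\<bar>" using t by linarith
   thus ?thesis using r t(2) by (simp add: field_simps)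
  qed
  hence v: "norm v < r / 2" using nv by simp
  have hol: "A_profile s \<nu> holomorphic_on ball 0 profile_radius" by (rule holomorphic_A_profile[OF sv(3)])
  have D: "(A_profile s \<nu> has_field_derivative deriv (A_profile s \<nu>) w) (at w within ball 0 (r / 2))" if "w \<in> ball 0 (r / 2)" for w
   using holomorphic_derivI[OF hol open_ball, of w "ball 0 (r / 2)"] that r by auto
  have "norm (deriv (A_profile s \<nu>) w) \<le> M / (r / 2)" if w: "w \<in> ball 0 (r / 2)" for w
  proof -
   have sub: "cball w (r / 2) \<subseteq> cball 0 r"
   proof
    fix y assume "y \<in> cball w (r / 2)"
    hence "norm (w - y) \<le> r / 2" by (simp add: dist_norm)
    thus "y \<in> cball 0 r" using w norm_triangle_ineq4[of w "w - y"] by simp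
   qed
   have sub': "cball 0 r \<subseteq> ball 0 profile_radius" using r by auto
   have "norm ((deriv ^^ 1) (A_profile s \<nu>) w) \<le> fact 1 * M / (r / 2) ^ 1"
   proof (rule Cauchy_inequality)
    show "A_profile s \<nu> holomorphic_on ball w (r / 2)" using hol sub sub' ball_subset_cball by (meson holomorphic_on_subset subset_trans)
    show "continuous_on (cball w (r / 2)) (A_profile s \<nu>)"
     using hol sub sub' by (meson holomorphic_on_imp_continuous_on holomorphic_on_subset subset_trans)
    show "norm (A_profile s \<nu> x) \<le> M" if "norm (w - x) = r / 2" for x
    proof -
     have "x \<in> cball 0 r" using sub that by (auto simp: dist_norm)
     thus ?thesis using Mb sv by simp
    qed
   qed (use r in simp)
   thus ?thesis by simp
  qed
  from field_differentiable_bound[OF convex_ball D this, of v 0]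
  have bd: "norm (A_profile s \<nu> v - A_profile s \<nu> 0) \<le> M / (r / 2) * norm v" using v r by simp
  have "norm (1 / (\<i> * of_real t)) \<le> profile_radius" using v r by (simp add: v_def)
  hence "reduced_A s \<nu> t - A_lead s \<nu> t = exp (?B s \<nu> t) * (A_profile s \<nu> v - A_profile s \<nu> 0)"
   unfolding A_lead_def A_profile_0 v_def using reduced_A_eq_profile[OF t(2)] by (simp add: right_diff_distrib)
  hence "norm (reduced_A s \<nu> t - A_lead s \<nu> t) = norm (exp (?B s \<nu> t)) * norm (A_profile s \<nu> v - A_profile s \<nu> 0)"
   by (simp only: norm_mult)
  also have "\<dots> \<le> (exp ?A * \<bar>t\<bar> powr (- (1 + Re (s + \<nu>)))) * (M / (r / 2) * norm v)"
  proof (intro mult_mono bd)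
   have "norm (exp (?B s \<nu> t)) \<le> exp (pi / 2 * \<bar>Im (1 + s + \<nu>)\<bar>) * \<bar>t\<bar> powr (- Re (1 + s + \<nu>))"
    by (rule norm_exp_Ln_imaginary[OF t(2)])
   also have "\<dots> \<le> exp ?A * \<bar>t\<bar> powr (- (1 + Re (s + \<nu>)))"
   proof (intro mult_mono)
    have "\<bar>Im (1 + s + \<nu>)\<bar> \<le> 2 * \<bar>R\<bar>" using abs_Im_le_cmod[of s] abs_Im_le_cmod[of \<nu>] sv by simp
    thus "exp (pi / 2 * \<bar>Im (1 + s + \<nu>)\<bar>) \<le> exp ?A" by simp
    have "- Re (1 + s + \<nu>) = - (1 + Re (s + \<nu>))" by simp
    thus "\<bar>t\<bar> powr (- Re (1 + s + \<nu>)) \<le> \<bar>t\<bar> powr (- (1 + Re (s + \<nu>)))" by (simp only: order_refl)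
   qed auto
   finally show "norm (exp (?B s \<nu> t)) \<le> exp ?A * \<bar>t\<bar> powr (- (1 + Re (s + \<nu>)))" .
  qed (auto simp: M)
  also have "\<dots> = C * (\<bar>t\<bar> powr (- (1 + Re (s + \<nu>))) * norm v)" by (simp only: C_def mult_ac)
  also have "\<bar>t\<bar> powr (- (1 + Re (s + \<nu>))) * norm v = \<bar>t\<bar> powr (- (2 + Re (s + \<nu>)))"
  proof -
   have "norm v = \<bar>t\<bar> powr (- 1)" unfolding nv by (simp add: powr_minus inverse_eq_divide)
   moreover have "- (1 + Re (s + \<nu>)) + - 1 = - (2 + Re (s + \<nu>))" by simp
   ultimately show ?thesis by (simp only: powr_add[symmetric])
  qed
  finally show ?thesis .
 qed
 thus ?thesis using C0 by blast
qed

text \<open>The finitely many \<open>n\<close> below the threshold are absorbed into the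
  constant.\<close>

lemma reduced_A_asymptotics:
 "\<exists>C\<ge>0. \<forall>s \<nu> t n. norm s \<le> R \<longrightarrow> norm \<nu> \<le> R \<longrightarrow> Re \<nu> \<ge> 0 \<longrightarrow> n > 0 \<longrightarrow> \<bar>t\<bar> = real n \<longrightarrow>
   norm (reduced_A s \<nu> t - A_lead s \<nu> t) \<le> C * real n powr (- (2 + Re (s + \<nu>)))"
proof (cases "R \<ge> 0")
 case R: True
 obtain C N where C: "C \<ge> 0" and CN: "\<forall>s \<nu> t. norm s \<le> R \<longrightarrow> norm \<nu> \<le> R \<longrightarrow> Re \<nu> \<ge> 0 \<longrightarrow> \<bar>t\<bar> \<ge> N \<longrightarrow> t \<noteq> 0 \<longrightarrow>
   norm (reduced_A s \<nu> t - A_lead s \<nu> t) \<le> C * \<bar>t\<bar> powr (- (2 + Re (s + \<nu>)))"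
  using reduced_A_asymptotics_large[of R] by (elim exE conjE)
 obtain B where B: "\<forall>t. B t \<ge> 0 \<and> (\<forall>s \<nu>. norm s \<le> R \<longrightarrow> norm \<nu> \<le> R \<longrightarrow> Re \<nu> \<ge> 0 \<longrightarrow> norm (reduced_A s \<nu> t) \<le> B t)"
  using reduced_A_bounded_at[of R] by metis
 define L where "L = (\<lambda>t. exp ((1 + 2 * R) * norm (Ln (\<i> * complex_of_real t))) * exp (4 * R * ln 2))"
 \<comment> \<open>Since \<open>Re (s + \<nu>) \<le> 2 * R\<close>, the factor
   \<open>n powr (2 + 2 * R)\<close> outweighs \<open>n powr (- (2 + Re (s + \<nu>)))\<close>, so
   \<open>K n\<close> is a valid constant for this single \<open>n\<close>.\<close>
 define K where "K = (\<lambda>n. (B (real n) + B (- real n) + L (real n) + L (- real n)) * real n powr (2 + 2 * R))"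
 have K0: "K n \<ge> 0" for n using B by (auto simp: K_def L_def)
 define D where "D = C + (\<Sum>n\<in>{n. real n < N}. K n)"
 have fin: "finite {n. real n < N}"
  by (rule finite_subset[of _ "{..nat \<lceil>N\<rceil>}"]) (auto, linarith)
 have S0: "(\<Sum>n\<in>{n. real n < N}. K n) \<ge> 0" using K0 by (simp add: sum_nonneg)
 have "norm (reduced_A s \<nu> t - A_lead s \<nu> t) \<le> D * real n powr (- (2 + Re (s + \<nu>)))"
  if sv: "norm s \<le> R" "norm \<nu> \<le> R" "Re \<nu> \<ge> 0" and n: "n > 0" "\<bar>t\<bar> = real n" for s \<nu> t n
 proof (cases "real n < N")
  case False
  hence "norm (reduced_A s \<nu> t - A_lead s \<nu> t) \<le> C * real n powr (- (2 + Re (s + \<nu>)))"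
   using CN[rule_format, of s \<nu> t] sv n by auto
  also have "\<dots> \<le> D * real n powr (- (2 + Re (s + \<nu>)))" using S0 by (intro mult_right_mono) (auto simp: D_def)
  finally show ?thesis .
 next
  case True
  have t: "t = real n \<or> t = - real n" using n by linarith
  have l: "norm (A_lead s \<nu> t) \<le> L t"
   unfolding A_lead_def L_def norm_mult
  proof (intro mult_mono)
   have "norm (1 + s + \<nu>) \<le> 1 + 2 * R" using norm_triangle_ineq[of "1 + s" \<nu>] norm_triangle_ineq[of 1 s] sv by simp
   hence "norm (- (1 + s + \<nu>) * Ln (\<i> * of_real t)) \<le> (1 + 2 * R) * norm (Ln (\<i> * complex_of_real t))"
    unfolding norm_mult norm_minus_cancel by (intro mult_right_mono) auto
   thus "norm (exp (- (1 + s + \<nu>) * Ln (\<i> * of_real t))) \<le> exp ((1 + 2 * R) * norm (Ln (\<i> * complex_of_real t)))"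
    by (rule norm_exp_le)
   have "norm ((2 * s - 2 * \<nu>) * complex_of_real (ln 2)) \<le> 4 * R * ln 2"
    unfolding norm_mult using norm_triangle_ineq4[of "2 * s" "2 * \<nu>"] sv R by (intro mult_mono) (auto simp: norm_mult)
   thus "norm (exp ((2 * s - 2 * \<nu>) * complex_of_real (ln 2))) \<le> exp (4 * R * ln 2)"
    by (rule norm_exp_le)
  qed auto
  have Lp: "L x \<ge> 0" for x by (simp add: L_def)
  have "norm (reduced_A s \<nu> t - A_lead s \<nu> t) \<le> norm (reduced_A s \<nu> t) + norm (A_lead s \<nu> t)" by (rule norm_triangle_ineq4)
  also have "\<dots> \<le> B t + L t" using B l sv by (intro add_mono) auto
  also have "\<dots> \<le> B (real n) + B (- real n) + L (real n) + L (- real n)"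
   using t B Lp by (smt (verit))
  also have "\<dots> = (B (real n) + B (- real n) + L (real n) + L (- real n)) * real n powr 0" using n by simp
  also have "\<dots> \<le> (B (real n) + B (- real n) + L (real n) + L (- real n)) * real n powr (2 * R - Re (s + \<nu>))"
   using n B Lp sv complex_Re_le_cmod[of s] complex_Re_le_cmod[of \<nu>] by (intro mult_left_mono powr_mono) (auto intro!: add_nonneg_nonneg)
  also have "real n powr (2 * R - Re (s + \<nu>)) = real n powr (2 + 2 * R) * real n powr (- (2 + Re (s + \<nu>)))"
  proof -
   have "2 * R - Re (s + \<nu>) = 2 + 2 * R + - (2 + Re (s + \<nu>))" by simp
   thus ?thesis by (simp only: powr_add)
  qed
  also have "(B (real n) + B (- real n) + L (real n) + L (- real n)) * (real n powr (2 + 2 * R) * real n powr (- (2 + Re (s + \<nu>)))) = K n * real n powr (- (2 + Re (s + \<nu>)))"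
   unfolding K_def by (simp only: mult.assoc)
  also have "\<dots> \<le> D * real n powr (- (2 + Re (s + \<nu>)))"
  proof (intro mult_right_mono)
   have "K n \<le> (\<Sum>n\<in>{n. real n < N}. K n)" using True fin K0 by (intro member_le_sum) auto
   thus "K n \<le> D" using C by (simp add: D_def)
  qed auto
  finally show ?thesis .
 qed
 moreover have "D \<ge> 0" using C S0 by (simp add: D_def)
 ultimately show ?thesis by blast
next
 case False
 hence "\<not> norm (s :: complex) \<le> R" for s using norm_ge_zero[of s] by linarith
 thus ?thesis by (intro exI[of _ 0]) auto
qed

lemma reduced_A_bound:
 assumes "Re \<nu> \<ge> 0"
 shows "\<exists>C\<ge>0. \<forall>t n. n > 0 \<longrightarrow> \<bar>t\<bar> = real n \<longrightarrow> norm (reduced_A s \<nu> t) \<le> C * real n powr (- (1 + Re (s + \<nu>)))"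
proof -
 let ?B = "- (1 + Re (s + \<nu>))"
 let ?A = "exp ((2 * s - 2 * \<nu>) * complex_of_real (ln 2))"
 obtain C where C: "C \<ge> 0" and b: "\<forall>s' \<nu>' t n. norm s' \<le> max (norm s) (norm \<nu>) \<longrightarrow> norm \<nu>' \<le> max (norm s) (norm \<nu>) \<longrightarrow> Re \<nu>' \<ge> 0 \<longrightarrow> n > 0 \<longrightarrow> \<bar>t\<bar> = real n \<longrightarrow>
   norm (reduced_A s' \<nu>' t - A_lead s' \<nu>' t) \<le> C * real n powr (- (2 + Re (s' + \<nu>')))"
  using reduced_A_asymptotics[of "max (norm s) (norm \<nu>)"] by (elim exE conjE)
 define D where "D = exp (pi / 2 * \<bar>Im (1 + s + \<nu>)\<bar>) * norm ?A"
 have "norm (reduced_A s \<nu> t) \<le> (C + D) * real n powr ?B" if n: "n > 0" "\<bar>t\<bar> = real n" for t n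
 proof -
  have t: "t \<noteq> 0" using n by auto
  have "norm (A_lead s \<nu> t) \<le> D * real n powr ?B"
   using mult_right_mono[OF norm_exp_Ln_imaginary[OF t, of "1 + s + \<nu>"], of "norm ?A"] n
   unfolding A_lead_def D_def norm_mult by (simp add: mult_ac add.assoc)
  moreover have "norm (reduced_A s \<nu> t - A_lead s \<nu> t) \<le> C * real n powr (- (2 + Re (s + \<nu>)))"
   using b assms n by simp
  moreover have "C * real n powr (- (2 + Re (s + \<nu>))) \<le> C * real n powr ?B"
   using C n by (intro mult_left_mono powr_mono) auto
  moreover have "norm (reduced_A s \<nu> t) \<le> norm (reduced_A s \<nu> t - A_lead s \<nu> t) + norm (A_lead s \<nu> t)"
   using norm_triangle_ineq[of "reduced_A s \<nu> t - A_lead s \<nu> t" "A_lead s \<nu> t"] by simp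
  ultimately show ?thesis unfolding distrib_right by linarith
 qed
 moreover have "C + D \<ge> 0" using C by (simp add: D_def)
 ultimately show ?thesis by blast
qed

end

section \<open>The identity in the domain of absolute convergence\<close>

text \<open>From \<open>y \<le> exp y\<close> raised to the power \<open>- p\<close>: exponential
  decay is traded for a power with explicit constant.\<close>

lemma exp_minus_le_powr:
 fixes x p \<delta> :: real
 assumes "x > 0" "p > 0" "\<delta> > 0"
 shows "exp (- (\<delta> * x)) \<le> (\<delta> * x / p) powr (- p)"
proof -
 define y where "y = \<delta> * x / p"
 have y: "y > 0" using assms by (simp add: y_def)
 have "y \<le> exp y" using exp_ge_add_one_self[of y] by linarith
 hence "exp y powr (- p) \<le> y powr (- p)" using y assms by (intro powr_mono2') auto
 moreover have "exp y powr (- p) = exp (- (\<delta> * x))" using assms by (simp add: exp_powr_real y_def)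
 ultimately show ?thesis by (simp add: y_def)
qed

lemma norm_divisor_sigma_le_uniform:
 assumes n: "n > 0" and F: "norm F \<le> C * real n powr (- q)" and C: "C \<ge> 0" and q: "q0 \<le> q" "q - Re s \<ge> 2"
 shows "norm (divisor_sigma s n * F) \<le> C * (\<Sum>d | d dvd n. real d powr (- 2) * real (n div d) powr (- q0))"
proof -
 have "norm (divisor_sigma s n * F) \<le> C * (\<Sum>d | d dvd n. real d powr (- (q - Re s)) * real (n div d) powr (- q))"
  by (rule norm_divisor_sigma_le[OF n F C])
 also have "\<dots> \<le> C * (\<Sum>d | d dvd n. real d powr (- 2) * real (n div d) powr (- q0))"
 proof (intro mult_left_mono sum_mono C)
  fix d assume "d \<in> {d. d dvd n}"
  then obtain k where k: "n = d * k" by auto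
  hence d: "d \<ge> 1" "n div d \<ge> 1" using n by auto
  show "real d powr (- (q - Re s)) * real (n div d) powr (- q) \<le> real d powr (- 2) * real (n div d) powr (- q0)"
   using d q by (intro mult_mono powr_mono) (auto simp: real_of_nat_ge_one_iff)
 qed
 finally show ?thesis .
qed

lemma holomorphic_divisor_sigma [holomorphic_intros]:
 "f holomorphic_on S \<Longrightarrow> (\<lambda>z. divisor_sigma (f z) n) holomorphic_on S"
 unfolding divisor_sigma_def by (intro holomorphic_intros)

lemma local_parameter_bounds:
 fixes s \<nu> :: "complex \<Rightarrow> complex"
 assumes S: "open S" "z0 \<in> S" and c: "continuous_on S s" "continuous_on S \<nu>" and p: "Re (\<nu> z0) > 0" "Re (s z0 + \<nu> z0) > m"
 shows "\<exists>r>0. \<exists>a>0. \<exists>b>m. \<exists>R>0. \<forall>z\<in>ball z0 r. Re (\<nu> z) \<ge> a \<and> Re (s z + \<nu> z) \<ge> b \<and> norm (s z) \<le> R \<and> norm (\<nu> z) \<le> R"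
proof -
 define a where "a = Re (\<nu> z0) / 2"
 define b where "b = (m + Re (s z0 + \<nu> z0)) / 2"
 define R where "R = norm (s z0) + norm (\<nu> z0) + 1"
 have lim: "(s \<longlongrightarrow> s z0) (nhds z0)" "(\<nu> \<longlongrightarrow> \<nu> z0) (nhds z0)"
  using c S by (auto simp: continuous_on_eq_continuous_at isCont_def tendsto_at_iff_tendsto_nhds)
 have ab: "a < Re (\<nu> z0)" "b < Re (s z0 + \<nu> z0)" "norm (s z0) < R" "norm (\<nu> z0) < R"
  using p by (auto simp: a_def b_def R_def field_simps add_pos_nonneg intro: add_nonneg_pos)
 have "\<forall>\<^sub>F z in nhds z0. a < Re (\<nu> z) \<and> b < Re (s z + \<nu> z) \<and> norm (s z) < R \<and> norm (\<nu> z) < R"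
  by (intro eventually_conj order_tendstoD(1)[OF tendsto_Re ab(1)] order_tendstoD(1)[OF tendsto_Re ab(2)] order_tendstoD(2)[OF tendsto_norm ab(3)] order_tendstoD(2)[OF tendsto_norm ab(4)] tendsto_add lim)
 then obtain r where r: "r > 0" "\<forall>z. dist z z0 < r \<longrightarrow> a < Re (\<nu> z) \<and> b < Re (s z + \<nu> z) \<and> norm (s z) < R \<and> norm (\<nu> z) < R"
  unfolding eventually_nhds_metric by blast
 have "\<forall>z\<in>ball z0 r. Re (\<nu> z) \<ge> a \<and> Re (s z + \<nu> z) \<ge> b \<and> norm (s z) \<le> R \<and> norm (\<nu> z) \<le> R"
 proof
  fix z assume "z \<in> ball z0 r"
  hence "dist z z0 < r" by (simp add: dist_commute)
  thus "Re (\<nu> z) \<ge> a \<and> Re (s z + \<nu> z) \<ge> b \<and> norm (s z) \<le> R \<and> norm (\<nu> z) \<le> R" using r(2) by (meson less_imp_le)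
 qed
 moreover have "a > 0" "b > m" "R > 0" using p by (auto simp: a_def b_def R_def add_nonneg_pos)
 ultimately show ?thesis using r(1) by blast
qed

section \<open>The two-way summation and holomorphy of both series\<close>

context bessel_pair
begin

definition N_pm :: "complex \<Rightarrow> nat \<Rightarrow> complex" where
 "N_pm \<nu> n = psi_inverse_transform \<nu> (of_real (2 * pi * real n) * \<i>) + psi_inverse_transform \<nu> (- (of_real (2 * pi * real n) * \<i>))"

lemma N_pm_decay:
 assumes a: "a > 0"
 shows "\<exists>C\<ge>0. \<forall>\<nu> n. Re \<nu> \<ge> a \<longrightarrow> norm \<nu> \<le> R \<longrightarrow> n > 0 \<longrightarrow> norm (N_pm \<nu> n) \<le> C * real n powr (- A)"
proof -
 obtain C1 where C1: "C1 \<ge> 0" "\<forall>\<nu> n. Re \<nu> \<ge> a \<longrightarrow> norm \<nu> \<le> R \<longrightarrow> n > 0 \<longrightarrow>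
   norm (psi_inverse_transform \<nu> (of_real (2 * pi * real n) * \<i>)) \<le> C1 * real n powr (- A)"
  using psi_inverse_transform_decay_powr[OF disjI1[OF refl] a, of R A] by (elim exE conjE)
 obtain C2 where C2: "C2 \<ge> 0" "\<forall>\<nu> n. Re \<nu> \<ge> a \<longrightarrow> norm \<nu> \<le> R \<longrightarrow> n > 0 \<longrightarrow>
   norm (psi_inverse_transform \<nu> (of_real (2 * pi * real n) * (- \<i>))) \<le> C2 * real n powr (- A)"
  using psi_inverse_transform_decay_powr[OF disjI2[OF refl] a, of R A] by (elim exE conjE)
 have "norm (N_pm \<nu> n) \<le> (C1 + C2) * real n powr (- A)" if "Re \<nu> \<ge> a" "norm \<nu> \<le> R" "n > 0" for \<nu> n
  unfolding N_pm_def distrib_right mult_minus_right[symmetric]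
  by (intro order_trans[OF norm_triangle_ineq] add_mono C1(2)[rule_format] C2(2)[rule_format] that)
 thus ?thesis using C1 C2 by (intro exI[of _ "C1 + C2"]) auto
qed

text \<open>The exponential decay in \<open>d / k\<close> is replaced by
  \<open>(d / k) powr (- p)\<close>. With \<open>p = Re \<nu> - r\<close> the exponents of
  \<open>d\<close> and \<open>k\<close> become \<open>Re s + r\<close> and \<open>- (1 + r)\<close>,
  so the double series has a product majorant.\<close>

lemma lattice_term_summable:
 assumes \<nu>: "Re \<nu> > 0" and s: "Re s < - 1"
 shows "(\<lambda>(d, k). lattice_term s \<nu> (Suc d) (Suc k)) summable_on UNIV"
proof -
 let ?B = "- (1 + Re \<nu>)"
 \<comment> \<open>Half of the room available on each side: \<open>r > 0\<close> serves the sum over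
   \<open>k\<close>, \<open>Re s + r < - 1\<close> the sum over \<open>d\<close>, and
   \<open>r < Re \<nu>\<close> keeps \<open>p\<close> positive.\<close>
 define r where "r = min (Re \<nu>) (- 1 - Re s) / 2"
 let ?A = "- (- (Re s + r))"
 have r: "r > 0" "r < Re \<nu>" "Re s + r < - 1"
 proof -
  have "r \<le> (- 1 - Re s) / 2" "r \<le> Re \<nu> / 2" by (auto simp: r_def)
  thus "r < Re \<nu>" using \<nu> by linarith
  have "2 * r \<le> - 1 - Re s" using \<open>r \<le> (- 1 - Re s) / 2\<close> by simp
  thus "Re s + r < - 1" using s by linarith
  show "r > 0" using \<nu> s by (simp add: r_def)
 qed
 define p where "p = Re \<nu> - r"
 have p: "p > 0" using r by (simp add: p_def)
 obtain C where "C > 0" and C': "\<forall>j\<le>2. \<forall>x\<ge>0. norm ((deriv ^^ j) (bessel_psi \<nu>) (of_real x)) \<le> C * exp (- (decay * x))"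
  using bessel_psi_deriv_decay[OF \<nu>] by (elim exE conjE)
 have C: "norm (bessel_psi \<nu> (of_real x)) \<le> C * exp (- (decay * x))" if "x \<ge> 0" for x
  using C' that by (metis funpow_0 zero_le)
 define K where "K = C * (decay / p) powr (- p)"
 have K: "K \<ge> 0" using \<open>C > 0\<close> by (simp add: K_def)
 have "(\<lambda>(d, k). lattice_term s \<nu> (Suc d) (Suc k)) summable_on UNIV \<times> UNIV"
 proof (rule summable_on_product_bound[of "\<lambda>d. K * real (Suc d) powr ?A" _ "\<lambda>k. real (Suc k) powr (- (1 + r))"])
  show "(\<lambda>d. K * real (Suc d) powr ?A) summable_on UNIV" "(\<lambda>k. real (Suc k) powr (- (1 + r))) summable_on UNIV"
   using r K by (intro summable_on_nat_of_nonneg summable_mult summable_Suc_powr; simp)+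
  fix d k :: nat
  define D where "D = real (Suc d)"
  define J where "J = real (Suc k)"
  have DJ: "D > 0" "J > 0" by (simp_all add: D_def J_def)
  have "norm (bessel_psi \<nu> (of_real (D / J))) \<le> C * exp (- (decay * (D / J)))" using DJ by (intro C) simp
  also have "\<dots> \<le> C * (decay * (D / J) / p) powr (- p)"
   using \<open>C > 0\<close> DJ p decay_pos by (intro mult_left_mono exp_minus_le_powr) auto
  also have "decay * (D / J) / p = (decay / p) * (D / J)" by simp
  also have "\<dots> powr (- p) = (decay / p) powr (- p) * (D powr (- p) * J powr p)"
   using DJ p decay_pos by (simp add: powr_mult powr_divide powr_minus_divide)
  finally have b: "norm (bessel_psi \<nu> (of_real (D / J))) \<le> K * (D powr (- p) * J powr p)" by (simp add: K_def mult_ac)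
  have "norm (lattice_term s \<nu> (Suc d) (Suc k)) = D powr Re (s + \<nu>) * J powr ?B * norm (bessel_psi \<nu> (of_real (D / J)))"
   unfolding lattice_term_def D_def[symmetric] J_def[symmetric] norm_mult using DJ by (simp add: norm_powr_real_powr)
  also have "\<dots> \<le> D powr Re (s + \<nu>) * J powr ?B * (K * (D powr (- p) * J powr p))"
   by (intro mult_left_mono b) auto
  also have "\<dots> = K * (D powr Re (s + \<nu>) * D powr (- p)) * (J powr ?B * J powr p)" by (simp only: mult_ac)
  also have "D powr Re (s + \<nu>) * D powr (- p) = D powr ?A" by (simp add: powr_add[symmetric] p_def add.commute)
  also have "J powr ?B * J powr p = J powr (- (1 + r))" by (simp add: powr_add[symmetric] p_def)
  finally show "norm (case (d, k) of (d, k) \<Rightarrow> lattice_term s \<nu> (Suc d) (Suc k)) \<le> K * real (Suc d) powr ?A * real (Suc k) powr (- (1 + r))"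
   by (simp add: D_def J_def)
 qed (use K in auto)
 thus ?thesis by simp
qed

lemma psi_transform_bound:
 assumes \<nu>: "Re \<nu> > 0" and u: "Re (s + \<nu> + 1) > 0"
 shows "\<exists>C\<ge>0. \<forall>t n. n > 0 \<longrightarrow> \<bar>t\<bar> = real n \<longrightarrow> norm (psi_transform s \<nu> t) \<le> C * real n powr (- (1 + Re (s + \<nu>)))"
proof -
 let ?A = "Acoeff s \<nu> * exp (\<nu> * Ln (\<alpha> - \<beta>))"
 obtain C where C: "C \<ge> 0" and b: "\<forall>t n. n > 0 \<longrightarrow> \<bar>t\<bar> = real n \<longrightarrow> norm (reduced_A s \<nu> t) \<le> C * real n powr (- (1 + Re (s + \<nu>)))"
  using reduced_A_bound[OF less_imp_le[OF \<nu>], of s] by (elim exE conjE)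
 have amp: "amp \<nu> \<noteq> 0" by (simp add: amp_def)
 define K where "K = norm (2 / amp \<nu> * ?A)"
 have "psi_transform s \<nu> t = 2 / amp \<nu> * ?A * reduced_A s \<nu> t" for t
 proof -
  have "psi_transform s \<nu> t = 2 / amp \<nu> * (amp \<nu> / 2 * psi_transform s \<nu> t)" using amp by simp
  thus ?thesis unfolding psi_transform_eq[OF \<nu> u] by (simp only: mult.assoc)
 qed
 hence e: "norm (psi_transform s \<nu> t) = K * norm (reduced_A s \<nu> t)" for t by (simp only: K_def norm_mult)
 have "norm (psi_transform s \<nu> t) \<le> K * C * real n powr (- (1 + Re (s + \<nu>)))" if "n > 0" "\<bar>t\<bar> = real n" for t n
  unfolding e mult.assoc using b that by (intro mult_left_mono) (auto simp: K_def)
 moreover have "K * C \<ge> 0" using C by (simp add: K_def)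
 ultimately show ?thesis by blast
qed

text \<open>Row sums of the double series are given by Poisson summation in \<open>k\<close>, column
  sums by Poisson summation in \<open>d\<close>. The zero frequencies carry the sum of
  \<open>d powr s\<close>, that is \<open>zeta (- s)\<close>, and the other frequencies regroup into
  divisor sums.\<close>

lemma voronoi_transform:
 assumes \<nu>: "Re \<nu> > 0" and s: "Re s < - 1" and u: "Re (s + \<nu>) > 1"
 shows "zeta (- s) * psi_inverse_transform \<nu> 0 + (\<Sum>n. divisor_sigma s (Suc n) * N_pm \<nu> (Suc n)) =
  zeta (- s) * psi_transform s \<nu> 0 +
   (\<Sum>n. divisor_sigma s (Suc n) * (psi_transform s \<nu> (real (Suc n)) + psi_transform s \<nu> (- real (Suc n))))"
proof -
 let ?A = "\<Sum>n. divisor_sigma s (Suc n) * N_pm \<nu> (Suc n)"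
 define T where "T = (\<lambda>(d, k). lattice_term s \<nu> (Suc d) (Suc k))"
 have T: "T summable_on UNIV" unfolding T_def by (rule lattice_term_summable[OF \<nu> s])
 define L where "L = (\<lambda>n. psi_transform s \<nu> (real n) + psi_transform s \<nu> (- real n))"
 let ?B = "\<Sum>n. divisor_sigma s (Suc n) * L (Suc n)"
 have z: "(\<lambda>d. of_real (real (Suc d)) powr s * c) sums (zeta (- s) * c)" for c
  using sums_mult2[OF zeta_sums_powr[of "- s"], of c] s by simp
 obtain C where C: "C \<ge> 0" "\<forall>\<nu>' n. Re \<nu>' \<ge> Re \<nu> \<longrightarrow> norm \<nu>' \<le> norm \<nu> \<longrightarrow> n > 0 \<longrightarrow> norm (N_pm \<nu>' n) \<le> C * real n powr (- 2)"
  using N_pm_decay[OF \<nu>, of "norm \<nu>" 2] by (elim exE conjE)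
 have N: "norm (N_pm \<nu> n) \<le> C * real n powr (- 2)" if "n > 0" for n using C(2) that by simp
 have Ns: "(\<lambda>d. \<Sum>j. of_real (real (Suc d)) powr s * N_pm \<nu> (Suc j * Suc d)) sums ?A"
  using s by (intro sigma_double_series(2)[of _ C 2] N C(1)) auto
 have u': "Re (s + \<nu> + 1) > 0" using u by simp
 obtain C' where C': "C' \<ge> 0" "\<forall>t n. n > 0 \<longrightarrow> \<bar>t\<bar> = real n \<longrightarrow> norm (psi_transform s \<nu> t) \<le> C' * real n powr (- (1 + Re (s + \<nu>)))"
  using psi_transform_bound[OF \<nu> u'] by (elim exE conjE)
 have Lb: "norm (L n) \<le> (C' + C') * real n powr (- (1 + Re (s + \<nu>)))" if "n > 0" for n
  unfolding L_def distrib_right using C'(2) that by (intro order_trans[OF norm_triangle_ineq] add_mono) auto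
 have Ls: "(\<lambda>d. \<Sum>j. of_real (real (Suc d)) powr s * L (Suc j * Suc d)) sums ?B"
  using s u \<nu> C'(1) by (intro sigma_double_series(2)[of _ "C' + C'" "1 + Re (s + \<nu>)"] Lb) auto
 have 1: "(\<Sum>k. T (d, k)) = of_real (real (Suc d)) powr s * psi_inverse_transform \<nu> 0 + (\<Sum>j. of_real (real (Suc d)) powr s * N_pm \<nu> (Suc j * Suc d))" for d
  using sums_unique[OF lattice_sum_second[OF \<nu> zero_less_Suc, of d s], folded N_pm_def]
  unfolding T_def prod.case diff_eq_eq by (simp only: add.commute)
 have 2: "(\<Sum>d. T (d, k)) = of_real (real (Suc k)) powr s * psi_transform s \<nu> 0 + (\<Sum>j. of_real (real (Suc k)) powr s * L (Suc j * Suc k))" for k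
  using sums_unique[OF lattice_sum_first[OF \<nu> u zero_less_Suc, of k]]
  unfolding T_def L_def prod.case diff_eq_eq by (simp only: add.commute)
 have A: "(\<lambda>d. \<Sum>k. T (d, k)) sums (zeta (- s) * psi_inverse_transform \<nu> 0 + ?A)"
  unfolding 1 by (intro sums_add z Ns)
 have B: "(\<lambda>k. \<Sum>d. T (d, k)) sums (zeta (- s) * psi_transform s \<nu> 0 + ?B)"
  unfolding 2 by (intro sums_add z Ls)
 show ?thesis
  using sums_unique2[OF A suminf_swap(1)[OF T]] sums_unique2[OF B suminf_swap(2)[OF T]] unfolding L_def by (simp only:)
qed

lemma holomorphic_psi_inverse_transform:
 assumes "Re X \<ge> 0"
 shows "(\<lambda>\<nu>. psi_inverse_transform \<nu> X) holomorphic_on {\<nu>. Re \<nu> > 0}"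
proof (rule holomorphic_transform)
 show "(\<lambda>\<nu>. bessel_It \<nu> (of_real (sqrt (2 * pi)) * root_diff * csqrt X) *
   bessel_moment (of_real pi * root_sum\<^sup>2 / 2) X \<nu>) holomorphic_on {\<nu>. Re \<nu> > 0}"
  by (intro holomorphic_on_mult holomorphic_bessel_It_order holomorphic_bessel_moment_order Re_mu_pos assms)
qed (use assms psi_inverse_transform_eq in auto)

lemma holomorphic_N_pm:
 assumes "\<nu> holomorphic_on S" "\<And>z. z \<in> S \<Longrightarrow> Re (\<nu> z) > 0"
 shows "(\<lambda>z. N_pm (\<nu> z) n) holomorphic_on S"
proof -
 have "(\<lambda>\<nu>. N_pm \<nu> n) holomorphic_on {\<nu>. Re \<nu> > 0}"
  unfolding N_pm_def by (intro holomorphic_on_add holomorphic_psi_inverse_transform) auto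
 from holomorphic_on_compose_gen[OF assms(1) this] show ?thesis using assms(2) by (auto simp: o_def)
qed

lemma holomorphic_reduced_A:
 assumes "open S" "s holomorphic_on S" "\<nu> holomorphic_on S" "\<And>z. z \<in> S \<Longrightarrow> Re (\<nu> z) > 0"
 shows "(\<lambda>z. reduced_A (s z) (\<nu> z) t) holomorphic_on S"
proof -
 have q: "norm (((csqrt (\<alpha> + \<i> * of_real t) - csqrt (\<beta> + \<i> * of_real t)) / (csqrt (\<alpha> + \<i> * of_real t) + csqrt (\<beta> + \<i> * of_real t)))\<^sup>2) < 1"
  unfolding norm_power using sector_quotient(1)[OF shifted_sectors, of t] by (simp add: power_less_one_iff)
 show ?thesis
  unfolding reduced_A_def Let_def
  by (intro holomorphic_intros holomorphic_hyp2F1_comp assms q) (use assms(4) less_imp_le in auto)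
qed

lemma bessel_series_holomorphic:
 assumes S: "open S" and hol: "s holomorphic_on S" "\<nu> holomorphic_on S" and \<nu>: "\<And>z. z \<in> S \<Longrightarrow> Re (\<nu> z) > 0"
 shows "(\<lambda>z. \<Sum>n. divisor_sigma (s z) (Suc n) * N_pm (\<nu> z) (Suc n)) holomorphic_on S"
proof (rule holomorphic_on_suminf[OF S])
 show "(\<lambda>z. divisor_sigma (s z) (Suc n) * N_pm (\<nu> z) (Suc n)) holomorphic_on S" for n
  by (intro holomorphic_intros holomorphic_N_pm hol \<nu>)
next
 fix z0 assume z0: "z0 \<in> S"
 \<comment> \<open>A dummy lower bound: only the bounds on \<open>\<nu>\<close> and on the norms are
   taken from the neighbourhood.\<close>
 have m: "Re (s z0 + \<nu> z0) > Re (s z0 + \<nu> z0) - 1" by simp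
 obtain r a b R where r: "r > 0" "a > 0" "R > 0" and bd: "\<forall>z\<in>ball z0 r. Re (\<nu> z) \<ge> a \<and> Re (s z + \<nu> z) \<ge> b \<and> norm (s z) \<le> R \<and> norm (\<nu> z) \<le> R"
  using local_parameter_bounds[OF S z0 holomorphic_on_imp_continuous_on[OF hol(1)] holomorphic_on_imp_continuous_on[OF hol(2)] \<nu>[OF z0] m] by (elim exE conjE)
 obtain C where C: "C \<ge> 0" "\<forall>\<nu>' n. Re \<nu>' \<ge> a \<longrightarrow> norm \<nu>' \<le> R \<longrightarrow> n > 0 \<longrightarrow> norm (N_pm \<nu>' n) \<le> C * real n powr (- (R + 2))"
  using N_pm_decay[OF r(2), of R "R + 2"] by (elim exE conjE)
 have "norm (divisor_sigma (s z) (Suc n) * N_pm (\<nu> z) (Suc n)) \<le> C * (\<Sum>d | d dvd Suc n. real d powr (- 2) * real (Suc n div d) powr (- (R + 2)))"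
  if "z \<in> ball z0 r" for z n
 proof (rule norm_divisor_sigma_le_uniform)
  show "norm (N_pm (\<nu> z) (Suc n)) \<le> C * real (Suc n) powr (- (R + 2))" using C(2)[rule_format, of "\<nu> z" "Suc n"] bd[rule_format, OF that] by simp
  have "Re (s z) \<le> R" using complex_Re_le_cmod[of "s z"] bd that by (meson order_trans)
  thus "2 \<le> R + 2 - Re (s z)" by simp
 qed (use C in auto)
 moreover have "summable (\<lambda>n. C * (\<Sum>d | d dvd Suc n. real d powr (- 2) * real (Suc n div d) powr (- (R + 2))))"
  using r by (intro summable_mult summable_divisor_majorant) auto
 ultimately show "\<exists>r>0. \<exists>B. summable B \<and> (\<forall>z\<in>ball z0 r \<inter> S. \<forall>n. norm (divisor_sigma (s z) (Suc n) * N_pm (\<nu> z) (Suc n)) \<le> B n)"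
  using r(1) by blast
qed

lemma bessel_series_summable:
 assumes \<nu>: "Re \<nu> > 0"
 shows "summable (\<lambda>n. divisor_sigma s (Suc n) * N_pm \<nu> (Suc n))"
proof -
 define p where "p = \<bar>Re s\<bar> + 2"
 obtain C where C: "C \<ge> 0" "\<forall>\<nu>' n. Re \<nu>' \<ge> Re \<nu> \<longrightarrow> norm \<nu>' \<le> norm \<nu> \<longrightarrow> n > 0 \<longrightarrow> norm (N_pm \<nu>' n) \<le> C * real n powr (- p)"
  using N_pm_decay[OF \<nu>, of "norm \<nu>" p] by (elim exE conjE)
 show ?thesis by (rule sigma_double_series(1)[of _ C p]) (use C in \<open>auto simp: p_def\<close>)
qed

definition A_remainder :: "complex \<Rightarrow> complex \<Rightarrow> nat \<Rightarrow> complex" where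
 "A_remainder s \<nu> n = (reduced_A s \<nu> (real n) - A_lead s \<nu> (real n)) + (reduced_A s \<nu> (- real n) - A_lead s \<nu> (- real n))"

lemma A_remainder_bound:
 "\<exists>C\<ge>0. \<forall>s \<nu> n. norm s \<le> R \<longrightarrow> norm \<nu> \<le> R \<longrightarrow> Re \<nu> \<ge> 0 \<longrightarrow> n > 0 \<longrightarrow> norm (A_remainder s \<nu> n) \<le> C * real n powr (- (2 + Re (s + \<nu>)))"
proof -
 obtain C where C: "C \<ge> 0" "\<forall>s \<nu> t n. norm s \<le> R \<longrightarrow> norm \<nu> \<le> R \<longrightarrow> Re \<nu> \<ge> 0 \<longrightarrow> n > 0 \<longrightarrow> \<bar>t\<bar> = real n \<longrightarrow>
   norm (reduced_A s \<nu> t - A_lead s \<nu> t) \<le> C * real n powr (- (2 + Re (s + \<nu>)))"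
  using reduced_A_asymptotics[of R] by (elim exE conjE)
 have "norm (A_remainder s \<nu> n) \<le> (C + C) * real n powr (- (2 + Re (s + \<nu>)))"
  if "norm s \<le> R" "norm \<nu> \<le> R" "Re \<nu> \<ge> 0" "n > 0" for s \<nu> n
  unfolding A_remainder_def distrib_right
  by (intro order_trans[OF norm_triangle_ineq] add_mono C(2)[rule_format] that) auto
 thus ?thesis using C by (intro exI[of _ "C + C"]) auto
qed

text \<open>Without the leading term the summands have order \<open>- (2 + Re (s + \<nu>))\<close>,
  which is below -1 locally uniformly when \<open>Re (s + \<nu>) > - 1\<close>. This includes a full
  neighbourhood of \<open>s = - \<nu>\<close>.\<close>

lemma A_remainder_series_holomorphic:
 assumes S: "open S" and hol: "s holomorphic_on S" "\<nu> holomorphic_on S" and \<nu>: "\<And>z. z \<in> S \<Longrightarrow> Re (\<nu> z) > 0"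
  and u: "\<And>z. z \<in> S \<Longrightarrow> Re (s z + \<nu> z) > - 1"
 shows "(\<lambda>z. \<Sum>n. divisor_sigma (s z) (Suc n) * A_remainder (s z) (\<nu> z) (Suc n)) holomorphic_on S"
proof (rule holomorphic_on_suminf[OF S])
 show "(\<lambda>z. divisor_sigma (s z) (Suc n) * A_remainder (s z) (\<nu> z) (Suc n)) holomorphic_on S" for n
  unfolding A_remainder_def A_lead_def by (intro holomorphic_intros holomorphic_reduced_A S hol \<nu>)
next
 fix z0 assume z0: "z0 \<in> S"
 obtain r a b R where r: "r > 0" "a > 0" "b > - 1" "R > 0" and bd: "\<forall>z\<in>ball z0 r. Re (\<nu> z) \<ge> a \<and> Re (s z + \<nu> z) \<ge> b \<and> norm (s z) \<le> R \<and> norm (\<nu> z) \<le> R"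
  using local_parameter_bounds[OF S z0 holomorphic_on_imp_continuous_on[OF hol(1)] holomorphic_on_imp_continuous_on[OF hol(2)] \<nu>[OF z0] u[OF z0]] by (elim exE conjE)
 obtain C where C: "C \<ge> 0" "\<forall>s \<nu> n. norm s \<le> R \<longrightarrow> norm \<nu> \<le> R \<longrightarrow> Re \<nu> \<ge> 0 \<longrightarrow> n > 0 \<longrightarrow> norm (A_remainder s \<nu> n) \<le> C * real n powr (- (2 + Re (s + \<nu>)))"
  using A_remainder_bound[of R] by (elim exE conjE)
 have "norm (divisor_sigma (s z) (Suc n) * A_remainder (s z) (\<nu> z) (Suc n)) \<le> C * (\<Sum>d | d dvd Suc n. real d powr (- 2) * real (Suc n div d) powr (- (2 + b)))"
  if "z \<in> ball z0 r" for z n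
 proof (rule norm_divisor_sigma_le_uniform)
  show "norm (A_remainder (s z) (\<nu> z) (Suc n)) \<le> C * real (Suc n) powr (- (2 + Re (s z + \<nu> z)))"
   using C(2)[rule_format, of "s z" "\<nu> z" "Suc n"] bd[rule_format, OF that] r by auto
  show "2 + b \<le> 2 + Re (s z + \<nu> z)" "2 \<le> 2 + Re (s z + \<nu> z) - Re (s z)" using bd[rule_format, OF that] r by auto
 qed (use C in auto)
 moreover have "summable (\<lambda>n. C * (\<Sum>d | d dvd Suc n. real d powr (- 2) * real (Suc n div d) powr (- (2 + b))))"
  using r by (intro summable_mult summable_divisor_majorant) auto
 ultimately show "\<exists>r>0. \<exists>B. summable B \<and> (\<forall>z\<in>ball z0 r \<inter> S. \<forall>n. norm (divisor_sigma (s z) (Suc n) * A_remainder (s z) (\<nu> z) (Suc n)) \<le> B n)"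
  using r(1) by blast
qed

lemma A_remainder_summable:
 assumes \<nu>: "Re \<nu> > 0" and u: "Re (s + \<nu>) > - 1"
 shows "summable (\<lambda>n. divisor_sigma s (Suc n) * A_remainder s \<nu> (Suc n))"
proof -
 define R where "R = max (norm s) (norm \<nu>)"
 obtain C where C: "C \<ge> 0" "\<forall>s \<nu> n. norm s \<le> R \<longrightarrow> norm \<nu> \<le> R \<longrightarrow> Re \<nu> \<ge> 0 \<longrightarrow> n > 0 \<longrightarrow> norm (A_remainder s \<nu> n) \<le> C * real n powr (- (2 + Re (s + \<nu>)))"
  using A_remainder_bound[of R] by (elim exE conjE)
 have "norm (A_remainder s \<nu> n) \<le> C * real n powr (- (2 + Re (s + \<nu>)))" if "n > 0" for n
  using C(2)[rule_format, of s \<nu> n] \<nu> that by (simp add: R_def)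
 thus ?thesis using C u \<nu> by (intro sigma_double_series(1)[of _ C "2 + Re (s + \<nu>)"]) auto
qed

end

section \<open>Analytic continuation\<close>

text \<open>\<open>- sin (pi * u / 2) * zeta (1 + u)\<close> with the singularity at 0 removed: by
  \<open>zeta_eq\<close> the polar part of \<open>zeta (1 + u)\<close> is
  \<open>rGamma (1 + u) / u\<close>, and the division by \<open>u\<close> is moved to the
  sine.\<close>

definition kappa :: "complex \<Rightarrow> complex" where
 "kappa u = - ((if u = 0 then of_real pi / 2 else sin (of_real pi / 2 * u) / u) * rGamma (1 + u)) - sin (of_real pi / 2 * u) * zeta_entire (1 + u)"

lemma kappa_0: "kappa 0 = - (of_real pi / 2)"
 by (simp add: kappa_def)

lemma kappa_eq: "u \<noteq> 0 \<Longrightarrow> kappa u = - sin (of_real pi / 2 * u) * zeta (1 + u)"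
 using zeta_eq[of "1 + u"] by (simp add: kappa_def algebra_simps)

lemma holomorphic_kappa: "kappa holomorphic_on UNIV"
proof -
 let ?A = "\<lambda>u. if u = 0 then of_real pi / 2 else sin (of_real pi / 2 * u) / u"
 define f where "f = (\<lambda>u :: complex. sin (of_real pi / 2 * u))"
 let ?B = "\<lambda>u. if u = 0 then deriv f 0 else (f u - f 0) / (u - 0)"
 have d: "deriv f 0 = of_real pi / 2"
  unfolding f_def by (rule DERIV_imp_deriv) (auto intro!: derivative_eq_intros)
 have "?B holomorphic_on UNIV"
  by (rule pole_lemma_open) (auto simp: f_def intro!: holomorphic_intros)
 moreover have "?B = ?A"
  unfolding d by (simp add: f_def fun_eq_iff)
 ultimately have "?A holomorphic_on UNIV"
  by (simp only:)
 moreover have "(\<lambda>u. zeta_entire (1 + u)) holomorphic_on UNIV"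
 proof -
  have "(\<lambda>u. 1 + u :: complex) holomorphic_on UNIV" by (intro holomorphic_intros)
  from holomorphic_on_compose_gen[OF this holomorphic_zeta_entire] show ?thesis by (simp add: o_def)
 qed
 ultimately show ?thesis unfolding kappa_def[abs_def] by (intro holomorphic_intros)
qed

lemma holomorphic_zeta_comp:
 assumes "f holomorphic_on S" "\<And>z. z \<in> S \<Longrightarrow> f z \<noteq> 1"
 shows "(\<lambda>z. zeta (f z)) holomorphic_on S"
proof -
 have "f ` S \<subseteq> - {1}" using assms(2) by auto
 from holomorphic_on_compose_gen[OF assms(1) zeta_spec(1) this] show ?thesis by (simp add: o_def)
qed

lemma cos_half_pi_shift: "cos (of_real pi / 2 * (1 + u)) = - sin (of_real pi / 2 * (u :: complex))"
proof -
 have "cos (complex_of_real pi / 2) = 0" "sin (complex_of_real pi / 2) = 1"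
  using cos_of_real[of "pi / 2", where 'a = complex] sin_of_real[of "pi / 2", where 'a = complex] by simp_all
 thus ?thesis by (simp add: distrib_left cos_add)
qed

section \<open>The identity for the full range of parameters\<close>

context bessel_pair
begin

text \<open>The logarithms of \<open>\<i> * n\<close> and \<open>- \<i> * n\<close> differ only in
  the sign of the phase pi/2, so the two leading terms add up to a cosine, which is minus a sine
  after the shift by \<open>1\<close>.\<close>

lemma A_lead_sum:
 assumes n: "n > 0"
 shows "A_lead s \<nu> (real n) + A_lead s \<nu> (- real n) =
  - (exp ((2 * s - 2 * \<nu>) * of_real (ln 2)) * 2 * sin (of_real pi / 2 * (s + \<nu>))) * of_real (real n) powr (- (1 + s + \<nu>))"
proof -
 let ?D = "2 * sin (of_real pi / 2 * (s + \<nu>))"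
 let ?C = "\<i> * of_real (real n)"
 let ?B = "\<i> * of_real (- real n)"
 define w where "w = 1 + s + \<nu>"
 let ?A = "\<i> * (of_real pi / 2 * w)"
 have L: "Ln ?C = of_real (ln (real n)) + of_real pi / 2 * \<i>"
  "Ln ?B = of_real (ln (real n)) - of_real pi / 2 * \<i>"
  using n Ln_imaginary[of "real n"] Ln_imaginary[of "- real n"] by (simp_all add: mult_ac)
 have Lr: "Ln (complex_of_real (real n)) = of_real (ln (real n))" using n by (intro Ln_of_real) simp
 have "complex_of_real (real n) \<noteq> 0" using n by simp
 hence p: "of_real (real n) powr (- w) = exp (- w * of_real (ln (real n)))" by (simp only: powr_def Lr if_False)
 have "exp (- w * Ln ?C) + exp (- w * Ln ?B) = of_real (real n) powr (- w) * (exp (- ?A) + exp ?A)"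
  unfolding L p distrib_left exp_add[symmetric] by (simp add: algebra_simps)
 also have "exp (- ?A) + exp ?A = 2 * cos (of_real pi / 2 * (1 + (s + \<nu>)))"
 proof -
  have "1 + (s + \<nu>) = w" by (simp add: w_def)
  thus ?thesis unfolding cos_exp_eq by simp
 qed
 also have "\<dots> = - ?D" unfolding cos_half_pi_shift by simp
 finally have e: "exp (- w * Ln ?C) + exp (- w * Ln ?B) = of_real (real n) powr (- w) * - ?D" .
 show ?thesis unfolding A_lead_def w_def[symmetric] distrib_right[symmetric] e by (simp only: mult_ac mult_minus_left mult_minus_right)
qed

lemma A_remainder_eq:
 assumes "n > 0"
 shows "reduced_A s \<nu> (real n) + reduced_A s \<nu> (- real n) = A_remainder s \<nu> n
  - (exp ((2 * s - 2 * \<nu>) * of_real (ln 2)) * 2 * sin (of_real pi / 2 * (s + \<nu>))) * of_real (real n) powr (- (1 + s + \<nu>))"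
 using A_lead_sum[OF assms, of s \<nu>] unfolding A_remainder_def by (simp add: algebra_simps)

text \<open>For \<open>Re (s + \<nu>) > 0\<close> the leading terms form a convergent divisor series
  with value \<open>zeta (1 + s + \<nu>) * zeta (1 + \<nu>)\<close>; together with the sine this is
  \<open>kappa\<close>.\<close>

lemma reduced_A_series:
 assumes \<nu>: "Re \<nu> > 0" and u: "Re (s + \<nu>) > 0"
 shows "(\<lambda>n. divisor_sigma s (Suc n) * (reduced_A s \<nu> (real (Suc n)) + reduced_A s \<nu> (- real (Suc n)))) sums
  ((\<Sum>n. divisor_sigma s (Suc n) * A_remainder s \<nu> (Suc n)) + exp ((2 * s - 2 * \<nu>) * of_real (ln 2)) * 2 * kappa (s + \<nu>) * zeta (1 + \<nu>))"
proof -
 let ?C = "\<lambda>n. divisor_sigma s (Suc n) * of_real (real (Suc n)) powr (- (1 + s + \<nu>))"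
 let ?B = "(2 * s - 2 * \<nu>) * of_real (ln 2)"
 let ?A = "zeta (1 + s + \<nu>) * zeta (1 + s + \<nu> - s)"
 define c where "c = exp ?B * 2 * sin (of_real pi / 2 * (s + \<nu>))"
 have 1: "(\<lambda>n. divisor_sigma s (Suc n) * A_remainder s \<nu> (Suc n)) sums (\<Sum>n. divisor_sigma s (Suc n) * A_remainder s \<nu> (Suc n))"
  using u by (intro summable_sums A_remainder_summable \<nu>) simp
 have 2: "(\<lambda>n. c * (?C n)) sums (c * ?A)"
  using \<nu> u by (intro sums_mult ramanujan_dirichlet_series) auto
 have e: "divisor_sigma s (Suc n) * A_remainder s \<nu> (Suc n) - c * (?C n) =
   divisor_sigma s (Suc n) * (reduced_A s \<nu> (real (Suc n)) + reduced_A s \<nu> (- real (Suc n)))" for n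
  unfolding A_remainder_eq[OF zero_less_Suc] c_def[symmetric] by (simp only: right_diff_distrib mult_ac)
 have "s + \<nu> \<noteq> 0" using u by (metis less_irrefl zero_complex.sel(1))
 hence "- (c * ?A) = exp ?B * 2 * kappa (s + \<nu>) * zeta (1 + \<nu>)"
  by (simp add: kappa_eq c_def add.assoc)
 hence "x - c * ?A = x + exp ?B * 2 * kappa (s + \<nu>) * zeta (1 + \<nu>)" for x
  by (metis diff_conv_add_uminus)
 with sums_diff[OF 1 2] show ?thesis unfolding e by (simp only:)
qed

text \<open>The series side minus the summand side, with the leading terms of the latter replaced by
  their continued sum \<open>kappa\<close>. In this form everything is holomorphic for
  \<open>Re \<nu> > 0\<close> and \<open>Re (s + \<nu>) > - 1\<close>, including
  \<open>s = - 1\<close> and \<open>s = - \<nu>\<close>.\<close>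

definition regular_part :: "complex \<Rightarrow> complex \<Rightarrow> complex" where
 "regular_part s \<nu> = amp \<nu> / 2 * (\<Sum>n. divisor_sigma s (Suc n) * N_pm \<nu> (Suc n)) -
   Acoeff s \<nu> * exp (\<nu> * Ln (\<alpha> - \<beta>)) * ((\<Sum>n. divisor_sigma s (Suc n) * A_remainder s \<nu> (Suc n)) +
    exp ((2 * s - 2 * \<nu>) * of_real (ln 2)) * 2 * kappa (s + \<nu>) * zeta (1 + \<nu>))"

text \<open>The cofactor of \<open>zeta (- s)\<close> formed by the two zero-frequency
  terms.\<close>

definition polar_part :: "complex \<Rightarrow> complex \<Rightarrow> complex" where
 "polar_part s \<nu> = Acoeff s \<nu> * exp (\<nu> * Ln (\<alpha> - \<beta>)) * reduced_A s \<nu> 0 - amp \<nu> / 2 * psi_inverse_transform \<nu> 0"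

text \<open>The two-way summation multiplied by \<open>amp \<nu> / 2\<close>, with the transforms
  expressed through \<open>reduced_A\<close> and its leading terms summed separately.\<close>

lemma regular_eq_polar_of_convergent:
 assumes \<nu>: "Re \<nu> > 0" and s: "Re s < - 1" and u: "Re (s + \<nu>) > 1"
 shows "regular_part s \<nu> = zeta (- s) * polar_part s \<nu>"
proof -
 let ?D = "\<Sum>n. divisor_sigma s (Suc n) * N_pm \<nu> (Suc n)"
 let ?C = "\<lambda>n. psi_transform s \<nu> (real (Suc n)) + psi_transform s \<nu> (- real (Suc n))"
 let ?B = "\<nu> * Ln (\<alpha> - \<beta>)"
 let ?A = "\<lambda>n. divisor_sigma s (Suc n) * (reduced_A s \<nu> (real (Suc n)) + reduced_A s \<nu> (- real (Suc n)))"
 have amp: "amp \<nu> \<noteq> 0" by (simp add: amp_def)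
 define K where "K = 2 / amp \<nu> * (Acoeff s \<nu> * exp ?B)"
 have K: "psi_transform s \<nu> t = K * reduced_A s \<nu> t" for t
 proof -
  have "psi_transform s \<nu> t = 2 / amp \<nu> * (amp \<nu> / 2 * psi_transform s \<nu> t)" using amp by simp
  also have "amp \<nu> / 2 * psi_transform s \<nu> t = Acoeff s \<nu> * exp ?B * reduced_A s \<nu> t"
   using u by (intro psi_transform_eq \<nu>) simp
  finally show ?thesis unfolding K_def by (simp only: mult.assoc)
 qed
 have aK: "amp \<nu> / 2 * (K * z) = Acoeff s \<nu> * exp ?B * z" for z using amp by (simp add: K_def)
 define R where "R = (\<Sum>n. divisor_sigma s (Suc n) * A_remainder s \<nu> (Suc n)) + exp ((2 * s - 2 * \<nu>) * of_real (ln 2)) * 2 * kappa (s + \<nu>) * zeta (1 + \<nu>)"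
 have "(\<lambda>n. K * (?A n)) sums (K * R)"
  unfolding R_def using u by (intro sums_mult reduced_A_series \<nu>) simp
 moreover have "K * (?A n) =
   divisor_sigma s (Suc n) * (?C n)" for n
  unfolding K by (simp only: distrib_left mult_ac)
 ultimately have "(\<Sum>n. divisor_sigma s (Suc n) * (?C n)) = K * R"
  by (metis (no_types, lifting) sums_cong sums_unique)
 hence "zeta (- s) * psi_inverse_transform \<nu> 0 + ?D = zeta (- s) * (K * reduced_A s \<nu> 0) + K * R"
  using voronoi_transform[OF \<nu> s u] unfolding K by simp
 hence "amp \<nu> / 2 * (zeta (- s) * psi_inverse_transform \<nu> 0 + ?D) =
   zeta (- s) * (amp \<nu> / 2 * (K * reduced_A s \<nu> 0)) + amp \<nu> / 2 * (K * R)" by (simp add: distrib_left mult_ac)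
 thus ?thesis unfolding aK regular_part_def polar_part_def R_def[symmetric] by (simp add: algebra_simps)
qed

lemma holomorphic_Acoeff:
 assumes "s holomorphic_on S" "\<nu> holomorphic_on S" "\<And>z. z \<in> S \<Longrightarrow> Re (s z + \<nu> z) > - 1"
 shows "(\<lambda>z. Acoeff (s z) (\<nu> z)) holomorphic_on S"
proof -
 have "s z + \<nu> z + 1 \<notin> \<int>\<^sub>\<le>\<^sub>0" if "z \<in> S" for z
 proof
  assume "s z + \<nu> z + 1 \<in> \<int>\<^sub>\<le>\<^sub>0"
  then obtain n where n: "s z + \<nu> z + 1 = of_int n" "n \<le> 0" by (elim nonpos_Ints_cases)
  have "Re (s z + \<nu> z + 1) = of_int n" unfolding n(1) by simp
  moreover have "real_of_int n \<le> 0" using n(2) by simp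
  ultimately show False using assms(3)[OF that] by simp
 qed
 thus ?thesis unfolding Acoeff_def using assms(1,2) by (intro holomorphic_intros) auto
qed

lemma holomorphic_regular_part:
 assumes S: "open S" and hol: "s holomorphic_on S" "\<nu> holomorphic_on S" and \<nu>: "\<And>z. z \<in> S \<Longrightarrow> Re (\<nu> z) > 0"
  and u: "\<And>z. z \<in> S \<Longrightarrow> Re (s z + \<nu> z) > - 1"
 shows "(\<lambda>z. regular_part (s z) (\<nu> z)) holomorphic_on S"
proof -
 have "(\<lambda>z. kappa (s z + \<nu> z)) holomorphic_on S"
  using holomorphic_on_compose_gen[OF holomorphic_on_add[OF hol] holomorphic_kappa] by (auto simp: o_def)
 moreover have "(\<lambda>z. zeta (1 + \<nu> z)) holomorphic_on S"
 proof (intro holomorphic_zeta_comp holomorphic_intros hol)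
  fix z assume "z \<in> S"
  hence "\<nu> z \<noteq> 0" using \<nu>[of z] by auto
  thus "1 + \<nu> z \<noteq> 1" by simp
 qed
 ultimately show ?thesis
  unfolding regular_part_def amp_def
  by (intro holomorphic_intros hol bessel_series_holomorphic A_remainder_series_holomorphic holomorphic_Acoeff S \<nu> u) auto
qed

lemma holomorphic_polar_part:
 assumes S: "open S" and hol: "s holomorphic_on S" "\<nu> holomorphic_on S" and \<nu>: "\<And>z. z \<in> S \<Longrightarrow> Re (\<nu> z) > 0"
  and u: "\<And>z. z \<in> S \<Longrightarrow> Re (s z + \<nu> z) > - 1"
 shows "(\<lambda>z. polar_part (s z) (\<nu> z)) holomorphic_on S"
proof -
 have "(\<lambda>z. psi_inverse_transform (\<nu> z) 0) holomorphic_on S"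
  using holomorphic_on_compose_gen[OF hol(2) holomorphic_psi_inverse_transform[of 0]] \<nu> by (auto simp: o_def)
 thus ?thesis unfolding polar_part_def amp_def
  by (intro holomorphic_intros hol holomorphic_reduced_A holomorphic_Acoeff S \<nu> u) auto
qed

text \<open>
 The two sides are compared along the complex line \<open>\<tau> \<mapsto> (s - \<tau>, \<nu> + 2 * \<tau>)\<close>, on which the series
 converge absolutely for large \<open>Re \<tau>\<close>.
\<close>

lemma regular_eq_polar:
 assumes \<nu>: "Re \<nu> > 0" and u: "Re (s + \<nu>) > - 1" and s: "s \<noteq> - 1"
 shows "regular_part s \<nu> = zeta (- s) * polar_part s \<nu>"
proof -
 \<comment> \<open>To the right of \<open>c\<close> both \<open>Re (\<nu> + 2 * \<tau>) > 0\<close>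
   and \<open>Re (s + \<nu> + \<tau>) > - 1\<close> hold. The deleted point \<open>s + 1\<close> is
   where the zeta factor has its pole.\<close>
 define c where "c = max (- Re \<nu> / 2) (- 1 - Re (s + \<nu>))"
 \<comment> \<open>To the right of \<open>M\<close> the conditions
   \<open>Re (s - \<tau>) < - 1\<close> and \<open>Re (s + \<nu> + \<tau>) > 1\<close> of absolute
   convergence hold; the 0 keeps \<open>Re (\<nu> + 2 * \<tau>)\<close> positive.\<close>
 define M where "M = max (Re s + 1) (max (1 - Re (s + \<nu>)) 0)"
 define H where "H = {\<tau>. Re \<tau> > c}"
 define S where "S = H - {s + 1}"
 have H: "open H" "connected H" unfolding H_def by (auto intro!: open_halfspace_Re_gt convex_connected convex_halfspace_Re_gt)
 have "connected (H - {s + 1})" by (rule connected_open_delete[OF H]) simp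
 hence S: "open S" "connected S" unfolding S_def using H(1) by auto
 have p: "Re (\<nu> + 2 * \<tau>) > 0" "Re (s - \<tau> + (\<nu> + 2 * \<tau>)) > - 1" "- (s - \<tau>) \<noteq> 1" if "\<tau> \<in> S" for \<tau>
  using that by (auto simp: S_def H_def c_def algebra_simps)
 have "regular_part (s - 0) (\<nu> + 2 * 0) = zeta (- (s - 0)) * polar_part (s - 0) (\<nu> + 2 * 0)"
 proof (rule analytic_continuation_open[of "{\<tau>. Re \<tau> > M}" S "\<lambda>\<tau>. regular_part (s - \<tau>) (\<nu> + 2 * \<tau>)" "\<lambda>\<tau>. zeta (- (s - \<tau>)) * polar_part (s - \<tau>) (\<nu> + 2 * \<tau>)"])
  show "open {\<tau>. M < Re \<tau>}" by (rule open_halfspace_Re_gt)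
  have "of_real (M + 1) \<in> {\<tau>. M < Re \<tau>}" by simp
  thus "{\<tau>. M < Re \<tau>} \<noteq> {}" by blast
  have "c \<le> M" using \<nu> u by (auto simp: c_def M_def)
  thus "{\<tau>. M < Re \<tau>} \<subseteq> S" by (auto simp: S_def H_def M_def)
  show "(\<lambda>\<tau>. regular_part (s - \<tau>) (\<nu> + 2 * \<tau>)) holomorphic_on S"
   by (intro holomorphic_regular_part S holomorphic_intros p)
  show "(\<lambda>\<tau>. zeta (- (s - \<tau>)) * polar_part (s - \<tau>) (\<nu> + 2 * \<tau>)) holomorphic_on S"
   by (intro holomorphic_on_mult holomorphic_zeta_comp holomorphic_polar_part S holomorphic_intros p)
  show "regular_part (s - \<tau>) (\<nu> + 2 * \<tau>) = zeta (- (s - \<tau>)) * polar_part (s - \<tau>) (\<nu> + 2 * \<tau>)" if "\<tau> \<in> {\<tau>. M < Re \<tau>}" for \<tau>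
   using that \<nu> by (intro regular_eq_polar_of_convergent) (auto simp: M_def)
  show "0 \<in> S" using \<nu> u s by (auto simp: S_def H_def c_def add_eq_0_iff2)
 qed (use S in auto)
 thus ?thesis by simp
qed

lemma Acoeff_eq: "Acoeff s \<nu> = Gamma (\<nu> + s + 1) / (2 powr (3 * s + 2) * of_real pi powr (s + 1) * Gamma (\<nu> + 1))"
proof -
 have 1: "(2 :: complex) powr (3 * s + 2) = exp ((3 * s + 2) * of_real (ln 2))"
  using Ln_of_real[of 2] by (simp add: powr_def)
 have 2: "complex_of_real pi powr (s + 1) = exp ((s + 1) * of_real (ln pi))"
  by (simp add: powr_def Ln_of_real)
 have 3: "exp (- (3 * s + 2) * of_real (ln 2) - (s + 1) * of_real (ln pi)) = inverse (exp ((3 * s + 2) * of_real (ln 2))) * inverse (exp ((s + 1) * complex_of_real (ln pi)))"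
  by (simp only: exp_diff mult_minus_left exp_minus divide_inverse)
 show ?thesis unfolding Acoeff_def 1 2 3 rGamma_inverse_Gamma divide_inverse inverse_mult_distrib
  by (simp only: mult_ac add_ac)
qed

text \<open>Two roots from the sector have a product in the right half plane, which is therefore the
  principal root.\<close>

lemma csqrt_mult: "csqrt (\<alpha> * \<beta>) = csqrt \<alpha> * csqrt \<beta>"
proof (rule csqrt_unique)
 let ?A = "csqrt \<alpha> * csqrt \<beta>"
 have "\<bar>Im (csqrt \<alpha>) * Im (csqrt \<beta>)\<bar> < Re (csqrt \<alpha>) * Re (csqrt \<beta>)"
  unfolding abs_mult using sectors by (intro mult_strict_mono') auto
 hence "Re ?A > 0" unfolding times_complex.sel by linarith
 thus "0 < Re ?A \<or> Re ?A = 0 \<and> 0 \<le> Im ?A" ..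
qed (simp add: power_mult_distrib)

text \<open>The hypergeometric zeta term is the summand at \<open>t = 0\<close>, where the continued
  quotient power agrees with the principal one because \<open>Ln_quot\<close> applies.\<close>

lemma zeta_terms_eq:
 assumes \<nu>: "Re \<nu> > 0"
 shows "zeta_terms \<alpha> \<beta> \<nu> s = zeta (- s) * polar_part s \<nu>"
proof -
 define q where "q = root_diff / root_sum"
 have mem: "(csqrt \<alpha>, csqrt \<beta>) \<in> zw_region" using sectors Re_less by (simp add: zw_region_eq)
 have sr: "shifted_root 0 (csqrt \<alpha>) = csqrt \<alpha>" "shifted_root 0 (csqrt \<beta>) = csqrt \<beta>"
  by (simp_all only: shifted_root_def of_real_0 mult_zero_right add_0_right power2_csqrt)
 have q0: "q \<noteq> 0" using sqrt_diff_nonzero sqrt_sum_nonzero by (simp add: q_def)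
 have rq: "root_quot_powr 0 \<nu> (csqrt \<alpha>, csqrt \<beta>) = q powr \<nu>"
 proof -
  have "root_quot_powr 0 \<nu> (csqrt \<alpha>, csqrt \<beta>) = exp (\<nu> * (Ln (\<alpha> - \<beta>) - 2 * Ln root_sum))"
   unfolding root_quot_powr_eq[OF mem] root_quot_branch_def prod.case sr power2_csqrt ..
  also have "Ln (\<alpha> - \<beta>) - 2 * Ln root_sum = Ln q" unfolding Ln_diff q_def Ln_quot by simp
  finally show ?thesis using q0 by (simp add: powr_def)
 qed
 have A: "exp (\<nu> * Ln (\<alpha> - \<beta>)) * reduced_A s \<nu> 0 = 1 / csqrt (\<alpha> * \<beta>) * (1 / csqrt \<alpha> + 1 / csqrt \<beta>) powr (2 * s) * q powr \<nu> * hyp2F1 (\<nu> - s) (- s) (\<nu> + 1) (q\<^sup>2)"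
  unfolding A_eq_reduced[symmetric] \<A>_def sr root_quot_def rq csqrt_mult q_def ..
 have "polar_part s \<nu> = Acoeff s \<nu> * (exp (\<nu> * Ln (\<alpha> - \<beta>)) * reduced_A s \<nu> 0) - q powr \<nu> / (2 * \<nu>)"
  unfolding polar_part_def psi_inverse_transform_0[OF \<nu>] q_def by (simp only: mult.assoc)
 moreover have "zeta_terms \<alpha> \<beta> \<nu> s = zeta (- s) * (Acoeff s \<nu> * (1 / csqrt (\<alpha> * \<beta>) * (1 / csqrt \<alpha> + 1 / csqrt \<beta>) powr (2 * s) * q powr \<nu> * hyp2F1 (\<nu> - s) (- s) (\<nu> + 1) (q\<^sup>2)) - q powr \<nu> / (2 * \<nu>))"
  unfolding zeta_terms_def q_def[symmetric] Acoeff_eq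
  unfolding divide_inverse inverse_mult_distrib by (simp add: algebra_simps)
 ultimately show ?thesis unfolding A by simp
qed

text \<open>\<open>regular_part\<close> is continuous at \<open>s = - 1\<close> and equals the zeta
  terms at all other points nearby, so it is their limit; the cancellation of the poles needs no
  separate computation.\<close>

lemma zeta_terms_limit:
 assumes \<nu>: "Re \<nu> > 0" and u: "Re (s + \<nu>) > - 1"
 shows "if s = - 1 then (zeta_terms \<alpha> \<beta> \<nu> \<longlongrightarrow> regular_part s \<nu>) (at (- 1)) else regular_part s \<nu> = zeta_terms \<alpha> \<beta> \<nu> s"
proof (cases "s = - 1")
 case True
 define S where "S = {z. Re z > - 1 - Re \<nu>}"
 have S: "open S" "s \<in> S" unfolding S_def using u by (auto intro: open_halfspace_Re_gt)
 have "(\<lambda>z. regular_part z \<nu>) holomorphic_on S"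
  using \<nu> by (intro holomorphic_regular_part[of S "\<lambda>z. z" "\<lambda>_. \<nu>"] S holomorphic_intros) (auto simp: S_def)
 hence "isCont (\<lambda>z. regular_part z \<nu>) s"
  using S holomorphic_on_imp_continuous_on continuous_on_eq_continuous_at by blast
 hence lim: "((\<lambda>z. regular_part z \<nu>) \<longlongrightarrow> regular_part s \<nu>) (at (- 1))" using True by (simp add: isCont_def)
 have eq: "regular_part z \<nu> = zeta_terms \<alpha> \<beta> \<nu> z" if "z \<in> S" "z \<noteq> - 1" for z
  unfolding zeta_terms_eq[OF \<nu>] using that by (intro regular_eq_polar \<nu>) (auto simp: S_def)
 have "- 1 \<in> S" using S(2) True by simp
 hence "(zeta_terms \<alpha> \<beta> \<nu> \<longlongrightarrow> regular_part s \<nu>) (at (- 1))"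
  by (rule Lim_transform_within_open[OF lim S(1) _ eq])
 thus ?thesis using True by simp
next
 case False
 thus ?thesis using regular_eq_polar[OF \<nu> u] zeta_terms_eq[OF \<nu>] by simp
qed

text \<open>At \<open>s = - \<nu>\<close> the continued sum of the leading terms has
  \<open>kappa 0 = - pi / 2\<close>, the product of the zero of the sine and the pole of zeta. The
  rest is a comparison of powers of 2 and pi.\<close>

lemma critical_term_eq:
 "Acoeff (- \<nu>) \<nu> * exp (\<nu> * Ln (\<alpha> - \<beta>)) * (exp ((2 * (- \<nu>) - 2 * \<nu>) * of_real (ln 2)) * 2 * kappa (- \<nu> + \<nu>) * zeta (1 + \<nu>)) =
  - (Gamma (- \<nu> + \<nu> + 1) * zeta (1 - (- \<nu>)) / (2 * (8 * of_real pi) powr (- \<nu>) * Gamma (\<nu> + 1)) * h_term \<alpha> \<beta> (- \<nu>) \<nu>)"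
proof -
 let ?D = "2 * (- \<nu>) - 2 * \<nu>"
 let ?C = "\<nu> * Ln (\<alpha> - \<beta>)"
 let ?F = "rGamma (\<nu> + 1) * exp ?C * zeta (1 + \<nu>)"
 define l p where "l = complex_of_real (ln 2)" and "p = complex_of_real (ln pi)"
 let ?E = "\<nu> * (3 * l + p)"
 let ?B = "(4 * \<nu> + 1) * l"
 let ?A = "- (3 * (- \<nu>) + 2) * l - (- \<nu> + 1) * p"
 have L2: "Ln (2 :: complex) = l" using Ln_of_real[of 2] by (simp add: l_def)
 have e2: "exp l = 2" and ep: "exp p = of_real pi" by (simp_all add: l_def p_def exp_of_real)
 have "ln (8 * pi) = 3 * ln 2 + ln pi"
 proof -
  have "ln (8 :: real) = 3 * ln 2" using ln_realpow[of 2 3] by simp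
  thus ?thesis by (simp add: ln_mult)
 qed
 hence L8: "Ln (8 * complex_of_real pi) = 3 * l + p" using Ln_of_real[of "8 * pi"] by (simp add: l_def p_def)
 have h: "h_term \<alpha> \<beta> (- \<nu>) \<nu> = exp ?C / exp ?B"
  using diff_nonzero by (simp add: h_term_def powr_def L2)
 have p8: "(8 * complex_of_real pi) powr (- \<nu>) = exp (- \<nu> * (3 * l + p))" by (simp add: powr_def L8)
 have A: "Acoeff (- \<nu>) \<nu> = rGamma (\<nu> + 1) * exp ?A" by (simp add: Acoeff_def l_def p_def)
 have "exp ?A * exp (?D * l) * exp p = exp ?E * exp (- ?B) * exp (- l)"
  unfolding exp_add[symmetric] by (intro arg_cong[of _ _ exp]) (simp add: algebra_simps)
 hence E: "exp ?A * exp (?D * l) * of_real pi = exp ?E * exp (- ?B) / 2"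
  unfolding ep by (simp add: exp_minus[of l] e2 inverse_eq_divide)
 have "Acoeff (- \<nu>) \<nu> * exp ?C * (exp (?D * of_real (ln 2)) * 2 * kappa (- \<nu> + \<nu>) * zeta (1 + \<nu>)) =
   - ?F * (exp ?A * exp (?D * l) * of_real pi)"
  unfolding A l_def[symmetric] by (simp add: kappa_0)
 also have "\<dots> = - ?F * (exp ?E * exp (- ?B) / 2)"
  unfolding E ..
 also have "\<dots> = - (Gamma (- \<nu> + \<nu> + 1) * zeta (1 - (- \<nu>)) / (2 * (8 * of_real pi) powr (- \<nu>) * Gamma (\<nu> + 1)) * h_term \<alpha> \<beta> (- \<nu>) \<nu>)"
 proof -
  have g: "Gamma (- \<nu> + \<nu> + 1) = 1" and z: "1 - (- \<nu>) = 1 + \<nu>" by simp_all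
  have i: "exp (- ?B) = inverse (exp ?B)" "exp (- \<nu> * (3 * l + p)) = inverse (exp ?E)"
   by (simp_all only: mult_minus_left exp_minus)
  show ?thesis
   unfolding h p8 g z i rGamma_inverse_Gamma divide_inverse inverse_mult_distrib inverse_inverse_eq
   by (simp only: mult_minus_left mult_minus_right mult_1_left mult_ac)
 qed
 finally show ?thesis .
qed

end

theorem theorem2p2:
  fixes \<alpha> \<beta> \<nu> s :: complex
  assumes "\<alpha> \<noteq> 0" and "\<bar>Arg \<alpha>\<bar> < pi / 2"
    and "\<beta> \<noteq> 0" and "\<bar>Arg \<beta>\<bar> < pi / 2"
    and "Re (csqrt \<alpha>) > Re (csqrt \<beta>)"
    and "Re \<nu> > 0"
    and "Re (s + \<nu>) > 0 \<or> s = - \<nu>"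
  defines "bessel_summand \<equiv> (\<lambda>n :: nat. divisor_sigma s n *
      (bessel_I \<nu> (2 * of_real pi * cnj eps8 * (csqrt (of_nat n * \<alpha>) - csqrt (of_nat n * \<beta>)))
       * bessel_K \<nu> (2 * of_real pi * cnj eps8 * (csqrt (of_nat n * \<alpha>) + csqrt (of_nat n * \<beta>)))
     + bessel_I \<nu> (2 * of_real pi * eps8 * (csqrt (of_nat n * \<alpha>) - csqrt (of_nat n * \<beta>)))
       * bessel_K \<nu> (2 * of_real pi * eps8 * (csqrt (of_nat n * \<alpha>) + csqrt (of_nat n * \<beta>)))))"
    and "A_summand \<equiv> (\<lambda>n :: nat. divisor_sigma s n *
      (\<A> s \<nu> (csqrt \<alpha>) (csqrt \<beta>) (real n) + \<A> s \<nu> (csqrt \<alpha>) (csqrt \<beta>) (- real n)))"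
  shows "summable (\<lambda>n. bessel_summand (Suc n)) \<and>
    summable (\<lambda>n. A_summand (Suc n)) \<and>
    (\<exists>Z. (if s = -1 then (zeta_terms \<alpha> \<beta> \<nu> \<longlongrightarrow> Z) (at (-1)) else Z = zeta_terms \<alpha> \<beta> \<nu> s) \<and>
      (\<Sum>n. bessel_summand (Suc n)) =
        - (Gamma (s + \<nu> + 1) * zeta (1 - s)
           / (2 * (8 * of_real pi) powr s * Gamma (\<nu> + 1)) * h_term \<alpha> \<beta> s \<nu>)
        + Z
        + Gamma (\<nu> + s + 1) / (2 powr (3 * s + 2) * of_real pi powr (s + 1) * Gamma (\<nu> + 1))
          * (\<Sum>n. A_summand (Suc n)))"
proof -
  interpret bessel_pair \<alpha> \<beta>
    by unfold_locales (use assms(1-5) abs_Arg_less_half_pi in auto)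
  note \<nu> = \<open>Re \<nu> > 0\<close>
  have u: "Re (s + \<nu>) > - 1" using assms(7) by auto
  have b: "bessel_summand n = amp \<nu> / 2 * (divisor_sigma s n * N_pm \<nu> n)" if n: "n > 0" for n
    unfolding bessel_summand_def N_pm_def
      bessel_IK_eq_transform[OF \<nu> n disjI1[OF conjI[OF refl refl]]] bessel_IK_eq_transform[OF \<nu> n disjI2[OF conjI[OF refl refl]]]
    by (simp only: distrib_left mult_ac add_ac)
  have B: "(\<lambda>n. bessel_summand (Suc n)) sums (amp \<nu> / 2 * (\<Sum>n. divisor_sigma s (Suc n) * N_pm \<nu> (Suc n)))"
    unfolding b[OF zero_less_Suc] by (intro sums_mult summable_sums bessel_series_summable \<nu>)
  define E where "E = exp (\<nu> * Ln (\<alpha> - \<beta>))"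
  define R where "R = (\<Sum>n. divisor_sigma s (Suc n) * A_remainder s \<nu> (Suc n))"
  define T where "T = exp ((2 * s - 2 * \<nu>) * of_real (ln 2)) * 2 * kappa (s + \<nu>) * zeta (1 + \<nu>)"
  define V where "V = Gamma (s + \<nu> + 1) * zeta (1 - s) / (2 * (8 * of_real pi) powr s * Gamma (\<nu> + 1)) * h_term \<alpha> \<beta> s \<nu>"
  have a: "A_summand n = E * (divisor_sigma s n * (reduced_A s \<nu> (real n) + reduced_A s \<nu> (- real n)))" for n
    unfolding A_summand_def A_eq_reduced E_def by (simp only: distrib_left mult_ac)
  \<comment> \<open>\<open>W\<close> is the sum of the last series. In either case the relation with
    \<open>V\<close> accounts for the term \<open>T\<close> of \<open>regular_part\<close>: for
    \<open>Re (s + \<nu>) > 0\<close> it belongs to \<open>W\<close> and \<open>V = 0\<close>, at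
    \<open>s = - \<nu>\<close> it is missing from \<open>W\<close> and is the term with
    \<open>h\<close>.\<close>
  obtain W where W: "(\<lambda>n. A_summand (Suc n)) sums W" "Acoeff s \<nu> * W - V = Acoeff s \<nu> * E * (R + T)"
  proof (cases "Re (s + \<nu>) > 0")
    case True
    have "(\<lambda>n. A_summand (Suc n)) sums (E * (R + T))"
      unfolding a R_def T_def by (intro sums_mult reduced_A_series \<nu> True)
    moreover have "V = 0" using True by (simp add: V_def h_term_def)
    ultimately show ?thesis by (intro that[of "E * (R + T)"]) (simp_all add: mult.assoc)
  next
    case False
    hence s: "s = - \<nu>" using assms(7) by simp
    \<comment> \<open>The sine factor is 0 at \<open>s = - \<nu>\<close>, so the leading terms at
      \<open>n\<close> and \<open>- n\<close> cancel exactly.\<close>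
    have "A_summand (Suc n) = E * (divisor_sigma s (Suc n) * A_remainder s \<nu> (Suc n))" for n
      unfolding a A_remainder_eq[OF zero_less_Suc] by (simp add: s)
    hence "(\<lambda>n. A_summand (Suc n)) sums (E * R)"
      unfolding R_def by (simp only:) (intro sums_mult summable_sums A_remainder_summable \<nu> u)
    moreover have "Acoeff s \<nu> * E * T = - V"
      unfolding T_def V_def E_def s by (rule critical_term_eq)
    ultimately show ?thesis by (intro that[of "E * R"]) (simp_all add: algebra_simps)
  qed
  have "amp \<nu> / 2 * (\<Sum>n. divisor_sigma s (Suc n) * N_pm \<nu> (Suc n)) = - V + regular_part s \<nu> + Acoeff s \<nu> * W"
    using W(2) unfolding regular_part_def E_def[symmetric] R_def[symmetric] T_def[symmetric] by (simp add: algebra_simps)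
  hence eq: "(\<Sum>n. bessel_summand (Suc n)) = - V + regular_part s \<nu> + Acoeff s \<nu> * (\<Sum>n. A_summand (Suc n))"
    by (simp only: sums_unique[OF B, symmetric] sums_unique[OF W(1), symmetric])
  show ?thesis
    using sums_summable[OF B] sums_summable[OF W(1)] zeta_terms_limit[OF \<nu> u] eq[unfolded V_def Acoeff_eq]
    by (intro conjI exI[of _ "regular_part s \<nu>"])
qed

end
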